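(* Let $\mathcal{A}$ be an abelian category, let $D^+(\mathcal{A})=K^+(\mathcal{A})/K^{+,\emptyset}(\mathcal{A})$ be the left bounded derived category of $\mathcal{A}$, and let $D^+_{\infty}(\mathcal{A})=K^+(\mathcal{A})/K^{+,b}(\mathcal{A})$. Let $G:D^+(\mathcal{A})\to D^+_{\infty}(\mathcal{A})$ be the canonical quotient functor, and let $X,Y$ be objects of $D^+(\mathcal{A})$. Then, considering the inductive system indexed by $(n\in\mathbb{Z};\leq)$, with increasing integers $n$, the natural map $$\varinjlim_{(n\in\mathbb{Z};\leq)}\mathrm{Hom}_{D^+(\mathcal{A})}(\sigma_{\geq n}X,\sigma_{\geq n}Y)\to \mathrm{Hom}_{D^+_{\infty}(\mathcal{A})}(GX,GY)$$ is an isomorphism.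
   Context: Complexes are cochain complexes. $K^+(\mathcal{A})$ is the homotopy category of complexes over $\mathcal{A}$ homotopy equivalent to left bounded complexes ($X^n=0$ for $n\ll 0$); $K^{+,b}(\mathcal{A})$ (resp. $K^{+,\emptyset}(\mathcal{A})$) is its full subcategory of complexes homotopy equivalent to left bounded complexes with bounded cohomology (resp. to left bounded exact complexes). Quotients are Verdier quotients. The intelligent truncation is $$\sigma_{\geq n}X=(\cdots\to 0\to\mathrm{Im}(d^{n-1})\to X^{n}\xrightarrow{d^n}X^{n+1}\xrightarrow{d^{n+1}}\cdots),$$ with $\mathrm{Im}(d^{n-1})$ in degree $n-1$. It induces a functor $\sigma_{\geq n}:D^+(\mathcal{A})\to D^+(\mathcal{A})$, and $\sigma_{\geq n+1}\sigma_{\geq n}=\sigma_{\geq n+1}$. The transition maps of the inductive system are $f\mapsto\sigma_{\geq n+1}f$, from $\mathrm{Hom}_{D^+(\mathcal{A})}(\sigma_{\geq n}X,\sigma_{\geq n}Y)$ to $\mathrm{Hom}_{D^+(\mathcal{A})}(\sigma_{\geq n+1}X,\sigma_{\geq n+1}Y)$. Let $p_n^X:X\to\sigma_{\geq n}X$ be the canonical projection; it becomes an isomorphism in $D^+_\infty(\mathcal{A})$. The natural map from the colimit is induced by the compatible maps sending $f:\sigma_{\geq n}X\to\sigma_{\geq n}Y$ to the composite $X\xrightarrow{p_n^X}\sigma_{\geq n}X\xrightarrow{f}\sigma_{\geq n}Y\xrightarrow{(p_n^Y)^{-1}}Y$ in $D^+_\infty(\mathcal{A})$. *)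

theory Defs
  imports "HOL-Algebra.Group"
begin

section \<open>Categories and abelian categories\<close>

text \<open>
  Every arrow knows its source and target, so hom-sets are pairwise disjoint. The operations
  \<open>cmp\<close> (composition, written in the order of functions) and \<open>plus_arr\<close> are only meaningful on
  composable, respectively parallel, arrows.
\<close>

record ('o, 'm) addcat =
  obj :: "'o set"
  arr :: "'m set"
  src :: "'m \<Rightarrow> 'o"
  tgt :: "'m \<Rightarrow> 'o"
  ident :: "'o \<Rightarrow> 'm"
  cmp :: "'m \<Rightarrow> 'm \<Rightarrow> 'm"  (infixr \<open>\<cdot>\<index>\<close> 75)
  plus_arr :: "'m \<Rightarrow> 'm \<Rightarrow> 'm"  (infixl \<open>\<boxplus>\<index>\<close> 65)
  zero_arr :: "'o \<Rightarrow> 'o \<Rightarrow> 'm"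

definition Hom :: "('o, 'm) addcat \<Rightarrow> 'o \<Rightarrow> 'o \<Rightarrow> 'm set" where
  "Hom C X Y = {f \<in> arr C. src C f = X \<and> tgt C f = Y}"

definition hom_group :: "('o, 'm) addcat \<Rightarrow> 'o \<Rightarrow> 'o \<Rightarrow> 'm monoid" where
  "hom_group C X Y = \<lparr>carrier = Hom C X Y, mult = plus_arr C, one = zero_arr C X Y\<rparr>"

definition minus_arr :: "('o, 'm) addcat \<Rightarrow> 'm \<Rightarrow> 'm" where
  "minus_arr C f = inv\<^bsub>hom_group C (src C f) (tgt C f)\<^esub> f"

locale category =
  fixes C :: "('o, 'm) addcat" (structure)
  assumes src_obj: "f \<in> arr C \<Longrightarrow> src C f \<in> obj C"
    and tgt_obj: "f \<in> arr C \<Longrightarrow> tgt C f \<in> obj C"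
    and ident_Hom: "X \<in> obj C \<Longrightarrow> ident C X \<in> Hom C X X"
    and cmp_Hom: "f \<in> Hom C X Y \<Longrightarrow> g \<in> Hom C Y Z \<Longrightarrow> g \<cdot> f \<in> Hom C X Z"
    and ident_left: "f \<in> Hom C X Y \<Longrightarrow> ident C Y \<cdot> f = f"
    and ident_right: "f \<in> Hom C X Y \<Longrightarrow> f \<cdot> ident C X = f"
    and cmp_assoc: "f \<in> Hom C W X \<Longrightarrow> g \<in> Hom C X Y \<Longrightarrow> h \<in> Hom C Y Z \<Longrightarrow>
      (h \<cdot> g) \<cdot> f = h \<cdot> (g \<cdot> f)"

locale preadditive_category = category +
  assumes hom_comm_group: "X \<in> obj C \<Longrightarrow> Y \<in> obj C \<Longrightarrow> comm_group (hom_group C X Y)"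
    and cmp_plus_left: "f \<in> Hom C X Y \<Longrightarrow> g \<in> Hom C Y Z \<Longrightarrow> g' \<in> Hom C Y Z \<Longrightarrow>
      (g \<boxplus> g') \<cdot> f = g \<cdot> f \<boxplus> g' \<cdot> f"
    and cmp_plus_right: "f \<in> Hom C X Y \<Longrightarrow> f' \<in> Hom C X Y \<Longrightarrow> g \<in> Hom C Y Z \<Longrightarrow>
      g \<cdot> (f \<boxplus> f') = g \<cdot> f \<boxplus> g \<cdot> f'"

definition is_iso :: "('o, 'm) addcat \<Rightarrow> 'm \<Rightarrow> bool" where
  "is_iso C f \<longleftrightarrow> f \<in> arr C \<and> (\<exists>g \<in> Hom C (tgt C f) (src C f).
     g \<cdot>\<^bsub>C\<^esub> f = ident C (src C f) \<and> f \<cdot>\<^bsub>C\<^esub> g = ident C (tgt C f))"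

definition inverse_arr :: "('o, 'm) addcat \<Rightarrow> 'm \<Rightarrow> 'm" where
  "inverse_arr C f = (THE g. g \<in> Hom C (tgt C f) (src C f) \<and>
     g \<cdot>\<^bsub>C\<^esub> f = ident C (src C f) \<and> f \<cdot>\<^bsub>C\<^esub> g = ident C (tgt C f))"

definition isomorphic :: "('o, 'm) addcat \<Rightarrow> 'o \<Rightarrow> 'o \<Rightarrow> bool" where
  "isomorphic C X Y \<longleftrightarrow> (\<exists>f \<in> Hom C X Y. is_iso C f)"

definition is_zero_obj :: "('o, 'm) addcat \<Rightarrow> 'o \<Rightarrow> bool" where
  "is_zero_obj C Z \<longleftrightarrow> Z \<in> obj C \<and>
     (\<forall>X \<in> obj C. (\<exists>!f. f \<in> Hom C X Z) \<and> (\<exists>!f. f \<in> Hom C Z X))"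

definition is_mono :: "('o, 'm) addcat \<Rightarrow> 'm \<Rightarrow> bool" where
  "is_mono C f \<longleftrightarrow> f \<in> arr C \<and> (\<forall>W. \<forall>g \<in> Hom C W (src C f). \<forall>h \<in> Hom C W (src C f).
     f \<cdot>\<^bsub>C\<^esub> g = f \<cdot>\<^bsub>C\<^esub> h \<longrightarrow> g = h)"

definition is_epi :: "('o, 'm) addcat \<Rightarrow> 'm \<Rightarrow> bool" where
  "is_epi C f \<longleftrightarrow> f \<in> arr C \<and> (\<forall>W. \<forall>g \<in> Hom C (tgt C f) W. \<forall>h \<in> Hom C (tgt C f) W.
     g \<cdot>\<^bsub>C\<^esub> f = h \<cdot>\<^bsub>C\<^esub> f \<longrightarrow> g = h)"

definition is_kernel :: "('o, 'm) addcat \<Rightarrow> 'm \<Rightarrow> 'm \<Rightarrow> bool" where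
  "is_kernel C f k \<longleftrightarrow> k \<in> arr C \<and> tgt C k = src C f \<and>
     f \<cdot>\<^bsub>C\<^esub> k = zero_arr C (src C k) (tgt C f) \<and>
     (\<forall>W. \<forall>g \<in> Hom C W (src C f). f \<cdot>\<^bsub>C\<^esub> g = zero_arr C W (tgt C f) \<longrightarrow>
        (\<exists>!h. h \<in> Hom C W (src C k) \<and> k \<cdot>\<^bsub>C\<^esub> h = g))"

definition is_cokernel :: "('o, 'm) addcat \<Rightarrow> 'm \<Rightarrow> 'm \<Rightarrow> bool" where
  "is_cokernel C f q \<longleftrightarrow> q \<in> arr C \<and> src C q = tgt C f \<and>
     q \<cdot>\<^bsub>C\<^esub> f = zero_arr C (src C f) (tgt C q) \<and>
     (\<forall>W. \<forall>g \<in> Hom C (tgt C f) W. g \<cdot>\<^bsub>C\<^esub> f = zero_arr C (src C f) W \<longrightarrow>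
        (\<exists>!h. h \<in> Hom C (tgt C q) W \<and> h \<cdot>\<^bsub>C\<^esub> q = g))"

record ('o, 'm) biproduct =
  bsum :: 'o
  inj1 :: 'm
  inj2 :: 'm
  prj1 :: 'm
  prj2 :: 'm

definition is_biproduct :: "('o, 'm) addcat \<Rightarrow> 'o \<Rightarrow> 'o \<Rightarrow> ('o, 'm) biproduct \<Rightarrow> bool" where
  "is_biproduct C X Y B \<longleftrightarrow> bsum B \<in> obj C \<and>
     inj1 B \<in> Hom C X (bsum B) \<and> inj2 B \<in> Hom C Y (bsum B) \<and>
     prj1 B \<in> Hom C (bsum B) X \<and> prj2 B \<in> Hom C (bsum B) Y \<and>
     prj1 B \<cdot>\<^bsub>C\<^esub> inj1 B = ident C X \<and> prj2 B \<cdot>\<^bsub>C\<^esub> inj2 B = ident C Y \<and>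
     prj2 B \<cdot>\<^bsub>C\<^esub> inj1 B = zero_arr C X Y \<and> prj1 B \<cdot>\<^bsub>C\<^esub> inj2 B = zero_arr C Y X \<and>
     (inj1 B \<cdot>\<^bsub>C\<^esub> prj1 B) \<boxplus>\<^bsub>C\<^esub> (inj2 B \<cdot>\<^bsub>C\<^esub> prj2 B) = ident C (bsum B)"

locale abelian_category = preadditive_category +
  assumes zero_obj_exists: "\<exists>Z. is_zero_obj C Z"
    and biproduct_exists: "X \<in> obj C \<Longrightarrow> Y \<in> obj C \<Longrightarrow> \<exists>B. is_biproduct C X Y B"
    and kernel_exists: "f \<in> arr C \<Longrightarrow> \<exists>k. is_kernel C f k"
    and cokernel_exists: "f \<in> arr C \<Longrightarrow> \<exists>q. is_cokernel C f q"
    and mono_normal: "is_mono C f \<Longrightarrow> \<exists>g \<in> arr C. is_kernel C g f"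
    and epi_normal: "is_epi C f \<Longrightarrow> \<exists>g \<in> arr C. is_cokernel C g f"

text \<open>
  Chosen zero objects, biproducts, kernels and cokernels. The kernel and the image of an arrow are
  the inclusion monomorphisms, the cokernel is the projection; their objects are the respective
  source and target. Since the image depends on the arrow only, truncations of complexes compose
  strictly.
\<close>

definition zero_obj :: "('o, 'm) addcat \<Rightarrow> 'o" where
  "zero_obj C = (SOME Z. is_zero_obj C Z)"

definition biprod :: "('o, 'm) addcat \<Rightarrow> 'o \<Rightarrow> 'o \<Rightarrow> ('o, 'm) biproduct" where
  "biprod C X Y = (SOME B. is_biproduct C X Y B)"

definition ker_arr :: "('o, 'm) addcat \<Rightarrow> 'm \<Rightarrow> 'm" where
  "ker_arr C f = (SOME k. is_kernel C f k)"

definition coker_arr :: "('o, 'm) addcat \<Rightarrow> 'm \<Rightarrow> 'm" where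
  "coker_arr C f = (SOME q. is_cokernel C f q)"

definition im_arr :: "('o, 'm) addcat \<Rightarrow> 'm \<Rightarrow> 'm" where
  "im_arr C f = ker_arr C (coker_arr C f)"

text \<open>The factorisation of an arrow \<open>f\<close> through a monomorphism \<open>k\<close> with the same target.\<close>

definition lift_arr :: "('o, 'm) addcat \<Rightarrow> 'm \<Rightarrow> 'm \<Rightarrow> 'm" where
  "lift_arr C k f = (THE e. e \<in> Hom C (src C f) (src C k) \<and> k \<cdot>\<^bsub>C\<^esub> e = f)"

definition full_subcategory :: "('o, 'm) addcat \<Rightarrow> 'o set \<Rightarrow> ('o, 'm) addcat" where
  "full_subcategory C S = C\<lparr>obj := obj C \<inter> S, arr := {f \<in> arr C. src C f \<in> S \<and> tgt C f \<in> S}\<rparr>"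

section \<open>Cochain complexes\<close>

record ('o, 'm) cochain =
  cob :: "int \<Rightarrow> 'o"
  cdiff :: "int \<Rightarrow> 'm"

definition is_cochain :: "('o, 'm) addcat \<Rightarrow> ('o, 'm) cochain \<Rightarrow> bool" where
  "is_cochain A X \<longleftrightarrow> (\<forall>n. cob X n \<in> obj A \<and> cdiff X n \<in> Hom A (cob X n) (cob X (n + 1)) \<and>
     cdiff X (n + 1) \<cdot>\<^bsub>A\<^esub> cdiff X n = zero_arr A (cob X n) (cob X (n + 2)))"

definition chain_maps ::
    "('o, 'm) addcat \<Rightarrow> ('o, 'm) cochain \<Rightarrow> ('o, 'm) cochain \<Rightarrow> (int \<Rightarrow> 'm) set" where
  "chain_maps A X Y = {f. \<forall>n. f n \<in> Hom A (cob X n) (cob Y n) \<and>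
     cdiff Y n \<cdot>\<^bsub>A\<^esub> f n = f (n + 1) \<cdot>\<^bsub>A\<^esub> cdiff X n}"

definition homotopic ::
    "('o, 'm) addcat \<Rightarrow> ('o, 'm) cochain \<Rightarrow> ('o, 'm) cochain \<Rightarrow> (int \<Rightarrow> 'm) \<Rightarrow> (int \<Rightarrow> 'm) \<Rightarrow> bool" where
  "homotopic A X Y f g \<longleftrightarrow> (\<exists>h. \<forall>n. h n \<in> Hom A (cob X n) (cob Y (n - 1)) \<and>
     f n = g n \<boxplus>\<^bsub>A\<^esub> ((cdiff Y (n - 1) \<cdot>\<^bsub>A\<^esub> h n) \<boxplus>\<^bsub>A\<^esub> (h (n + 1) \<cdot>\<^bsub>A\<^esub> cdiff X n)))"

definition left_bounded :: "('o, 'm) addcat \<Rightarrow> ('o, 'm) cochain \<Rightarrow> bool" where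
  "left_bounded A X \<longleftrightarrow> (\<exists>N. \<forall>n < N. is_zero_obj A (cob X n))"

text \<open>The cokernel of the map from \<open>X\<^sup>n\<^sup>-\<^sup>1\<close> to the kernel of \<open>d\<^sup>n\<close> induced by the differential.\<close>

definition cohomology :: "('o, 'm) addcat \<Rightarrow> ('o, 'm) cochain \<Rightarrow> int \<Rightarrow> 'o" where
  "cohomology A X n =
     tgt A (coker_arr A (lift_arr A (ker_arr A (cdiff X n)) (cdiff X (n - 1))))"

definition bounded_cohomology :: "('o, 'm) addcat \<Rightarrow> ('o, 'm) cochain \<Rightarrow> bool" where
  "bounded_cohomology A X \<longleftrightarrow>
     (\<exists>a b. \<forall>n. n < a \<or> b < n \<longrightarrow> is_zero_obj A (cohomology A X n))"

definition exact_cochain :: "('o, 'm) addcat \<Rightarrow> ('o, 'm) cochain \<Rightarrow> bool" where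
  "exact_cochain A X \<longleftrightarrow> (\<forall>n. is_zero_obj A (cohomology A X n))"

section \<open>The homotopy category and its distinguished triangles\<close>

type_synonym ('o, 'm) harr = "('o, 'm) cochain \<times> (int \<Rightarrow> 'm) set \<times> ('o, 'm) cochain"

definition hclass ::
    "('o, 'm) addcat \<Rightarrow> ('o, 'm) cochain \<Rightarrow> ('o, 'm) cochain \<Rightarrow> (int \<Rightarrow> 'm) \<Rightarrow> ('o, 'm) harr" where
  "hclass A X Y f = (X, {g \<in> chain_maps A X Y. homotopic A X Y f g}, Y)"

text \<open>
  Operations on classes are given by the union of the classes obtained from all representatives,
  so that no representatives have to be chosen. The same device is used for fractions below.
\<close>

definition hlift ::
    "('o, 'm) addcat \<Rightarrow> ('o, 'm) cochain \<Rightarrow> ('o, 'm) cochain \<Rightarrow> (int \<Rightarrow> 'm) set \<Rightarrow> ('o, 'm) harr" where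
  "hlift A X Y F = (X, \<Union>f \<in> F. fst (snd (hclass A X Y f)), Y)"

definition homotopy_category ::
    "('o, 'm) addcat \<Rightarrow> (('o, 'm) cochain, ('o, 'm) harr) addcat" where
  "homotopy_category A = \<lparr>
     obj = {X. is_cochain A X},
     arr = {hclass A X Y f | X Y f. is_cochain A X \<and> is_cochain A Y \<and> f \<in> chain_maps A X Y},
     src = (\<lambda>(X, F, Y). X),
     tgt = (\<lambda>(X, F, Y). Y),
     ident = (\<lambda>X. hclass A X X (\<lambda>n. ident A (cob X n))),
     cmp = (\<lambda>(Y', G, Z) (X, F, Y). hlift A X Z {(\<lambda>n. g n \<cdot>\<^bsub>A\<^esub> f n) | g f. g \<in> G \<and> f \<in> F}),
     plus_arr = (\<lambda>(X, F, Y) (X', G, Y'). hlift A X Y {(\<lambda>n. f n \<boxplus>\<^bsub>A\<^esub> g n) | f g. f \<in> F \<and> g \<in> G}),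
     zero_arr = (\<lambda>X Y. hclass A X Y (\<lambda>n. zero_arr A (cob X n) (cob Y n)))\<rparr>"

definition shift :: "('o, 'm) addcat \<Rightarrow> ('o, 'm) cochain \<Rightarrow> ('o, 'm) cochain" where
  "shift A X = \<lparr>cob = (\<lambda>n. cob X (n + 1)), cdiff = (\<lambda>n. minus_arr A (cdiff X (n + 1)))\<rparr>"

definition shift_arr :: "('o, 'm) addcat \<Rightarrow> ('o, 'm) harr \<Rightarrow> ('o, 'm) harr" where
  "shift_arr A = (\<lambda>(X, F, Y). hlift A (shift A X) (shift A Y) ((\<lambda>f n. f (n + 1)) ` F))"

definition cone_biprod :: "('o, 'm) addcat \<Rightarrow> ('o, 'm) cochain \<Rightarrow> ('o, 'm) cochain \<Rightarrow> int \<Rightarrow>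
    ('o, 'm) biproduct" where
  "cone_biprod A X Y n = biprod A (cob X (n + 1)) (cob Y n)"

text \<open>The mapping cone; its differential sends \<open>(x, y)\<close> to \<open>(- d x, f x + d y)\<close>.\<close>

definition cone ::
    "('o, 'm) addcat \<Rightarrow> ('o, 'm) cochain \<Rightarrow> ('o, 'm) cochain \<Rightarrow> (int \<Rightarrow> 'm) \<Rightarrow> ('o, 'm) cochain" where
  "cone A X Y f = \<lparr>
     cob = (\<lambda>n. bsum (cone_biprod A X Y n)),
     cdiff = (\<lambda>n. let B = cone_biprod A X Y n; B' = cone_biprod A X Y (n + 1) in
       (inj1 B' \<cdot>\<^bsub>A\<^esub> minus_arr A (cdiff X (n + 1)) \<cdot>\<^bsub>A\<^esub> prj1 B) \<boxplus>\<^bsub>A\<^esub>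
       ((inj2 B' \<cdot>\<^bsub>A\<^esub> f (n + 1) \<cdot>\<^bsub>A\<^esub> prj1 B) \<boxplus>\<^bsub>A\<^esub> (inj2 B' \<cdot>\<^bsub>A\<^esub> cdiff Y n \<cdot>\<^bsub>A\<^esub> prj2 B)))\<rparr>"

definition standard_triangle :: "('o, 'm) addcat \<Rightarrow> ('o, 'm) cochain \<Rightarrow> ('o, 'm) cochain \<Rightarrow>
    (int \<Rightarrow> 'm) \<Rightarrow> ('o, 'm) harr \<times> ('o, 'm) harr \<times> ('o, 'm) harr" where
  "standard_triangle A X Y f =
     (hclass A X Y f,
      hclass A Y (cone A X Y f) (\<lambda>n. inj2 (cone_biprod A X Y n)),
      hclass A (cone A X Y f) (shift A X) (\<lambda>n. prj1 (cone_biprod A X Y n)))"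

definition distinguished_triangles ::
    "('o, 'm) addcat \<Rightarrow> (('o, 'm) harr \<times> ('o, 'm) harr \<times> ('o, 'm) harr) set" where
  "distinguished_triangles A = (let K = homotopy_category A in
     {(u, v, w) | u v w. \<exists>X Y Z. u \<in> Hom K X Y \<and> v \<in> Hom K Y Z \<and> w \<in> Hom K Z (shift A X) \<and>
        (\<exists>X' Y' f u' v' w' a b c. X' \<in> obj K \<and> Y' \<in> obj K \<and> f \<in> chain_maps A X' Y' \<and>
           (u', v', w') = standard_triangle A X' Y' f \<and>
           a \<in> Hom K X X' \<and> b \<in> Hom K Y Y' \<and> c \<in> Hom K Z (cone A X' Y' f) \<and>
           is_iso K a \<and> is_iso K b \<and> is_iso K c \<and>
           b \<cdot>\<^bsub>K\<^esub> u = u' \<cdot>\<^bsub>K\<^esub> a \<and> c \<cdot>\<^bsub>K\<^esub> v = v' \<cdot>\<^bsub>K\<^esub> b \<and> shift_arr A a \<cdot>\<^bsub>K\<^esub> w = w' \<cdot>\<^bsub>K\<^esub> c)})"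

definition K_plus_obj :: "('o, 'm) addcat \<Rightarrow> ('o, 'm) cochain set" where
  "K_plus_obj A = {X. is_cochain A X \<and>
     (\<exists>Y. is_cochain A Y \<and> left_bounded A Y \<and> isomorphic (homotopy_category A) X Y)}"

definition K_plus_b_obj :: "('o, 'm) addcat \<Rightarrow> ('o, 'm) cochain set" where
  "K_plus_b_obj A = {X. is_cochain A X \<and>
     (\<exists>Y. is_cochain A Y \<and> left_bounded A Y \<and> bounded_cohomology A Y \<and>
        isomorphic (homotopy_category A) X Y)}"

definition K_plus_exact_obj :: "('o, 'm) addcat \<Rightarrow> ('o, 'm) cochain set" where
  "K_plus_exact_obj A = {X. is_cochain A X \<and>
     (\<exists>Y. is_cochain A Y \<and> left_bounded A Y \<and> exact_cochain A Y \<and>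
        isomorphic (homotopy_category A) X Y)}"

definition K_plus :: "('o, 'm) addcat \<Rightarrow> (('o, 'm) cochain, ('o, 'm) harr) addcat" where
  "K_plus A = full_subcategory (homotopy_category A) (K_plus_obj A)"

definition K_plus_triangles ::
    "('o, 'm) addcat \<Rightarrow> (('o, 'm) harr \<times> ('o, 'm) harr \<times> ('o, 'm) harr) set" where
  "K_plus_triangles A = {(u, v, w) \<in> distinguished_triangles A.
     u \<in> arr (K_plus A) \<and> v \<in> arr (K_plus A) \<and> w \<in> arr (K_plus A)}"

section \<open>Verdier quotients\<close>

text \<open>
  Calculus of fractions: arrows \<open>X \<rightarrow> Y\<close> of the localisation of \<open>C\<close> at \<open>S\<close> are classes of roofs
  \<open>(s, f)\<close>, that is \<open>X \<leftarrow> Z \<rightarrow> Y\<close> with left leg \<open>s\<close> in \<open>S\<close>; two roofs are equivalent if they are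
  dominated by a common third roof.
\<close>

type_synonym ('o, 'm) qarr = "'o \<times> ('m \<times> 'm) set \<times> 'o"

definition roofs :: "('o, 'm) addcat \<Rightarrow> 'm set \<Rightarrow> 'o \<Rightarrow> 'o \<Rightarrow> ('m \<times> 'm) set" where
  "roofs C S X Y = {(s, f). s \<in> S \<and> s \<in> arr C \<and> f \<in> arr C \<and>
     src C s = src C f \<and> tgt C s = X \<and> tgt C f = Y}"

definition roof_equiv :: "('o, 'm) addcat \<Rightarrow> 'm set \<Rightarrow> 'm \<times> 'm \<Rightarrow> 'm \<times> 'm \<Rightarrow> bool" where
  "roof_equiv C S = (\<lambda>(s, f) (s', f'). \<exists>W. \<exists>u \<in> Hom C W (src C s). \<exists>v \<in> Hom C W (src C s').
     s \<cdot>\<^bsub>C\<^esub> u = s' \<cdot>\<^bsub>C\<^esub> v \<and> f \<cdot>\<^bsub>C\<^esub> u = f' \<cdot>\<^bsub>C\<^esub> v \<and> s \<cdot>\<^bsub>C\<^esub> u \<in> S)"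

definition qclass :: "('o, 'm) addcat \<Rightarrow> 'm set \<Rightarrow> 'o \<Rightarrow> 'o \<Rightarrow> 'm \<times> 'm \<Rightarrow> ('o, 'm) qarr" where
  "qclass C S X Y r = (X, {r' \<in> roofs C S X Y. roof_equiv C S r r'}, Y)"

definition qlift :: "('o, 'm) addcat \<Rightarrow> 'm set \<Rightarrow> 'o \<Rightarrow> 'o \<Rightarrow> ('m \<times> 'm) set \<Rightarrow> ('o, 'm) qarr" where
  "qlift C S X Y R = (X, \<Union>r \<in> R. fst (snd (qclass C S X Y r)), Y)"

text \<open>
  Composition completes \<open>f\<close> and \<open>t\<close> to a commutative square \<open>f \<cdot> t' = t \<cdot> h\<close> with \<open>t'\<close> in \<open>S\<close>;
  addition uses roofs with the same left leg.
\<close>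

definition localisation :: "('o, 'm) addcat \<Rightarrow> 'm set \<Rightarrow> ('o, ('o, 'm) qarr) addcat" where
  "localisation C S = \<lparr>
     obj = obj C,
     arr = {qclass C S X Y r | X Y r. X \<in> obj C \<and> Y \<in> obj C \<and> r \<in> roofs C S X Y},
     src = (\<lambda>(X, R, Y). X),
     tgt = (\<lambda>(X, R, Y). Y),
     ident = (\<lambda>X. qclass C S X X (ident C X, ident C X)),
     cmp = (\<lambda>(Y', T, Z) (X, R, Y). qlift C S X Z
       {(s \<cdot>\<^bsub>C\<^esub> t', g \<cdot>\<^bsub>C\<^esub> h) | s t' g h. \<exists>f t W. (s, f) \<in> R \<and> (t, g) \<in> T \<and>
          t' \<in> S \<and> t' \<in> Hom C W (src C s) \<and> h \<in> Hom C W (src C t) \<and> f \<cdot>\<^bsub>C\<^esub> t' = t \<cdot>\<^bsub>C\<^esub> h}),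
     plus_arr = (\<lambda>(X, R, Y) (X', T, Y'). qlift C S X Y
       {(s, f \<boxplus>\<^bsub>C\<^esub> g) | s f g. (s, f) \<in> R \<and> (s, g) \<in> T}),
     zero_arr = (\<lambda>X Y. qclass C S X Y (ident C X, zero_arr C X Y))\<rparr>"

definition loc_arr :: "('o, 'm) addcat \<Rightarrow> 'm set \<Rightarrow> 'm \<Rightarrow> ('o, 'm) qarr" where
  "loc_arr C S f = qclass C S (src C f) (tgt C f) (ident C (src C f), f)"

text \<open>
  The quotient of the triangulated category \<open>C\<close> with distinguished triangles \<open>D\<close> by the triangulated
  subcategory with object set \<open>N\<close>: the localisation at the arrows whose cone lies in \<open>N\<close>.
\<close>

definition verdier_system :: "('o, 'm) addcat \<Rightarrow> ('m \<times> 'm \<times> 'm) set \<Rightarrow> 'o set \<Rightarrow> 'm set" where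
  "verdier_system C D N = {s \<in> arr C. \<exists>v w. (s, v, w) \<in> D \<and> tgt C v \<in> N}"

definition verdier_quotient ::
    "('o, 'm) addcat \<Rightarrow> ('m \<times> 'm \<times> 'm) set \<Rightarrow> 'o set \<Rightarrow> ('o, ('o, 'm) qarr) addcat" where
  "verdier_quotient C D N = localisation C (verdier_system C D N)"

type_synonym ('o, 'm) darr = "(('o, 'm) cochain, ('o, 'm) harr) qarr"

abbreviation S_exact :: "('o, 'm) addcat \<Rightarrow> ('o, 'm) harr set" where
  "S_exact A \<equiv> verdier_system (K_plus A) (K_plus_triangles A) (K_plus_exact_obj A)"

abbreviation S_b :: "('o, 'm) addcat \<Rightarrow> ('o, 'm) harr set" where
  "S_b A \<equiv> verdier_system (K_plus A) (K_plus_triangles A) (K_plus_b_obj A)"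

definition D_plus :: "('o, 'm) addcat \<Rightarrow> (('o, 'm) cochain, ('o, 'm) darr) addcat" where
  "D_plus A = verdier_quotient (K_plus A) (K_plus_triangles A) (K_plus_exact_obj A)"

definition D_plus_inf :: "('o, 'm) addcat \<Rightarrow> (('o, 'm) cochain, ('o, 'm) darr) addcat" where
  "D_plus_inf A = verdier_quotient (K_plus A) (K_plus_triangles A) (K_plus_b_obj A)"

text \<open>
  The canonical functor from \<open>D_plus\<close> to \<open>D_plus_inf\<close>. It is the identity on objects and sends the
  fraction represented by a roof to the fraction represented by the same roof.
\<close>

definition G_obj :: "('o, 'm) cochain \<Rightarrow> ('o, 'm) cochain" where
  "G_obj X = X"

definition G_arr :: "('o, 'm) addcat \<Rightarrow> ('o, 'm) darr \<Rightarrow> ('o, 'm) darr" where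
  "G_arr A = (\<lambda>(X, R, Y). qlift (K_plus A) (S_b A) (G_obj X) (G_obj Y) R)"

section \<open>Intelligent truncation\<close>

definition trunc :: "('o, 'm) addcat \<Rightarrow> int \<Rightarrow> ('o, 'm) cochain \<Rightarrow> ('o, 'm) cochain" where
  "trunc A n X = \<lparr>
     cob = (\<lambda>i. if i \<ge> n then cob X i
                else if i = n - 1 then src A (im_arr A (cdiff X (n - 1)))
                else zero_obj A),
     cdiff = (\<lambda>i. if i \<ge> n then cdiff X i
                  else if i = n - 1 then im_arr A (cdiff X (n - 1))
                  else if i = n - 2 then zero_arr A (zero_obj A) (src A (im_arr A (cdiff X (n - 1))))
                  else zero_arr A (zero_obj A) (zero_obj A))\<rparr>"

text \<open>This strict equality makes \<open>trunc_D A (n + 1)\<close> below a transition map between hom-sets.\<close>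

lemma trunc_Suc_trunc: "trunc A (n + 1) (trunc A n X) = trunc A (n + 1) X"
  by (simp add: trunc_def fun_eq_iff)

definition trunc_chain_map :: "('o, 'm) addcat \<Rightarrow> int \<Rightarrow> ('o, 'm) cochain \<Rightarrow> ('o, 'm) cochain \<Rightarrow>
    (int \<Rightarrow> 'm) \<Rightarrow> int \<Rightarrow> 'm" where
  "trunc_chain_map A n X Y f = (\<lambda>i.
     if i \<ge> n then f i
     else if i = n - 1 then
       lift_arr A (im_arr A (cdiff Y (n - 1))) (f n \<cdot>\<^bsub>A\<^esub> im_arr A (cdiff X (n - 1)))
     else zero_arr A (zero_obj A) (zero_obj A))"

definition trunc_K :: "('o, 'm) addcat \<Rightarrow> int \<Rightarrow> ('o, 'm) harr \<Rightarrow> ('o, 'm) harr" where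
  "trunc_K A n = (\<lambda>(X, F, Y).
     hlift A (trunc A n X) (trunc A n Y) (trunc_chain_map A n X Y ` F))"

definition trunc_D :: "('o, 'm) addcat \<Rightarrow> int \<Rightarrow> ('o, 'm) darr \<Rightarrow> ('o, 'm) darr" where
  "trunc_D A n = (\<lambda>(X, R, Y).
     qlift (K_plus A) (S_exact A) (trunc A n X) (trunc A n Y)
       ((\<lambda>(s, f). (trunc_K A n s, trunc_K A n f)) ` R))"

definition trunc_proj_chain_map :: "('o, 'm) addcat \<Rightarrow> int \<Rightarrow> ('o, 'm) cochain \<Rightarrow> int \<Rightarrow> 'm" where
  "trunc_proj_chain_map A n X = (\<lambda>i.
     if i \<ge> n then ident A (cob X i)
     else if i = n - 1 then lift_arr A (im_arr A (cdiff X (n - 1))) (cdiff X (n - 1))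
     else zero_arr A (cob X i) (zero_obj A))"

definition trunc_proj :: "('o, 'm) addcat \<Rightarrow> int \<Rightarrow> ('o, 'm) cochain \<Rightarrow> ('o, 'm) darr" where
  "trunc_proj A n X = loc_arr (K_plus A) (S_exact A)
     (hclass A X (trunc A n X) (trunc_proj_chain_map A n X))"

section \<open>Inductive limits of groups along the integers\<close>

text \<open>
  A system is given by groups \<open>M n\<close> and transition maps \<open>t n\<close> from \<open>M n\<close> to \<open>M (n + 1)\<close>;
  \<open>transition t n k\<close> is the composite from \<open>M n\<close> to \<open>M (n + k)\<close>.
\<close>

primrec transition :: "(int \<Rightarrow> 'a \<Rightarrow> 'a) \<Rightarrow> int \<Rightarrow> nat \<Rightarrow> 'a \<Rightarrow> 'a" where
  "transition t n 0 x = x"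
| "transition t n (Suc k) x = t (n + int k) (transition t n k x)"

definition ind_class ::
    "(int \<Rightarrow> 'a monoid) \<Rightarrow> (int \<Rightarrow> 'a \<Rightarrow> 'a) \<Rightarrow> int \<times> 'a \<Rightarrow> (int \<times> 'a) set" where
  "ind_class M t = (\<lambda>(m, x). {(n, y). y \<in> carrier (M n) \<and>
     (\<exists>i j. m + int i = n + int j \<and> transition t m i x = transition t n j y)})"

definition ind_lim :: "(int \<Rightarrow> 'a monoid) \<Rightarrow> (int \<Rightarrow> 'a \<Rightarrow> 'a) \<Rightarrow> (int \<times> 'a) set monoid" where
  "ind_lim M t = \<lparr>
     carrier = {ind_class M t (n, x) | n x. x \<in> carrier (M n)},
     mult = (\<lambda>c c'. \<Union>{ind_class M t (n, x \<otimes>\<^bsub>M n\<^esub> y) | n x y. (n, x) \<in> c \<and> (n, y) \<in> c'}),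
     one = ind_class M t (0, \<one>\<^bsub>M 0\<^esub>)\<rparr>"

text \<open>For a compatible family \<open>\<psi>\<close> the image below is a singleton.\<close>

definition ind_lim_map :: "(int \<Rightarrow> 'a \<Rightarrow> 'b) \<Rightarrow> (int \<times> 'a) set \<Rightarrow> 'b" where
  "ind_lim_map \<psi> c = the_elem ((\<lambda>(n, x). \<psi> n x) ` c)"

section \<open>The natural map\<close>

definition hom_colim ::
    "('o, 'm) addcat \<Rightarrow> ('o, 'm) cochain \<Rightarrow> ('o, 'm) cochain \<Rightarrow> (int \<times> ('o, 'm) darr) set monoid" where
  "hom_colim A X Y =
     ind_lim (\<lambda>n. hom_group (D_plus A) (trunc A n X) (trunc A n Y)) (\<lambda>n. trunc_D A (n + 1))"

definition level_map :: "('o, 'm) addcat \<Rightarrow> ('o, 'm) cochain \<Rightarrow> ('o, 'm) cochain \<Rightarrow> int \<Rightarrow>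
    ('o, 'm) darr \<Rightarrow> ('o, 'm) darr" where
  "level_map A X Y n f =
     inverse_arr (D_plus_inf A) (G_arr A (trunc_proj A n Y)) \<cdot>\<^bsub>D_plus_inf A\<^esub>
       (G_arr A f \<cdot>\<^bsub>D_plus_inf A\<^esub> G_arr A (trunc_proj A n X))"

definition natural_map :: "('o, 'm) addcat \<Rightarrow> ('o, 'm) cochain \<Rightarrow> ('o, 'm) cochain \<Rightarrow>
    (int \<times> ('o, 'm) darr) set \<Rightarrow> ('o, 'm) darr" where
  "natural_map A X Y = ind_lim_map (level_map A X Y)"

end

theory Submission
  imports Defs
begin

text \<open>
  Both categories are localisations of \<open>K\<^sup>+\<close> and admit a calculus of right fractions. An arrow of
  \<open>K\<^sup>+\<close> is inverted in \<open>D\<^sup>+\<close> if it induces isomorphisms on cohomology in all degrees, and in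
  \<open>D\<^sup>+\<^sub>\<infinity>\<close> if it does so in all sufficiently high degrees. Truncation acts on fractions, and
  it turns every arrow \<open>s\<close> of the second kind into one of the first kind: \<open>\<sigma>\<^sub>\<ge>\<^sub>n s\<close> is a
  quasi-isomorphism for \<open>n\<close> large. Hence a fraction \<open>a s\<^sup>-\<^sup>1\<close> in \<open>D\<^sup>+\<^sub>\<infinity>\<close> comes
  from the fraction \<open>(\<sigma>\<^sub>\<ge>\<^sub>n a) (\<sigma>\<^sub>\<ge>\<^sub>n s)\<^sup>-\<^sup>1\<close> in \<open>D\<^sup>+\<close> by naturality of the projections
  \<open>p\<^sub>n\<close>, and two fractions \<open>a s\<^sup>-\<^sup>1\<close>, \<open>b s\<^sup>-\<^sup>1\<close> of \<open>D\<^sup>+\<close> that become equal in \<open>D\<^sup>+\<^sub>\<infinity>\<close>, say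
  \<open>a u = b u\<close> with \<open>s u\<close> of the second kind, become equal after applying \<open>\<sigma>\<^sub>\<ge>\<^sub>n\<close> for \<open>n\<close> large.
\<close>

section \<open>Preadditive categories inside a ring\<close>

text \<open>The axioms of a triangulated category are never established. Of the two classes of
  inverted arrows only the calculus of right fractions is used, and it comes from their description
  by cohomology: explicit homotopy limits supply the Ore square and the cancellation. Each of them
  loses at most two degrees, which is harmless both for all degrees and for all sufficiently high
  degrees; hence one argument serves both quotients.

  Truncation is not a triangulated functor, so its action on fractions cannot be read off from
  triangles. It rests on the image in degree \<open>n - 1\<close>: with it the cohomology of the
  truncation agrees with that of \<open>X\<close> from degree \<open>n\<close> on and vanishes
  below. So a map that is an isomorphism on cohomology from degree \<open>N\<close> on is truncated
  to a quasi-isomorphism for every \<open>n \<ge> N\<close>.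

  Diagram chases meet two obstacles: an abelian category has no elements, and arrow equations carry
  conditions on sources and targets. Arrows from test objects, with preimages only up to an
  epimorphism, replace elements; moving all arrows into one ring removes the conditions.\<close>

definition hom_group_or_trivial :: "('o, 'm) addcat \<Rightarrow> 'o \<Rightarrow> 'o \<Rightarrow> 'm monoid" where
  "hom_group_or_trivial C X Y =
     (if preadditive_category C \<and> X \<in> obj C \<and> Y \<in> obj C then hom_group C X Y
      else \<lparr>carrier = {undefined}, mult = (\<lambda>_ _. undefined), one = undefined\<rparr>)"

text \<open>The product over all records \<open>C\<close> and all \<open>X\<close>, \<open>Y\<close>
  of the types needs a group at every index. Where no hom group is available the one-element group
  stands in.\<close>

lemma comm_group_hom_group_or_trivial: "comm_group (hom_group_or_trivial C X Y)"
proof (cases "preadditive_category C \<and> X \<in> obj C \<and> Y \<in> obj C")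
  case True
  then show ?thesis
    by (simp add: hom_group_or_trivial_def preadditive_category.hom_comm_group)
next
  case False
  then have "hom_group_or_trivial C X Y = \<lparr>carrier = {undefined}, mult = (\<lambda>_ _. undefined), one = undefined\<rparr>"
    by (auto simp: hom_group_or_trivial_def)
  then show ?thesis
    by (auto intro!: comm_groupI)
qed

text \<open>
  The product of the hom groups of all categories over given carrier types. Quantifying over the
  categories as well makes this a single type, hence an instance of the class of abelian groups.
\<close>

typedef ('o, 'm) hom_family =
  "{F :: ('o, 'm) addcat \<Rightarrow> 'o \<Rightarrow> 'o \<Rightarrow> 'm. \<forall>C X Y. F C X Y \<in> carrier (hom_group_or_trivial C X Y)}"
  by (rule exI[of _ "\<lambda>C X Y. \<one>\<^bsub>hom_group_or_trivial C X Y\<^esub>"])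
     (simp add: comm_group.axioms(2) comm_group_hom_group_or_trivial group.is_monoid monoid.one_closed)

setup_lifting type_definition_hom_family

lemmas hom_group_or_trivial_group [simp] = comm_group.axioms(2)[OF comm_group_hom_group_or_trivial]
lemmas hom_group_or_trivial_monoid [simp] = group.is_monoid[OF hom_group_or_trivial_group]

instantiation hom_family :: (type, type) ab_group_add
begin

lift_definition zero_hom_family :: "('a, 'b) hom_family"
  is "\<lambda>C X Y. \<one>\<^bsub>hom_group_or_trivial C X Y\<^esub>"
  by (simp add: monoid.one_closed)

lift_definition plus_hom_family :: "('a, 'b) hom_family \<Rightarrow> ('a, 'b) hom_family \<Rightarrow> ('a, 'b) hom_family"
  is "\<lambda>F G C X Y. F C X Y \<otimes>\<^bsub>hom_group_or_trivial C X Y\<^esub> G C X Y"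
  by (simp add: monoid.m_closed)

lift_definition uminus_hom_family :: "('a, 'b) hom_family \<Rightarrow> ('a, 'b) hom_family"
  is "\<lambda>F C X Y. inv\<^bsub>hom_group_or_trivial C X Y\<^esub> F C X Y"
  by (simp add: group.inv_closed)

definition minus_hom_family :: "('a, 'b) hom_family \<Rightarrow> ('a, 'b) hom_family \<Rightarrow> ('a, 'b) hom_family" where
  "minus_hom_family F G = F + - G"

instance
proof
  fix a b c :: "('a, 'b) hom_family"
  show "a + b + c = a + (b + c)"
    by transfer (simp add: monoid.m_assoc)
  show "a + b = b + a"
    by transfer (auto simp: fun_eq_iff intro!: comm_monoid.m_comm[OF
        comm_group.axioms(1)[OF comm_group_hom_group_or_trivial]])
  show "0 + a = a"
    by transfer (simp add: monoid.l_one)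
  show "- a + a = 0"
    by transfer (simp add: group.l_inv)
  show "a - b = a + - b"
    by (simp add: minus_hom_family_def)
qed

end

text \<open>Composition of additive endomorphisms is associative and distributive for arbitrary
  factors, whereas arrows compose only when they match. The ring is used without a unit: identities
  of objects become idempotents, each acting as a unit only on arrows at its object.\<close>

typedef (overloaded) 'a add_endo = "{f :: 'a::ab_group_add \<Rightarrow> 'a. \<forall>x y. f (x + y) = f x + f y}"
  by (rule exI[of _ "\<lambda>x. x"]) simp

setup_lifting type_definition_add_endo

instantiation add_endo :: (ab_group_add) ring
begin

lift_definition zero_add_endo :: "'a add_endo" is "\<lambda>_. 0" by simp
lift_definition plus_add_endo :: "'a add_endo \<Rightarrow> 'a add_endo \<Rightarrow> 'a add_endo" is "\<lambda>f g x. f x + g x"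
  by (simp add: algebra_simps)
lift_definition minus_add_endo :: "'a add_endo \<Rightarrow> 'a add_endo \<Rightarrow> 'a add_endo" is "\<lambda>f g x. f x - g x"
  by (simp add: algebra_simps)
lift_definition uminus_add_endo :: "'a add_endo \<Rightarrow> 'a add_endo" is "\<lambda>f x. - f x"
  by (simp add: algebra_simps)
lift_definition times_add_endo :: "'a add_endo \<Rightarrow> 'a add_endo \<Rightarrow> 'a add_endo" is "\<lambda>f g x. f (g x)"
  by simp

instance
  by standard (transfer; simp add: algebra_simps fun_eq_iff)+

end

lemma Rep_hom_family_carrier: "Rep_hom_family F C X Y \<in> carrier (hom_group_or_trivial C X Y)"
  using Rep_hom_family[of F] by blast

type_synonym ('o, 'm) hring = "('o, 'm) hom_family add_endo"

section \<open>Embedding of the arrows of a preadditive category into the ring\<close>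

context preadditive_category
begin

lemma Hom_objD: "f \<in> Hom C X Y \<Longrightarrow> X \<in> obj C \<and> Y \<in> obj C"
  by (auto simp: Hom_def src_obj tgt_obj)

lemma hom_group_simps [simp]:
  "carrier (hom_group C X Y) = Hom C X Y"
  "f \<otimes>\<^bsub>hom_group C X Y\<^esub> g = f \<boxplus> g"
  "\<one>\<^bsub>hom_group C X Y\<^esub> = zero_arr C X Y"
  by (simp_all add: hom_group_def)

lemma group_hom_group: "X \<in> obj C \<Longrightarrow> Y \<in> obj C \<Longrightarrow> group (hom_group C X Y)"
  using hom_comm_group comm_group.axioms(2) by blast

lemma plus_Hom: "f \<in> Hom C X Y \<Longrightarrow> g \<in> Hom C X Y \<Longrightarrow> f \<boxplus> g \<in> Hom C X Y"
  using monoid.m_closed[OF group.is_monoid[OF group_hom_group]] Hom_objD by (metis hom_group_simps(1,2))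

lemma zero_Hom: "X \<in> obj C \<Longrightarrow> Y \<in> obj C \<Longrightarrow> zero_arr C X Y \<in> Hom C X Y"
  using monoid.one_closed[OF group.is_monoid[OF group_hom_group]] by (metis hom_group_simps(1,3))

lemma minus_Hom: "f \<in> Hom C X Y \<Longrightarrow> minus_arr C f \<in> Hom C X Y"
  using group.inv_closed[OF group_hom_group, of X Y f] Hom_objD[of f X Y]
  by (auto simp: minus_arr_def Hom_def)

lemma minus_arr_plus: "f \<in> Hom C X Y \<Longrightarrow> minus_arr C f \<boxplus> f = zero_arr C X Y"
  using group.l_inv[OF group_hom_group, of X Y f] Hom_objD[of f X Y]
  by (simp add: minus_arr_def Hom_def)

lemma hom_group_or_trivial_eq:
  "X \<in> obj C \<Longrightarrow> Y \<in> obj C \<Longrightarrow> hom_group_or_trivial C X Y = hom_group C X Y"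
  using preadditive_category_axioms by (simp add: hom_group_or_trivial_def)

text \<open>
  Every arrow acts on \<open>hom_family\<close> by postcomposition. This embeds the arrows of \<open>C\<close> into a ring,
  compatibly with composition and addition and injectively on each hom-set, so that identities
  between arrows become identities in a ring, without side conditions on sources and targets.
\<close>

definition post :: "'b \<Rightarrow> ('a, 'b) hom_family \<Rightarrow> ('a, 'b) addcat \<Rightarrow> 'a \<Rightarrow> 'a \<Rightarrow> 'b" where
  "post f F = (\<lambda>C' T Z. if C' = C \<and> T \<in> obj C \<and> Z = tgt C f \<and> f \<in> arr C
     then f \<cdot> Rep_hom_family F C T (src C f) else Rep_hom_family 0 C' T Z)"

lemma Rep_hom_family_in: "T \<in> obj C \<Longrightarrow> Z \<in> obj C \<Longrightarrow> Rep_hom_family F C T Z \<in> Hom C T Z"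
  using Rep_hom_family_carrier[of F C T Z] hom_group_or_trivial_eq[of T Z] by simp

lemma arr_Hom: "f \<in> arr C \<Longrightarrow> f \<in> Hom C (src C f) (tgt C f)"
  by (simp add: Hom_def)

lemma post_in: "post f F C' X Y \<in> carrier (hom_group_or_trivial C' X Y)"
proof (cases "C' = C \<and> X \<in> obj C \<and> Y = tgt C f \<and> f \<in> arr C")
  case True
  then have "f \<cdot> Rep_hom_family F C X (src C f) \<in> Hom C X Y"
    using cmp_Hom[OF Rep_hom_family_in arr_Hom] src_obj by blast
  then show ?thesis
    using True tgt_obj by (simp add: post_def hom_group_or_trivial_eq)
next
  case False
  then show ?thesis using Rep_hom_family_carrier[of 0 C' X Y] by (auto simp: post_def)
qed

lemma Rep_post: "Rep_hom_family (Abs_hom_family (post f F)) = post f F"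
  by (rule Abs_hom_family_inverse) (simp add: post_in)

lemma Rep_plus: "T \<in> obj C \<Longrightarrow> Z \<in> obj C \<Longrightarrow>
    Rep_hom_family (F + G) C T Z = Rep_hom_family F C T Z \<boxplus> Rep_hom_family G C T Z"
  by (simp add: plus_hom_family.rep_eq hom_group_or_trivial_eq)

text \<open>Outside the components that \<open>post f\<close> fills, its value is the neutral
  element; additivity there amounts to the neutral element being its own double.\<close>

lemma Rep_plus_0: "Rep_hom_family 0 C' T Z = Rep_hom_family 0 C' T Z \<otimes>\<^bsub>hom_group_or_trivial C' T Z\<^esub> Rep_hom_family 0 C' T Z"
  by (metis add_0 plus_hom_family.rep_eq)

lemma post_plus: "Abs_hom_family (post f (F + G)) = Abs_hom_family (post f F) + Abs_hom_family (post f G)"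
proof -
  have "post f (F + G) C' T Z =
      post f F C' T Z \<otimes>\<^bsub>hom_group_or_trivial C' T Z\<^esub> post f G C' T Z" for C' T Z
  proof (cases "C' = C \<and> T \<in> obj C \<and> Z = tgt C f \<and> f \<in> arr C")
    case True
    then have s: "src C f \<in> obj C" "Z \<in> obj C" using src_obj tgt_obj by auto
    have "f \<cdot> (Rep_hom_family F C T (src C f) \<boxplus> Rep_hom_family G C T (src C f)) =
       f \<cdot> Rep_hom_family F C T (src C f) \<boxplus> f \<cdot> Rep_hom_family G C T (src C f)"
      using cmp_plus_right[OF Rep_hom_family_in Rep_hom_family_in arr_Hom] s True by blast
    then show ?thesis
      using True s by (simp add: post_def hom_group_or_trivial_eq Rep_plus)
  next
    case False
    then show ?thesis using Rep_plus_0[of C' T Z] by (auto simp: post_def)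
  qed
  then show ?thesis
    by (intro Rep_hom_family_inject[THEN iffD1]) (simp add: Rep_post plus_hom_family.rep_eq fun_eq_iff)
qed

definition emb :: "'b \<Rightarrow> ('a, 'b) hring" where
  "emb f = Abs_add_endo (\<lambda>F. Abs_hom_family (post f F))"

lemma Rep_emb: "Rep_add_endo (emb f) F = Abs_hom_family (post f F)"
  unfolding emb_def by (subst Abs_add_endo_inverse) (auto simp: post_plus)

lemma Rep_emb': "Rep_hom_family (Rep_add_endo (emb f) F) = post f F"
  by (simp add: Rep_emb Rep_post)

lemma emb_eqI: "(\<And>F. post f F = G F) \<Longrightarrow> (\<And>F. Rep_hom_family (Rep_add_endo g F) = G F) \<Longrightarrow> emb f = g"
  by (rule Rep_add_endo_inject[THEN iffD1], rule ext, rule Rep_hom_family_inject[THEN iffD1])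
     (simp add: Rep_emb')

text \<open>\<open>post f\<close> fills only components with target \<open>tgt C f\<close>, and
  \<open>post g\<close> reads only those with target \<open>src C g\<close>. For composable arrows
  these are the same components, and the claim there is associativity.\<close>

lemma emb_cmp:
  assumes f: "f \<in> Hom C X Y" and g: "g \<in> Hom C Y Z"
  shows "emb (g \<cdot> f) = emb g * emb f"
proof (rule emb_eqI[OF refl])
  fix F
  have gf: "g \<cdot> f \<in> Hom C X Z" using cmp_Hom f g by blast
  have o: "X \<in> obj C" "Y \<in> obj C" using f Hom_objD by blast+
  have a: "src C f = X" "tgt C f = Y" "src C g = Y" "tgt C g = Z" "f \<in> arr C" "g \<in> arr C"
    "g \<cdot> f \<in> arr C" "src C (g \<cdot> f) = X" "tgt C (g \<cdot> f) = Z"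
    using f g gf by (auto simp: Hom_def)
  show "Rep_hom_family (Rep_add_endo (emb g * emb f) F) = post (g \<cdot> f) F"
    using a o by (auto simp: times_add_endo.rep_eq Rep_emb' post_def fun_eq_iff
        cmp_assoc[OF Rep_hom_family_in f g])
qed

lemma emb_plus:
  assumes f: "f \<in> Hom C X Y" and g: "g \<in> Hom C X Y"
  shows "emb (f \<boxplus> g) = emb f + emb g"
proof (rule emb_eqI[OF refl])
  fix F
  have o: "X \<in> obj C" "Y \<in> obj C" using f Hom_objD by blast+
  have a: "src C f = X" "tgt C f = Y" "src C g = X" "tgt C g = Y" "f \<in> arr C" "g \<in> arr C"
    "f \<boxplus> g \<in> arr C" "src C (f \<boxplus> g) = X" "tgt C (f \<boxplus> g) = Y"
    using f g plus_Hom[OF f g] by (auto simp: Hom_def)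
  show "Rep_hom_family (Rep_add_endo (emb f + emb g) F) = post (f \<boxplus> g) F"
    using a o by (auto simp: Rep_plus_0[symmetric] plus_add_endo.rep_eq plus_hom_family.rep_eq Rep_emb' post_def
        fun_eq_iff hom_group_or_trivial_eq cmp_plus_left[OF Rep_hom_family_in f g])
qed

lemma emb_zero: "X \<in> obj C \<Longrightarrow> Y \<in> obj C \<Longrightarrow> emb (zero_arr C X Y) = 0"
proof -
  assume o: "X \<in> obj C" "Y \<in> obj C"
  have "zero_arr C X Y \<boxplus> zero_arr C X Y = zero_arr C X Y"
    using monoid.l_one[OF group.is_monoid[OF group_hom_group], of X Y "zero_arr C X Y"] o zero_Hom by simp
  then have "emb (zero_arr C X Y) + emb (zero_arr C X Y) = emb (zero_arr C X Y)"
    using emb_plus[OF zero_Hom[OF o] zero_Hom[OF o]] by simp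
  then show ?thesis by simp
qed

lemma emb_minus: "f \<in> Hom C X Y \<Longrightarrow> emb (minus_arr C f) = - emb f"
  using emb_plus[OF minus_Hom[of f X Y], of f] minus_arr_plus[of f X Y] emb_zero[of X Y] Hom_objD[of f X Y]
  by (simp add: eq_neg_iff_add_eq_0)

text \<open>Test on the family that has the identity at \<open>(C, X, X)\<close> and neutral
  elements elsewhere: \<open>post\<close> returns the arrow itself as the component at
  \<open>(C, X, Y)\<close>.\<close>

lemma emb_inj:
  assumes f: "f \<in> Hom C X Y" and g: "g \<in> Hom C X Y" and eq: "emb f = emb g"
  shows "f = g"
proof -
  have o: "X \<in> obj C" "Y \<in> obj C" using f Hom_objD by blast+
  define F :: "('a, 'b) addcat \<Rightarrow> 'a \<Rightarrow> 'a \<Rightarrow> 'b" where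
    "F = (\<lambda>C' T Z. if C' = C \<and> T = X \<and> Z = X then ident C X else Rep_hom_family 0 C' T Z)"
  have "\<forall>C' T Z. F C' T Z \<in> carrier (hom_group_or_trivial C' T Z)"
    using Rep_hom_family_carrier[of 0] ident_Hom[OF o(1)] by (auto simp: F_def hom_group_or_trivial_eq[OF o(1) o(1)])
  then have F: "Rep_hom_family (Abs_hom_family F) = F"
    by (simp add: Abs_hom_family_inverse)
  have "post h (Abs_hom_family F) C X Y = h" if "h \<in> Hom C X Y" for h
    using that o ident_right[OF that] by (simp add: post_def F Hom_def) (simp add: F_def)
  then show ?thesis using f g eq Rep_emb' by metis
qed

text \<open>Membership here takes over the typing of arrows. An element of the ring does not
  determine its source and target: zero lies in every \<open>Homr X Y\<close> between
  objects.\<close>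

definition Homr :: "'a \<Rightarrow> 'a \<Rightarrow> ('a, 'b) hring set" where
  "Homr X Y = emb ` Hom C X Y"

lemma Homr_emb: "f \<in> Hom C X Y \<Longrightarrow> emb f \<in> Homr X Y"
  by (simp add: Homr_def)

lemma Homr_E: "x \<in> Homr X Y \<Longrightarrow> (\<And>f. f \<in> Hom C X Y \<Longrightarrow> x = emb f \<Longrightarrow> thesis) \<Longrightarrow> thesis"
  unfolding Homr_def by blast

lemma Homr_obj: "x \<in> Homr X Y \<Longrightarrow> X \<in> obj C" "x \<in> Homr X Y \<Longrightarrow> Y \<in> obj C"
  unfolding Homr_def using Hom_objD by blast+

lemma Homr_mult: "x \<in> Homr Y Z \<Longrightarrow> y \<in> Homr X Y \<Longrightarrow> x * y \<in> Homr X Z"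
  unfolding Homr_def by (elim imageE) (simp add: emb_cmp[symmetric] cmp_Hom)

lemma Homr_plus: "x \<in> Homr X Y \<Longrightarrow> y \<in> Homr X Y \<Longrightarrow> x + y \<in> Homr X Y"
  unfolding Homr_def by (elim imageE) (simp add: emb_plus[symmetric] plus_Hom)

lemma Homr_uminus: "x \<in> Homr X Y \<Longrightarrow> - x \<in> Homr X Y"
  unfolding Homr_def by (elim imageE) (simp add: emb_minus[symmetric] minus_Hom)

lemma Homr_minus: "x \<in> Homr X Y \<Longrightarrow> y \<in> Homr X Y \<Longrightarrow> x - y \<in> Homr X Y"
  using Homr_plus[of x X Y "- y"] Homr_uminus[of y X Y] by simp

lemma Homr_zero: "X \<in> obj C \<Longrightarrow> Y \<in> obj C \<Longrightarrow> 0 \<in> Homr X Y"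
  using Homr_emb[OF zero_Hom, of X Y] by (simp add: emb_zero)

definition idr :: "'a \<Rightarrow> ('a, 'b) hring" where
  "idr X = emb (ident C X)"

lemma Homr_idr: "X \<in> obj C \<Longrightarrow> idr X \<in> Homr X X"
  by (simp add: Homr_emb idr_def ident_Hom)

lemma idr_left: "x \<in> Homr X Y \<Longrightarrow> idr Y * x = x"
  unfolding Homr_def idr_def using emb_cmp[OF _ ident_Hom, of _ X Y] Hom_objD ident_left by fastforce

lemma idr_right: "x \<in> Homr X Y \<Longrightarrow> x * idr X = x"
  unfolding Homr_def idr_def using emb_cmp[OF ident_Hom, of X _ Y] Hom_objD ident_right by fastforce

definition unemb :: "'a \<Rightarrow> 'a \<Rightarrow> ('a, 'b) hring \<Rightarrow> 'b" where
  "unemb X Y = inv_into (Hom C X Y) emb"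

lemma unemb_Hom: "x \<in> Homr X Y \<Longrightarrow> unemb X Y x \<in> Hom C X Y"
  by (simp add: Homr_def inv_into_into unemb_def)

lemma emb_unemb: "x \<in> Homr X Y \<Longrightarrow> emb (unemb X Y x) = x"
  by (simp add: Homr_def f_inv_into_f unemb_def)

end

section \<open>Generalized elements in abelian categories\<close>

context preadditive_category
begin

lemma emb_eq_0_iff: "f \<in> Hom C X Y \<Longrightarrow> emb f = 0 \<longleftrightarrow> f = zero_arr C X Y"
  by (metis Hom_objD emb_inj emb_zero zero_Hom)

text \<open>Cancellation is tested against zero only; since each \<open>Homr\<close> is closed under
  differences, this is the usual notion.\<close>

definition epir :: "'a \<Rightarrow> 'a \<Rightarrow> ('a, 'b) hring \<Rightarrow> bool" where
  "epir X Y a \<longleftrightarrow> a \<in> Homr X Y \<and> (\<forall>W. \<forall>g \<in> Homr Y W. g * a = 0 \<longrightarrow> g = 0)"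

definition monor :: "'a \<Rightarrow> 'a \<Rightarrow> ('a, 'b) hring \<Rightarrow> bool" where
  "monor X Y a \<longleftrightarrow> a \<in> Homr X Y \<and> (\<forall>W. \<forall>g \<in> Homr W X. a * g = 0 \<longrightarrow> g = 0)"

lemma epirD: "epir X Y a \<Longrightarrow> g \<in> Homr Y W \<Longrightarrow> g * a = 0 \<Longrightarrow> g = 0"
  by (auto simp: epir_def)

lemma monorD: "monor X Y a \<Longrightarrow> g \<in> Homr W X \<Longrightarrow> a * g = 0 \<Longrightarrow> g = 0"
  by (auto simp: monor_def)

lemma monor_cancel:
  "monor X Y a \<Longrightarrow> g \<in> Homr W X \<Longrightarrow> h \<in> Homr W X \<Longrightarrow> a * g = a * h \<Longrightarrow> g = h"
  using monorD[of X Y a "g - h" W] Homr_minus[of g W X h] by (simp add: algebra_simps)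

lemma epir_Homr: "epir X Y a \<Longrightarrow> a \<in> Homr X Y"
  by (simp add: epir_def)

lemma epir_idr: "X \<in> obj C \<Longrightarrow> epir X X (idr X)"
  by (auto simp: epir_def Homr_idr idr_right)

lemma epir_mult: "epir X Y a \<Longrightarrow> epir Y Z b \<Longrightarrow> epir X Z (b * a)"
  unfolding epir_def
proof (intro conjI allI ballI impI; elim conjE)
  fix W g assume a: "a \<in> Homr X Y" "\<forall>W. \<forall>g\<in>Homr Y W. g * a = 0 \<longrightarrow> g = 0"
    and b: "b \<in> Homr Y Z" "\<forall>W. \<forall>g\<in>Homr Z W. g * b = 0 \<longrightarrow> g = 0"
    and g: "g \<in> Homr Z W" "g * (b * a) = 0"
  have "g * b = 0" using a(2) Homr_mult[OF g(1) b(1)] g(2) by (simp add: mult.assoc)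
  then show "g = 0" using b(2) g(1) by blast
qed (rule Homr_mult)

lemma is_epi_iff: "f \<in> Hom C X Y \<Longrightarrow> is_epi C f \<longleftrightarrow> epir X Y (emb f)"
proof
  assume f: "f \<in> Hom C X Y" and e: "is_epi C f"
  have a: "f \<in> arr C" "src C f = X" "tgt C f = Y" using f by (auto simp: Hom_def)
  show "epir X Y (emb f)"
    unfolding epir_def
  proof (intro conjI allI ballI impI)
    fix W g assume g: "g \<in> Homr Y W" "g * emb f = 0"
    then obtain g' where g': "g' \<in> Hom C Y W" "g = emb g'" by (auto elim: Homr_E)
    have o: "Y \<in> obj C" "W \<in> obj C" "X \<in> obj C" using g' f Hom_objD by blast+
    have z: "zero_arr C Y W \<in> Hom C Y W" using o zero_Hom by blast
    have "emb (g' \<cdot> f) = emb (zero_arr C Y W \<cdot> f)"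
      using g g' f z o by (simp add: emb_cmp emb_zero)
    then have "g' \<cdot> f = zero_arr C Y W \<cdot> f"
      using emb_inj cmp_Hom f g' z by metis
    then have "g' = zero_arr C Y W"
      using e g' z a unfolding is_epi_def by metis
    then show "g = 0" using g' o emb_zero by simp
  qed (simp add: f Homr_emb)
next
  assume f: "f \<in> Hom C X Y" and e: "epir X Y (emb f)"
  have a: "f \<in> arr C" "src C f = X" "tgt C f = Y" using f by (auto simp: Hom_def)
  show "is_epi C f"
    unfolding is_epi_def a
  proof (intro conjI allI ballI impI a)
    fix W g h assume g: "g \<in> Hom C Y W" "h \<in> Hom C Y W" "g \<cdot> f = h \<cdot> f"
    have "(emb g - emb h) * emb f = 0"
      using emb_cmp[OF f g(1)] emb_cmp[OF f g(2)] g(3) by (simp add: left_diff_distrib)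
    then have "emb g - emb h = 0"
      using epirD[OF e Homr_minus[OF Homr_emb[OF g(1)] Homr_emb[OF g(2)]]] by blast
    then show "g = h" using emb_inj g by simp
  qed
qed

lemma is_mono_iff: "f \<in> Hom C X Y \<Longrightarrow> is_mono C f \<longleftrightarrow> monor X Y (emb f)"
proof
  assume f: "f \<in> Hom C X Y" and e: "is_mono C f"
  have a: "f \<in> arr C" "src C f = X" "tgt C f = Y" using f by (auto simp: Hom_def)
  show "monor X Y (emb f)"
    unfolding monor_def
  proof (intro conjI allI ballI impI)
    fix W g assume g: "g \<in> Homr W X" "emb f * g = 0"
    then obtain g' where g': "g' \<in> Hom C W X" "g = emb g'" by (auto elim: Homr_E)
    have o: "Y \<in> obj C" "W \<in> obj C" "X \<in> obj C" using g' f Hom_objD by blast+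
    have z: "zero_arr C W X \<in> Hom C W X" using o zero_Hom by blast
    have "emb (f \<cdot> g') = emb (f \<cdot> zero_arr C W X)"
      using g emb_cmp[OF g'(1) f] emb_cmp[OF z f] g' o by (simp add: emb_zero)
    then have "f \<cdot> g' = f \<cdot> zero_arr C W X"
      using emb_inj cmp_Hom f g' z by metis
    then have "g' = zero_arr C W X"
      using e g' z a unfolding is_mono_def by metis
    then show "g = 0" using g' o emb_zero by simp
  qed (simp add: f Homr_emb)
next
  assume f: "f \<in> Hom C X Y" and e: "monor X Y (emb f)"
  have a: "f \<in> arr C" "src C f = X" "tgt C f = Y" using f by (auto simp: Hom_def)
  show "is_mono C f"
    unfolding is_mono_def a
  proof (intro conjI allI ballI impI a)
    fix W g h assume g: "g \<in> Hom C W X" "h \<in> Hom C W X" "f \<cdot> g = f \<cdot> h"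
    have "emb f * (emb g - emb h) = 0"
      using emb_cmp[OF g(1) f] emb_cmp[OF g(2) f] g(3) by (simp add: right_diff_distrib)
    then have "emb g - emb h = 0"
      using monorD[OF e Homr_minus[OF Homr_emb[OF g(1)] Homr_emb[OF g(2)]]] by blast
    then show "g = h" using emb_inj g by simp
  qed
qed

text \<open>Existence in the universal property is kept as a factorisation statement; uniqueness,
  applied to the factorisations of the zero arrow, turns into \<open>monor\<close>.\<close>

lemma is_kernelE:
  assumes "is_kernel C f k" and f: "f \<in> Hom C X Y"
  obtains K where "k \<in> Hom C K X" "emb f * emb k = 0" "monor K X (emb k)"
    "\<forall>W. \<forall>g \<in> Homr W X. emb f * g = 0 \<longrightarrow> (\<exists>h \<in> Homr W K. emb k * h = g)"
proof -
  have a: "f \<in> arr C" "src C f = X" "tgt C f = Y" using f by (auto simp: Hom_def)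
  define K where "K = src C k"
  have k: "k \<in> Hom C K X" and fk: "f \<cdot> k = zero_arr C K Y"
    and un: "\<And>W g. g \<in> Hom C W X \<Longrightarrow> f \<cdot> g = zero_arr C W Y \<Longrightarrow> \<exists>!h. h \<in> Hom C W K \<and> k \<cdot> h = g"
    using assms(1) a by (auto simp: is_kernel_def K_def Hom_def)
  have o: "K \<in> obj C" "X \<in> obj C" "Y \<in> obj C" using k f Hom_objD by blast+
  have lift: "\<exists>!h. h \<in> Homr W K \<and> emb k * h = g" if g: "g \<in> Homr W X" "emb f * g = 0" for W g
  proof -
    obtain g' where g': "g' \<in> Hom C W X" "g = emb g'" using g by (auto elim: Homr_E)
    have "emb (f \<cdot> g') = 0" using g g' f by (simp add: emb_cmp)
    then have "f \<cdot> g' = zero_arr C W Y" using emb_eq_0_iff cmp_Hom g' f by metis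
    from un[OF g'(1) this] obtain h where h: "h \<in> Hom C W K" "k \<cdot> h = g'"
      and u: "\<And>h'. h' \<in> Hom C W K \<Longrightarrow> k \<cdot> h' = g' \<Longrightarrow> h' = h" by blast
    show ?thesis
    proof (rule ex1I[of _ "emb h"])
      show "emb h \<in> Homr W K \<and> emb k * emb h = g"
        using h k g' Homr_emb emb_cmp[OF h(1) k] by auto
      fix x assume x: "x \<in> Homr W K \<and> emb k * x = g"
      then obtain x' where x': "x' \<in> Hom C W K" "x = emb x'" by (auto elim: Homr_E)
      have "k \<cdot> x' = g'"
        using x x' k g' emb_cmp[OF x'(1) k] by (intro emb_inj[OF cmp_Hom[OF x'(1) k] g'(1)]) auto
      then show "x = emb h" using u x' by blast
    qed
  qed
  have fk0: "emb f * emb k = 0" using fk emb_cmp[OF k f] o by (simp add: emb_zero)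
  show ?thesis
  proof (rule that[OF k fk0])
    show "monor K X (emb k)"
      unfolding monor_def
    proof (intro conjI allI ballI impI)
      fix W g assume g: "g \<in> Homr W K" "emb k * g = 0"
      have "W \<in> obj C" using g Homr_obj by blast
      then have z: "0 \<in> Homr W X" "0 \<in> Homr W K" using o Homr_zero by blast+
      obtain h where u: "\<And>x. x \<in> Homr W K \<Longrightarrow> emb k * x = 0 \<Longrightarrow> x = h"
        using lift[OF z(1)] by auto
      show "g = 0" using u[OF g] u[OF z(2)] by simp
    qed (simp add: k Homr_emb)
  next
    show "\<forall>W. \<forall>g \<in> Homr W X. emb f * g = 0 \<longrightarrow> (\<exists>h \<in> Homr W K. emb k * h = g)" using lift by blast
  qed
qed

lemma is_cokernelE:
  assumes "is_cokernel C f q" and f: "f \<in> Hom C X Y"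
  obtains Q where "q \<in> Hom C Y Q" "emb q * emb f = 0" "epir Y Q (emb q)"
    "\<forall>W. \<forall>g \<in> Homr Y W. g * emb f = 0 \<longrightarrow> (\<exists>h \<in> Homr Q W. h * emb q = g)"
proof -
  have a: "f \<in> arr C" "src C f = X" "tgt C f = Y" using f by (auto simp: Hom_def)
  define Q where "Q = tgt C q"
  have q: "q \<in> Hom C Y Q" and fq: "q \<cdot> f = zero_arr C X Q"
    and un: "\<And>W g. g \<in> Hom C Y W \<Longrightarrow> g \<cdot> f = zero_arr C X W \<Longrightarrow> \<exists>!h. h \<in> Hom C Q W \<and> h \<cdot> q = g"
    using assms(1) a by (auto simp: is_cokernel_def Q_def Hom_def)
  have o: "Q \<in> obj C" "X \<in> obj C" "Y \<in> obj C" using q f Hom_objD by blast+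
  have lift: "\<exists>!h. h \<in> Homr Q W \<and> h * emb q = g" if g: "g \<in> Homr Y W" "g * emb f = 0" for W g
  proof -
    obtain g' where g': "g' \<in> Hom C Y W" "g = emb g'" using g by (auto elim: Homr_E)
    have "emb (g' \<cdot> f) = 0" using g g' f by (simp add: emb_cmp)
    then have "g' \<cdot> f = zero_arr C X W" using emb_eq_0_iff cmp_Hom g' f by metis
    from un[OF g'(1) this] obtain h where h: "h \<in> Hom C Q W" "h \<cdot> q = g'"
      and u: "\<And>h'. h' \<in> Hom C Q W \<Longrightarrow> h' \<cdot> q = g' \<Longrightarrow> h' = h" by blast
    show ?thesis
    proof (rule ex1I[of _ "emb h"])
      show "emb h \<in> Homr Q W \<and> emb h * emb q = g"
        using h q g' Homr_emb emb_cmp[OF q h(1)] by auto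
      fix x assume x: "x \<in> Homr Q W \<and> x * emb q = g"
      then obtain x' where x': "x' \<in> Hom C Q W" "x = emb x'" by (auto elim: Homr_E)
      have "x' \<cdot> q = g'"
        using x x' q g' emb_cmp[OF q x'(1)] by (intro emb_inj[OF cmp_Hom[OF q x'(1)] g'(1)]) auto
      then show "x = emb h" using u x' by blast
    qed
  qed
  have fq0: "emb q * emb f = 0" using fq emb_cmp[OF f q] o by (simp add: emb_zero)
  show ?thesis
  proof (rule that[OF q fq0])
    show "epir Y Q (emb q)"
      unfolding epir_def
    proof (intro conjI allI ballI impI)
      fix W g assume g: "g \<in> Homr Q W" "g * emb q = 0"
      have "W \<in> obj C" using g Homr_obj by blast
      then have z: "0 \<in> Homr Y W" "0 \<in> Homr Q W" using o Homr_zero by blast+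
      obtain h where u: "\<And>x. x \<in> Homr Q W \<Longrightarrow> x * emb q = 0 \<Longrightarrow> x = h"
        using lift[OF z(1)] by auto
      show "g = 0" using u[OF g] u[OF z(2)] by simp
    qed (simp add: q Homr_emb)
  next
    show "\<forall>W. \<forall>g \<in> Homr Y W. g * emb f = 0 \<longrightarrow> (\<exists>h \<in> Homr Q W. h * emb q = g)" using lift by blast
  qed
qed

text \<open>\<open>lift_arr\<close> is a definite description, which makes sense because
  \<open>k\<close> is a monomorphism. Any ring element that solves the equation is then its
  value.\<close>

lemma lift_arr_props:
  assumes k: "k \<in> Hom C K Y" "monor K Y (emb k)" and f: "f \<in> Hom C X Y"
    and h: "h \<in> Homr X K" "emb k * h = emb f"
  shows "lift_arr C k f \<in> Hom C X K \<and> emb (lift_arr C k f) = h"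
proof -
  have a: "src C f = X" "src C k = K" using f k by (auto simp: Hom_def)
  obtain h' where h': "h' \<in> Hom C X K" "h = emb h'" using h by (auto elim: Homr_E)
  have "k \<cdot> h' = f"
    using h h' k emb_cmp[OF h'(1) k(1)] by (intro emb_inj[OF cmp_Hom[OF h'(1) k(1)] f]) auto
  moreover have "x = h'" if x: "x \<in> Hom C X K" "k \<cdot> x = f" for x
  proof (rule emb_inj[OF x(1) h'(1)])
    show "emb x = emb h'"
      using monor_cancel[OF k(2) Homr_emb[OF x(1)] h(1)] h h' x emb_cmp[OF x(1) k(1)] by auto
  qed
  ultimately have "lift_arr C k f = h'"
    unfolding lift_arr_def a using h'(1) by blast
  then show ?thesis using h' by simp
qed

lemma zero_obj_Homr:
  assumes "is_zero_obj C Z"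
  shows "x \<in> Homr X Z \<Longrightarrow> x = 0" "x \<in> Homr Z X \<Longrightarrow> x = 0"
proof -
  have Z: "Z \<in> obj C" using assms by (simp add: is_zero_obj_def)
  { assume x: "x \<in> Homr X Z"
    then obtain f where f: "f \<in> Hom C X Z" "x = emb f" by (auto elim: Homr_E)
    then have "X \<in> obj C" using Hom_objD by blast
    with Z assms f have "f = zero_arr C X Z"
      using zero_Hom by (metis is_zero_obj_def)
    then show "x = 0" using f \<open>X \<in> obj C\<close> Z emb_zero by blast }
  { assume x: "x \<in> Homr Z X"
    then obtain f where f: "f \<in> Hom C Z X" "x = emb f" by (auto elim: Homr_E)
    then have "X \<in> obj C" using Hom_objD by blast
    with Z assms f have "f = zero_arr C Z X"
      using zero_Hom by (metis is_zero_obj_def)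
    then show "x = 0" using f \<open>X \<in> obj C\<close> Z emb_zero by blast }
qed

lemma is_zero_objI:
  assumes "Z \<in> obj C" "idr Z = 0"
  shows "is_zero_obj C Z"
  unfolding is_zero_obj_def
proof (intro conjI ballI ex1I)
  fix X assume X: "X \<in> obj C"
  show "zero_arr C X Z \<in> Hom C X Z" "zero_arr C Z X \<in> Hom C Z X"
    using X assms zero_Hom by blast+
  show "f = zero_arr C X Z" if "f \<in> Hom C X Z" for f
    using that emb_eq_0_iff[OF that] idr_left[OF Homr_emb[OF that]] assms(2) by simp
  show "f = zero_arr C Z X" if "f \<in> Hom C Z X" for f
    using that emb_eq_0_iff[OF that] idr_right[OF Homr_emb[OF that]] assms(2) by simp
qed (rule assms)

lemma is_biproductE:
  assumes "is_biproduct C X Y B" "X \<in> obj C" "Y \<in> obj C"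
  shows "bsum B \<in> obj C" "inj1 B \<in> Hom C X (bsum B)" "inj2 B \<in> Hom C Y (bsum B)"
    "prj1 B \<in> Hom C (bsum B) X" "prj2 B \<in> Hom C (bsum B) Y"
    "emb (prj1 B) * emb (inj1 B) = idr X" "emb (prj2 B) * emb (inj2 B) = idr Y"
    "emb (prj2 B) * emb (inj1 B) = 0" "emb (prj1 B) * emb (inj2 B) = 0"
    "emb (inj1 B) * emb (prj1 B) + emb (inj2 B) * emb (prj2 B) = idr (bsum B)"
proof -
  show m: "bsum B \<in> obj C" "inj1 B \<in> Hom C X (bsum B)" "inj2 B \<in> Hom C Y (bsum B)"
    "prj1 B \<in> Hom C (bsum B) X" "prj2 B \<in> Hom C (bsum B) Y"
    using assms(1) by (auto simp: is_biproduct_def)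
  show "emb (prj1 B) * emb (inj1 B) = idr X" "emb (prj2 B) * emb (inj2 B) = idr Y"
    "emb (prj2 B) * emb (inj1 B) = 0" "emb (prj1 B) * emb (inj2 B) = 0"
    using assms m by (auto simp: is_biproduct_def idr_def emb_zero
        emb_cmp[OF m(2) m(4), symmetric] emb_cmp[OF m(3) m(5), symmetric]
        emb_cmp[OF m(2) m(5), symmetric] emb_cmp[OF m(3) m(4), symmetric])
  have "inj1 B \<cdot> prj1 B \<boxplus> inj2 B \<cdot> prj2 B = ident C (bsum B)"
    using assms(1) by (simp add: is_biproduct_def)
  then show "emb (inj1 B) * emb (prj1 B) + emb (inj2 B) * emb (prj2 B) = idr (bsum B)"
    by (simp add: idr_def emb_cmp[OF m(4) m(2), symmetric] emb_cmp[OF m(5) m(3), symmetric]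
        emb_plus[OF cmp_Hom[OF m(4) m(2)] cmp_Hom[OF m(5) m(3)], symmetric])
qed

end

section \<open>Exactness properties of abelian categories: pullbacks of epimorphisms and
  images\<close>

context abelian_category
begin

lemma biprod: "X \<in> obj C \<Longrightarrow> Y \<in> obj C \<Longrightarrow> is_biproduct C X Y (biprod C X Y)"
  unfolding biprod_def using biproduct_exists someI_ex by metis

lemma zero_obj: "is_zero_obj C (zero_obj C)"
  unfolding zero_obj_def using zero_obj_exists someI_ex by metis

lemma zero_obj_in: "zero_obj C \<in> obj C"
  using zero_obj by (simp add: is_zero_obj_def)

lemma ker_arr: "f \<in> Hom C X Y \<Longrightarrow> is_kernel C f (ker_arr C f)"
  unfolding ker_arr_def Hom_def using kernel_exists someI_ex by (metis (mono_tags, lifting) mem_Collect_eq)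

lemma coker_arr: "f \<in> Hom C X Y \<Longrightarrow> is_cokernel C f (coker_arr C f)"
  unfolding coker_arr_def Hom_def using cokernel_exists someI_ex by (metis (mono_tags, lifting) mem_Collect_eq)

text \<open>An epimorphism is the cokernel of its kernel: normality makes \<open>\<phi>\<close> the
  cokernel of some \<open>g\<close>, and \<open>g\<close> factors through \<open>k\<close>, so
  whatever kills \<open>k\<close> also kills \<open>g\<close>.\<close>

lemma epir_kernel_factor:
  assumes p: "\<phi> \<in> Hom C X Y" "epir X Y (emb \<phi>)" and k: "is_kernel C \<phi> k"
    and m: "m \<in> Homr X W" "m * emb k = 0"
  shows "\<exists>h \<in> Homr Y W. h * emb \<phi> = m"
proof -
  have "is_epi C \<phi>" using is_epi_iff p by blast
  then obtain g where g: "g \<in> arr C" "is_cokernel C g \<phi>" using epi_normal by blast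
  then have gH: "g \<in> Hom C (src C g) X" using p by (auto simp: is_cokernel_def Hom_def)
  obtain Q where Q: "\<phi> \<in> Hom C X Q" "emb \<phi> * emb g = 0" "epir X Q (emb \<phi>)"
    "\<forall>W. \<forall>x \<in> Homr X W. x * emb g = 0 \<longrightarrow> (\<exists>h \<in> Homr Q W. h * emb \<phi> = x)"
    by (rule is_cokernelE[OF g(2) gH])
  have [simp]: "Q = Y" using Q p by (auto simp: Hom_def)
  obtain K where K: "k \<in> Hom C K X" "emb \<phi> * emb k = 0" "monor K X (emb k)"
    "\<forall>W. \<forall>g \<in> Homr W X. emb \<phi> * g = 0 \<longrightarrow> (\<exists>h \<in> Homr W K. emb k * h = g)"
    by (rule is_kernelE[OF k p(1)])
  from K(4)[rule_format, OF Homr_emb[OF gH] Q(2)] obtain h where "emb k * h = emb g" by blast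
  then have "m * emb g = m * emb k * h" by (simp add: mult.assoc)
  then have "m * emb g = 0" using m(2) by simp
  then show ?thesis using Q(4)[rule_format, OF m(1)] by simp
qed

text \<open>Stability of epimorphisms under pullback is what lets arrows from \<open>T\<close> act
  as elements, with preimages after an epimorphic change of \<open>T\<close>. The pullback is the
  kernel \<open>k\<close> of \<open>\<phi> = a p1 - x p2\<close> on the sum of \<open>A\<close> and
  \<open>T\<close>. If \<open>g p2 k = 0\<close>, then \<open>g p2\<close> factors as
  \<open>h \<phi>\<close>; restricting to \<open>A\<close> gives \<open>h a = 0\<close>, so
  \<open>h = 0\<close>, and restricting to \<open>T\<close> gives \<open>g = 0\<close>.\<close>

lemma pullback_epir:
  assumes a: "epir A B a" and x: "x \<in> Homr T B"
  shows "\<exists>T' a' x'. epir T' T a' \<and> x' \<in> Homr T' A \<and> a * x' = x * a'"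
proof -
  have aH: "a \<in> Homr A B" using a by (rule epir_Homr)
  have o: "A \<in> obj C" "B \<in> obj C" "T \<in> obj C" using aH x Homr_obj by blast+
  define P where "P = biprod C A T"
  note P = is_biproductE[OF biprod[OF o(1) o(3)] o(1) o(3), folded P_def]
  define i1 i2 p1 p2 where "i1 = emb (inj1 P)" "i2 = emb (inj2 P)" "p1 = emb (prj1 P)" "p2 = emb (prj2 P)"
  note d = i1_i2_p1_p2_def
  have H: "i1 \<in> Homr A (bsum P)" "i2 \<in> Homr T (bsum P)" "p1 \<in> Homr (bsum P) A" "p2 \<in> Homr (bsum P) T"
    using P Homr_emb by (auto simp: d)
  note R = P(6-10)[folded d]
  define \<phi> where "\<phi> = a * p1 - x * p2"
  have \<phi>: "\<phi> \<in> Homr (bsum P) B"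
    unfolding \<phi>_def by (rule aH x H Homr_minus Homr_mult)+
  then obtain f where f: "f \<in> Hom C (bsum P) B" "\<phi> = emb f" by (auto elim: Homr_E)
  \<comment> \<open>\<open>\<phi>\<close> inherits being an epimorphism from \<open>a\<close>, its
    restriction to the first summand.\<close>
  have fi: "\<phi> * i1 = a"
    using idr_right[OF aH] by (simp add: \<phi>_def left_diff_distrib mult.assoc R)
  have ep: "epir (bsum P) B (emb f)"
    unfolding epir_def
  proof (intro conjI allI ballI impI)
    fix W g assume g: "g \<in> Homr B W" "g * emb f = 0"
    then have "g * a = 0" using f(2) by (simp add: fi[symmetric] mult.assoc[symmetric])
    then show "g = 0" using epirD[OF a g(1)] by blast
  qed (use \<phi> f in simp)
  define k where "k = ker_arr C f"
  have kk: "is_kernel C f k" using ker_arr f(1) k_def by blast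
  obtain K where K: "k \<in> Hom C K (bsum P)" "emb f * emb k = 0" "monor K (bsum P) (emb k)"
    "\<forall>W. \<forall>g \<in> Homr W (bsum P). emb f * g = 0 \<longrightarrow> (\<exists>h \<in> Homr W K. emb k * h = g)"
    by (rule is_kernelE[OF kk f(1)])
  have kH: "emb k \<in> Homr K (bsum P)" using K Homr_emb by blast
  have "epir K T (p2 * emb k)"
    unfolding epir_def
  proof (intro conjI allI ballI impI)
    show "p2 * emb k \<in> Homr K T" by (rule H kH Homr_mult)+
    fix W g assume g: "g \<in> Homr T W" "g * (p2 * emb k) = 0"
    have gp: "g * p2 \<in> Homr (bsum P) W" by (rule Homr_mult[OF g(1) H(4)])
    obtain h where h: "h \<in> Homr B W" "h * emb f = g * p2"
      using epir_kernel_factor[OF f(1) ep kk gp] g(2) by (auto simp: mult.assoc)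
    have "h * a = h * emb f * i1" using fi f(2) by (simp add: mult.assoc)
    then have "h * a = g * (p2 * i1)" using h(2) by (simp add: mult.assoc)
    then have "h * a = 0" by (simp add: R)
    then have "h = 0" using epirD[OF a h(1)] by blast
    then have "g * p2 * i2 = 0" using h(2) by auto
    then have "g * (p2 * i2) = 0" by (simp add: mult.assoc)
    then show "g = 0" using R idr_right[OF g(1)] by simp
  qed
  moreover have "p1 * emb k \<in> Homr K A" by (rule H kH Homr_mult)+
  moreover have "a * (p1 * emb k) = x * (p2 * emb k)"
  proof -
    have "\<phi> * emb k = 0" using K(2) f(2) by simp
    then show ?thesis by (simp add: \<phi>_def left_diff_distrib mult.assoc)
  qed
  ultimately show ?thesis by blast
qed

text \<open>The delicate point is that the corestriction \<open>\<epsilon>\<close> is an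
  epimorphism. If \<open>g \<epsilon> = 0\<close>, then \<open>f\<close> factors through
  \<open>m k\<close> with \<open>k\<close> the kernel of \<open>g\<close>. This composite is a
  monomorphism, hence the kernel of some \<open>c\<close>; as \<open>c f = 0\<close>, the arrow
  \<open>c\<close> factors through the cokernel of \<open>f\<close> and kills \<open>m\<close>. So
  \<open>m\<close> factors through \<open>m k\<close>, which gives \<open>k\<close> a right inverse,
  and \<open>g = 0\<close>.\<close>

lemma im_arr_props:
  assumes f: "f \<in> Hom C X Y"
  obtains I where "im_arr C f \<in> Hom C I Y" "src C (im_arr C f) = I" "monor I Y (emb (im_arr C f))"
    "\<exists>\<epsilon>. epir X I \<epsilon> \<and> emb (im_arr C f) * \<epsilon> = emb f"
    "\<forall>W. \<forall>g \<in> Homr W Y. emb (coker_arr C f) * g = 0 \<longrightarrow> (\<exists>h \<in> Homr W I. emb (im_arr C f) * h = g)"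
    "emb (coker_arr C f) * emb f = 0"
proof -
  define q where "q = coker_arr C f"
  define m where "m = im_arr C f"
  obtain Q where
    q: "q \<in> Hom C Y Q" "emb q * emb f = 0" "epir Y Q (emb q)" and
    qf: "\<forall>W. \<forall>g \<in> Homr Y W. g * emb f = 0 \<longrightarrow> (\<exists>h \<in> Homr Q W. h * emb q = g)"
    by (rule is_cokernelE[OF coker_arr[OF f] f, folded q_def])
  have "is_kernel C q m" using ker_arr[OF q(1)] by (simp add: m_def im_arr_def q_def)
  then obtain I where
    m: "m \<in> Hom C I Y" "emb q * emb m = 0" "monor I Y (emb m)" and
    mf: "\<forall>W. \<forall>g \<in> Homr W Y. emb q * g = 0 \<longrightarrow> (\<exists>h \<in> Homr W I. emb m * h = g)"
    by (rule is_kernelE[OF _ q(1)])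
  from mf[rule_format, OF Homr_emb[OF f] q(2)] obtain \<epsilon> where \<epsilon>: "\<epsilon> \<in> Homr X I" "emb m * \<epsilon> = emb f" by blast
  have mH: "emb m \<in> Homr I Y" using m Homr_emb by blast
  have "epir X I \<epsilon>"
    unfolding epir_def
  proof (intro conjI allI ballI impI \<epsilon>)
    fix W g assume g: "g \<in> Homr I W" "g * \<epsilon> = 0"
    then obtain g' where g': "g' \<in> Hom C I W" "g = emb g'" by (auto elim: Homr_E)
    define k where "k = ker_arr C g'"
    obtain K where
      k: "k \<in> Hom C K I" "emb g' * emb k = 0" "monor K I (emb k)" and
      kf: "\<forall>W. \<forall>x \<in> Homr W I. emb g' * x = 0 \<longrightarrow> (\<exists>h \<in> Homr W K. emb k * h = x)"
      by (rule is_kernelE[OF ker_arr[OF g'(1)] g'(1), folded k_def])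
    obtain \<epsilon>' where \<epsilon>': "\<epsilon>' \<in> Homr X K" "emb k * \<epsilon>' = \<epsilon>" using kf[rule_format, OF \<epsilon>(1)] g g' by blast
    have kH: "emb k \<in> Homr K I" using k Homr_emb by blast
    define u where "u = m \<cdot> k"
    have u: "u \<in> Hom C K Y" using cmp_Hom m k u_def by blast
    have ue: "emb u = emb m * emb k" using emb_cmp[OF k(1) m(1)] by (simp add: u_def)
    have um: "monor K Y (emb u)"
      unfolding monor_def
    proof (intro conjI allI ballI impI)
      fix V x assume x: "x \<in> Homr V K" "emb u * x = 0"
      have "emb k * x = 0"
        by (rule monorD[OF m(3) Homr_mult[OF kH x(1)]]) (use x ue in \<open>simp add: mult.assoc\<close>)
      then show "x = 0" by (rule monorD[OF k(3) x(1)])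
    qed (use u Homr_emb in blast)
    then have "is_mono C u" using is_mono_iff u by blast
    then obtain c where c: "c \<in> arr C" "is_kernel C c u" using mono_normal by blast
    then have cH: "c \<in> Hom C Y (tgt C c)" using u by (auto simp: is_kernel_def Hom_def)
    obtain K' where K': "u \<in> Hom C K' Y" "emb c * emb u = 0" "monor K' Y (emb u)"
      "\<forall>W. \<forall>g \<in> Homr W Y. emb c * g = 0 \<longrightarrow> (\<exists>h \<in> Homr W K'. emb u * h = g)"
      by (rule is_kernelE[OF c(2) cH])
    have [simp]: "K' = K" using K'(1) u by (auto simp: Hom_def)
    have "emb f = emb u * \<epsilon>'" using ue \<epsilon> \<epsilon>' by (simp add: mult.assoc)
    then have "emb c * emb f = 0" using K'(2) by (simp add: mult.assoc[symmetric])
    then obtain c' where "c' * emb q = emb c" using qf[rule_format, OF Homr_emb[OF cH]] by blast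
    then have "emb c * emb m = c' * (emb q * emb m)" by (simp add: mult.assoc[symmetric])
    then have "emb c * emb m = 0" using m(2) by simp
    then obtain l where l: "l \<in> Homr I K" "emb u * l = emb m" using K'(4)[rule_format, OF mH] by auto
    have "emb k * l = idr I"
      by (rule monor_cancel[OF m(3), of _ I])
        (use l ue idr_right[OF mH] Homr_mult[OF kH l(1)] Homr_idr Homr_obj(1)[OF mH] in
          \<open>auto simp: mult.assoc\<close>)
    then have "g = g * emb k * l" using idr_right[OF g(1)] by (simp add: mult.assoc)
    then show "g = 0" using k(2) g' by simp
  qed
  then have ex: "\<exists>\<epsilon>. epir X I \<epsilon> \<and> emb m * \<epsilon> = emb f" using \<epsilon>(2) by blast
  have s: "src C m = I" using m(1) by (simp add: Hom_def)
  show ?thesis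
    by (rule that[folded m_def q_def, OF m(1) s m(3) ex mf q(2)])
qed

section \<open>Exactness of complexes\<close>

definition dd :: "('a, 'b) cochain \<Rightarrow> int \<Rightarrow> ('a, 'b) hring" where
  "dd X n = emb (cdiff X n)"

lemma is_cochain_iff: "is_cochain C X \<longleftrightarrow> (\<forall>n. cdiff X n \<in> Hom C (cob X n) (cob X (n + 1))) \<and> (\<forall>n. dd X (n + 1) * dd X n = 0)"
  (is "_ \<longleftrightarrow> ?R")
proof -
  have eq: "cdiff X (n + 1) \<cdot> cdiff X n = zero_arr C (cob X n) (cob X (n + 2)) \<longleftrightarrow> dd X (n + 1) * dd X n = 0"
    if h: "\<forall>n. cdiff X n \<in> Hom C (cob X n) (cob X (n + 1))" for n
  proof -
    have 2: "n + 1 + 1 = n + 2" by simp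
    have d: "cdiff X n \<in> Hom C (cob X n) (cob X (n + 1))"
      "cdiff X (n + 1) \<in> Hom C (cob X (n + 1)) (cob X (n + 2))"
      using h[rule_format, of n] h[rule_format, of "n + 1"] unfolding 2 by auto
    show ?thesis
      using emb_eq_0_iff[OF cmp_Hom[OF d]] emb_cmp[OF d] by (simp add: dd_def)
  qed
  show ?thesis
    unfolding is_cochain_def using eq Hom_objD by metis
qed

lemma cochainD:
  assumes "is_cochain C X"
  shows "cob X n \<in> obj C" "cdiff X n \<in> Hom C (cob X n) (cob X (n + 1))"
    "dd X n \<in> Homr (cob X n) (cob X (n + 1))" "dd X (n + 1) * dd X n = 0"
    "dd X (n - 1) \<in> Homr (cob X (n - 1)) (cob X n)" "dd X n * dd X (n - 1) = 0"
    "cdiff X (n - 1) \<in> Hom C (cob X (n - 1)) (cob X n)"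
proof -
  show 1: "cob X n \<in> obj C" "cdiff X n \<in> Hom C (cob X n) (cob X (n + 1))" for n
    using assms by (auto simp: is_cochain_def)
  then show 2: "dd X n \<in> Homr (cob X n) (cob X (n + 1))" for n
    by (simp add: dd_def Homr_emb)
  show 3: "dd X (n + 1) * dd X n = 0" for n
    using assms is_cochain_iff by blast
  show "dd X (n - 1) \<in> Homr (cob X (n - 1)) (cob X n)" "dd X n * dd X (n - 1) = 0"
    "cdiff X (n - 1) \<in> Hom C (cob X (n - 1)) (cob X n)"
    using 2[of "n - 1"] 3[of "n - 1"] 1[of "n - 1"] by auto
qed

definition exact_at :: "('a, 'b) cochain \<Rightarrow> int \<Rightarrow> bool" where
  "exact_at X n \<longleftrightarrow> (\<forall>T. \<forall>x \<in> Homr T (cob X n). dd X n * x = 0 \<longrightarrow>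
     (\<exists>T' a y. epir T' T a \<and> y \<in> Homr T' (cob X (n - 1)) \<and> dd X (n - 1) * y = x * a))"

lemma exact_atE:
  assumes "exact_at X n" "x \<in> Homr T (cob X n)" "dd X n * x = 0"
  obtains T' a y where "epir T' T a" "y \<in> Homr T' (cob X (n - 1))" "dd X (n - 1) * y = x * a"
  using assms unfolding exact_at_def by blast

text \<open>Cohomology is the cokernel of the lift \<open>l\<close> of one differential to the
  kernel of the next, so it vanishes exactly when \<open>l\<close> is an epimorphism. In that case a
  cocycle factors through the kernel and is then lifted along \<open>l\<close> by pullback.\<close>

lemma cohomology_zero_iff:
  assumes X: "is_cochain C X"
  shows "is_zero_obj C (cohomology C X n) \<longleftrightarrow> exact_at X n"
proof -
  define k where "k = ker_arr C (cdiff X n)"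
  note c = cochainD[OF X, of n]
  obtain K where
    k: "k \<in> Hom C K (cob X n)" "dd X n * emb k = 0" "monor K (cob X n) (emb k)"
    and kf: "\<forall>W. \<forall>g \<in> Homr W (cob X n). dd X n * g = 0 \<longrightarrow> (\<exists>h \<in> Homr W K. emb k * h = g)"
    by (rule is_kernelE[OF ker_arr[OF c(2)] c(2), folded k_def dd_def])
  obtain l' where l': "l' \<in> Homr (cob X (n - 1)) K" "emb k * l' = emb (cdiff X (n - 1))"
    using kf[rule_format, OF c(5) c(6)] unfolding dd_def by blast
  define l where "l = lift_arr C k (cdiff X (n - 1))"
  have l: "l \<in> Hom C (cob X (n - 1)) K" "emb l = l'"
    using lift_arr_props[OF k(1) k(3) c(7) l'] by (auto simp: l_def)
  define q where "q = coker_arr C l"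
  obtain Q where
    q: "q \<in> Hom C K Q" "emb q * emb l = 0" "epir K Q (emb q)"
    and qf: "\<forall>W. \<forall>g \<in> Homr K W. g * emb l = 0 \<longrightarrow> (\<exists>h \<in> Homr Q W. h * emb q = g)"
    by (rule is_cokernelE[OF coker_arr[OF l(1)] l(1), folded q_def])
  have coh: "cohomology C X n = Q"
    using q(1) by (simp add: cohomology_def k_def[symmetric] l_def[symmetric] q_def[symmetric] Hom_def)
  have QO: "Q \<in> obj C" using q Hom_objD by blast
  show ?thesis
    unfolding coh
  proof
    assume Z: "is_zero_obj C Q"
    have ep: "epir (cob X (n - 1)) K l'"
      unfolding epir_def
    proof (intro conjI allI ballI impI l'(1))
      fix W g assume g: "g \<in> Homr K W" "g * l' = 0"
      then obtain h where "h \<in> Homr Q W" "h * emb q = g" using qf l(2) by blast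
      then show "g = 0" using zero_obj_Homr(2)[OF Z] by fastforce
    qed
    show "exact_at X n"
      unfolding exact_at_def
    proof (intro allI ballI impI)
      fix T x assume x: "x \<in> Homr T (cob X n)" "dd X n * x = 0"
      then obtain x' where x': "x' \<in> Homr T K" "emb k * x' = x" using kf by blast
      obtain T' a y where y: "epir T' T a" "y \<in> Homr T' (cob X (n - 1))" "l' * y = x' * a"
        using pullback_epir[OF ep x'(1)] by blast
      have "dd X (n - 1) * y = emb k * (l' * y)"
        using l'(2) by (simp add: dd_def mult.assoc[symmetric])
      then have "dd X (n - 1) * y = x * a"
        using x'(2) y(3) by (simp add: mult.assoc[symmetric])
      then show "\<exists>T' a y. epir T' T a \<and> y \<in> Homr T' (cob X (n - 1)) \<and> dd X (n - 1) * y = x * a"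
        using y by blast
    qed
  next
    assume E: "exact_at X n"
    \<comment> \<open>The kernel inclusion is the universal cocycle; exactness applied to it shows
      that \<open>emb q\<close> kills the epimorphism \<open>a\<close>.\<close>
    obtain T' a y where y: "epir T' K a" "y \<in> Homr T' (cob X (n - 1))" "dd X (n - 1) * y = emb k * a"
      using exact_atE[OF E Homr_emb[OF k(1)] k(2)] by blast
    have "l' * y = a"
      by (rule monor_cancel[OF k(3) Homr_mult[OF l'(1) y(2)] epir_Homr[OF y(1)]])
        (use y(3) l'(2) in \<open>simp add: dd_def mult.assoc[symmetric]\<close>)
    then have "emb q * a = 0" using q(2) l(2) by (auto simp: mult.assoc[symmetric])
    then have "emb q = 0" using epirD[OF y(1) Homr_emb[OF q(1)]] by blast
    then have "idr Q * emb q = 0" by simp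
    then have "idr Q = 0" using epirD[OF q(3) Homr_idr[OF QO]] by blast
    then show "is_zero_obj C Q" using is_zero_objI QO by blast
  qed
qed

section \<open>The homotopy category\<close>

text \<open>
  Chain maps and homotopies are taken with values in the ring: every arrow of the homotopy category
  has the form \<open>htpy_class X Y \<phi>\<close>.
\<close>

definition cmaps :: "('a, 'b) cochain \<Rightarrow> ('a, 'b) cochain \<Rightarrow> (int \<Rightarrow> ('a, 'b) hring) set" where
  "cmaps X Y = {\<phi>. \<forall>n. \<phi> n \<in> Homr (cob X n) (cob Y n) \<and> dd Y n * \<phi> n = \<phi> (n + 1) * dd X n}"

definition htpy :: "('a, 'b) cochain \<Rightarrow> ('a, 'b) cochain \<Rightarrow>
    (int \<Rightarrow> ('a, 'b) hring) \<Rightarrow> (int \<Rightarrow> ('a, 'b) hring) \<Rightarrow> bool" where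
  "htpy X Y \<phi> \<psi> \<longleftrightarrow> (\<exists>h. \<forall>n. h n \<in> Homr (cob X n) (cob Y (n - 1)) \<and>
     \<phi> n - \<psi> n = dd Y (n - 1) * h n + h (n + 1) * dd X n)"

definition htpy_class :: "('a, 'b) cochain \<Rightarrow> ('a, 'b) cochain \<Rightarrow> (int \<Rightarrow> ('a, 'b) hring) \<Rightarrow> ('a, 'b) harr" where
  "htpy_class X Y \<phi> = (X, {g \<in> chain_maps C X Y. htpy X Y \<phi> (\<lambda>n. emb (g n))}, Y)"

lemma cmapsD:
  assumes "\<phi> \<in> cmaps X Y"
  shows "\<phi> n \<in> Homr (cob X n) (cob Y n)"
    "dd Y n * \<phi> n = \<phi> (n + 1) * dd X n"
    "dd Y (n - 1) * \<phi> (n - 1) = \<phi> n * dd X (n - 1)"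
    "\<phi> n * (dd X (n - 1) * z) = dd Y (n - 1) * (\<phi> (n - 1) * z)"
    "\<phi> (n + 1) * (dd X n * z) = dd Y n * (\<phi> n * z)"
proof -
  show 1: "\<phi> n \<in> Homr (cob X n) (cob Y n)" "dd Y n * \<phi> n = \<phi> (n + 1) * dd X n" for n
    using assms by (auto simp: cmaps_def)
  show 2: "dd Y (n - 1) * \<phi> (n - 1) = \<phi> n * dd X (n - 1)"
    using 1(2)[of "n - 1"] by simp
  show "\<phi> n * (dd X (n - 1) * z) = dd Y (n - 1) * (\<phi> (n - 1) * z)"
    by (simp only: mult.assoc[symmetric] 2)
  show "\<phi> (n + 1) * (dd X n * z) = dd Y n * (\<phi> n * z)"
    by (simp only: mult.assoc[symmetric] 1(2))
qed

lemma cmapsI: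
  assumes "\<And>n. \<phi> n \<in> Homr (cob X n) (cob Y n)" "\<And>n. dd Y n * \<phi> n = \<phi> (n + 1) * dd X n"
  shows "\<phi> \<in> cmaps X Y"
  using assms by (simp add: cmaps_def)

lemma hpyI:
  assumes "\<And>n. h n \<in> Homr (cob X n) (cob Y (n - 1))"
    "\<And>n. \<phi> n - \<psi> n = dd Y (n - 1) * h n + h (n + 1) * dd X n"
  shows "htpy X Y \<phi> \<psi>"
  using assms unfolding htpy_def by blast

lemma hpyE:
  assumes "htpy X Y \<phi> \<psi>"
  obtains h where "\<And>n. h n \<in> Homr (cob X n) (cob Y (n - 1))"
    "\<And>n. \<phi> n - \<psi> n = dd Y (n - 1) * h n + h (n + 1) * dd X n"
  using assms unfolding htpy_def by blast

lemma cochain_obj: "is_cochain C X \<Longrightarrow> cob X n \<in> obj C"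
  by (simp add: is_cochain_def)

lemma htpy_refl:
  assumes "is_cochain C X" "is_cochain C Y"
  shows "htpy X Y \<phi> \<phi>"
  by (rule hpyI[of "\<lambda>_. 0"]) (auto intro: Homr_zero cochain_obj assms)

lemma htpy_sym:
  assumes "htpy X Y \<phi> \<psi>"
  shows "htpy X Y \<psi> \<phi>"
proof -
  obtain h where h: "\<And>n. h n \<in> Homr (cob X n) (cob Y (n - 1))"
    "\<And>n. \<phi> n - \<psi> n = dd Y (n - 1) * h n + h (n + 1) * dd X n" using assms by (rule hpyE) blast
  show ?thesis
  proof (rule hpyI[of "\<lambda>n. - h n"])
    show "\<psi> n - \<phi> n = dd Y (n - 1) * - h n + - h (n + 1) * dd X n" for n
      using h(2)[of n] by (simp add: algebra_simps)
  qed (rule Homr_uminus h)+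
qed

lemma htpy_trans:
  assumes "htpy X Y \<phi> \<psi>" "htpy X Y \<psi> \<chi>"
  shows "htpy X Y \<phi> \<chi>"
proof -
  obtain h where h: "\<And>n. h n \<in> Homr (cob X n) (cob Y (n - 1))"
    "\<And>n. \<phi> n - \<psi> n = dd Y (n - 1) * h n + h (n + 1) * dd X n" using assms(1) by (rule hpyE) blast
  obtain k where k: "\<And>n. k n \<in> Homr (cob X n) (cob Y (n - 1))"
    "\<And>n. \<psi> n - \<chi> n = dd Y (n - 1) * k n + k (n + 1) * dd X n" using assms(2) by (rule hpyE) blast
  show ?thesis
  proof (rule hpyI[of "\<lambda>n. h n + k n"])
    fix n
    have "\<phi> n - \<chi> n = (\<phi> n - \<psi> n) + (\<psi> n - \<chi> n)" by simp
    also have "\<dots> = dd Y (n - 1) * (h n + k n) + (h (n + 1) + k (n + 1)) * dd X n"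
      by (simp only: h(2) k(2) distrib_left distrib_right ac_simps)
    finally show "\<phi> n - \<chi> n = dd Y (n - 1) * (h n + k n) + (h (n + 1) + k (n + 1)) * dd X n" .
  qed (rule Homr_plus h k)+
qed

lemma cmaps_mult:
  assumes "\<phi> \<in> cmaps X Y" "\<psi> \<in> cmaps Y Z"
  shows "(\<lambda>n. \<psi> n * \<phi> n) \<in> cmaps X Z"
proof (rule cmapsI)
  note f = cmapsD[OF assms(1)] and g = cmapsD[OF assms(2)]
  show "\<psi> n * \<phi> n \<in> Homr (cob X n) (cob Z n)" for n
    by (rule Homr_mult[OF g(1) f(1)])
  show "dd Z n * (\<psi> n * \<phi> n) = \<psi> (n + 1) * \<phi> (n + 1) * dd X n" for n
    by (simp only: mult.assoc f(2)[symmetric] g(5))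
qed

lemma cmaps_plus:
  assumes "\<phi> \<in> cmaps X Y" "\<psi> \<in> cmaps X Y"
  shows "(\<lambda>n. \<phi> n + \<psi> n) \<in> cmaps X Y"
proof (rule cmapsI)
  note f = cmapsD[OF assms(1)] and g = cmapsD[OF assms(2)]
  show "\<phi> n + \<psi> n \<in> Homr (cob X n) (cob Y n)" for n
    by (rule Homr_plus[OF f(1) g(1)])
  show "dd Y n * (\<phi> n + \<psi> n) = (\<phi> (n + 1) + \<psi> (n + 1)) * dd X n" for n
    by (simp only: distrib_left distrib_right f(2) g(2))
qed

lemma cmaps_uminus:
  assumes "\<phi> \<in> cmaps X Y"
  shows "(\<lambda>n. - \<phi> n) \<in> cmaps X Y"
proof (rule cmapsI)
  note f = cmapsD[OF assms(1)]
  show "- \<phi> n \<in> Homr (cob X n) (cob Y n)" for n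
    by (rule Homr_uminus[OF f(1)])
  show "dd Y n * - \<phi> n = - \<phi> (n + 1) * dd X n" for n
    by (simp add: f(2))
qed

lemma cmaps_minus:
  assumes "\<phi> \<in> cmaps X Y" "\<psi> \<in> cmaps X Y"
  shows "(\<lambda>n. \<phi> n - \<psi> n) \<in> cmaps X Y"
  using cmaps_plus[OF assms(1) cmaps_uminus[OF assms(2)]] by simp

lemma cmaps_idr: "is_cochain C X \<Longrightarrow> (\<lambda>n. idr (cob X n)) \<in> cmaps X X"
  by (rule cmapsI) (auto intro: Homr_idr cochain_obj simp: idr_right[OF cochainD(3)] idr_left[OF cochainD(3)])

lemma cmaps_zero: "is_cochain C X \<Longrightarrow> is_cochain C Y \<Longrightarrow> (\<lambda>n. 0) \<in> cmaps X Y"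
  by (rule cmapsI) (auto intro: Homr_zero cochain_obj)

lemma htpy_mult:
  assumes "\<phi>' \<in> cmaps X Y" "\<psi> \<in> cmaps Y Z" "htpy X Y \<phi> \<phi>'" "htpy Y Z \<psi> \<psi>'"
  shows "htpy X Z (\<lambda>n. \<psi> n * \<phi> n) (\<lambda>n. \<psi>' n * \<phi>' n)"
proof -
  obtain h where h: "\<And>n. h n \<in> Homr (cob X n) (cob Y (n - 1))"
    "\<And>n. \<phi> n - \<phi>' n = dd Y (n - 1) * h n + h (n + 1) * dd X n" using assms(3) by (rule hpyE) blast
  obtain k where k: "\<And>n. k n \<in> Homr (cob Y n) (cob Z (n - 1))"
    "\<And>n. \<psi> n - \<psi>' n = dd Z (n - 1) * k n + k (n + 1) * dd Y n" using assms(4) by (rule hpyE) blast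
  note f = cmapsD[OF assms(1)] and g = cmapsD[OF assms(2)]
  show ?thesis
  \<comment> \<open>The homotopy follows the splitting \<psi> (\<phi> - \<phi>') + (\<psi> -
    \<psi>') \<phi>', in which \<psi> and \<phi>' are the maps that have to commute with the
    differentials.\<close>
  proof (rule hpyI[of "\<lambda>n. \<psi> (n - 1) * h n + k n * \<phi>' n"])
    show "\<psi> (n - 1) * h n + k n * \<phi>' n \<in> Homr (cob X n) (cob Z (n - 1))" for n
      by (rule Homr_plus Homr_mult[OF g(1) h(1)] Homr_mult[OF k(1) f(1)])+
    fix n
    have "\<psi> n * \<phi> n - \<psi>' n * \<phi>' n = \<psi> n * (\<phi> n - \<phi>' n) + (\<psi> n - \<psi>' n) * \<phi>' n"
      by (simp add: algebra_simps)
    also have "\<dots> = dd Z (n - 1) * (\<psi> (n - 1) * h n + k n * \<phi>' n) +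
        (\<psi> (n + 1 - 1) * h (n + 1) + k (n + 1) * \<phi>' (n + 1)) * dd X n"
      by (simp add: h(2) k(2) distrib_left distrib_right mult.assoc f(2) g(4))
    finally show "\<psi> n * \<phi> n - \<psi>' n * \<phi>' n = dd Z (n - 1) * (\<psi> (n - 1) * h n + k n * \<phi>' n) +
        (\<psi> (n + 1 - 1) * h (n + 1) + k (n + 1) * \<phi>' (n + 1)) * dd X n" .
  qed
qed

lemma htpy_plus:
  assumes "htpy X Y \<phi> \<phi>'" "htpy X Y \<psi> \<psi>'"
  shows "htpy X Y (\<lambda>n. \<phi> n + \<psi> n) (\<lambda>n. \<phi>' n + \<psi>' n)"
proof -
  obtain h where h: "\<And>n. h n \<in> Homr (cob X n) (cob Y (n - 1))"
    "\<And>n. \<phi> n - \<phi>' n = dd Y (n - 1) * h n + h (n + 1) * dd X n" using assms(1) by (rule hpyE) blast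
  obtain k where k: "\<And>n. k n \<in> Homr (cob X n) (cob Y (n - 1))"
    "\<And>n. \<psi> n - \<psi>' n = dd Y (n - 1) * k n + k (n + 1) * dd X n" using assms(2) by (rule hpyE) blast
  show ?thesis
  proof (rule hpyI[of "\<lambda>n. h n + k n"])
    fix n
    have "\<phi> n + \<psi> n - (\<phi>' n + \<psi>' n) = (\<phi> n - \<phi>' n) + (\<psi> n - \<psi>' n)" by simp
    also have "\<dots> = dd Y (n - 1) * (h n + k n) + (h (n + 1) + k (n + 1)) * dd X n"
      by (simp only: h(2) k(2) distrib_left distrib_right ac_simps)
    finally show "\<phi> n + \<psi> n - (\<phi>' n + \<psi>' n) = dd Y (n - 1) * (h n + k n) + (h (n + 1) + k (n + 1)) * dd X n" .
  qed (rule Homr_plus h k)+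
qed

section \<open>Comparison of chain maps and homotopies with their ring-valued forms\<close>

lemma chain_maps_iff:
  assumes X: "is_cochain C X" and Y: "is_cochain C Y"
  shows "f \<in> chain_maps C X Y \<longleftrightarrow> (\<forall>n. f n \<in> Hom C (cob X n) (cob Y n)) \<and> (\<lambda>n. emb (f n)) \<in> cmaps X Y"
proof -
  have "cdiff Y n \<cdot> f n = f (n + 1) \<cdot> cdiff X n \<longleftrightarrow> dd Y n * emb (f n) = emb (f (n + 1)) * dd X n"
    if f: "\<forall>n. f n \<in> Hom C (cob X n) (cob Y n)" for n
  proof -
    have 1: "cdiff Y n \<cdot> f n \<in> Hom C (cob X n) (cob Y (n + 1))"
      "f (n + 1) \<cdot> cdiff X n \<in> Hom C (cob X n) (cob Y (n + 1))"
      using cmp_Hom f cochainD(2)[OF X] cochainD(2)[OF Y] by blast+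
    have 2: "emb (cdiff Y n \<cdot> f n) = dd Y n * emb (f n)"
      unfolding dd_def by (rule emb_cmp[OF f[rule_format] cochainD(2)[OF Y]])
    have 3: "emb (f (n + 1) \<cdot> cdiff X n) = emb (f (n + 1)) * dd X n"
      unfolding dd_def by (rule emb_cmp[OF cochainD(2)[OF X] f[rule_format]])
    show ?thesis using emb_inj[OF 1] 2 3 by metis
  qed
  then show ?thesis
    unfolding chain_maps_def cmaps_def using Homr_emb by auto
qed

lemma homotopic_iff:
  assumes X: "is_cochain C X" and Y: "is_cochain C Y"
    and f: "f \<in> chain_maps C X Y" and g: "g \<in> chain_maps C X Y"
  shows "homotopic C X Y f g \<longleftrightarrow> htpy X Y (\<lambda>n. emb (f n)) (\<lambda>n. emb (g n))"
proof -
  have F: "f n \<in> Hom C (cob X n) (cob Y n)" "g n \<in> Hom C (cob X n) (cob Y n)" for n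
    using f g by (auto simp: chain_maps_def)
  have *: "f n = g n \<boxplus> ((cdiff Y (n - 1) \<cdot> h n) \<boxplus> (h (n + 1) \<cdot> cdiff X n)) \<longleftrightarrow>
      emb (f n) - emb (g n) = dd Y (n - 1) * emb (h n) + emb (h (n + 1)) * dd X n"
    if h: "\<And>n. h n \<in> Hom C (cob X n) (cob Y (n - 1))" for h n
  proof -
    have h': "h (n + 1) \<in> Hom C (cob X (n + 1)) (cob Y n)" using h[of "n + 1"] by simp
    have 1: "cdiff Y (n - 1) \<cdot> h n \<in> Hom C (cob X n) (cob Y n)"
      by (rule cmp_Hom[OF h cochainD(7)[OF Y]])
    have 2: "h (n + 1) \<cdot> cdiff X n \<in> Hom C (cob X n) (cob Y n)"
      by (rule cmp_Hom[OF cochainD(2)[OF X] h'])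
    have 3: "emb (g n \<boxplus> ((cdiff Y (n - 1) \<cdot> h n) \<boxplus> (h (n + 1) \<cdot> cdiff X n))) =
        emb (g n) + (dd Y (n - 1) * emb (h n) + emb (h (n + 1)) * dd X n)"
      by (simp only: emb_plus[OF F(2) plus_Hom[OF 1 2]] emb_plus[OF 1 2] dd_def
          emb_cmp[OF h cochainD(7)[OF Y]] emb_cmp[OF cochainD(2)[OF X] h'])
    have "f n = g n \<boxplus> ((cdiff Y (n - 1) \<cdot> h n) \<boxplus> (h (n + 1) \<cdot> cdiff X n)) \<longleftrightarrow>
        emb (f n) = emb (g n) + (dd Y (n - 1) * emb (h n) + emb (h (n + 1)) * dd X n)"
      using emb_inj[OF F(1) plus_Hom[OF F(2) plus_Hom[OF 1 2]]] 3 by auto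
    then show ?thesis by (simp add: diff_eq_eq ac_simps(1-3))
  qed
  show ?thesis
  proof
    assume "homotopic C X Y f g"
    then obtain h where h: "\<And>n. h n \<in> Hom C (cob X n) (cob Y (n - 1))"
      "\<And>n. f n = g n \<boxplus> ((cdiff Y (n - 1) \<cdot> h n) \<boxplus> (h (n + 1) \<cdot> cdiff X n))"
      unfolding homotopic_def by blast
    show "htpy X Y (\<lambda>n. emb (f n)) (\<lambda>n. emb (g n))"
      by (rule hpyI[of "\<lambda>n. emb (h n)"], rule Homr_emb[OF h(1)], rule *[OF h(1), THEN iffD1, OF h(2)])
  next
    assume "htpy X Y (\<lambda>n. emb (f n)) (\<lambda>n. emb (g n))"
    then obtain h where h: "\<And>n. h n \<in> Homr (cob X n) (cob Y (n - 1))"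
      "\<And>n. emb (f n) - emb (g n) = dd Y (n - 1) * h n + h (n + 1) * dd X n" by (rule hpyE) blast
    define k where "k n = unemb (cob X n) (cob Y (n - 1)) (h n)" for n
    have k: "k n \<in> Hom C (cob X n) (cob Y (n - 1))" "emb (k n) = h n" for n
      using unemb_Hom[OF h(1)] emb_unemb[OF h(1)] by (auto simp: k_def)
    show "homotopic C X Y f g"
      unfolding homotopic_def
    proof (intro exI allI conjI)
      show "k n \<in> Hom C (cob X n) (cob Y (n - 1))" for n by (rule k)
      show "f n = g n \<boxplus> ((cdiff Y (n - 1) \<cdot> k n) \<boxplus> (k (n + 1) \<cdot> cdiff X n))" for n
        by (rule *[OF k(1), THEN iffD2]) (simp only: k h(2))
    qed
  qed
qed

lemma hclass_htpy_class:
  assumes "is_cochain C X" "is_cochain C Y" "f \<in> chain_maps C X Y"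
  shows "hclass C X Y f = htpy_class X Y (\<lambda>n. emb (f n))"
  using homotopic_iff[OF assms(1,2,3)] by (auto simp: hclass_def htpy_class_def)

lemma cmaps_chain_map:
  assumes "is_cochain C X" "is_cochain C Y" "\<phi> \<in> cmaps X Y"
  obtains f where "f \<in> chain_maps C X Y" "(\<lambda>n. emb (f n)) = \<phi>"
proof -
  define f where "f n = unemb (cob X n) (cob Y n) (\<phi> n)" for n
  have f: "f n \<in> Hom C (cob X n) (cob Y n)" "emb (f n) = \<phi> n" for n
    using unemb_Hom[OF cmapsD(1)[OF assms(3)]] emb_unemb[OF cmapsD(1)[OF assms(3)]] by (auto simp: f_def)
  have "f \<in> chain_maps C X Y" using f assms by (simp add: chain_maps_iff)
  then show ?thesis using that f by blast
qed

lemma htpy_class_hclass: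
  assumes "is_cochain C X" "is_cochain C Y" "\<phi> \<in> cmaps X Y"
  shows "\<exists>f \<in> chain_maps C X Y. htpy_class X Y \<phi> = hclass C X Y f"
  by (rule cmaps_chain_map[OF assms]) (metis hclass_htpy_class[OF assms(1,2)])

lemma chain_map_cmaps: "is_cochain C X \<Longrightarrow> is_cochain C Y \<Longrightarrow> f \<in> chain_maps C X Y \<Longrightarrow> (\<lambda>n. emb (f n)) \<in> cmaps X Y"
  by (simp add: chain_maps_iff)

lemma htpy_class_eq_iff:
  assumes "is_cochain C X" "is_cochain C Y" "\<phi> \<in> cmaps X Y" "\<psi> \<in> cmaps X Y"
  shows "htpy_class X Y \<phi> = htpy_class X Y \<psi> \<longleftrightarrow> htpy X Y \<phi> \<psi>"
proof
  obtain f where f: "f \<in> chain_maps C X Y" "(\<lambda>n. emb (f n)) = \<psi>"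
    by (rule cmaps_chain_map[OF assms(1,2,4)])
  assume "htpy_class X Y \<phi> = htpy_class X Y \<psi>"
  moreover have "f \<in> fst (snd (htpy_class X Y \<psi>))" using f htpy_refl[OF assms(1,2)] by (simp add: htpy_class_def)
  ultimately show "htpy X Y \<phi> \<psi>" using f by (auto simp: htpy_class_def)
next
  assume "htpy X Y \<phi> \<psi>"
  then show "htpy_class X Y \<phi> = htpy_class X Y \<psi>" unfolding htpy_class_def using htpy_sym htpy_trans by blast
qed

text \<open>Every member of \<open>F\<close> represents the same class, so the union in
  \<open>hlift\<close> is a union of equal sets; \<open>F \<noteq> {}\<close> keeps it from being
  empty. Composition, addition, shift and truncation of classes are all evaluated through
  this.\<close>

lemma hlift_htpy_class:
  assumes X: "is_cochain C X" and Y: "is_cochain C Y" and phi: "\<phi> \<in> cmaps X Y" and ne: "F \<noteq> {}"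
    and F: "\<And>f. f \<in> F \<Longrightarrow> f \<in> chain_maps C X Y \<and> htpy X Y \<phi> (\<lambda>n. emb (f n))"
  shows "hlift C X Y F = htpy_class X Y \<phi>"
proof -
  have "hclass C X Y f = htpy_class X Y \<phi>" if "f \<in> F" for f
    using F[OF that] hclass_htpy_class[OF X Y] htpy_class_eq_iff[OF X Y phi] chain_map_cmaps[OF X Y] by metis
  then show ?thesis using ne by (auto simp: hlift_def htpy_class_def)
qed

abbreviation K :: "(('a, 'b) cochain, ('a, 'b) harr) addcat" where
  "K \<equiv> homotopy_category C"

lemma obj_K: "X \<in> obj K \<longleftrightarrow> is_cochain C X"
  by (simp add: homotopy_category_def)

lemma htpy_class_Hom: "is_cochain C X \<Longrightarrow> is_cochain C Y \<Longrightarrow> \<phi> \<in> cmaps X Y \<Longrightarrow> htpy_class X Y \<phi> \<in> Hom K X Y"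
  using htpy_class_hclass[of X Y \<phi>] by (auto simp: Hom_def homotopy_category_def hclass_def)

lemma HomK_E:
  assumes "u \<in> Hom K X Y"
  obtains \<phi> where "is_cochain C X" "is_cochain C Y" "\<phi> \<in> cmaps X Y" "u = htpy_class X Y \<phi>"
proof -
  obtain f where "is_cochain C X" "is_cochain C Y" "f \<in> chain_maps C X Y" "u = hclass C X Y f"
    using assms by (auto simp: Hom_def homotopy_category_def hclass_def)
  then show ?thesis using that hclass_htpy_class chain_map_cmaps by metis
qed

lemma htpy_class_cmp:
  assumes X: "is_cochain C X" and Y: "is_cochain C Y" and Z: "is_cochain C Z"
    and phi: "\<phi> \<in> cmaps X Y" and psi: "\<psi> \<in> cmaps Y Z"
  shows "htpy_class Y Z \<psi> \<cdot>\<^bsub>K\<^esub> htpy_class X Y \<phi> = htpy_class X Z (\<lambda>n. \<psi> n * \<phi> n)"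
proof -
  obtain f where f: "f \<in> chain_maps C X Y" "(\<lambda>n. emb (f n)) = \<phi>"
    by (rule cmaps_chain_map[OF X Y phi])
  obtain g where g: "g \<in> chain_maps C Y Z" "(\<lambda>n. emb (g n)) = \<psi>"
    by (rule cmaps_chain_map[OF Y Z psi])
  define F where "F = fst (snd (htpy_class X Y \<phi>))"
  define G where "G = fst (snd (htpy_class Y Z \<psi>))"
  have "htpy_class Y Z \<psi> \<cdot>\<^bsub>K\<^esub> htpy_class X Y \<phi> = hlift C X Z {(\<lambda>n. g n \<cdot> f n) | g f. g \<in> G \<and> f \<in> F}"
    by (simp add: homotopy_category_def htpy_class_def F_def G_def)
  also have "\<dots> = htpy_class X Z (\<lambda>n. \<psi> n * \<phi> n)"
  proof (rule hlift_htpy_class[OF X Z cmaps_mult[OF phi psi]])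
    show "{(\<lambda>n. g n \<cdot> f n) | g f. g \<in> G \<and> f \<in> F} \<noteq> {}"
      using f g htpy_refl[OF X Y] htpy_refl[OF Y Z] by (auto simp: F_def G_def htpy_class_def)
    fix h assume "h \<in> {(\<lambda>n. g n \<cdot> f n) | g f. g \<in> G \<and> f \<in> F}"
    then obtain g f where h: "h = (\<lambda>n. g n \<cdot> f n)" "g \<in> G" "f \<in> F" by blast
    have gf: "g \<in> chain_maps C Y Z" "f \<in> chain_maps C X Y" "htpy Y Z \<psi> (\<lambda>n. emb (g n))" "htpy X Y \<phi> (\<lambda>n. emb (f n))"
      using h by (auto simp: F_def G_def htpy_class_def)
    have t: "g n \<in> Hom C (cob Y n) (cob Z n)" "f n \<in> Hom C (cob X n) (cob Y n)" for n
      using gf by (auto simp: chain_maps_def)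
    have eh: "(\<lambda>n. emb (h n)) = (\<lambda>n. emb (g n) * emb (f n))"
      by (simp add: h(1) emb_cmp[OF t(2) t(1)])
    have hh: "\<forall>n. h n \<in> Hom C (cob X n) (cob Z n)" using cmp_Hom[OF t(2) t(1)] h(1) by simp
    have cg: "(\<lambda>n. emb (g n)) \<in> cmaps Y Z" and cf: "(\<lambda>n. emb (f n)) \<in> cmaps X Y"
      using gf chain_map_cmaps X Y Z by blast+
    show "h \<in> chain_maps C X Z \<and> htpy X Z (\<lambda>n. \<psi> n * \<phi> n) (\<lambda>n. emb (h n))"
      unfolding chain_maps_iff[OF X Z] eh
      using cmaps_mult[OF cf cg] htpy_mult[OF cf psi gf(4) gf(3)] hh by blast
  qed
  finally show ?thesis .
qed

lemma htpy_class_plus: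
  assumes X: "is_cochain C X" and Y: "is_cochain C Y"
    and phi: "\<phi> \<in> cmaps X Y" and psi: "\<psi> \<in> cmaps X Y"
  shows "htpy_class X Y \<phi> \<boxplus>\<^bsub>K\<^esub> htpy_class X Y \<psi> = htpy_class X Y (\<lambda>n. \<phi> n + \<psi> n)"
proof -
  obtain f where f: "f \<in> chain_maps C X Y" "(\<lambda>n. emb (f n)) = \<phi>"
    by (rule cmaps_chain_map[OF X Y phi])
  obtain g where g: "g \<in> chain_maps C X Y" "(\<lambda>n. emb (g n)) = \<psi>"
    by (rule cmaps_chain_map[OF X Y psi])
  define F where "F = fst (snd (htpy_class X Y \<phi>))"
  define G where "G = fst (snd (htpy_class X Y \<psi>))"
  have "htpy_class X Y \<phi> \<boxplus>\<^bsub>K\<^esub> htpy_class X Y \<psi> = hlift C X Y {(\<lambda>n. f n \<boxplus> g n) | f g. f \<in> F \<and> g \<in> G}"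
    by (simp add: homotopy_category_def htpy_class_def F_def G_def)
  also have "\<dots> = htpy_class X Y (\<lambda>n. \<phi> n + \<psi> n)"
  proof (rule hlift_htpy_class[OF X Y cmaps_plus[OF phi psi]])
    show "{(\<lambda>n. f n \<boxplus> g n) | f g. f \<in> F \<and> g \<in> G} \<noteq> {}"
      using f g htpy_refl[OF X Y] by (auto simp: F_def G_def htpy_class_def)
    fix h assume "h \<in> {(\<lambda>n. f n \<boxplus> g n) | f g. f \<in> F \<and> g \<in> G}"
    then obtain g f where h: "h = (\<lambda>n. f n \<boxplus> g n)" "g \<in> G" "f \<in> F" by blast
    have gf: "g \<in> chain_maps C X Y" "f \<in> chain_maps C X Y" "htpy X Y \<psi> (\<lambda>n. emb (g n))" "htpy X Y \<phi> (\<lambda>n. emb (f n))"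
      using h by (auto simp: F_def G_def htpy_class_def)
    have t: "g n \<in> Hom C (cob X n) (cob Y n)" "f n \<in> Hom C (cob X n) (cob Y n)" for n
      using gf by (auto simp: chain_maps_def)
    have eh: "(\<lambda>n. emb (h n)) = (\<lambda>n. emb (f n) + emb (g n))"
      by (simp add: h(1) emb_plus[OF t(2) t(1)])
    have hh: "\<forall>n. h n \<in> Hom C (cob X n) (cob Y n)" using plus_Hom[OF t(2) t(1)] h(1) by simp
    have cg: "(\<lambda>n. emb (g n)) \<in> cmaps X Y" and cf: "(\<lambda>n. emb (f n)) \<in> cmaps X Y"
      using gf chain_map_cmaps X Y by blast+
    show "h \<in> chain_maps C X Y \<and> htpy X Y (\<lambda>n. \<phi> n + \<psi> n) (\<lambda>n. emb (h n))"
      unfolding chain_maps_iff[OF X Y] eh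
      using cmaps_plus[OF cf cg] htpy_plus[OF gf(4) gf(3)] hh by blast
  qed
  finally show ?thesis .
qed

lemma ident_K: "is_cochain C X \<Longrightarrow> ident K X = htpy_class X X (\<lambda>n. idr (cob X n))"
proof -
  assume X: "is_cochain C X"
  have "(\<lambda>n. ident C (cob X n)) \<in> chain_maps C X X"
    unfolding chain_maps_iff[OF X X] using cmaps_idr[OF X] ident_Hom cochain_obj[OF X] by (simp add: idr_def)
  then show ?thesis using hclass_htpy_class[OF X X] by (simp add: homotopy_category_def idr_def)
qed

lemma zero_K: "is_cochain C X \<Longrightarrow> is_cochain C Y \<Longrightarrow> zero_arr K X Y = htpy_class X Y (\<lambda>n. 0)"
proof -
  assume X: "is_cochain C X" and Y: "is_cochain C Y"
  have 0: "(\<lambda>n. emb (zero_arr C (cob X n) (cob Y n))) = (\<lambda>n. 0)"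
    using emb_zero cochain_obj X Y by blast
  have "(\<lambda>n. zero_arr C (cob X n) (cob Y n)) \<in> chain_maps C X Y"
    unfolding chain_maps_iff[OF X Y] 0 using cmaps_zero[OF X Y] zero_Hom cochain_obj X Y by blast
  then show ?thesis using hclass_htpy_class[OF X Y] 0 by (simp add: homotopy_category_def)
qed

lemma category_K: "category K"
proof
  fix f assume "f \<in> arr K"
  then have "f \<in> Hom K (src K f) (tgt K f)" by (simp add: Hom_def)
  then have "is_cochain C (src K f) \<and> is_cochain C (tgt K f)" by (rule HomK_E) blast
  then show "src K f \<in> obj K" "tgt K f \<in> obj K" using obj_K by blast+
next
  fix X assume "X \<in> obj K"
  then show "ident K X \<in> Hom K X X" by (simp add: obj_K ident_K htpy_class_Hom cmaps_idr)
next
  fix X Y Z f g assume f: "f \<in> Hom K X Y" and g: "g \<in> Hom K Y Z"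
  obtain \<phi> where \<phi>: "is_cochain C X" "is_cochain C Y" "\<phi> \<in> cmaps X Y" "f = htpy_class X Y \<phi>" using f by (rule HomK_E)
  obtain \<psi> where \<psi>: "is_cochain C Y" "is_cochain C Z" "\<psi> \<in> cmaps Y Z" "g = htpy_class Y Z \<psi>" using g by (rule HomK_E)
  show "g \<cdot>\<^bsub>K\<^esub> f \<in> Hom K X Z" using \<phi> \<psi> by (simp add: htpy_class_cmp htpy_class_Hom cmaps_mult)
next
  fix X Y f assume f: "f \<in> Hom K X Y"
  obtain \<phi> where \<phi>: "is_cochain C X" "is_cochain C Y" "\<phi> \<in> cmaps X Y" "f = htpy_class X Y \<phi>" using f by (rule HomK_E)
  show "ident K Y \<cdot>\<^bsub>K\<^esub> f = f" "f \<cdot>\<^bsub>K\<^esub> ident K X = f" using \<phi>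
    by (simp_all add: ident_K htpy_class_cmp cmaps_idr idr_left[OF cmapsD(1)[OF \<phi>(3)]] idr_right[OF cmapsD(1)[OF \<phi>(3)]])
next
  fix W X Y Z f g h assume f: "f \<in> Hom K W X" and g: "g \<in> Hom K X Y" and h: "h \<in> Hom K Y Z"
  obtain \<phi> where \<phi>: "is_cochain C W" "is_cochain C X" "\<phi> \<in> cmaps W X" "f = htpy_class W X \<phi>" using f by (rule HomK_E)
  obtain \<psi> where \<psi>: "is_cochain C X" "is_cochain C Y" "\<psi> \<in> cmaps X Y" "g = htpy_class X Y \<psi>" using g by (rule HomK_E)
  obtain \<chi> where \<chi>: "is_cochain C Y" "is_cochain C Z" "\<chi> \<in> cmaps Y Z" "h = htpy_class Y Z \<chi>" using h by (rule HomK_E)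
  show "(h \<cdot>\<^bsub>K\<^esub> g) \<cdot>\<^bsub>K\<^esub> f = h \<cdot>\<^bsub>K\<^esub> g \<cdot>\<^bsub>K\<^esub> f"
    using \<phi> \<psi> \<chi> by (simp add: htpy_class_cmp cmaps_mult mult.assoc)
qed

lemma preadditive_category_K: "preadditive_category K"
proof -
  show ?thesis
  proof (intro preadditive_category.intro preadditive_category_axioms.intro category_K)
    fix X Y assume "X \<in> obj K" "Y \<in> obj K"
    then have X: "is_cochain C X" and Y: "is_cochain C Y" by (auto simp: obj_K)
    show "comm_group (hom_group K X Y)"
    proof (rule comm_groupI, unfold hom_group_def partial_object.simps monoid.simps)
      show "zero_arr K X Y \<in> Hom K X Y"
        using X Y by (simp add: zero_K htpy_class_Hom cmaps_zero)
    next
      fix u v assume "u \<in> Hom K X Y" "v \<in> Hom K X Y"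
      then show "u \<boxplus>\<^bsub>K\<^esub> v \<in> Hom K X Y" "u \<boxplus>\<^bsub>K\<^esub> v = v \<boxplus>\<^bsub>K\<^esub> u"
        by (auto elim!: HomK_E simp: htpy_class_plus htpy_class_Hom cmaps_plus add.commute)
    next
      fix u v w assume "u \<in> Hom K X Y" "v \<in> Hom K X Y" "w \<in> Hom K X Y"
      then show "u \<boxplus>\<^bsub>K\<^esub> v \<boxplus>\<^bsub>K\<^esub> w = u \<boxplus>\<^bsub>K\<^esub> (v \<boxplus>\<^bsub>K\<^esub> w)"
        by (auto elim!: HomK_E simp: htpy_class_plus cmaps_plus add.assoc)
    next
      fix u assume "u \<in> Hom K X Y"
      then obtain \<phi> where \<phi>: "\<phi> \<in> cmaps X Y" "u = htpy_class X Y \<phi>" by (rule HomK_E)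
      then show "zero_arr K X Y \<boxplus>\<^bsub>K\<^esub> u = u"
        using X Y by (simp add: zero_K htpy_class_plus cmaps_zero)
      have "htpy_class X Y (\<lambda>n. - \<phi> n) \<boxplus>\<^bsub>K\<^esub> u = zero_arr K X Y"
        using \<phi> X Y by (simp add: zero_K htpy_class_plus cmaps_uminus)
      then show "\<exists>y \<in> Hom K X Y. y \<boxplus>\<^bsub>K\<^esub> u = zero_arr K X Y"
        using htpy_class_Hom[OF X Y cmaps_uminus[OF \<phi>(1)]] by blast
    qed
  next
    fix X Y Z f g g' assume f: "f \<in> Hom K X Y" and g: "g \<in> Hom K Y Z" and g': "g' \<in> Hom K Y Z"
    obtain \<phi> where \<phi>: "is_cochain C X" "is_cochain C Y" "\<phi> \<in> cmaps X Y" "f = htpy_class X Y \<phi>" using f by (rule HomK_E)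
    obtain \<psi> where \<psi>: "is_cochain C Y" "is_cochain C Z" "\<psi> \<in> cmaps Y Z" "g = htpy_class Y Z \<psi>" using g by (rule HomK_E)
    obtain \<chi> where \<chi>: "is_cochain C Y" "is_cochain C Z" "\<chi> \<in> cmaps Y Z" "g' = htpy_class Y Z \<chi>" using g' by (rule HomK_E)
    show "(g \<boxplus>\<^bsub>K\<^esub> g') \<cdot>\<^bsub>K\<^esub> f = g \<cdot>\<^bsub>K\<^esub> f \<boxplus>\<^bsub>K\<^esub> g' \<cdot>\<^bsub>K\<^esub> f"
      using \<phi> \<psi> \<chi> by (simp add: htpy_class_cmp htpy_class_plus cmaps_mult cmaps_plus distrib_right)
  next
    fix X Y Z f f' g assume f: "f \<in> Hom K X Y" and f': "f' \<in> Hom K X Y" and g: "g \<in> Hom K Y Z"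
    obtain \<phi> where \<phi>: "is_cochain C X" "is_cochain C Y" "\<phi> \<in> cmaps X Y" "f = htpy_class X Y \<phi>" using f by (rule HomK_E)
    obtain \<psi> where \<psi>: "is_cochain C Y" "is_cochain C Z" "\<psi> \<in> cmaps Y Z" "g = htpy_class Y Z \<psi>" using g by (rule HomK_E)
    obtain \<chi> where \<chi>: "\<chi> \<in> cmaps X Y" "f' = htpy_class X Y \<chi>" using f' by (rule HomK_E)
    show "g \<cdot>\<^bsub>K\<^esub> (f \<boxplus>\<^bsub>K\<^esub> f') = g \<cdot>\<^bsub>K\<^esub> f \<boxplus>\<^bsub>K\<^esub> g \<cdot>\<^bsub>K\<^esub> f'"
      using \<phi> \<psi> \<chi> by (simp add: htpy_class_cmp htpy_class_plus cmaps_mult cmaps_plus distrib_left)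
  qed
qed

section \<open>Quasi-isomorphisms in high degrees\<close>

text \<open>
  \<open>epi_at\<close> and \<open>mono_at\<close> say that the induced map on cohomology in degree \<open>n\<close> is an epimorphism
  respectively a monomorphism, in terms of generalized elements: an arrow \<open>T \<rightarrow> X\<^sup>n\<close> plays the role of
  an element, and existence of a preimage is required only after composition with an epimorphism
  \<open>T' \<rightarrow> T\<close>.
\<close>

definition epi_at :: "('a, 'b) cochain \<Rightarrow> ('a, 'b) cochain \<Rightarrow> (int \<Rightarrow> ('a, 'b) hring) \<Rightarrow> int \<Rightarrow> bool" where
  "epi_at X Y \<phi> n \<longleftrightarrow> (\<forall>T. \<forall>y \<in> Homr T (cob Y n). dd Y n * y = 0 \<longrightarrow>
     (\<exists>T' a x y'. epir T' T a \<and> x \<in> Homr T' (cob X n) \<and> y' \<in> Homr T' (cob Y (n - 1)) \<and>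
        dd X n * x = 0 \<and> \<phi> n * x + dd Y (n - 1) * y' = y * a))"

definition mono_at :: "('a, 'b) cochain \<Rightarrow> ('a, 'b) cochain \<Rightarrow> (int \<Rightarrow> ('a, 'b) hring) \<Rightarrow> int \<Rightarrow> bool" where
  "mono_at X Y \<phi> n \<longleftrightarrow> (\<forall>T. \<forall>x \<in> Homr T (cob X n). \<forall>y \<in> Homr T (cob Y (n - 1)).
     dd X n * x = 0 \<longrightarrow> \<phi> n * x = dd Y (n - 1) * y \<longrightarrow>
     (\<exists>T' a x'. epir T' T a \<and> x' \<in> Homr T' (cob X (n - 1)) \<and> dd X (n - 1) * x' = x * a))"

definition qis :: "('a, 'b) cochain \<Rightarrow> ('a, 'b) cochain \<Rightarrow> (int \<Rightarrow> ('a, 'b) hring) \<Rightarrow> int \<Rightarrow> bool" where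
  "qis X Y \<phi> N \<longleftrightarrow> (\<forall>n \<ge> N. epi_at X Y \<phi> n \<and> mono_at X Y \<phi> n)"

lemma epi_atE:
  assumes "epi_at X Y \<phi> n" "y \<in> Homr T (cob Y n)" "dd Y n * y = 0"
  obtains T' a x y' where "epir T' T a" "x \<in> Homr T' (cob X n)" "y' \<in> Homr T' (cob Y (n - 1))"
    "dd X n * x = 0" "\<phi> n * x + dd Y (n - 1) * y' = y * a"
  using assms unfolding epi_at_def by blast

lemma mono_atE:
  assumes "mono_at X Y \<phi> n" "x \<in> Homr T (cob X n)" "y \<in> Homr T (cob Y (n - 1))"
    "dd X n * x = 0" "\<phi> n * x = dd Y (n - 1) * y"
  obtains T' a x' where "epir T' T a" "x' \<in> Homr T' (cob X (n - 1))" "dd X (n - 1) * x' = x * a"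
  using assms unfolding mono_at_def by blast

lemma epi_atI:
  assumes "\<And>T y. y \<in> Homr T (cob Y n) \<Longrightarrow> dd Y n * y = 0 \<Longrightarrow>
     \<exists>T' a x y'. epir T' T a \<and> x \<in> Homr T' (cob X n) \<and> y' \<in> Homr T' (cob Y (n - 1)) \<and>
        dd X n * x = 0 \<and> \<phi> n * x + dd Y (n - 1) * y' = y * a"
  shows "epi_at X Y \<phi> n"
  using assms unfolding epi_at_def by blast

lemma mono_atI:
  assumes "\<And>T x y. x \<in> Homr T (cob X n) \<Longrightarrow> y \<in> Homr T (cob Y (n - 1)) \<Longrightarrow>
     dd X n * x = 0 \<Longrightarrow> \<phi> n * x = dd Y (n - 1) * y \<Longrightarrow>
     \<exists>T' a x'. epir T' T a \<and> x' \<in> Homr T' (cob X (n - 1)) \<and> dd X (n - 1) * x' = x * a"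
  shows "mono_at X Y \<phi> n"
  using assms unfolding mono_at_def by blast

lemma qis_mono: "qis X Y \<phi> N \<Longrightarrow> N \<le> M \<Longrightarrow> qis X Y \<phi> M"
  by (auto simp: qis_def)

text \<open>For the epimorphism, an element is lifted along \<psi> and then along \<phi>, and the
  coboundary left over by the second lift is carried to \<open>Z\<close> by \<psi>. The epimorphisms
  \<open>a1\<close> and \<open>a2\<close> onto the test objects compose.\<close>

lemma qis_mult:
  assumes phi: "\<phi> \<in> cmaps X Y" and psi: "\<psi> \<in> cmaps Y Z"
    and X: "is_cochain C X" and Y: "is_cochain C Y" and Z: "is_cochain C Z"
    and q: "qis X Y \<phi> N" "qis Y Z \<psi> N"
  shows "qis X Z (\<lambda>n. \<psi> n * \<phi> n) N"
  unfolding qis_def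
proof (intro allI impI conjI)
  note f = cmapsD[OF phi] and g = cmapsD[OF psi]
  fix n assume "N \<le> n"
  then have E: "epi_at X Y \<phi> n" "epi_at Y Z \<psi> n" and M: "mono_at X Y \<phi> n" "mono_at Y Z \<psi> n"
    using q by (auto simp: qis_def)
  show "epi_at X Z (\<lambda>n. \<psi> n * \<phi> n) n"
  proof (rule epi_atI)
    fix T z assume z: "z \<in> Homr T (cob Z n)" "dd Z n * z = 0"
    obtain T1 a1 y z' where 1: "epir T1 T a1" "y \<in> Homr T1 (cob Y n)" "z' \<in> Homr T1 (cob Z (n - 1))"
      "dd Y n * y = 0" "\<psi> n * y + dd Z (n - 1) * z' = z * a1" using epi_atE[OF E(2) z] by blast
    obtain T2 a2 x y' where 2: "epir T2 T1 a2" "x \<in> Homr T2 (cob X n)" "y' \<in> Homr T2 (cob Y (n - 1))"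
      "dd X n * x = 0" "\<phi> n * x + dd Y (n - 1) * y' = y * a2" using epi_atE[OF E(1) 1(2) 1(4)] by blast
    have "\<psi> n * \<phi> n * x + dd Z (n - 1) * (\<psi> (n - 1) * y' + z' * a2) =
        \<psi> n * (\<phi> n * x + dd Y (n - 1) * y') + dd Z (n - 1) * (z' * a2)"
      by (simp add: distrib_left mult.assoc g(4))
    also have "\<dots> = (\<psi> n * y + dd Z (n - 1) * z') * a2"
      by (simp only: 2(5)) (simp add: distrib_right mult.assoc)
    also have "\<dots> = z * (a1 * a2)"
      by (simp only: 1(5) mult.assoc)
    finally have "\<psi> n * \<phi> n * x + dd Z (n - 1) * (\<psi> (n - 1) * y' + z' * a2) = z * (a1 * a2)" .
    moreover have "\<psi> (n - 1) * y' + z' * a2 \<in> Homr T2 (cob Z (n - 1))"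
      by (rule Homr_plus Homr_mult[OF g(1) 2(3)] Homr_mult[OF 1(3) epir_Homr[OF 2(1)]])+
    ultimately show "\<exists>T' a x y'. epir T' T a \<and> x \<in> Homr T' (cob X n) \<and> y' \<in> Homr T' (cob Z (n - 1)) \<and>
        dd X n * x = 0 \<and> \<psi> n * \<phi> n * x + dd Z (n - 1) * y' = z * a"
      using epir_mult[OF 2(1) 1(1)] 2(2,4) by blast
  qed
  show "mono_at X Z (\<lambda>n. \<psi> n * \<phi> n) n"
  proof (rule mono_atI)
    fix T x z assume x: "x \<in> Homr T (cob X n)" "z \<in> Homr T (cob Z (n - 1))"
      "dd X n * x = 0" "\<psi> n * \<phi> n * x = dd Z (n - 1) * z"
    have c: "dd Y n * (\<phi> n * x) = 0" using x(3) f(5)[of n x, symmetric] by simp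
    have e: "\<psi> n * (\<phi> n * x) = dd Z (n - 1) * z" using x(4) by (simp add: mult.assoc)
    obtain T1 a1 y where 1: "epir T1 T a1" "y \<in> Homr T1 (cob Y (n - 1))" "dd Y (n - 1) * y = \<phi> n * x * a1"
      using mono_atE[OF M(2) Homr_mult[OF f(1) x(1)] x(2) c e] by blast
    have xa: "x * a1 \<in> Homr T1 (cob X n)" by (rule Homr_mult[OF x(1) epir_Homr[OF 1(1)]])
    have "dd X n * (x * a1) = 0" using x(3) by (simp add: mult.assoc[symmetric])
    moreover have "\<phi> n * (x * a1) = dd Y (n - 1) * y" using 1(3) by (simp add: mult.assoc)
    ultimately obtain T2 a2 x' where 2: "epir T2 T1 a2" "x' \<in> Homr T2 (cob X (n - 1))" "dd X (n - 1) * x' = x * a1 * a2"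
      using mono_atE[OF M(1) xa 1(2)] by blast
    show "\<exists>T' a x'. epir T' T a \<and> x' \<in> Homr T' (cob X (n - 1)) \<and> dd X (n - 1) * x' = x * a"
      using epir_mult[OF 2(1) 1(1)] 2(2,3) by (auto simp: mult.assoc)
  qed
qed

lemma qis_htpy:
  assumes h: "htpy X Y \<phi> \<psi>" and q: "qis X Y \<phi> N"
  shows "qis X Y \<psi> N"
  unfolding qis_def
proof (intro allI impI conjI)
  fix n assume "N \<le> n"
  then have E: "epi_at X Y \<phi> n" and M: "mono_at X Y \<phi> n"
    using q by (auto simp: qis_def)
  obtain h where h: "\<And>n. h n \<in> Homr (cob X n) (cob Y (n - 1))"
    "\<And>n. \<phi> n - \<psi> n = dd Y (n - 1) * h n + h (n + 1) * dd X n" using assms(1) by (rule hpyE) blast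
  \<comment> \<open>On a cocycle the summand with \<open>h (n + 1) * dd X n\<close> vanishes, so
    homotopic maps differ by a coboundary there.\<close>
  have hx: "\<phi> n * x = \<psi> n * x + dd Y (n - 1) * (h n * x)" if "dd X n * x = 0" for x
  proof -
    have "(\<phi> n - \<psi> n) * x = dd Y (n - 1) * (h n * x)"
      unfolding h(2) using that by (simp add: distrib_right mult.assoc)
    then show ?thesis by (simp add: left_diff_distrib diff_eq_eq add.commute)
  qed
  show "epi_at X Y \<psi> n"
  proof (rule epi_atI)
    fix T y assume y: "y \<in> Homr T (cob Y n)" "dd Y n * y = 0"
    obtain T1 a x y' where 1: "epir T1 T a" "x \<in> Homr T1 (cob X n)" "y' \<in> Homr T1 (cob Y (n - 1))"
      "dd X n * x = 0" "\<phi> n * x + dd Y (n - 1) * y' = y * a" using epi_atE[OF E y] by blast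
    have "\<psi> n * x + dd Y (n - 1) * (h n * x + y') = y * a"
      using 1(5) hx[OF 1(4)] by (simp add: distrib_left add.assoc)
    moreover have "h n * x + y' \<in> Homr T1 (cob Y (n - 1))"
      by (rule Homr_plus Homr_mult[OF h(1) 1(2)] 1)+
    ultimately show "\<exists>T' a x y'. epir T' T a \<and> x \<in> Homr T' (cob X n) \<and> y' \<in> Homr T' (cob Y (n - 1)) \<and>
        dd X n * x = 0 \<and> \<psi> n * x + dd Y (n - 1) * y' = y * a"
      using 1(1,2,4) by blast
  qed
  show "mono_at X Y \<psi> n"
  proof (rule mono_atI)
    fix T x y assume x: "x \<in> Homr T (cob X n)" "y \<in> Homr T (cob Y (n - 1))"
      "dd X n * x = 0" "\<psi> n * x = dd Y (n - 1) * y"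
    have "\<phi> n * x = dd Y (n - 1) * (y + h n * x)"
      using hx[OF x(3)] x(4) by (simp add: distrib_left)
    moreover have "y + h n * x \<in> Homr T (cob Y (n - 1))"
      by (rule Homr_plus Homr_mult[OF h(1) x(1)] x)+
    ultimately show "\<exists>T' a x'. epir T' T a \<and> x' \<in> Homr T' (cob X (n - 1)) \<and> dd X (n - 1) * x' = x * a"
      using M x(1,3) unfolding mono_at_def by blast
  qed
qed

section \<open>Homotopy equivalences and cohomology\<close>

definition hequiv :: "('a, 'b) cochain \<Rightarrow> ('a, 'b) cochain \<Rightarrow>
    (int \<Rightarrow> ('a, 'b) hring) \<Rightarrow> (int \<Rightarrow> ('a, 'b) hring) \<Rightarrow> bool" where
  "hequiv X Y \<phi> \<psi> \<longleftrightarrow> is_cochain C X \<and> is_cochain C Y \<and> \<phi> \<in> cmaps X Y \<and> \<psi> \<in> cmaps Y X \<and>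
     htpy X X (\<lambda>n. \<psi> n * \<phi> n) (\<lambda>n. idr (cob X n)) \<and> htpy Y Y (\<lambda>n. \<phi> n * \<psi> n) (\<lambda>n. idr (cob Y n))"

lemma hequiv_sym: "hequiv X Y \<phi> \<psi> \<Longrightarrow> hequiv Y X \<psi> \<phi>"
  by (auto simp: hequiv_def)

lemma hequiv_elements:
  assumes "hequiv X Y \<phi> \<psi>"
  obtains k where "\<And>n. k n \<in> Homr (cob Y n) (cob Y (n - 1))"
    "\<And>n y T. y \<in> Homr T (cob Y n) \<Longrightarrow> dd Y n * y = 0 \<Longrightarrow> \<phi> n * (\<psi> n * y) = y + dd Y (n - 1) * (k n * y)"
proof -
  have "htpy Y Y (\<lambda>n. \<phi> n * \<psi> n) (\<lambda>n. idr (cob Y n))" using assms by (simp add: hequiv_def)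
  then obtain k where k: "\<And>n. k n \<in> Homr (cob Y n) (cob Y (n - 1))"
    "\<And>n. \<phi> n * \<psi> n - idr (cob Y n) = dd Y (n - 1) * k n + k (n + 1) * dd Y n" by (rule hpyE) blast
  have "\<phi> n * (\<psi> n * y) = y + dd Y (n - 1) * (k n * y)" if y: "y \<in> Homr T (cob Y n)" "dd Y n * y = 0" for n y T
  proof -
    have "(\<phi> n * \<psi> n - idr (cob Y n)) * y = dd Y (n - 1) * (k n * y)"
      unfolding k(2) using y by (simp add: distrib_right mult.assoc)
    then show ?thesis by (simp add: left_diff_distrib diff_eq_eq idr_left[OF y(1)] mult.assoc add.commute)
  qed
  then show ?thesis using that k(1) by blast
qed

text \<open>The homotopy inverse produces preimages outright, so the identity of \<open>T\<close>
  serves as the required epimorphism and every degree qualifies.\<close>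

lemma qis_hequiv:
  assumes "hequiv X Y \<phi> \<psi>"
  shows "qis X Y \<phi> N"
  unfolding qis_def
proof (intro allI impI conjI)
  have c: "is_cochain C X" "is_cochain C Y" "\<phi> \<in> cmaps X Y" "\<psi> \<in> cmaps Y X" using assms by (auto simp: hequiv_def)
  note f = cmapsD[OF c(3)] and g = cmapsD[OF c(4)]
  fix n assume "N \<le> n"
  show "epi_at X Y \<phi> n"
  proof (rule epi_atI)
    fix T y assume y: "y \<in> Homr T (cob Y n)" "dd Y n * y = 0"
    obtain k where k: "\<And>n. k n \<in> Homr (cob Y n) (cob Y (n - 1))"
      "\<And>n y T. y \<in> Homr T (cob Y n) \<Longrightarrow> dd Y n * y = 0 \<Longrightarrow> \<phi> n * (\<psi> n * y) = y + dd Y (n - 1) * (k n * y)"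
      using hequiv_elements[OF assms] by blast
    have T: "epir T T (idr T)" using y Homr_obj epir_idr by blast
    have "\<phi> n * (\<psi> n * y) + dd Y (n - 1) * (- (k n * y)) = y * idr T"
      using k(2)[OF y] by (simp add: idr_right[OF y(1)])
    moreover have "dd X n * (\<psi> n * y) = 0" using g(5)[of n y, symmetric] y(2) by simp
    moreover have "- (k n * y) \<in> Homr T (cob Y (n - 1))" by (rule Homr_uminus Homr_mult[OF k(1) y(1)])+
    moreover have "\<psi> n * y \<in> Homr T (cob X n)" by (rule Homr_mult[OF g(1) y(1)])
    ultimately show "\<exists>T' a x y'. epir T' T a \<and> x \<in> Homr T' (cob X n) \<and> y' \<in> Homr T' (cob Y (n - 1)) \<and>
        dd X n * x = 0 \<and> \<phi> n * x + dd Y (n - 1) * y' = y * a"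
      using T by blast
  qed
  show "mono_at X Y \<phi> n"
  proof (rule mono_atI)
    fix T x y assume x: "x \<in> Homr T (cob X n)" "y \<in> Homr T (cob Y (n - 1))"
      "dd X n * x = 0" "\<phi> n * x = dd Y (n - 1) * y"
    obtain h where h: "\<And>n. h n \<in> Homr (cob X n) (cob X (n - 1))"
      "\<And>n y T. y \<in> Homr T (cob X n) \<Longrightarrow> dd X n * y = 0 \<Longrightarrow> \<psi> n * (\<phi> n * y) = y + dd X (n - 1) * (h n * y)"
      using hequiv_elements[OF hequiv_sym[OF assms]] by blast
    have T: "epir T T (idr T)" using x Homr_obj epir_idr by blast
    have "dd X (n - 1) * (\<psi> (n - 1) * y - h n * x) = \<psi> n * (\<phi> n * x) - dd X (n - 1) * (h n * x)"
      using x(4) by (simp add: right_diff_distrib g(4))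
    also have "\<dots> = x * idr T" using h(2)[OF x(1,3)] by (simp add: idr_right[OF x(1)])
    finally show "\<exists>T' a x'. epir T' T a \<and> x' \<in> Homr T' (cob X (n - 1)) \<and> dd X (n - 1) * x' = x * a"
      using T Homr_minus[OF Homr_mult[OF g(1) x(2)] Homr_mult[OF h(1) x(1)]] by blast
  qed
qed

lemma exact_at_hequiv:
  assumes "hequiv X Y \<phi> \<psi>" and E: "exact_at X n"
  shows "exact_at Y n"
  unfolding exact_at_def
proof (intro allI ballI impI)
  have c: "is_cochain C X" "is_cochain C Y" "\<phi> \<in> cmaps X Y" "\<psi> \<in> cmaps Y X" using assms by (auto simp: hequiv_def)
  note f = cmapsD[OF c(3)] and g = cmapsD[OF c(4)]
  fix T y assume y: "y \<in> Homr T (cob Y n)" "dd Y n * y = 0"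
  obtain k where k: "\<And>n. k n \<in> Homr (cob Y n) (cob Y (n - 1))"
    "\<And>n y T. y \<in> Homr T (cob Y n) \<Longrightarrow> dd Y n * y = 0 \<Longrightarrow> \<phi> n * (\<psi> n * y) = y + dd Y (n - 1) * (k n * y)"
    using hequiv_elements[OF assms(1)] by blast
  have "dd X n * (\<psi> n * y) = 0" using g(5)[of n y, symmetric] y(2) by simp
  then obtain T' a x where x: "epir T' T a" "x \<in> Homr T' (cob X (n - 1))" "dd X (n - 1) * x = \<psi> n * y * a"
    using exact_atE[OF E Homr_mult[OF g(1) y(1)]] by blast
  \<comment> \<open>Once \<open>x\<close> bounds \<psi> y, its image \<phi> x bounds \<phi> \<psi>
    y, and the homotopy term corrects this to a bound for \<open>y\<close>.\<close>
  have "dd Y (n - 1) * (\<phi> (n - 1) * x - k n * y * a) = \<phi> n * (dd X (n - 1) * x) - dd Y (n - 1) * (k n * y * a)"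
    by (simp add: right_diff_distrib f(4))
  also have "\<dots> = (\<phi> n * (\<psi> n * y) - dd Y (n - 1) * (k n * y)) * a"
    by (simp add: x(3) left_diff_distrib mult.assoc)
  also have "\<dots> = y * a" using k(2)[OF y] by simp
  finally show "\<exists>T' a x. epir T' T a \<and> x \<in> Homr T' (cob Y (n - 1)) \<and> dd Y (n - 1) * x = y * a"
    using x(1) Homr_minus[OF Homr_mult[OF f(1) x(2)] Homr_mult[OF Homr_mult[OF k(1) y(1)] epir_Homr[OF x(1)]]] by blast
qed

section \<open>Mapping cones and shifts\<close>

lemma shift_simps [simp]: "cob (shift C X) n = cob X (n + 1)"
  by (simp add: shift_def)

lemma dd_shift: "is_cochain C X \<Longrightarrow> dd (shift C X) n = - dd X (n + 1)"
  using emb_minus[OF cochainD(2)[of X "n + 1"]] by (simp add: shift_def dd_def)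

lemma is_cochain_shift: "is_cochain C X \<Longrightarrow> is_cochain C (shift C X)"
  unfolding is_cochain_iff[of "shift C X"]
proof (intro conjI allI)
  fix n assume X: "is_cochain C X"
  show "cdiff (shift C X) n \<in> Hom C (cob (shift C X) n) (cob (shift C X) (n + 1))"
    using minus_Hom[OF cochainD(2)[OF X, of "n + 1"]] by (simp add: shift_def)
  show "dd (shift C X) (n + 1) * dd (shift C X) n = 0"
    using cochainD(4)[OF X, of "n + 1"] by (simp add: dd_shift X)
qed

lemma cmaps_shift:
  assumes "is_cochain C X" "is_cochain C Y" "\<phi> \<in> cmaps X Y"
  shows "(\<lambda>n. \<phi> (n + 1)) \<in> cmaps (shift C X) (shift C Y)"
  by (rule cmapsI) (simp_all add: dd_shift assms cmapsD(1)[OF assms(3)] cmapsD(2)[OF assms(3)])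

lemma htpy_shift:
  assumes "is_cochain C X" "is_cochain C Y" "htpy X Y \<phi> \<psi>"
  shows "htpy (shift C X) (shift C Y) (\<lambda>n. \<phi> (n + 1)) (\<lambda>n. \<psi> (n + 1))"
proof -
  obtain h where h: "\<And>n. h n \<in> Homr (cob X n) (cob Y (n - 1))"
    "\<And>n. \<phi> n - \<psi> n = dd Y (n - 1) * h n + h (n + 1) * dd X n" using assms(3) by (rule hpyE) blast
  show ?thesis
  \<comment> \<open>The shift negates the differentials, so the homotopy changes its sign as
    well.\<close>
  proof (rule hpyI[of "\<lambda>n. - h (n + 1)"])
    show "- h (n + 1) \<in> Homr (cob (shift C X) n) (cob (shift C Y) (n - 1))" for n
      using Homr_uminus[OF h(1)[of "n + 1"]] by simp
    show "\<phi> (n + 1) - \<psi> (n + 1) = dd (shift C Y) (n - 1) * - h (n + 1) + - h (n + 1 + 1) * dd (shift C X) n" for n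
      using h(2)[of "n + 1"] by (simp add: dd_shift assms)
  qed
qed

lemma shift_arr_htpy_class:
  assumes X: "is_cochain C X" and Y: "is_cochain C Y" and phi: "\<phi> \<in> cmaps X Y"
  shows "shift_arr C (htpy_class X Y \<phi>) = htpy_class (shift C X) (shift C Y) (\<lambda>n. \<phi> (n + 1))"
proof -
  obtain f where f: "f \<in> chain_maps C X Y" "(\<lambda>n. emb (f n)) = \<phi>"
    by (rule cmaps_chain_map[OF X Y phi])
  define F where "F = fst (snd (htpy_class X Y \<phi>))"
  have "shift_arr C (htpy_class X Y \<phi>) = hlift C (shift C X) (shift C Y) ((\<lambda>f n. f (n + 1)) ` F)"
    by (simp add: shift_arr_def htpy_class_def F_def)
  also have "\<dots> = htpy_class (shift C X) (shift C Y) (\<lambda>n. \<phi> (n + 1))"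
  proof (rule hlift_htpy_class[OF is_cochain_shift[OF X] is_cochain_shift[OF Y] cmaps_shift[OF X Y phi]])
    show "(\<lambda>f n. f (n + 1)) ` F \<noteq> {}"
      using f htpy_refl[OF X Y] by (auto simp: F_def htpy_class_def)
    fix g assume "g \<in> (\<lambda>f n. f (n + 1)) ` F"
    then obtain f where g: "g = (\<lambda>n. f (n + 1))" "f \<in> F" by blast
    then have f: "f \<in> chain_maps C X Y" "htpy X Y \<phi> (\<lambda>n. emb (f n))" by (auto simp: F_def htpy_class_def)
    have "g n \<in> Hom C (cob (shift C X) n) (cob (shift C Y) n)" for n
      using f(1) g(1) by (simp add: chain_maps_def)
    then show "g \<in> chain_maps C (shift C X) (shift C Y) \<and>
        htpy (shift C X) (shift C Y) (\<lambda>n. \<phi> (n + 1)) (\<lambda>n. emb (g n))"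
      unfolding chain_maps_iff[OF is_cochain_shift[OF X] is_cochain_shift[OF Y]]
      using htpy_shift[OF X Y f(2)] cmaps_shift[OF X Y chain_map_cmaps[OF X Y f(1)]] g(1) by simp
  qed
  finally show ?thesis .
qed

lemma hequiv_shift:
  assumes "hequiv X Y \<phi> \<psi>"
  shows "hequiv (shift C X) (shift C Y) (\<lambda>n. \<phi> (n + 1)) (\<lambda>n. \<psi> (n + 1))"
  using assms htpy_shift[of X X "\<lambda>n. \<psi> n * \<phi> n" "\<lambda>n. idr (cob X n)"]
    htpy_shift[of Y Y "\<lambda>n. \<phi> n * \<psi> n" "\<lambda>n. idr (cob Y n)"]
  by (simp add: hequiv_def is_cochain_shift cmaps_shift)

section \<open>The mapping cone through its injections and projections\<close>

definition cone_in1 :: "('a, 'b) cochain \<Rightarrow> ('a, 'b) cochain \<Rightarrow> int \<Rightarrow> ('a, 'b) hring" where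
  "cone_in1 X Y n = emb (inj1 (cone_biprod C X Y n))"
definition cone_in2 :: "('a, 'b) cochain \<Rightarrow> ('a, 'b) cochain \<Rightarrow> int \<Rightarrow> ('a, 'b) hring" where
  "cone_in2 X Y n = emb (inj2 (cone_biprod C X Y n))"
definition cone_pr1 :: "('a, 'b) cochain \<Rightarrow> ('a, 'b) cochain \<Rightarrow> int \<Rightarrow> ('a, 'b) hring" where
  "cone_pr1 X Y n = emb (prj1 (cone_biprod C X Y n))"
definition cone_pr2 :: "('a, 'b) cochain \<Rightarrow> ('a, 'b) cochain \<Rightarrow> int \<Rightarrow> ('a, 'b) hring" where
  "cone_pr2 X Y n = emb (prj2 (cone_biprod C X Y n))"

context
  fixes X Y f
  assumes X: "is_cochain C X" and Y: "is_cochain C Y" and f: "f \<in> chain_maps C X Y"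
begin

lemma cone_biprod: "is_biproduct C (cob X (n + 1)) (cob Y n) (cone_biprod C X Y n)"
  unfolding cone_biprod_def by (rule biprod[OF cochain_obj[OF X] cochain_obj[OF Y]])

lemmas cone_biprodE = is_biproductE[OF cone_biprod cochain_obj[OF X] cochain_obj[OF Y]]

lemma cone_Homr:
  "cone_in1 X Y n \<in> Homr (cob X (n + 1)) (cob (cone C X Y f) n)"
  "cone_in2 X Y n \<in> Homr (cob Y n) (cob (cone C X Y f) n)"
  "cone_pr1 X Y n \<in> Homr (cob (cone C X Y f) n) (cob X (n + 1))"
  "cone_pr2 X Y n \<in> Homr (cob (cone C X Y f) n) (cob Y n)"
  using cone_biprodE(2-5)[of n] Homr_emb by (auto simp: cone_in1_def cone_in2_def cone_pr1_def cone_pr2_def cone_def)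

text \<open>The trailing factor \<open>x\<close> lets these rules fire inside right-associated
  products.\<close>

lemma cone_rules:
  "cone_pr1 X Y n * (cone_in1 X Y n * x) = idr (cob X (n + 1)) * x" "cone_pr2 X Y n * (cone_in2 X Y n * x) = idr (cob Y n) * x"
  "cone_pr2 X Y n * (cone_in1 X Y n * x) = 0" "cone_pr1 X Y n * (cone_in2 X Y n * x) = 0"
  using cone_biprodE(6-9)[of n]
  by (simp_all add: cone_in1_def cone_in2_def cone_pr1_def cone_pr2_def mult.assoc[symmetric])

lemma cone_rules0:
  "cone_pr1 X Y n * cone_in1 X Y n = idr (cob X (n + 1))" "cone_pr2 X Y n * cone_in2 X Y n = idr (cob Y n)"
  "cone_pr2 X Y n * cone_in1 X Y n = 0" "cone_pr1 X Y n * cone_in2 X Y n = 0"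
  using cone_biprodE(6-9)[of n]
  by (simp_all add: cone_in1_def cone_in2_def cone_pr1_def cone_pr2_def)

lemma cone_sum: "cone_in1 X Y n * cone_pr1 X Y n + cone_in2 X Y n * cone_pr2 X Y n = idr (cob (cone C X Y f) n)"
  using cone_biprodE(10)[of n] by (simp add: cone_in1_def cone_in2_def cone_pr1_def cone_pr2_def cone_def)

lemma cone_eqI:
  assumes "x \<in> Homr T (cob (cone C X Y f) n)" "y \<in> Homr T (cob (cone C X Y f) n)"
    "cone_pr1 X Y n * x = cone_pr1 X Y n * y" "cone_pr2 X Y n * x = cone_pr2 X Y n * y"
  shows "x = y"
proof -
  have "z = cone_in1 X Y n * (cone_pr1 X Y n * z) + cone_in2 X Y n * (cone_pr2 X Y n * z)"
    if "z \<in> Homr T (cob (cone C X Y f) n)" for z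
    using idr_left[OF that] by (simp add: cone_sum[symmetric] distrib_right mult.assoc)
  then show ?thesis using assms by metis
qed

abbreviation "fr \<equiv> \<lambda>n. emb (f n)"

lemma fr: "fr \<in> cmaps X Y"
  using chain_map_cmaps[OF X Y f] .

lemma cone_cdiff:
  "cdiff (cone C X Y f) n \<in> Hom C (cob (cone C X Y f) n) (cob (cone C X Y f) (n + 1))"
  "dd (cone C X Y f) n = cone_in1 X Y (n + 1) * (- dd X (n + 1) * cone_pr1 X Y n) +
     (cone_in2 X Y (n + 1) * (fr (n + 1) * cone_pr1 X Y n) + cone_in2 X Y (n + 1) * (dd Y n * cone_pr2 X Y n))"
proof -
  define B where "B = cone_biprod C X Y n"
  define B' where "B' = cone_biprod C X Y (n + 1)"
  note b = cone_biprodE(2-5)[of n, folded B_def] and b' = cone_biprodE(2-5)[of "n + 1", folded B'_def]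
  have F: "f (n + 1) \<in> Hom C (cob X (n + 1)) (cob Y (n + 1))" using f by (simp add: chain_maps_def)
  have dX: "minus_arr C (cdiff X (n + 1)) \<in> Hom C (cob X (n + 1)) (cob X (n + 1 + 1))"
    by (rule minus_Hom[OF cochainD(2)[OF X]])
  note dY = cochainD(2)[OF Y, of n]
  note t1 = cmp_Hom[OF b(3) dX] and t2 = cmp_Hom[OF b(3) F] and t3 = cmp_Hom[OF b(4) dY]
  note s1 = cmp_Hom[OF t1 b'(1)] and s2 = cmp_Hom[OF t2 b'(2)] and s3 = cmp_Hom[OF t3 b'(2)]
  have eq: "cdiff (cone C X Y f) n = (inj1 B' \<cdot> minus_arr C (cdiff X (n + 1)) \<cdot> prj1 B) \<boxplus>
       ((inj2 B' \<cdot> f (n + 1) \<cdot> prj1 B) \<boxplus> (inj2 B' \<cdot> cdiff Y n \<cdot> prj2 B))"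
    by (simp add: cone_def Let_def B_def B'_def)
  have co: "cob (cone C X Y f) n = bsum B" "cob (cone C X Y f) (n + 1) = bsum B'"
    by (simp_all add: cone_def B_def B'_def)
  show "cdiff (cone C X Y f) n \<in> Hom C (cob (cone C X Y f) n) (cob (cone C X Y f) (n + 1))"
    unfolding eq co by (rule plus_Hom[OF s1 plus_Hom[OF s2 s3]])
  show "dd (cone C X Y f) n = cone_in1 X Y (n + 1) * (- dd X (n + 1) * cone_pr1 X Y n) +
     (cone_in2 X Y (n + 1) * (fr (n + 1) * cone_pr1 X Y n) + cone_in2 X Y (n + 1) * (dd Y n * cone_pr2 X Y n))"
    unfolding dd_def eq emb_plus[OF s1 plus_Hom[OF s2 s3]] emb_plus[OF s2 s3]
      emb_cmp[OF t1 b'(1)] emb_cmp[OF t2 b'(2)] emb_cmp[OF t3 b'(2)]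
      emb_cmp[OF b(3) dX] emb_cmp[OF b(3) F] emb_cmp[OF b(4) dY] emb_minus[OF cochainD(2)[OF X]]
    by (simp add: cone_in1_def cone_in2_def cone_pr1_def cone_pr2_def B_def B'_def)
qed

lemma cone_dd_Homr: "dd (cone C X Y f) n \<in> Homr (cob (cone C X Y f) n) (cob (cone C X Y f) (n + 1))"
  unfolding dd_def by (rule Homr_emb[OF cone_cdiff(1)])

lemma cp_dd:
  "cone_pr1 X Y (n + 1) * dd (cone C X Y f) n = - dd X (n + 1) * cone_pr1 X Y n"
  "cone_pr2 X Y (n + 1) * dd (cone C X Y f) n = fr (n + 1) * cone_pr1 X Y n + dd Y n * cone_pr2 X Y n"
proof -
  note d = cochainD(3)[OF X, of "n + 1"]
  show "cone_pr1 X Y (n + 1) * dd (cone C X Y f) n = - dd X (n + 1) * cone_pr1 X Y n"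
    unfolding cone_cdiff(2)
    by (simp only: distrib_left cone_rules idr_left[OF Homr_mult[OF Homr_uminus[OF d] cone_Homr(3)]]
        add_0_right add_0_left)
  show "cone_pr2 X Y (n + 1) * dd (cone C X Y f) n = fr (n + 1) * cone_pr1 X Y n + dd Y n * cone_pr2 X Y n"
    unfolding cone_cdiff(2)
    by (simp only: distrib_left cone_rules idr_left[OF Homr_mult[OF cochainD(3)[OF Y] cone_Homr(4)]]
        idr_left[OF Homr_mult[OF cmapsD(1)[OF fr] cone_Homr(3)]] add_0_right add_0_left)
qed

lemma cp_dd':
  "cone_pr1 X Y (n + 1) * (dd (cone C X Y f) n * x) = - (dd X (n + 1) * (cone_pr1 X Y n * x))"
  "cone_pr2 X Y (n + 1) * (dd (cone C X Y f) n * x) = fr (n + 1) * (cone_pr1 X Y n * x) + dd Y n * (cone_pr2 X Y n * x)"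
  by (simp_all add: mult.assoc[symmetric] cp_dd distrib_right)

lemma is_cochain_cone: "is_cochain C (cone C X Y f)"
  unfolding is_cochain_iff
proof (intro conjI allI cone_cdiff(1))
  fix n
  let ?Z = "cone C X Y f"
  have o: "cob ?Z n \<in> obj C" "cob ?Z (n + 1 + 1) \<in> obj C"
    using cone_Homr Homr_obj by blast+
  have dX: "dd X (n + 1 + 1) * dd X (n + 1) = 0" by (rule cochainD(4)[OF X])
  show "dd ?Z (n + 1) * dd ?Z n = 0"
  proof (rule cone_eqI[OF Homr_mult[OF cone_dd_Homr cone_dd_Homr] Homr_zero[OF o]])
    show "cone_pr1 X Y (n + 1 + 1) * (dd ?Z (n + 1) * dd ?Z n) = cone_pr1 X Y (n + 1 + 1) * 0"
      unfolding cp_dd' cp_dd using dX by (simp add: mult.assoc[symmetric])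
    show "cone_pr2 X Y (n + 1 + 1) * (dd ?Z (n + 1) * dd ?Z n) = cone_pr2 X Y (n + 1 + 1) * 0"
      unfolding cp_dd' cp_dd
      by (simp only: distrib_left mult.assoc[symmetric] mult_minus_right mult_minus_left cmapsD(2)[OF fr]
          cochainD(4)[OF Y] mult_zero_left mult_zero_right add_0_right left_minus)
  qed
qed

lemma cone_in2_cmaps: "cone_in2 X Y \<in> cmaps Y (cone C X Y f)"
proof (rule cmapsI)
  fix n
  show "cone_in2 X Y n \<in> Homr (cob Y n) (cob (cone C X Y f) n)" by (rule cone_Homr)
  show "dd (cone C X Y f) n * cone_in2 X Y n = cone_in2 X Y (n + 1) * dd Y n"
    using idr_right[OF cochainD(3)[OF Y, of n]] 
    by (intro cone_eqI[OF Homr_mult[OF cone_dd_Homr cone_Homr(2)] Homr_mult[OF cone_Homr(2) cochainD(3)[OF Y]]])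
       (simp_all add: cp_dd' cone_rules cone_rules0 idr_left[OF cochainD(3)[OF Y]])
qed

lemma cone_pr1_cmaps: "cone_pr1 X Y \<in> cmaps (cone C X Y f) (shift C X)"
  by (rule cmapsI) (use cone_Homr in \<open>auto simp: dd_shift X cp_dd\<close>)

text \<open>The two degrees are those of the maps on both sides of the cohomology of the cone in
  degree \<open>n\<close> in the long exact sequence. Exactness is applied to the cocycle
  \<open>(0, y)\<close> for the first part and to \<open>(x, - y)\<close> with
  \<open>f x = d y\<close> for the second.\<close>

lemma exact_cone_imp_qis:
  assumes E: "exact_at (cone C X Y f) n"
  shows "epi_at X Y fr n" "mono_at X Y fr (n + 1)"
proof -
  let ?Z = "cone C X Y f"
  note Z = cochainD[OF is_cochain_cone]
  have Z0: "dd ?Z n * z = 0" if z: "z \<in> Homr T (cob ?Z n)" "dd X (n + 1) * (cone_pr1 X Y n * z) = 0"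
    "fr (n + 1) * (cone_pr1 X Y n * z) + dd Y n * (cone_pr2 X Y n * z) = 0" for z T
    by (rule cone_eqI[OF Homr_mult[OF cone_dd_Homr z(1)] Homr_zero[OF Homr_obj(1)[OF z(1)] cochain_obj[OF is_cochain_cone]]])
      (simp_all only: cp_dd' z(2,3) mult_zero_right minus_zero)
  have cpn: "cone_pr1 X Y n * (dd ?Z (n - 1) * w) = - (dd X n * (cone_pr1 X Y (n - 1) * w))"
    "cone_pr2 X Y n * (dd ?Z (n - 1) * w) = fr n * (cone_pr1 X Y (n - 1) * w) + dd Y (n - 1) * (cone_pr2 X Y (n - 1) * w)" for w
    using cp_dd'[of "n - 1" w] by simp_all
  have cpH: "cone_pr1 X Y (n - 1) \<in> Homr (cob ?Z (n - 1)) (cob X n)" using cone_Homr(3)[of "n - 1"] by simp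
  show "epi_at X Y fr n"
  proof (rule epi_atI)
    fix T y assume y: "y \<in> Homr T (cob Y n)" "dd Y n * y = 0"
    have z: "cone_in2 X Y n * y \<in> Homr T (cob ?Z n)" by (rule Homr_mult[OF cone_Homr(2) y(1)])
    have "dd ?Z n * (cone_in2 X Y n * y) = 0"
      by (rule Z0[OF z]) (simp_all add: cone_rules idr_left[OF y(1)] y(2))
    then obtain T' a w where w: "epir T' T a" "w \<in> Homr T' (cob ?Z (n - 1))" "dd ?Z (n - 1) * w = cone_in2 X Y n * y * a"
      using exact_atE[OF E z] by blast
    have "dd X n * (cone_pr1 X Y (n - 1) * w) = 0"
      using cpn(1)[of w] by (simp add: w(3) mult.assoc cone_rules)
    moreover have "fr n * (cone_pr1 X Y (n - 1) * w) + dd Y (n - 1) * (cone_pr2 X Y (n - 1) * w) = y * a"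
      using cpn(2)[of w] by (simp add: w(3) mult.assoc cone_rules) (simp add: idr_left[OF y(1)] mult.assoc[symmetric])
    ultimately show "\<exists>T' a x y'. epir T' T a \<and> x \<in> Homr T' (cob X n) \<and> y' \<in> Homr T' (cob Y (n - 1)) \<and>
        dd X n * x = 0 \<and> fr n * x + dd Y (n - 1) * y' = y * a"
      using w(1) Homr_mult[OF cpH w(2)] Homr_mult[OF cone_Homr(4) w(2)] by blast
  qed
  show "mono_at X Y fr (n + 1)"
  proof (rule mono_atI)
    fix T x y assume x: "x \<in> Homr T (cob X (n + 1))" "y \<in> Homr T (cob Y (n + 1 - 1))"
      "dd X (n + 1) * x = 0" "fr (n + 1) * x = dd Y (n + 1 - 1) * y"
    have y: "y \<in> Homr T (cob Y n)" using x(2) by simp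
    let ?z = "cone_in1 X Y n * x - cone_in2 X Y n * y"
    have z: "?z \<in> Homr T (cob ?Z n)" by (rule Homr_minus Homr_mult[OF cone_Homr(1) x(1)] Homr_mult[OF cone_Homr(2) y])+
    have "dd ?Z n * ?z = 0"
      using x(3,4) by (intro Z0[OF z]) (simp_all add: right_diff_distrib cone_rules idr_left[OF y] idr_left[OF x(1)])
    then obtain T' a w where w: "epir T' T a" "w \<in> Homr T' (cob ?Z (n - 1))" "dd ?Z (n - 1) * w = ?z * a"
      using exact_atE[OF E z] by blast
    have "cone_pr1 X Y n * ?z = x"
      by (simp add: right_diff_distrib cone_rules idr_left[OF x(1)])
    then have "dd X n * (- (cone_pr1 X Y (n - 1) * w)) = x * a"
      using cpn(1)[of w] by (simp add: w(3) mult.assoc[symmetric])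
    then show "\<exists>T' a x'. epir T' T a \<and> x' \<in> Homr T' (cob X (n + 1 - 1)) \<and> dd X (n + 1 - 1) * x' = x * a"
      unfolding add_diff_cancel_right' using w(1) Homr_uminus[OF Homr_mult[OF cpH w(2)]] by blast
  qed
qed

text \<open>A cocycle \<open>(x, y)\<close> of the cone has \<open>d x = 0\<close> and
  \<open>f x = - d y\<close>. Injectivity in degree \<open>n + 1\<close> yields \<open>x1\<close>
  bounding \<open>x\<close>; then \<open>y + f x1\<close> is a cocycle of \<open>Y\<close>, equal to
  \<open>f x2 + d y2\<close>, and \<open>(x2 - x1, y2)\<close> bounds \<open>(x, y)\<close>, all up
  to epimorphisms.\<close>

lemma qis_imp_exact_cone:
  assumes E: "epi_at X Y fr n" and M: "mono_at X Y fr (n + 1)"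
  shows "exact_at (cone C X Y f) n"
  unfolding exact_at_def
proof (intro allI ballI impI)
  let ?Z = "cone C X Y f"
  note F = cmapsD[OF fr]
  fix T z assume z: "z \<in> Homr T (cob ?Z n)" "dd ?Z n * z = 0"
  define x where "x = cone_pr1 X Y n * z"
  define y where "y = cone_pr2 X Y n * z"
  have xH: "x \<in> Homr T (cob X (n + 1))" "y \<in> Homr T (cob Y n)"
    unfolding x_def y_def by (rule Homr_mult[OF cone_Homr(3) z(1)] Homr_mult[OF cone_Homr(4) z(1)])+
  have x0: "dd X (n + 1) * x = 0" using cp_dd'(1)[of n z] z(2) by (simp add: x_def)
  have "fr (n + 1) * x + dd Y n * y = 0" using cp_dd'(2)[of n z] z(2) by (simp add: x_def y_def)
  then have fx: "fr (n + 1) * x = - (dd Y n * y)" by (simp add: eq_neg_iff_add_eq_0)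
  have "- y \<in> Homr T (cob Y (n + 1 - 1))" using Homr_uminus[OF xH(2)] by simp
  moreover have "fr (n + 1) * x = dd Y (n + 1 - 1) * (- y)" using fx by simp
  ultimately obtain T1 a1 x1 where 1: "epir T1 T a1" "x1 \<in> Homr T1 (cob X (n + 1 - 1))" "dd X (n + 1 - 1) * x1 = x * a1"
    using mono_atE[OF M xH(1) _ x0] by blast
  have x1: "x1 \<in> Homr T1 (cob X n)" "dd X n * x1 = x * a1" using 1 by auto
  define y1 where "y1 = y * a1 + fr n * x1"
  have y1: "y1 \<in> Homr T1 (cob Y n)"
    unfolding y1_def by (rule Homr_plus Homr_mult[OF xH(2) epir_Homr[OF 1(1)]] Homr_mult[OF F(1) x1(1)])+
  have "dd Y n * y1 = dd Y n * y * a1 + fr (n + 1) * (dd X n * x1)"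
    by (simp add: y1_def distrib_left F(5) mult.assoc)
  also have "\<dots> = (dd Y n * y + fr (n + 1) * x) * a1" by (simp add: x1(2) distrib_right mult.assoc)
  also have "\<dots> = 0" by (simp add: fx)
  finally obtain T2 a2 x2 y2 where 2: "epir T2 T1 a2" "x2 \<in> Homr T2 (cob X n)" "y2 \<in> Homr T2 (cob Y (n - 1))"
    "dd X n * x2 = 0" "fr n * x2 + dd Y (n - 1) * y2 = y1 * a2"
    using epi_atE[OF E y1] by blast
  define w where "w = cone_in1 X Y (n - 1) * (x2 - x1 * a2) + cone_in2 X Y (n - 1) * y2"
  have xx: "x2 - x1 * a2 \<in> Homr T2 (cob X n)" by (rule Homr_minus 2 Homr_mult[OF x1(1) epir_Homr[OF 2(1)]])+
  have iH: "cone_in1 X Y (n - 1) \<in> Homr (cob X n) (cob ?Z (n - 1))" using cone_Homr(1)[of "n - 1"] by simp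
  have wH: "w \<in> Homr T2 (cob ?Z (n - 1))"
    unfolding w_def by (rule Homr_plus Homr_mult[OF iH xx] Homr_mult[OF cone_Homr(2) 2(3)])+
  have cw: "cone_pr1 X Y (n - 1) * w = x2 - x1 * a2" "cone_pr2 X Y (n - 1) * w = y2"
    using idr_left[OF xx] idr_left[OF 2(3)] by (simp_all add: w_def distrib_left cone_rules)
  have cpn: "cone_pr1 X Y n * (dd ?Z (n - 1) * w) = - (dd X n * (cone_pr1 X Y (n - 1) * w))"
    "cone_pr2 X Y n * (dd ?Z (n - 1) * w) = fr n * (cone_pr1 X Y (n - 1) * w) + dd Y (n - 1) * (cone_pr2 X Y (n - 1) * w)"
    using cp_dd'[of "n - 1" w] by simp_all
  have a: "a1 * a2 \<in> Homr T2 T" by (rule Homr_mult[OF epir_Homr[OF 1(1)] epir_Homr[OF 2(1)]])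
  have "dd ?Z (n - 1) * w = z * (a1 * a2)"
  proof (rule cone_eqI[OF Homr_mult[OF cochainD(5)[OF is_cochain_cone] wH] Homr_mult[OF z(1) a]])
    have "cone_pr1 X Y n * (dd ?Z (n - 1) * w) = dd X n * x1 * a2"
      by (simp add: cpn cw right_diff_distrib 2(4) mult.assoc)
    then show "cone_pr1 X Y n * (dd ?Z (n - 1) * w) = cone_pr1 X Y n * (z * (a1 * a2))"
      by (simp add: x1(2) x_def mult.assoc)
    have "cone_pr2 X Y n * (dd ?Z (n - 1) * w) = (fr n * x2 + dd Y (n - 1) * y2) - fr n * x1 * a2"
      by (simp add: cpn cw right_diff_distrib mult.assoc)
    also have "\<dots> = y * a1 * a2" unfolding 2(5) by (simp add: y1_def distrib_right)
    finally show "cone_pr2 X Y n * (dd ?Z (n - 1) * w) = cone_pr2 X Y n * (z * (a1 * a2))"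
      by (simp add: y_def mult.assoc)
  qed
  then show "\<exists>T' a w. epir T' T a \<and> w \<in> Homr T' (cob ?Z (n - 1)) \<and> dd ?Z (n - 1) * w = z * a"
    using epir_mult[OF 2(1) 1(1)] wH by blast
qed

lemma left_bounded_cone: "left_bounded C X \<Longrightarrow> left_bounded C Y \<Longrightarrow> left_bounded C (cone C X Y f)"
proof -
  assume "left_bounded C X" "left_bounded C Y"
  then obtain M N where MN: "\<forall>n<M. is_zero_obj C (cob X n)" "\<forall>n<N. is_zero_obj C (cob Y n)"
    by (auto simp: left_bounded_def)
  have "is_zero_obj C (cob (cone C X Y f) n)" if "n < min (M - 1) N" for n
  proof (rule is_zero_objI)
    show "cob (cone C X Y f) n \<in> obj C" using cone_Homr Homr_obj by blast
    have "is_zero_obj C (cob X (n + 1))" "is_zero_obj C (cob Y n)" using that MN by auto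
    then have "cone_pr1 X Y n = 0" "cone_pr2 X Y n = 0" using zero_obj_Homr(1) cone_Homr by blast+
    then show "idr (cob (cone C X Y f) n) = 0" using cone_sum[of n] by simp
  qed
  then show ?thesis unfolding left_bounded_def by blast
qed

lemma standard_triangle_htpy_class: "standard_triangle C X Y f =
    (htpy_class X Y fr, htpy_class Y (cone C X Y f) (cone_in2 X Y), htpy_class (cone C X Y f) (shift C X) (cone_pr1 X Y))"
proof -
  have "(\<lambda>n. inj2 (cone_biprod C X Y n)) \<in> chain_maps C Y (cone C X Y f)"
    unfolding chain_maps_iff[OF Y is_cochain_cone]
    using cone_biprodE(3) cone_in2_cmaps by (simp add: cone_in2_def[abs_def] cone_def)
  moreover have "(\<lambda>n. prj1 (cone_biprod C X Y n)) \<in> chain_maps C (cone C X Y f) (shift C X)"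
    unfolding chain_maps_iff[OF is_cochain_cone is_cochain_shift[OF X]]
    using cone_biprodE(4) cone_pr1_cmaps by (simp add: cone_pr1_def[abs_def] cone_def)
  ultimately show ?thesis
    using f X Y by (simp add: standard_triangle_def hclass_htpy_class is_cochain_cone is_cochain_shift
        cone_in2_def[abs_def] cone_pr1_def[abs_def])
qed

end

section \<open>Homotopy pullbacks\<close>

text \<open>
  A complex with objects \<open>U\<^sup>n \<oplus> V\<^sup>n \<oplus> W\<^sup>n\<close> and differential
  \<open>(u, v, w) \<mapsto> (d1 u, a u + d2 v, b u + c v + d3 w)\<close>, given by its projections.
\<close>

definition triangular where
  "triangular P p1 p2 p3 U V W d1 d2 d3 a b c \<longleftrightarrow> is_cochain C P \<and>
     (\<forall>n. p1 n \<in> Homr (cob P n) (U n) \<and> p2 n \<in> Homr (cob P n) (V n) \<and> p3 n \<in> Homr (cob P n) (W n)) \<and>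
     (\<forall>n. p1 (n + 1) * dd P n = d1 n * p1 n) \<and>
     (\<forall>n. p2 (n + 1) * dd P n = a n * p1 n + d2 n * p2 n) \<and>
     (\<forall>n. p3 (n + 1) * dd P n = b n * p1 n + (c n * p2 n + d3 n * p3 n)) \<and>
     (\<forall>T n. \<forall>u \<in> Homr T (U n). \<forall>v \<in> Homr T (V n). \<forall>w \<in> Homr T (W n).
        \<exists>x \<in> Homr T (cob P n). p1 n * x = u \<and> p2 n * x = v \<and> p3 n * x = w) \<and>
     (\<forall>T n. \<forall>x \<in> Homr T (cob P n). \<forall>y \<in> Homr T (cob P n).
        p1 n * x = p1 n * y \<longrightarrow> p2 n * x = p2 n * y \<longrightarrow> p3 n * x = p3 n * y \<longrightarrow> x = y) \<and>
     (\<forall>n. is_zero_obj C (U n) \<longrightarrow> is_zero_obj C (V n) \<longrightarrow> is_zero_obj C (W n) \<longrightarrow> is_zero_obj C (cob P n))"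

lemma triple_biproduct:
  assumes "U \<in> obj C" "V \<in> obj C" "W \<in> obj C"
  shows "\<exists>P i1 i2 i3 p1 p2 p3. P \<in> obj C \<and> i1 \<in> Homr U P \<and> i2 \<in> Homr V P \<and> i3 \<in> Homr W P \<and>
     p1 \<in> Homr P U \<and> p2 \<in> Homr P V \<and> p3 \<in> Homr P W \<and>
     p1 * i1 = idr U \<and> p2 * i2 = idr V \<and> p3 * i3 = idr W \<and>
     p1 * i2 = 0 \<and> p1 * i3 = 0 \<and> p2 * i1 = 0 \<and> p2 * i3 = 0 \<and> p3 * i1 = 0 \<and> p3 * i2 = 0 \<and>
     i1 * p1 + i2 * p2 + i3 * p3 = idr P"
proof -
  define B where "B = biprod C V W"
  note b = is_biproductE[OF biprod[OF assms(2,3)] assms(2,3), folded B_def]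
  define B' where "B' = biprod C U (bsum B)"
  note b' = is_biproductE[OF biprod[OF assms(1) b(1)] assms(1) b(1), folded B'_def]
  let ?i1 = "emb (inj1 B')" and ?i2 = "emb (inj2 B') * emb (inj1 B)" and ?i3 = "emb (inj2 B') * emb (inj2 B)"
  let ?p1 = "emb (prj1 B')" and ?p2 = "emb (prj1 B) * emb (prj2 B')" and ?p3 = "emb (prj2 B) * emb (prj2 B')"
  note h = b(2-5)[THEN Homr_emb] b'(2-5)[THEN Homr_emb]
  have z: "emb (prj2 B') * (emb (inj2 B') * x) = idr (bsum B) * x" "emb (prj2 B') * (emb (inj1 B') * x) = 0"
    "emb (prj1 B') * (emb (inj2 B') * x) = 0" for x
    by (simp_all add: mult.assoc[symmetric] b')
  have "?i1 \<in> Homr U (bsum B')" "?i2 \<in> Homr V (bsum B')" "?i3 \<in> Homr W (bsum B')"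
    "?p1 \<in> Homr (bsum B') U" "?p2 \<in> Homr (bsum B') V" "?p3 \<in> Homr (bsum B') W"
    by (rule h Homr_mult[OF h(6) h(1)] Homr_mult[OF h(6) h(2)] Homr_mult[OF h(3) h(8)] Homr_mult[OF h(4) h(8)])+
  moreover have "?p1 * ?i1 = idr U" "?p2 * ?i2 = idr V" "?p3 * ?i3 = idr W" "?p1 * ?i2 = 0" "?p1 * ?i3 = 0"
    "?p2 * ?i1 = 0" "?p2 * ?i3 = 0" "?p3 * ?i1 = 0" "?p3 * ?i2 = 0"
    by (simp_all add: mult.assoc z b b' idr_left[OF h(1)] idr_left[OF h(2)])
  moreover have "?i1 * ?p1 + ?i2 * ?p2 + ?i3 * ?p3 = idr (bsum B')"
  proof -
    have "?i2 * ?p2 + ?i3 * ?p3 = emb (inj2 B') * (emb (inj1 B) * emb (prj1 B) + emb (inj2 B) * emb (prj2 B)) * emb (prj2 B')"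
      by (simp add: distrib_left distrib_right mult.assoc)
    also have "\<dots> = emb (inj2 B') * emb (prj2 B')"
      unfolding b(10) by (simp add: idr_right[OF h(6)])
    finally show ?thesis using b'(10) by (simp add: add.assoc)
  qed
  ultimately show ?thesis using b'(1) by blast
qed

text \<open>The hypotheses in \<open>r\<close> say that the six entries on and below the diagonal of
  the square of the lower triangular matrix \<open>D\<close> vanish.\<close>

lemma triangular_exists:
  assumes o: "\<And>n. U n \<in> obj C" "\<And>n. V n \<in> obj C" "\<And>n. W n \<in> obj C"
    and d: "\<And>n. d1 n \<in> Homr (U n) (U (n + 1))" "\<And>n. d2 n \<in> Homr (V n) (V (n + 1))"
      "\<And>n. d3 n \<in> Homr (W n) (W (n + 1))" "\<And>n. a n \<in> Homr (U n) (V (n + 1))"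
      "\<And>n. b n \<in> Homr (U n) (W (n + 1))" "\<And>n. c n \<in> Homr (V n) (W (n + 1))"
    and r: "\<And>n. d1 (n + 1) * d1 n = 0" "\<And>n. d2 (n + 1) * d2 n = 0" "\<And>n. d3 (n + 1) * d3 n = 0"
      "\<And>n. a (n + 1) * d1 n + d2 (n + 1) * a n = 0" "\<And>n. c (n + 1) * d2 n + d3 (n + 1) * c n = 0"
      "\<And>n. b (n + 1) * d1 n + c (n + 1) * a n + d3 (n + 1) * b n = 0"
  shows "\<exists>P p1 p2 p3. triangular P p1 p2 p3 U V W d1 d2 d3 a b c"
proof -
  have "\<forall>n. \<exists>P i1 i2 i3 p1 p2 p3. P \<in> obj C \<and> i1 \<in> Homr (U n) P \<and> i2 \<in> Homr (V n) P \<and> i3 \<in> Homr (W n) P \<and>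
     p1 \<in> Homr P (U n) \<and> p2 \<in> Homr P (V n) \<and> p3 \<in> Homr P (W n) \<and>
     p1 * i1 = idr (U n) \<and> p2 * i2 = idr (V n) \<and> p3 * i3 = idr (W n) \<and>
     p1 * i2 = 0 \<and> p1 * i3 = 0 \<and> p2 * i1 = 0 \<and> p2 * i3 = 0 \<and> p3 * i1 = 0 \<and> p3 * i2 = 0 \<and>
     i1 * p1 + i2 * p2 + i3 * p3 = idr P"
    using triple_biproduct o by blast
  then obtain Q i1 i2 i3 p1 p2 p3 where A: "\<forall>n. Q n \<in> obj C \<and> i1 n \<in> Homr (U n) (Q n) \<and> i2 n \<in> Homr (V n) (Q n) \<and> i3 n \<in> Homr (W n) (Q n) \<and>
     p1 n \<in> Homr (Q n) (U n) \<and> p2 n \<in> Homr (Q n) (V n) \<and> p3 n \<in> Homr (Q n) (W n) \<and>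
     p1 n * i1 n = idr (U n) \<and> p2 n * i2 n = idr (V n) \<and> p3 n * i3 n = idr (W n) \<and>
     p1 n * i2 n = 0 \<and> p1 n * i3 n = 0 \<and> p2 n * i1 n = 0 \<and> p2 n * i3 n = 0 \<and> p3 n * i1 n = 0 \<and> p3 n * i2 n = 0 \<and>
     i1 n * p1 n + i2 n * p2 n + i3 n * p3 n = idr (Q n)"
    unfolding choice_iff by blast
  have H: "Q n \<in> obj C" "i1 n \<in> Homr (U n) (Q n)" "i2 n \<in> Homr (V n) (Q n)" "i3 n \<in> Homr (W n) (Q n)"
     "p1 n \<in> Homr (Q n) (U n)" "p2 n \<in> Homr (Q n) (V n)" "p3 n \<in> Homr (Q n) (W n)" for n
    using A by blast+
  have e: "p1 n * i1 n = idr (U n)" "p2 n * i2 n = idr (V n)" "p3 n * i3 n = idr (W n)"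
     "p1 n * i2 n = 0" "p1 n * i3 n = 0" "p2 n * i1 n = 0" "p2 n * i3 n = 0" "p3 n * i1 n = 0" "p3 n * i2 n = 0"
     and s: "i1 n * p1 n + i2 n * p2 n + i3 n * p3 n = idr (Q n)" for n
    using A by blast+
  have e': "p1 n * (i1 n * x) = idr (U n) * x" "p2 n * (i2 n * x) = idr (V n) * x" "p3 n * (i3 n * x) = idr (W n) * x"
     "p1 n * (i2 n * x) = 0" "p1 n * (i3 n * x) = 0" "p2 n * (i1 n * x) = 0" "p2 n * (i3 n * x) = 0"
     "p3 n * (i1 n * x) = 0" "p3 n * (i2 n * x) = 0" for n x
    by (simp_all add: mult.assoc[symmetric] e)
  have eqI: "x = y" if "x \<in> Homr T (Q n)" "y \<in> Homr T (Q n)" "p1 n * x = p1 n * y" "p2 n * x = p2 n * y"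
    "p3 n * x = p3 n * y" for x y T n
  proof -
    have "z = i1 n * (p1 n * z) + i2 n * (p2 n * z) + i3 n * (p3 n * z)" if "z \<in> Homr T (Q n)" for z
      using idr_left[OF that] by (simp add: s[symmetric] distrib_right mult.assoc)
    then show ?thesis using that by metis
  qed
  define D where "D n = i1 (n + 1) * (d1 n * p1 n) + i2 (n + 1) * (a n * p1 n + d2 n * p2 n) +
     i3 (n + 1) * (b n * p1 n + (c n * p2 n + d3 n * p3 n))" for n
  have t1: "d1 n * p1 n \<in> Homr (Q n) (U (n + 1))" for n by (rule Homr_mult[OF d(1) H(5)])
  have t2: "a n * p1 n + d2 n * p2 n \<in> Homr (Q n) (V (n + 1))" for n
    by (rule Homr_plus Homr_mult[OF d(4) H(5)] Homr_mult[OF d(2) H(6)])+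
  have t3: "b n * p1 n + (c n * p2 n + d3 n * p3 n) \<in> Homr (Q n) (W (n + 1))" for n
    by (rule Homr_plus Homr_mult[OF d(5) H(5)] Homr_mult[OF d(6) H(6)] Homr_mult[OF d(3) H(7)])+
  have DH: "D n \<in> Homr (Q n) (Q (n + 1))" for n
    unfolding D_def by (rule Homr_plus Homr_mult[OF H(2) t1] Homr_mult[OF H(3) t2] Homr_mult[OF H(4) t3])+
  have pD: "p1 (n + 1) * D n = d1 n * p1 n" "p2 (n + 1) * D n = a n * p1 n + d2 n * p2 n"
    "p3 (n + 1) * D n = b n * p1 n + (c n * p2 n + d3 n * p3 n)" for n
    by (simp_all only: D_def distrib_left[of "p1 (n + 1)"] distrib_left[of "p2 (n + 1)"] distrib_left[of "p3 (n + 1)"]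
        e' idr_left[OF t1] idr_left[OF t2] idr_left[OF t3] add_0_left add_0_right)
  have pD': "p1 (n + 1) * (D n * x) = d1 n * (p1 n * x)" "p2 (n + 1) * (D n * x) = a n * (p1 n * x) + d2 n * (p2 n * x)"
    "p3 (n + 1) * (D n * x) = b n * (p1 n * x) + (c n * (p2 n * x) + d3 n * (p3 n * x))" for n x
    by (simp_all only: mult.assoc[symmetric] pD distrib_right)
  define P where "P = \<lparr>cob = Q, cdiff = (\<lambda>n. unemb (Q n) (Q (n + 1)) (D n))\<rparr>"
  have dP: "dd P n = D n" "cob P n = Q n" "cdiff P n \<in> Hom C (Q n) (Q (n + 1))" for n
    using emb_unemb[OF DH] unemb_Hom[OF DH] by (simp_all add: dd_def P_def)
  have DD: "D (n + 1) * D n = 0" for n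
  proof (rule eqI[OF Homr_mult[OF DH DH] Homr_zero[OF H(1) H(1)]])
    show "p1 (n + 1 + 1) * (D (n + 1) * D n) = p1 (n + 1 + 1) * 0"
      unfolding pD' pD by (simp add: mult.assoc[symmetric] r)
    have "a (n + 1) * (d1 n * p1 n) + d2 (n + 1) * (a n * p1 n + d2 n * p2 n) =
        (a (n + 1) * d1 n + d2 (n + 1) * a n) * p1 n + (d2 (n + 1) * d2 n) * p2 n"
      by (simp add: algebra_simps)
    then show "p2 (n + 1 + 1) * (D (n + 1) * D n) = p2 (n + 1 + 1) * 0"
      unfolding pD' pD r by simp
    have "b (n + 1) * (d1 n * p1 n) + (c (n + 1) * (a n * p1 n + d2 n * p2 n) +
         d3 (n + 1) * (b n * p1 n + (c n * p2 n + d3 n * p3 n))) =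
       (b (n + 1) * d1 n + c (n + 1) * a n + d3 (n + 1) * b n) * p1 n +
       (c (n + 1) * d2 n + d3 (n + 1) * c n) * p2 n + (d3 (n + 1) * d3 n) * p3 n"
      by (simp add: algebra_simps)
    then show "p3 (n + 1 + 1) * (D (n + 1) * D n) = p3 (n + 1 + 1) * 0"
      unfolding pD' pD r by simp
  qed
  have "is_cochain C P" unfolding is_cochain_iff dP using DD dP(3) by simp
  moreover have "\<exists>x \<in> Homr T (Q n). p1 n * x = u \<and> p2 n * x = v \<and> p3 n * x = w"
    if "u \<in> Homr T (U n)" "v \<in> Homr T (V n)" "w \<in> Homr T (W n)" for T n u v w
  proof
    show "i1 n * u + i2 n * v + i3 n * w \<in> Homr T (Q n)"
      by (rule Homr_plus Homr_mult[OF H(2) that(1)] Homr_mult[OF H(3) that(2)] Homr_mult[OF H(4) that(3)])+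
    show "p1 n * (i1 n * u + i2 n * v + i3 n * w) = u \<and> p2 n * (i1 n * u + i2 n * v + i3 n * w) = v \<and>
        p3 n * (i1 n * u + i2 n * v + i3 n * w) = w"
      by (simp add: distrib_left e' idr_left[OF that(1)] idr_left[OF that(2)] idr_left[OF that(3)])
  qed
  moreover have "is_zero_obj C (Q n)" if "is_zero_obj C (U n)" "is_zero_obj C (V n)" "is_zero_obj C (W n)" for n
  proof (rule is_zero_objI[OF H(1)])
    have "p1 n = 0" "p2 n = 0" "p3 n = 0" using zero_obj_Homr(1)[OF that(1) H(5)]
      zero_obj_Homr(1)[OF that(2) H(6)] zero_obj_Homr(1)[OF that(3) H(7)] by blast+
    then show "idr (Q n) = 0" using s[of n] by simp
  qed
  ultimately have "triangular P p1 p2 p3 U V W d1 d2 d3 a b c"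
    unfolding triangular_def dP using H pD eqI by (intro conjI allI ballI impI) blast+
  then show ?thesis by blast
qed

lemma triangularD:
  assumes "triangular P p1 p2 p3 U V W d1 d2 d3 a b c"
  shows "is_cochain C P" "p1 n \<in> Homr (cob P n) (U n)" "p2 n \<in> Homr (cob P n) (V n)" "p3 n \<in> Homr (cob P n) (W n)"
    "p1 (n + 1) * dd P n = d1 n * p1 n"
    "p2 (n + 1) * dd P n = a n * p1 n + d2 n * p2 n"
    "p3 (n + 1) * dd P n = b n * p1 n + (c n * p2 n + d3 n * p3 n)"
    "u \<in> Homr T (U n) \<Longrightarrow> v \<in> Homr T (V n) \<Longrightarrow> w \<in> Homr T (W n) \<Longrightarrow>
        \<exists>x \<in> Homr T (cob P n). p1 n * x = u \<and> p2 n * x = v \<and> p3 n * x = w"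
    "x \<in> Homr T (cob P n) \<Longrightarrow> y \<in> Homr T (cob P n) \<Longrightarrow>
        p1 n * x = p1 n * y \<Longrightarrow> p2 n * x = p2 n * y \<Longrightarrow> p3 n * x = p3 n * y \<Longrightarrow> x = y"
    "is_zero_obj C (U n) \<Longrightarrow> is_zero_obj C (V n) \<Longrightarrow> is_zero_obj C (W n) \<Longrightarrow> is_zero_obj C (cob P n)"
    "p1 (n + 1) * (dd P n * z) = d1 n * (p1 n * z)"
    "p2 (n + 1) * (dd P n * z) = a n * (p1 n * z) + d2 n * (p2 n * z)"
    "p3 (n + 1) * (dd P n * z) = b n * (p1 n * z) + (c n * (p2 n * z) + d3 n * (p3 n * z))"
    "p1 n * (dd P (n - 1) * z) = d1 (n - 1) * (p1 (n - 1) * z)"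
    "p2 n * (dd P (n - 1) * z) = a (n - 1) * (p1 (n - 1) * z) + d2 (n - 1) * (p2 (n - 1) * z)"
    "p3 n * (dd P (n - 1) * z) = b (n - 1) * (p1 (n - 1) * z) + (c (n - 1) * (p2 (n - 1) * z) + d3 (n - 1) * (p3 (n - 1) * z))"
proof -
  show "is_cochain C P" "p1 n \<in> Homr (cob P n) (U n)" "p2 n \<in> Homr (cob P n) (V n)" "p3 n \<in> Homr (cob P n) (W n)"
    "u \<in> Homr T (U n) \<Longrightarrow> v \<in> Homr T (V n) \<Longrightarrow> w \<in> Homr T (W n) \<Longrightarrow>
        \<exists>x \<in> Homr T (cob P n). p1 n * x = u \<and> p2 n * x = v \<and> p3 n * x = w"
    "x \<in> Homr T (cob P n) \<Longrightarrow> y \<in> Homr T (cob P n) \<Longrightarrow>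
        p1 n * x = p1 n * y \<Longrightarrow> p2 n * x = p2 n * y \<Longrightarrow> p3 n * x = p3 n * y \<Longrightarrow> x = y"
    "is_zero_obj C (U n) \<Longrightarrow> is_zero_obj C (V n) \<Longrightarrow> is_zero_obj C (W n) \<Longrightarrow> is_zero_obj C (cob P n)"
    using assms unfolding triangular_def by blast+
  show *: "p1 (n + 1) * dd P n = d1 n * p1 n" "p2 (n + 1) * dd P n = a n * p1 n + d2 n * p2 n"
    "p3 (n + 1) * dd P n = b n * p1 n + (c n * p2 n + d3 n * p3 n)" for n
    using assms unfolding triangular_def by blast+
  show **: "p1 (n + 1) * (dd P n * z) = d1 n * (p1 n * z)"
    "p2 (n + 1) * (dd P n * z) = a n * (p1 n * z) + d2 n * (p2 n * z)"
    "p3 (n + 1) * (dd P n * z) = b n * (p1 n * z) + (c n * (p2 n * z) + d3 n * (p3 n * z))" for n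
    by (simp_all only: mult.assoc[symmetric] * distrib_right)
  show "p1 n * (dd P (n - 1) * z) = d1 (n - 1) * (p1 (n - 1) * z)"
    "p2 n * (dd P (n - 1) * z) = a (n - 1) * (p1 (n - 1) * z) + d2 (n - 1) * (p2 (n - 1) * z)"
    "p3 n * (dd P (n - 1) * z) = b (n - 1) * (p1 (n - 1) * z) + (c (n - 1) * (p2 (n - 1) * z) + d3 (n - 1) * (p3 (n - 1) * z))"
    using **[of "n - 1"] by simp_all
qed

text \<open>The homotopy pullback of \<open>\<sigma>\<close> and \<open>\<phi>\<close>: the third component is a homotopy between the two composites.\<close>

lemma homotopy_pullback:
  assumes W: "is_cochain C W" and Y: "is_cochain C Y" and Z: "is_cochain C Z"
    and lb: "left_bounded C W" "left_bounded C Y" "left_bounded C Z"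
    and sig: "\<sigma> \<in> cmaps W Y" and phi: "\<phi> \<in> cmaps Z Y"
  shows "\<exists>P \<tau> \<eta>. is_cochain C P \<and> left_bounded C P \<and> \<tau> \<in> cmaps P Z \<and> \<eta> \<in> cmaps P W \<and>
     htpy P Y (\<lambda>n. \<phi> n * \<tau> n) (\<lambda>n. \<sigma> n * \<eta> n) \<and> (\<forall>N. qis W Y \<sigma> N \<longrightarrow> qis P Z \<tau> (N + 1))"
proof -
  note f = cmapsD[OF phi] and g = cmapsD[OF sig]
  \<comment> \<open>An element is \<open>(w, z, y)\<close> with \<open>y\<close> one degree lower,
    and the third component of its differential is \<open>\<phi> z - \<sigma> w - d y\<close>. Hence
    \<open>p3\<close> is a homotopy between the two composites.\<close>
  have "\<exists>P p1 p2 p3. triangular P p1 p2 p3 (cob W) (cob Z) (\<lambda>n. cob Y (n - 1)) (dd W) (dd Z) (\<lambda>n. - dd Y (n - 1))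
      (\<lambda>n. 0) (\<lambda>n. - \<sigma> n) \<phi>"
    by (rule triangular_exists)
      (simp_all add: cochain_obj W Y Z cochainD(3)[OF W] cochainD(3)[OF Z] Homr_uminus[OF cochainD(5)[OF Y]]
        Homr_zero Homr_uminus[OF g(1)] f(1) cochainD(4)[OF W] cochainD(4)[OF Z] cochainD(6)[OF Y] f(2) g(2))
  then obtain P p1 p2 p3 where P: "triangular P p1 p2 p3 (cob W) (cob Z) (\<lambda>n. cob Y (n - 1)) (dd W) (dd Z) (\<lambda>n. - dd Y (n - 1))
      (\<lambda>n. 0) (\<lambda>n. - \<sigma> n) \<phi>" by blast
  note T = triangularD[OF P]
  obtain M1 M2 M3 where M: "\<forall>n<M1. is_zero_obj C (cob W n)" "\<forall>n<M2. is_zero_obj C (cob Y n)" "\<forall>n<M3. is_zero_obj C (cob Z n)"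
    using lb unfolding left_bounded_def by blast
  have "\<forall>n < min M1 (min M2 M3). is_zero_obj C (cob P n)"
    using M by (auto intro!: T(10))
  then have lbP: "left_bounded C P" unfolding left_bounded_def by blast
  have c1: "p1 \<in> cmaps P W" by (rule cmapsI) (simp_all add: T(2,5))
  have c2: "p2 \<in> cmaps P Z" by (rule cmapsI) (simp_all add: T(3,6))
  have h: "htpy P Y (\<lambda>n. \<phi> n * p2 n) (\<lambda>n. \<sigma> n * p1 n)"
    by (rule hpyI[of p3]) (simp_all add: T(4,7))
  \<comment> \<open>One degree is lost: the monomorphism in degree \<open>n\<close> uses that
    \<sigma> is an epimorphism in degree \<open>n - 1\<close>.\<close>
  have "qis P Z p2 (N + 1)" if q: "qis W Y \<sigma> N" for N
    unfolding qis_def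
  proof (intro allI impI conjI)
    fix n assume n: "N + 1 \<le> n"
    then have E: "epi_at W Y \<sigma> n" "epi_at W Y \<sigma> (n - 1)" and Mo: "mono_at W Y \<sigma> n" using q by (auto simp: qis_def)
    show "epi_at P Z p2 n"
    proof (rule epi_atI)
      fix T z assume z: "z \<in> Homr T (cob Z n)" "dd Z n * z = 0"
      have "dd Y n * (\<phi> n * z) = 0" using f(5)[of n z, symmetric] z(2) by simp
      then obtain T1 a w y' where 1: "epir T1 T a" "w \<in> Homr T1 (cob W n)" "y' \<in> Homr T1 (cob Y (n - 1))"
        "dd W n * w = 0" "\<sigma> n * w + dd Y (n - 1) * y' = \<phi> n * z * a"
        using epi_atE[OF E(1) Homr_mult[OF f(1) z(1)]] by blast
      \<comment> \<open>The element \<open>(w, z a, y')\<close> is a cocycle because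
        \<open>\<sigma> w + d y' = \<phi> z a\<close>.\<close>
      obtain x where x: "x \<in> Homr T1 (cob P n)" "p1 n * x = w" "p2 n * x = z * a" "p3 n * x = y'"
        using T(8)[OF 1(2) Homr_mult[OF z(1) epir_Homr[OF 1(1)]] 1(3)] by blast
      have T1: "T1 \<in> obj C" using x Homr_obj by blast
      have "dd P n * x = 0"
      proof (rule T(9)[OF Homr_mult[OF cochainD(3)[OF T(1)] x(1)] Homr_zero[OF T1 cochain_obj[OF T(1)]]])
        show "p1 (n + 1) * (dd P n * x) = p1 (n + 1) * 0" by (simp add: T x 1(4))
        show "p2 (n + 1) * (dd P n * x) = p2 (n + 1) * 0" unfolding T(12) x by (simp add: z(2) mult.assoc[symmetric])
        have "p3 (n + 1) * (dd P n * x) = \<phi> n * z * a - (\<sigma> n * w + dd Y (n - 1) * y')"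
          unfolding T(13) x by (simp add: algebra_simps)
        then show "p3 (n + 1) * (dd P n * x) = p3 (n + 1) * 0"
          unfolding 1(5) by simp
      qed
      moreover have "p2 n * x + dd Z (n - 1) * 0 = z * a" using x by simp
      ultimately show "\<exists>T' a x y'. epir T' T a \<and> x \<in> Homr T' (cob P n) \<and> y' \<in> Homr T' (cob Z (n - 1)) \<and>
          dd P n * x = 0 \<and> p2 n * x + dd Z (n - 1) * y' = z * a"
        using 1(1) x(1) Homr_zero[OF T1 cochain_obj[OF Z]] by blast
    qed
    show "mono_at P Z p2 n"
    proof (rule mono_atI)
      fix T x z assume x: "x \<in> Homr T (cob P n)" "z \<in> Homr T (cob Z (n - 1))" "dd P n * x = 0" "p2 n * x = dd Z (n - 1) * z"
      define w where "w = p1 n * x"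
      define y where "y = p3 n * x"
      have wH: "w \<in> Homr T (cob W n)" unfolding w_def by (rule Homr_mult[OF T(2) x(1)])
      have yH: "y \<in> Homr T (cob Y (n - 1))" unfolding y_def by (rule Homr_mult[OF T(4) x(1)])
      have w0: "dd W n * w = 0" using T(11)[of n x] x(3) by (simp add: w_def)
      have "\<phi> n * (p2 n * x) = \<sigma> n * w + dd Y (n - 1) * y"
        using T(13)[of n x] x(3) by (simp add: w_def y_def algebra_simps)
      then have sw: "\<sigma> n * w = dd Y (n - 1) * (\<phi> (n - 1) * z - y)"
        by (simp add: x(4) f(4) right_diff_distrib)
      have yy: "\<phi> (n - 1) * z - y \<in> Homr T (cob Y (n - 1))" by (rule Homr_minus yH Homr_mult[OF f(1) x(2)])+
      obtain T1 a w' where 1: "epir T1 T a" "w' \<in> Homr T1 (cob W (n - 1))" "dd W (n - 1) * w' = w * a"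
        using mono_atE[OF Mo wH yy w0 sw] by blast
      \<comment> \<open>The defect in the third component if \<open>x\<close> is to be bounded by an
        element with components \<open>w'\<close> and \<open>z\<close>. It is a cocycle, so \<sigma>
        being an epimorphism absorbs it into \<open>w2\<close> and \<open>y2\<close>.\<close>
      define y1 where "y1 = (\<phi> (n - 1) * z - y) * a - \<sigma> (n - 1) * w'"
      have y1: "y1 \<in> Homr T1 (cob Y (n - 1))"
        unfolding y1_def by (rule Homr_minus[OF Homr_mult[OF yy epir_Homr[OF 1(1)]] Homr_mult[OF g(1) 1(2)]])
      have "dd Y (n - 1) * y1 = dd Y (n - 1) * (\<phi> (n - 1) * z - y) * a - \<sigma> n * (dd W (n - 1) * w')"
        unfolding y1_def right_diff_distrib[of "dd Y (n - 1)" "_ * a"] g(4) by (simp only: mult.assoc)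
      also have "\<dots> = 0" by (simp only: 1(3) sw[symmetric] mult.assoc[symmetric] diff_self)
      finally obtain T2 a2 w2 y2 where 2: "epir T2 T1 a2" "w2 \<in> Homr T2 (cob W (n - 1))" "y2 \<in> Homr T2 (cob Y (n - 1 - 1))"
        "dd W (n - 1) * w2 = 0" "\<sigma> (n - 1) * w2 + dd Y (n - 1 - 1) * y2 = y1 * a2"
        using epi_atE[OF E(2) y1] by blast
      have a: "a * a2 \<in> Homr T2 T" by (rule Homr_mult[OF epir_Homr[OF 1(1)] epir_Homr[OF 2(1)]])
      obtain q where q: "q \<in> Homr T2 (cob P (n - 1))" "p1 (n - 1) * q = w' * a2 + w2" "p2 (n - 1) * q = z * (a * a2)"
        "p3 (n - 1) * q = y2"
        using T(8)[OF Homr_plus[OF Homr_mult[OF 1(2) epir_Homr[OF 2(1)]] 2(2)] Homr_mult[OF x(2) a] 2(3)] by blast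
      have "dd P (n - 1) * q = x * (a * a2)"
      proof (rule T(9)[OF Homr_mult[OF cochainD(5)[OF T(1)] q(1)] Homr_mult[OF x(1) a]])
        show "p1 n * (dd P (n - 1) * q) = p1 n * (x * (a * a2))"
          unfolding T(14) q distrib_left 2(4) by (simp add: 1(3) w_def mult.assoc[symmetric])
        show "p2 n * (dd P (n - 1) * q) = p2 n * (x * (a * a2))"
          unfolding T(15) q by (simp add: x(4) mult.assoc[symmetric])
        have "\<sigma> (n - 1) * w2 = y1 * a2 - dd Y (n - 1 - 1) * y2" using 2(5) by (simp add: eq_diff_eq)
        then show "p3 n * (dd P (n - 1) * q) = p3 n * (x * (a * a2))"
          unfolding T(16) q distrib_left mult_minus_left
          by (simp add: y1_def y_def algebra_simps)
      qed
      then show "\<exists>T' a x'. epir T' T a \<and> x' \<in> Homr T' (cob P (n - 1)) \<and> dd P (n - 1) * x' = x * a"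
        using epir_mult[OF 2(1) 1(1)] q(1) by blast
    qed
  qed
  then show ?thesis using T(1) lbP c1 c2 h by blast
qed

text \<open>
  A null-homotopy \<open>k\<close> of \<open>\<sigma> \<phi>\<close> lifts \<open>\<phi>\<close> to the homotopy fibre of \<open>\<sigma>\<close>; the complex below is
  the homotopy fibre of this lift.
\<close>

lemma homotopy_equalizer:
  assumes X: "is_cochain C X" and Y: "is_cochain C Y" and Y': "is_cochain C Y'"
    and lb: "left_bounded C X" "left_bounded C Y" "left_bounded C Y'"
    and sig: "\<sigma> \<in> cmaps Y Y'" and phi: "\<phi> \<in> cmaps X Y" and nul: "htpy X Y' (\<lambda>n. \<sigma> n * \<phi> n) (\<lambda>n. 0)"
  shows "\<exists>P \<tau>. is_cochain C P \<and> left_bounded C P \<and> \<tau> \<in> cmaps P X \<and>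
     htpy P Y (\<lambda>n. \<phi> n * \<tau> n) (\<lambda>n. 0) \<and> (\<forall>N. qis Y Y' \<sigma> N \<longrightarrow> qis P X \<tau> (N + 2))"
proof -
  note f = cmapsD[OF phi] and g = cmapsD[OF sig]
  obtain k where k: "\<And>n. k n \<in> Homr (cob X n) (cob Y' (n - 1))"
    "\<And>n. \<sigma> n * \<phi> n - 0 = dd Y' (n - 1) * k n + k (n + 1) * dd X n" using nul by (rule hpyE) blast
  have k2: "\<sigma> n * (\<phi> n * x) = dd Y' (n - 1) * (k n * x) + k (n + 1) * (dd X n * x)" for n x
    using k(2)[of n] by (simp add: mult.assoc[symmetric] distrib_right)
  have 2: "n + 1 - 2 = n - 1" "n - 2 + 1 = n - 1" "n - 1 - 1 = n - 2" for n :: int by simp_all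
  have dY': "dd Y' (n - 2) \<in> Homr (cob Y' (n - 2)) (cob Y' (n - 1))" "dd Y' (n - 1) * dd Y' (n - 2) = 0"
    "dd Y' (n - 2) * \<sigma> (n - 2) = \<sigma> (n - 1) * dd Y (n - 2)" for n
    using cochainD(3)[OF Y', of "n - 2"] cochainD(4)[OF Y', of "n - 2"] g(2)[of "n - 2"] unfolding 2 by auto
  \<comment> \<open>An element is \<open>(x, y, y')\<close> in degrees \<open>n\<close>,
    \<open>n - 1\<close> and \<open>n - 2\<close>, with differential
    \<open>(d x, \<phi> x - d y, k x - \<sigma> y + d y')\<close>. Thus \<open>p2\<close> is a
    null-homotopy of \<phi> on \<open>P\<close>, and \<open>y'\<close> compares its image under
    \<sigma> with \<open>k\<close>.\<close>
  have "\<exists>P p1 p2 p3. triangular P p1 p2 p3 (cob X) (\<lambda>n. cob Y (n - 1)) (\<lambda>n. cob Y' (n - 2))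
      (dd X) (\<lambda>n. - dd Y (n - 1)) (\<lambda>n. dd Y' (n - 2)) \<phi> k (\<lambda>n. - \<sigma> (n - 1))"
  proof (rule triangular_exists)
    fix n
    show "k (n + 1) * dd X n + - \<sigma> (n + 1 - 1) * \<phi> n + dd Y' (n + 1 - 2) * k n = 0"
      using k(2)[of n] unfolding 2 by (simp add: algebra_simps)
    show "- \<sigma> (n + 1 - 1) * - dd Y (n - 1) + dd Y' (n + 1 - 2) * - \<sigma> (n - 1) = 0"
      unfolding 2 by (simp add: g(3))
    show "dd Y' (n + 1 - 2) * dd Y' (n - 2) = 0" "dd Y' (n - 2) \<in> Homr (cob Y' (n - 2)) (cob Y' (n + 1 - 2))"
      "k n \<in> Homr (cob X n) (cob Y' (n + 1 - 2))" "- \<sigma> (n - 1) \<in> Homr (cob Y (n - 1)) (cob Y' (n + 1 - 2))"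
      unfolding 2 by (rule dY' k(1) Homr_uminus[OF g(1)])+
  qed (simp_all add: cochain_obj X Y Y' cochainD(3)[OF X] Homr_uminus[OF cochainD(5)[OF Y]] f(1) cochainD(4)[OF X]
        cochainD(6)[OF Y] f(2))
  then obtain P p1 p2 p3 where P: "triangular P p1 p2 p3 (cob X) (\<lambda>n. cob Y (n - 1)) (\<lambda>n. cob Y' (n - 2))
      (dd X) (\<lambda>n. - dd Y (n - 1)) (\<lambda>n. dd Y' (n - 2)) \<phi> k (\<lambda>n. - \<sigma> (n - 1))" by blast
  note T = triangularD[OF P]
  obtain M1 M2 M3 where M: "\<forall>n<M1. is_zero_obj C (cob X n)" "\<forall>n<M2. is_zero_obj C (cob Y n)" "\<forall>n<M3. is_zero_obj C (cob Y' n)"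
    using lb unfolding left_bounded_def by blast
  have "\<forall>n < min M1 (min M2 M3). is_zero_obj C (cob P n)"
    using M by (auto intro!: T(10))
  then have lbP: "left_bounded C P" unfolding left_bounded_def by blast
  have c1: "p1 \<in> cmaps P X" by (rule cmapsI) (simp_all add: T(2,5))
  have h: "htpy P Y (\<lambda>n. \<phi> n * p1 n) (\<lambda>n. 0)"
    by (rule hpyI[of p2]) (simp_all add: T(3,6))
  \<comment> \<open>Two degrees are lost: the chases use \<sigma> as a monomorphism in degrees
    \<open>n\<close> and \<open>n - 1\<close> and as an epimorphism in degrees \<open>n - 1\<close>
    and \<open>n - 2\<close>.\<close>
  have "qis P X p1 (N + 2)" if q: "qis Y Y' \<sigma> N" for N
    unfolding qis_def
  proof (intro allI impI conjI)
    fix n assume n: "N + 2 \<le> n"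
    then have E: "epi_at Y Y' \<sigma> (n - 1)" "epi_at Y Y' \<sigma> (n - 2)" and Mo: "mono_at Y Y' \<sigma> n" "mono_at Y Y' \<sigma> (n - 1)"
      using q by (auto simp: qis_def)
    show "epi_at P X p1 n"
    proof (rule epi_atI)
      fix T x assume x: "x \<in> Homr T (cob X n)" "dd X n * x = 0"
      have fx: "dd Y n * (\<phi> n * x) = 0" using f(5)[of n x, symmetric] x(2) by simp
      have s: "\<sigma> n * (\<phi> n * x) = dd Y' (n - 1) * (k n * x)" using k2[of n x] x(2) by simp
      obtain T1 a y where 1: "epir T1 T a" "y \<in> Homr T1 (cob Y (n - 1))" "dd Y (n - 1) * y = \<phi> n * x * a"
        using mono_atE[OF Mo(1) Homr_mult[OF f(1) x(1)] Homr_mult[OF k(1) x(1)] fx s] by blast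
      \<comment> \<open>Both \<open>k x a\<close> and \<open>\<sigma> y\<close> have the coboundary
        \<open>\<sigma> \<phi> x a\<close>, so their difference is a cocycle; changing
        \<open>y\<close> by \<open>y2\<close> turns it into a coboundary.\<close>
      define z where "z = k n * x * a - \<sigma> (n - 1) * y"
      have zH: "z \<in> Homr T1 (cob Y' (n - 1))"
        unfolding z_def by (rule Homr_minus[OF Homr_mult[OF Homr_mult[OF k(1) x(1)] epir_Homr[OF 1(1)]] Homr_mult[OF g(1) 1(2)]])
      have "dd Y' (n - 1) * z = dd Y' (n - 1) * (k n * x) * a - \<sigma> n * (dd Y (n - 1) * y)"
        by (simp add: z_def right_diff_distrib mult.assoc g(4))
      also have "\<dots> = 0" by (simp only: 1(3) s[symmetric] mult.assoc diff_self)
      finally obtain T2 a2 y2 z2 where 2: "epir T2 T1 a2" "y2 \<in> Homr T2 (cob Y (n - 1))" "z2 \<in> Homr T2 (cob Y' (n - 1 - 1))"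
        "dd Y (n - 1) * y2 = 0" "\<sigma> (n - 1) * y2 + dd Y' (n - 1 - 1) * z2 = z * a2"
        using epi_atE[OF E(1) zH] by blast
      have z2: "- z2 \<in> Homr T2 (cob Y' (n - 2))" using Homr_uminus[OF 2(3)] by simp
      have aH: "a * a2 \<in> Homr T2 T" by (rule Homr_mult[OF epir_Homr[OF 1(1)] epir_Homr[OF 2(1)]])
      obtain q where q: "q \<in> Homr T2 (cob P n)" "p1 n * q = x * (a * a2)" "p2 n * q = y * a2 + y2" "p3 n * q = - z2"
        using T(8)[OF Homr_mult[OF x(1) aH] Homr_plus[OF Homr_mult[OF 1(2) epir_Homr[OF 2(1)]] 2(2)] z2] by blast
      have T2: "T2 \<in> obj C" using q Homr_obj by blast
      have "dd P n * q = 0"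
      proof (rule T(9)[OF Homr_mult[OF cochainD(3)[OF T(1)] q(1)] Homr_zero[OF T2 cochain_obj[OF T(1)]]])
        show "p1 (n + 1) * (dd P n * q) = p1 (n + 1) * 0" unfolding T(11) q by (simp add: x(2) mult.assoc[symmetric])
        show "p2 (n + 1) * (dd P n * q) = p2 (n + 1) * 0"
          by (simp add: T q distrib_left 2(4)) (simp add: mult.assoc[symmetric] 1(3))
        have "\<sigma> (n - 1) * y2 = z * a2 - dd Y' (n - 2) * z2" using 2(5) by (simp add: eq_diff_eq)
        then show "p3 (n + 1) * (dd P n * q) = p3 (n + 1) * 0"
          unfolding T(13) q by (simp add: z_def algebra_simps)
      qed
      moreover have "p1 n * q + dd X (n - 1) * 0 = x * (a * a2)" using q by simp
      ultimately show "\<exists>T' a x' y'. epir T' T a \<and> x' \<in> Homr T' (cob P n) \<and> y' \<in> Homr T' (cob X (n - 1)) \<and>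
          dd P n * x' = 0 \<and> p1 n * x' + dd X (n - 1) * y' = x * a"
        using epir_mult[OF 2(1) 1(1)] q(1) Homr_zero[OF T2 cochain_obj[OF X]] by blast
    qed
    show "mono_at P X p1 n"
    proof (rule mono_atI)
      fix T q x assume x: "q \<in> Homr T (cob P n)" "x \<in> Homr T (cob X (n - 1))" "dd P n * q = 0" "p1 n * q = dd X (n - 1) * x"
      define y where "y = p2 n * q"
      define z where "z = p3 n * q"
      have yH: "y \<in> Homr T (cob Y (n - 1))" unfolding y_def by (rule Homr_mult[OF T(3) x(1)])
      have zH: "z \<in> Homr T (cob Y' (n - 2))" unfolding z_def by (rule Homr_mult[OF T(4) x(1)])
      have 1: "\<phi> n * (dd X (n - 1) * x) = dd Y (n - 1) * y"
        using T(12)[of n q] x(3,4) by (simp add: y_def)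
      have 2: "k n * (dd X (n - 1) * x) - \<sigma> (n - 1) * y + dd Y' (n - 2) * z = 0"
        using T(13)[of n q] x(3,4) by (simp add: y_def z_def algebra_simps)
      \<comment> \<open>For an element with first component \<open>x\<close> to bound
        \<open>q\<close>, its second component has to bound \<open>u\<close>. The third component
        then leaves the cocycle \<open>v\<close>, which is absorbed by changing the second component
        by \<open>y2\<close>.\<close>
      define u where "u = \<phi> (n - 1) * x - y"
      have uH: "u \<in> Homr T (cob Y (n - 1))" unfolding u_def by (rule Homr_minus[OF Homr_mult[OF f(1) x(2)] yH])
      have u0: "dd Y (n - 1) * u = 0" using 1 by (simp add: u_def right_diff_distrib f(4))
      have kx: "k (n - 1) * x - z \<in> Homr T (cob Y' (n - 1 - 1))"
        using Homr_minus[OF Homr_mult[OF k(1)[of "n - 1"] x(2)]] zH by simp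
      have su: "\<sigma> (n - 1) * u = dd Y' (n - 1 - 1) * (k (n - 1) * x - z)"
        using k2[of "n - 1" x] 2 by (simp add: u_def right_diff_distrib algebra_simps)
      have kx': "k (n - 1) * x - z \<in> Homr T (cob Y' (n - 2))" using kx by simp
      obtain T1 a y1 where 3: "epir T1 T a" "y1 \<in> Homr T1 (cob Y (n - 1 - 1))" "dd Y (n - 1 - 1) * y1 = u * a"
        using mono_atE[OF Mo(2) uH kx u0 su] by blast
      have y1H: "y1 \<in> Homr T1 (cob Y (n - 2))" and dy1: "dd Y (n - 2) * y1 = u * a" using 3 by simp_all
      define v where "v = (k (n - 1) * x - z) * a - \<sigma> (n - 2) * y1"
      have vH: "v \<in> Homr T1 (cob Y' (n - 2))"
        unfolding v_def using Homr_minus[OF Homr_mult[OF kx' epir_Homr[OF 3(1)]] Homr_mult[OF g(1) y1H]] .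
      have "dd Y' (n - 2) * v = dd Y' (n - 2) * (k (n - 1) * x - z) * a - \<sigma> (n - 1) * (dd Y (n - 2) * y1)"
        by (simp add: v_def right_diff_distrib mult.assoc[symmetric] dY'(3))
      also have "\<dots> = 0" using su by (simp add: dy1 mult.assoc[symmetric])
      finally obtain T2 a2 y2 v2 where 4: "epir T2 T1 a2" "y2 \<in> Homr T2 (cob Y (n - 2))" "v2 \<in> Homr T2 (cob Y' (n - 2 - 1))"
        "dd Y (n - 2) * y2 = 0" "\<sigma> (n - 2) * y2 + dd Y' (n - 2 - 1) * v2 = v * a2"
        using epi_atE[OF E(2) vH] by blast
      have aH: "a * a2 \<in> Homr T2 T" by (rule Homr_mult[OF epir_Homr[OF 3(1)] epir_Homr[OF 4(1)]])
      have yy: "y1 * a2 + y2 \<in> Homr T2 (cob Y (n - 1 - 1))"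
        using Homr_plus[OF Homr_mult[OF y1H epir_Homr[OF 4(1)]] 4(2)] by simp
      have vv: "- v2 \<in> Homr T2 (cob Y' (n - 1 - 2))" using Homr_uminus[OF 4(3)] by simp
      obtain r where r: "r \<in> Homr T2 (cob P (n - 1))" "p1 (n - 1) * r = x * (a * a2)" "p2 (n - 1) * r = y1 * a2 + y2"
        "p3 (n - 1) * r = - v2"
        using T(8)[OF Homr_mult[OF x(2) aH] yy vv] by blast
      have "dd P (n - 1) * r = q * (a * a2)"
      proof (rule T(9)[OF Homr_mult[OF cochainD(5)[OF T(1)] r(1)] Homr_mult[OF x(1) aH]])
        show "p1 n * (dd P (n - 1) * r) = p1 n * (q * (a * a2))"
          unfolding T(14) r by (simp add: x(4) mult.assoc[symmetric])
        have "p2 n * (dd P (n - 1) * r) = \<phi> (n - 1) * (x * (a * a2)) - dd Y (n - 2) * y1 * a2"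
          unfolding T(15) r by (simp add: distrib_left 4(4) mult.assoc)
        then show "p2 n * (dd P (n - 1) * r) = p2 n * (q * (a * a2))"
          unfolding dy1 by (simp add: u_def y_def algebra_simps)
        have "p3 n * (dd P (n - 1) * r) = k (n - 1) * (x * (a * a2)) - \<sigma> (n - 2) * y1 * a2 - (\<sigma> (n - 2) * y2 + dd Y' (n - 2 - 1) * v2)"
          unfolding T(16) r by (simp add: algebra_simps)
        then show "p3 n * (dd P (n - 1) * r) = p3 n * (q * (a * a2))"
          unfolding 4(5) by (simp add: v_def z_def algebra_simps)
      qed
      then show "\<exists>T' a x'. epir T' T a \<and> x' \<in> Homr T' (cob P (n - 1)) \<and> dd P (n - 1) * x' = q * a"
        using epir_mult[OF 4(1) 3(1)] r(1) by blast
    qed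
  qed
  then show ?thesis using T(1) lbP c1 h by blast
qed

end

section \<open>The multiplicative systems of the Verdier quotients\<close>

lemma full_subcategory_simps [simp]:
  "src (full_subcategory C S) = src C" "tgt (full_subcategory C S) = tgt C"
  "ident (full_subcategory C S) = ident C" "cmp (full_subcategory C S) = cmp C"
  "plus_arr (full_subcategory C S) = plus_arr C" "zero_arr (full_subcategory C S) = zero_arr C"
  "obj (full_subcategory C S) = obj C \<inter> S"
  by (simp_all add: full_subcategory_def)

lemma Hom_full_subcategory:
  "f \<in> Hom (full_subcategory C S) X Y \<longleftrightarrow> f \<in> Hom C X Y \<and> X \<in> S \<and> Y \<in> S"
  by (auto simp: Hom_def full_subcategory_def)

lemma (in preadditive_category) preadditive_full_subcategory: "preadditive_category (full_subcategory C S)"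
proof -
  have g: "hom_group (full_subcategory C S) X Y = hom_group C X Y" if "X \<in> S" "Y \<in> S" for X Y
  proof -
    have "Hom (full_subcategory C S) X Y = Hom C X Y" using that by (auto simp: Hom_full_subcategory)
    then show ?thesis by (simp add: hom_group_def)
  qed
  show ?thesis
  proof (intro preadditive_category.intro category.intro preadditive_category_axioms.intro)
    show "f \<in> arr (full_subcategory C S) \<Longrightarrow> src (full_subcategory C S) f \<in> obj (full_subcategory C S)" for f
      using src_obj by (auto simp: full_subcategory_def)
    show "f \<in> arr (full_subcategory C S) \<Longrightarrow> tgt (full_subcategory C S) f \<in> obj (full_subcategory C S)" for f
      using tgt_obj by (auto simp: full_subcategory_def)
    show "X \<in> obj (full_subcategory C S) \<Longrightarrow> Y \<in> obj (full_subcategory C S) \<Longrightarrow>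
        comm_group (hom_group (full_subcategory C S) X Y)" for X Y
      using g[of X Y] hom_comm_group[of X Y] by simp
  qed (auto simp: Hom_full_subcategory ident_Hom ident_left ident_right intro: cmp_Hom cmp_assoc cmp_plus_left cmp_plus_right)
qed

text \<open>One quantifier over the bound serves both quotients: applied to
  \<open>qis X Y \<sigma>\<close> it says that \<sigma> is a quasi-isomorphism if \<open>b\<close>
  holds, and an isomorphism on cohomology in high degrees otherwise.\<close>

definition all_or_some :: "bool \<Rightarrow> (int \<Rightarrow> bool) \<Rightarrow> bool" where
  "all_or_some b P \<longleftrightarrow> (if b then \<forall>N. P N else \<exists>N. P N)"

text \<open>The integers are unbounded in both directions, so a loss of \<open>c\<close> degrees
  affects neither quantifier.\<close>

lemma all_or_some_shift:
  assumes "all_or_some b P" "\<And>N. P N \<Longrightarrow> P' (N + c)"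
  shows "all_or_some b P'"
proof (cases b)
  case True
  then have "P' (N - c + c)" for N using assms unfolding all_or_some_def by presburger
  then have "\<forall>N. P' N" by simp
  then show ?thesis using True by (simp add: all_or_some_def)
next
  case False
  then obtain N where "P N" using assms(1) by (auto simp: all_or_some_def)
  then have "\<exists>N. P' N" using assms(2) by blast
  then show ?thesis using False by (simp add: all_or_some_def)
qed

lemma all_or_some_mono: "all_or_some b P \<Longrightarrow> (\<And>N. P N \<Longrightarrow> P' N) \<Longrightarrow> all_or_some b P'"
  by (rule all_or_some_shift[of b P P' 0]) simp_all

lemma all_or_some_all: "(\<And>N. P N) \<Longrightarrow> all_or_some b P"
  unfolding all_or_some_def by presburger

lemma all_or_some_conj:
  assumes "all_or_some b P" "all_or_some b P'" "\<And>M N. P M \<Longrightarrow> M \<le> N \<Longrightarrow> P N" "\<And>M N. P' M \<Longrightarrow> M \<le> N \<Longrightarrow> P' N"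
  shows "all_or_some b (\<lambda>N. P N \<and> P' N)"
proof (cases b)
  case True
  then show ?thesis using assms(1,2) by (simp add: all_or_some_def)
next
  case False
  then obtain M N where "P M" "P' N" using assms(1,2) by (auto simp: all_or_some_def)
  then have "P (max M N) \<and> P' (max M N)" using assms(3,4) by (meson max.cobounded1 max.cobounded2)
  then show ?thesis using False by (auto simp: all_or_some_def)
qed

context abelian_category
begin

text \<open>The two systems are treated uniformly: \<open>b\<close> selects exact complexes, \<open>\<not> b\<close> bounded cohomology.\<close>

definition null_objs :: "bool \<Rightarrow> ('a, 'b) cochain set" where
  "null_objs b = (if b then K_plus_exact_obj C else K_plus_b_obj C)"

abbreviation Kp where "Kp \<equiv> K_plus C"

definition null_system :: "bool \<Rightarrow> ('a, 'b) harr set" where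
  "null_system b = verdier_system Kp (K_plus_triangles C) (null_objs b)"

lemma src_tgt_htpy_class [simp]: "src K (htpy_class X Y \<phi>) = X" "tgt K (htpy_class X Y \<phi>) = Y"
  by (simp_all add: homotopy_category_def htpy_class_def)

lemma is_iso_htpy_class:
  assumes X: "is_cochain C X" and Y: "is_cochain C Y" and phi: "\<phi> \<in> cmaps X Y"
  shows "is_iso K (htpy_class X Y \<phi>) \<longleftrightarrow> (\<exists>\<psi>. hequiv X Y \<phi> \<psi>)"
proof
  assume "is_iso K (htpy_class X Y \<phi>)"
  then obtain g where g: "g \<in> Hom K Y X" "g \<cdot>\<^bsub>K\<^esub> htpy_class X Y \<phi> = ident K X" "htpy_class X Y \<phi> \<cdot>\<^bsub>K\<^esub> g = ident K Y"
    by (auto simp: is_iso_def)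
  obtain \<psi> where \<psi>: "\<psi> \<in> cmaps Y X" "g = htpy_class Y X \<psi>" using g(1) by (rule HomK_E)
  show "\<exists>\<psi>. hequiv X Y \<phi> \<psi>"
    using g(2,3) \<psi> X Y phi unfolding hequiv_def
    by (intro exI[of _ \<psi>]) (simp add: htpy_class_cmp ident_K htpy_class_eq_iff cmaps_mult cmaps_idr)
next
  assume "\<exists>\<psi>. hequiv X Y \<phi> \<psi>"
  then obtain \<psi> where \<psi>: "hequiv X Y \<phi> \<psi>" by blast
  then have p: "\<psi> \<in> cmaps Y X" by (simp add: hequiv_def)
  have "htpy_class X Y \<phi> \<in> arr K" using htpy_class_Hom[OF X Y phi] by (simp add: Hom_def)
  moreover have "htpy_class Y X \<psi> \<cdot>\<^bsub>K\<^esub> htpy_class X Y \<phi> = ident K X" "htpy_class X Y \<phi> \<cdot>\<^bsub>K\<^esub> htpy_class Y X \<psi> = ident K Y"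
    using \<psi> p X Y phi by (simp_all add: htpy_class_cmp ident_K htpy_class_eq_iff cmaps_mult cmaps_idr hequiv_def)
  ultimately show "is_iso K (htpy_class X Y \<phi>)"
    using htpy_class_Hom[OF Y X p] by (auto simp: is_iso_def)
qed

lemma isomorphic_iff:
  assumes X: "is_cochain C X" and Y: "is_cochain C Y"
  shows "isomorphic K X Y \<longleftrightarrow> (\<exists>\<phi> \<psi>. hequiv X Y \<phi> \<psi>)"
proof
  assume "isomorphic K X Y"
  then obtain f where f: "f \<in> Hom K X Y" "is_iso K f" by (auto simp: isomorphic_def)
  obtain \<phi> where \<phi>: "\<phi> \<in> cmaps X Y" "f = htpy_class X Y \<phi>" using f(1) by (rule HomK_E)
  show "\<exists>\<phi> \<psi>. hequiv X Y \<phi> \<psi>" using is_iso_htpy_class[OF X Y \<phi>(1)] f(2) \<phi>(2) by blast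
next
  assume "\<exists>\<phi> \<psi>. hequiv X Y \<phi> \<psi>"
  then obtain \<phi> \<psi> where h: "hequiv X Y \<phi> \<psi>" by blast
  then have p: "\<phi> \<in> cmaps X Y" by (simp add: hequiv_def)
  show "isomorphic K X Y" unfolding isomorphic_def
    using htpy_class_Hom[OF X Y p] is_iso_htpy_class[OF X Y p] h by blast
qed

lemma hequiv_refl: "is_cochain C X \<Longrightarrow> hequiv X X (\<lambda>n. idr (cob X n)) (\<lambda>n. idr (cob X n))"
  by (simp add: hequiv_def cmaps_idr idr_left[OF Homr_idr] cochain_obj htpy_refl)

lemma K_plus_obj_iff: "X \<in> K_plus_obj C \<longleftrightarrow> (\<exists>X' \<phi> \<psi>. hequiv X X' \<phi> \<psi> \<and> left_bounded C X')"
proof -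
  have "is_cochain C X \<and> is_cochain C X'" if "hequiv X X' \<phi> \<psi>" for X' \<phi> \<psi> using that by (simp add: hequiv_def)
  then show ?thesis unfolding K_plus_obj_def using isomorphic_iff by blast
qed

lemma K_plus_objD: "X \<in> K_plus_obj C \<Longrightarrow> is_cochain C X"
  by (simp add: K_plus_obj_def)

lemma K_plus_obj_left_bounded: "is_cochain C X \<Longrightarrow> left_bounded C X \<Longrightarrow> X \<in> K_plus_obj C"
  using K_plus_obj_iff hequiv_refl by blast

lemma exact_at_zero_obj:
  assumes X: "is_cochain C X" and "is_zero_obj C (cob X n)"
  shows "exact_at X n"
  unfolding exact_at_def
proof (intro allI ballI impI)
  fix T x assume x: "x \<in> Homr T (cob X n)"
  have "x = 0" using zero_obj_Homr(1)[OF assms(2) x] .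
  moreover have "T \<in> obj C" using x Homr_obj by blast
  ultimately show "\<exists>T' a y. epir T' T a \<and> y \<in> Homr T' (cob X (n - 1)) \<and> dd X (n - 1) * y = x * a"
    by (intro exI[of _ T] exI[of _ "idr T"] exI[of _ 0]) (simp add: epir_idr Homr_zero cochain_obj X)
qed

text \<open>A left bounded complex is zero, hence exact, in low degrees, so for it bounded
  cohomology means exactness in all high degrees. This puts both classes of null objects into the
  form of \<open>all_or_some\<close>.\<close>

lemma null_objs_iff: "X \<in> null_objs b \<longleftrightarrow>
    (\<exists>Y \<phi> \<psi>. hequiv X Y \<phi> \<psi> \<and> left_bounded C Y \<and> all_or_some b (\<lambda>N. \<forall>n \<ge> N. exact_at Y n))"
proof -
  have *: "(if b then exact_cochain C Y else bounded_cohomology C Y) \<longleftrightarrow> all_or_some b (\<lambda>N. \<forall>n \<ge> N. exact_at Y n)"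
    if Y: "is_cochain C Y" "left_bounded C Y" for Y
  proof (cases b)
    case True
    then show ?thesis by (auto simp: all_or_some_def exact_cochain_def cohomology_zero_iff[OF Y(1)])
  next
    case False
    obtain M where M: "\<forall>n<M. is_zero_obj C (cob Y n)" using Y(2) by (auto simp: left_bounded_def)
    show ?thesis
    proof
      assume "if b then exact_cochain C Y else bounded_cohomology C Y"
      then obtain a c where "\<forall>n. n < a \<or> c < n \<longrightarrow> exact_at Y n"
        using False by (auto simp: bounded_cohomology_def cohomology_zero_iff[OF Y(1)])
      then have "\<forall>n \<ge> c + 1. exact_at Y n" by auto
      then show "all_or_some b (\<lambda>N. \<forall>n \<ge> N. exact_at Y n)" using False by (auto simp: all_or_some_def)
    next
      assume "all_or_some b (\<lambda>N. \<forall>n \<ge> N. exact_at Y n)"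
      then obtain N where "\<forall>n \<ge> N. exact_at Y n" using False by (auto simp: all_or_some_def)
      then have "\<forall>n. n < M \<or> N < n \<longrightarrow> exact_at Y n" using M exact_at_zero_obj[OF Y(1)] by auto
      then show "if b then exact_cochain C Y else bounded_cohomology C Y"
        using False by (auto simp: bounded_cohomology_def cohomology_zero_iff[OF Y(1)])
    qed
  qed
  have c: "is_cochain C X \<and> is_cochain C Y" if "hequiv X Y \<phi> \<psi>" for Y \<phi> \<psi> using that by (simp add: hequiv_def)
  have "X \<in> null_objs b \<longleftrightarrow> is_cochain C X \<and> (\<exists>Y. is_cochain C Y \<and> left_bounded C Y \<and>
      (if b then exact_cochain C Y else bounded_cohomology C Y) \<and> isomorphic K X Y)"
    by (simp add: null_objs_def K_plus_exact_obj_def K_plus_b_obj_def)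
  also have "\<dots> \<longleftrightarrow> (\<exists>Y \<phi> \<psi>. hequiv X Y \<phi> \<psi> \<and> left_bounded C Y \<and> all_or_some b (\<lambda>N. \<forall>n \<ge> N. exact_at Y n))"
    using * c isomorphic_iff by blast
  finally show ?thesis .
qed

lemma Hom_Kp: "u \<in> Hom Kp X Y \<longleftrightarrow> u \<in> Hom K X Y \<and> X \<in> K_plus_obj C \<and> Y \<in> K_plus_obj C"
  by (simp add: K_plus_def Hom_full_subcategory)

lemma Kp_simps [simp]: "src Kp = src K" "tgt Kp = tgt K" "ident Kp = ident K" "cmp Kp = cmp K"
  "plus_arr Kp = plus_arr K" "zero_arr Kp = zero_arr K"
  by (simp_all add: K_plus_def)

lemma obj_Kp: "X \<in> obj Kp \<longleftrightarrow> X \<in> K_plus_obj C"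
  using K_plus_objD by (auto simp: K_plus_def obj_K)

lemma preadditive_Kp: "preadditive_category Kp"
  unfolding K_plus_def by (rule preadditive_category.preadditive_full_subcategory[OF preadditive_category_K])

lemma HomKp_E:
  assumes "u \<in> Hom Kp X Y"
  obtains \<phi> where "X \<in> K_plus_obj C" "Y \<in> K_plus_obj C" "is_cochain C X" "is_cochain C Y" "\<phi> \<in> cmaps X Y" "u = htpy_class X Y \<phi>"
proof -
  have u: "u \<in> Hom K X Y" "X \<in> K_plus_obj C" "Y \<in> K_plus_obj C" using assms Hom_Kp by auto
  obtain \<phi> where "is_cochain C X" "is_cochain C Y" "\<phi> \<in> cmaps X Y" "u = htpy_class X Y \<phi>" using u(1) by (rule HomK_E)
  then show ?thesis using that u by blast
qed

lemma htpy_class_Hom_Kp: "X \<in> K_plus_obj C \<Longrightarrow> Y \<in> K_plus_obj C \<Longrightarrow> \<phi> \<in> cmaps X Y \<Longrightarrow> htpy_class X Y \<phi> \<in> Hom Kp X Y"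
  by (simp add: Hom_Kp htpy_class_Hom K_plus_objD)

lemma arr_Kp_Hom: "u \<in> arr Kp \<longleftrightarrow> u \<in> Hom Kp (src K u) (tgt K u)"
  by (simp add: Hom_def)

section \<open>The null systems in terms of cohomology\<close>

lemma htpy_cancel_left:
  assumes "hequiv X Y \<phi> \<psi>" "\<chi> \<in> cmaps W X" "is_cochain C W"
  shows "htpy W X (\<lambda>n. \<psi> n * (\<phi> n * \<chi> n)) \<chi>"
proof -
  have c: "is_cochain C X" "\<phi> \<in> cmaps X Y" "\<psi> \<in> cmaps Y X" "htpy X X (\<lambda>n. \<psi> n * \<phi> n) (\<lambda>n. idr (cob X n))"
    using assms(1) by (auto simp: hequiv_def)
  have "htpy W X (\<lambda>n. \<psi> n * \<phi> n * \<chi> n) (\<lambda>n. idr (cob X n) * \<chi> n)"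
    by (rule htpy_mult[OF assms(2) cmaps_mult[OF c(2,3)] htpy_refl[OF assms(3) c(1)] c(4)])
  then show ?thesis by (simp add: idr_left[OF cmapsD(1)[OF assms(2)]] mult.assoc)
qed

text \<open>The triangle of \<open>s\<close> is isomorphic to a standard one, so \<open>s\<close>
  agrees up to homotopy equivalences with a chain map \<open>f\<close> whose cone is homotopy
  equivalent to a null object. Exactness of the cone is turned into a property of \<open>f\<close>,
  which passes to \<sigma> by composing with \<alpha> and \<beta>'.\<close>

lemma null_system_imp_qis:
  assumes s: "s \<in> null_system b" and sf: "s = htpy_class X Y \<sigma>" "\<sigma> \<in> cmaps X Y"
  shows "all_or_some b (qis X Y \<sigma>)"
proof -
  obtain v w where vw: "(s, v, w) \<in> K_plus_triangles C" "tgt Kp v \<in> null_objs b"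
    using s by (auto simp: null_system_def verdier_system_def)
  then have "(s, v, w) \<in> distinguished_triangles C" by (simp add: K_plus_triangles_def)
  then obtain X0 Y0 Z X' Y' f u' v' w' a b' c where
    h: "s \<in> Hom K X0 Y0" "v \<in> Hom K Y0 Z" "X' \<in> obj K" "Y' \<in> obj K" "f \<in> chain_maps C X' Y'"
      "(u', v', w') = standard_triangle C X' Y' f"
      "a \<in> Hom K X0 X'" "b' \<in> Hom K Y0 Y'" "c \<in> Hom K Z (cone C X' Y' f)"
      "is_iso K a" "is_iso K b'" "is_iso K c" "b' \<cdot>\<^bsub>K\<^esub> s = u' \<cdot>\<^bsub>K\<^esub> a"
    by (auto simp: distinguished_triangles_def Let_def)
  have e: "X0 = X" "Y0 = Y" "tgt Kp v = Z" using h(1,2) sf by (auto simp: Hom_def)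
  have c': "is_cochain C X'" "is_cochain C Y'" using h by (simp_all add: obj_K)
  note fr = fr[OF c' h(5)]
  have u': "u' = htpy_class X' Y' (\<lambda>n. emb (f n))" using h(6) by (simp add: standard_triangle_htpy_class[OF c' h(5)])
  obtain \<alpha> where \<alpha>: "is_cochain C X" "\<alpha> \<in> cmaps X X'" "a = htpy_class X X' \<alpha>" using h(7) unfolding e by (rule HomK_E)
  obtain \<beta> where \<beta>: "is_cochain C Y" "\<beta> \<in> cmaps Y Y'" "b' = htpy_class Y Y' \<beta>" using h(8) unfolding e by (rule HomK_E)
  obtain \<gamma> where \<gamma>: "is_cochain C Z" "\<gamma> \<in> cmaps Z (cone C X' Y' f)" "c = htpy_class Z (cone C X' Y' f) \<gamma>" using h(9) by (rule HomK_E)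
  obtain \<alpha>' where A: "hequiv X X' \<alpha> \<alpha>'" using is_iso_htpy_class[OF \<alpha>(1) c'(1) \<alpha>(2)] h(10) \<alpha>(3) by blast
  obtain \<beta>' where B: "hequiv Y Y' \<beta> \<beta>'" using is_iso_htpy_class[OF \<beta>(1) c'(2) \<beta>(2)] h(11) \<beta>(3) by blast
  have ccone: "is_cochain C (cone C X' Y' f)" by (rule is_cochain_cone[OF c' h(5)])
  obtain \<gamma>' where G: "hequiv Z (cone C X' Y' f) \<gamma> \<gamma>'" using is_iso_htpy_class[OF \<gamma>(1) ccone \<gamma>(2)] h(12) \<gamma>(3) by blast
  obtain Q \<kappa> \<kappa>' where Q: "hequiv Z Q \<kappa> \<kappa>'" "all_or_some b (\<lambda>N. \<forall>n \<ge> N. exact_at Q n)"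
    using vw(2) unfolding e null_objs_iff by blast
  have "all_or_some b (\<lambda>N. \<forall>n \<ge> N. exact_at (cone C X' Y' f) n)"
    by (rule all_or_some_mono[OF Q(2)]) (use exact_at_hequiv[OF G exact_at_hequiv[OF hequiv_sym[OF Q(1)]]] in blast)
  then have qf: "all_or_some b (qis X' Y' (\<lambda>n. emb (f n)))"
  proof (rule all_or_some_shift)
    fix N assume N: "\<forall>n \<ge> N. exact_at (cone C X' Y' f) n"
    \<comment> \<open>The bound moves by one because the monomorphism in degree \<open>n\<close>
      comes from the cone in degree \<open>n - 1\<close>.\<close>
    show "qis X' Y' (\<lambda>n. emb (f n)) (N + 1)"
      unfolding qis_def
    proof (intro allI impI conjI)
      fix n assume n: "N + 1 \<le> n"
      show "epi_at X' Y' (\<lambda>n. emb (f n)) n" using exact_cone_imp_qis(1)[OF c' h(5)] N n by simp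
      show "mono_at X' Y' (\<lambda>n. emb (f n)) n" using exact_cone_imp_qis(2)[OF c' h(5), of "n - 1"] N n by simp
    qed
  qed
  have "htpy X Y' (\<lambda>n. \<beta> n * \<sigma> n) (\<lambda>n. emb (f n) * \<alpha> n)"
    using h(13) unfolding sf(1) u' \<alpha>(3) \<beta>(3) htpy_class_cmp[OF \<alpha>(1) \<beta>(1) c'(2) sf(2) \<beta>(2)] htpy_class_cmp[OF \<alpha>(1) c' \<alpha>(2) fr]
      htpy_class_eq_iff[OF \<alpha>(1) c'(2) cmaps_mult[OF sf(2) \<beta>(2)] cmaps_mult[OF \<alpha>(2) fr]] .
  then have hs: "htpy X Y' (\<lambda>n. emb (f n) * \<alpha> n) (\<lambda>n. \<beta> n * \<sigma> n)" by (rule htpy_sym)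
  have \<beta>': "\<beta>' \<in> cmaps Y' Y" using B by (simp add: hequiv_def)
  have hh: "htpy X Y (\<lambda>n. \<beta>' n * (\<beta> n * \<sigma> n)) \<sigma>" by (rule htpy_cancel_left[OF B sf(2) \<alpha>(1)])
  show ?thesis
  proof (rule all_or_some_mono[OF qf])
    fix N assume "qis X' Y' (\<lambda>n. emb (f n)) N"
    then have "qis X Y' (\<lambda>n. emb (f n) * \<alpha> n) N"
      by (rule qis_mult[OF \<alpha>(2) fr \<alpha>(1) c' qis_hequiv[OF A]])
    then have "qis X Y' (\<lambda>n. \<beta> n * \<sigma> n) N" by (rule qis_htpy[OF hs])
    then have "qis X Y (\<lambda>n. \<beta>' n * (\<beta> n * \<sigma> n)) N"
      by (rule qis_mult[OF cmaps_mult[OF sf(2) \<beta>(2)] \<beta>' \<alpha>(1) c'(2) \<beta>(1) _ qis_hequiv[OF hequiv_sym[OF B]]])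
    then show "qis X Y \<sigma> N" by (rule qis_htpy[OF hh])
  qed
qed

text \<open>The cone is taken over left bounded replacements \<open>X'\<close> and
  \<open>Y'\<close>, so that it is itself left bounded, hence in \<open>K_plus_obj C\<close> and a
  null object. It becomes the third object of a triangle on \<sigma>, which is isomorphic to the
  standard one by \<alpha>, \<beta> and the identity of the cone.\<close>

lemma qis_imp_null_system:
  assumes X: "X \<in> K_plus_obj C" and Y: "Y \<in> K_plus_obj C" and sig: "\<sigma> \<in> cmaps X Y" and q: "all_or_some b (qis X Y \<sigma>)"
  shows "htpy_class X Y \<sigma> \<in> null_system b"
proof -
  note c = K_plus_objD[OF X] K_plus_objD[OF Y]
  obtain X' \<alpha> \<alpha>' where A: "hequiv X X' \<alpha> \<alpha>'" "left_bounded C X'" using X unfolding K_plus_obj_iff by blast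
  obtain Y' \<beta> \<beta>' where B: "hequiv Y Y' \<beta> \<beta>'" "left_bounded C Y'" using Y unfolding K_plus_obj_iff by blast
  have a: "is_cochain C X'" "\<alpha> \<in> cmaps X X'" "\<alpha>' \<in> cmaps X' X" using A by (auto simp: hequiv_def)
  have b: "is_cochain C Y'" "\<beta> \<in> cmaps Y Y'" "\<beta>' \<in> cmaps Y' Y" using B by (auto simp: hequiv_def)
  define \<phi> where "\<phi> = (\<lambda>n. \<beta> n * (\<sigma> n * \<alpha>' n))"
  have sa: "(\<lambda>n. \<sigma> n * \<alpha>' n) \<in> cmaps X' Y" by (rule cmaps_mult[OF a(3) sig])
  have phi: "\<phi> \<in> cmaps X' Y'" unfolding \<phi>_def by (rule cmaps_mult[OF sa b(2)])
  have q': "all_or_some b (qis X' Y' \<phi>)"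
  proof (rule all_or_some_mono[OF q])
    fix N assume "qis X Y \<sigma> N"
    then have "qis X' Y (\<lambda>n. \<sigma> n * \<alpha>' n) N"
      by (rule qis_mult[OF a(3) sig a(1) c(1) c(2) qis_hequiv[OF hequiv_sym[OF A(1)]]])
    then show "qis X' Y' \<phi> N"
      unfolding \<phi>_def by (rule qis_mult[OF sa b(2) a(1) c(2) b(1) _ qis_hequiv[OF B(1)]])
  qed
  obtain f where f: "f \<in> chain_maps C X' Y'" "(\<lambda>n. emb (f n)) = \<phi>"
    by (rule cmaps_chain_map[OF a(1) b(1) phi])
  define Z where "Z = cone C X' Y' f"
  have Z: "is_cochain C Z" unfolding Z_def by (rule is_cochain_cone[OF a(1) b(1) f(1)])
  have lbZ: "left_bounded C Z" unfolding Z_def by (rule left_bounded_cone[OF a(1) b(1) f(1) A(2) B(2)])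
  have "all_or_some b (\<lambda>N. \<forall>n \<ge> N. exact_at Z n)"
  proof (rule all_or_some_mono[OF q'], intro allI impI)
    fix N n assume "qis X' Y' \<phi> N" "N \<le> n"
    then have "epi_at X' Y' \<phi> n" "mono_at X' Y' \<phi> (n + 1)" by (auto simp: qis_def)
    then show "exact_at Z n"
      unfolding Z_def using qis_imp_exact_cone[OF a(1) b(1) f(1)] f(2) by simp
  qed
  then have ZN: "Z \<in> null_objs b" unfolding null_objs_iff using hequiv_refl[OF Z] lbZ by blast
  have ZK: "Z \<in> K_plus_obj C" by (rule K_plus_obj_left_bounded[OF Z lbZ])
  have sX: "shift C X \<in> K_plus_obj C"
  proof -
    obtain M where "\<forall>n<M. is_zero_obj C (cob X' n)" using A(2) by (auto simp: left_bounded_def)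
    then have "\<forall>n<M - 1. is_zero_obj C (cob (shift C X') n)" by simp
    then have "left_bounded C (shift C X')" unfolding left_bounded_def by blast
    then show ?thesis unfolding K_plus_obj_iff using hequiv_shift[OF A(1)] by blast
  qed
  note csX = is_cochain_shift[OF c(1)] and csX' = is_cochain_shift[OF a(1)]
  note i2 = cone_in2_cmaps[OF a(1) b(1) f(1), folded Z_def] and p1 = cone_pr1_cmaps[OF a(1) b(1) f(1), folded Z_def]
  define v where "v = htpy_class Y Z (\<lambda>n. cone_in2 X' Y' n * \<beta> n)"
  define w where "w = htpy_class Z (shift C X) (\<lambda>n. \<alpha>' (n + 1) * cone_pr1 X' Y' n)"
  note sa' = cmaps_shift[OF a(1) c(1) a(3)] and sa2 = cmaps_shift[OF c(1) a(1) a(2)]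
  have vm: "(\<lambda>n. cone_in2 X' Y' n * \<beta> n) \<in> cmaps Y Z" by (rule cmaps_mult[OF b(2) i2])
  have wm: "(\<lambda>n. \<alpha>' (n + 1) * cone_pr1 X' Y' n) \<in> cmaps Z (shift C X)" by (rule cmaps_mult[OF p1 sa'])
  have st: "standard_triangle C X' Y' f = (htpy_class X' Y' \<phi>, htpy_class Y' Z (cone_in2 X' Y'), htpy_class Z (shift C X') (cone_pr1 X' Y'))"
    using standard_triangle_htpy_class[OF a(1) b(1) f(1)] f(2) by (simp add: Z_def)
  have "(htpy_class X Y \<sigma>, v, w) \<in> distinguished_triangles C"
    unfolding distinguished_triangles_def Let_def
  proof (rule CollectI, intro exI conjI)
    show "(htpy_class X Y \<sigma>, v, w) = (htpy_class X Y \<sigma>, v, w)" ..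
    show "htpy_class X Y \<sigma> \<in> Hom K X Y" by (rule htpy_class_Hom[OF c sig])
    show "v \<in> Hom K Y Z" unfolding v_def by (rule htpy_class_Hom[OF c(2) Z vm])
    show "w \<in> Hom K Z (shift C X)" unfolding w_def by (rule htpy_class_Hom[OF Z csX wm])
    show "X' \<in> obj K" "Y' \<in> obj K" using a b obj_K by auto
    show "f \<in> chain_maps C X' Y'" by (rule f)
    show "(htpy_class X' Y' \<phi>, htpy_class Y' Z (cone_in2 X' Y'), htpy_class Z (shift C X') (cone_pr1 X' Y')) = standard_triangle C X' Y' f"
      using st by simp
    show "htpy_class X X' \<alpha> \<in> Hom K X X'" "htpy_class Y Y' \<beta> \<in> Hom K Y Y'" using htpy_class_Hom c a b by blast+
    show "htpy_class Z Z (\<lambda>n. idr (cob Z n)) \<in> Hom K Z (cone C X' Y' f)"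
      using htpy_class_Hom[OF Z Z cmaps_idr[OF Z]] by (simp add: Z_def)
    show "is_iso K (htpy_class X X' \<alpha>)" using is_iso_htpy_class[OF c(1) a(1,2)] A(1) by blast
    show "is_iso K (htpy_class Y Y' \<beta>)" using is_iso_htpy_class[OF c(2) b(1,2)] B(1) by blast
    show "is_iso K (htpy_class Z Z (\<lambda>n. idr (cob Z n)))" using is_iso_htpy_class[OF Z Z cmaps_idr[OF Z]] hequiv_refl[OF Z] by blast
    \<comment> \<open>The first square commutes only up to homotopy: \<open>\<phi> \<alpha>\<close>
      contains \<open>\<alpha>' \<alpha>\<close>, which is homotopic to the identity.\<close>
    have "htpy X Y (\<lambda>n. \<sigma> n * (\<alpha>' n * \<alpha> n)) (\<lambda>n. \<sigma> n * idr (cob X n))"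
      by (rule htpy_mult[OF cmaps_idr[OF c(1)] sig _ htpy_refl[OF c]]) (use A(1) in \<open>simp add: hequiv_def\<close>)
    then have "htpy X Y (\<lambda>n. \<sigma> n * (\<alpha>' n * \<alpha> n)) \<sigma>"
      by (simp add: idr_right[OF cmapsD(1)[OF sig]])
    then have "htpy X Y' (\<lambda>n. \<beta> n * (\<sigma> n * (\<alpha>' n * \<alpha> n))) (\<lambda>n. \<beta> n * \<sigma> n)"
      by (rule htpy_mult[OF sig b(2) _ htpy_refl[OF c(2) b(1)]])
    then have "htpy X Y' (\<lambda>n. \<beta> n * \<sigma> n) (\<lambda>n. \<phi> n * \<alpha> n)"
      unfolding \<phi>_def mult.assoc by (rule htpy_sym)
    then show "htpy_class Y Y' \<beta> \<cdot>\<^bsub>K\<^esub> htpy_class X Y \<sigma> = htpy_class X' Y' \<phi> \<cdot>\<^bsub>K\<^esub> htpy_class X X' \<alpha>"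
      unfolding htpy_class_cmp[OF c b(1) sig b(2)] htpy_class_cmp[OF c(1) a(1) b(1) a(2) phi]
        htpy_class_eq_iff[OF c(1) b(1) cmaps_mult[OF sig b(2)] cmaps_mult[OF a(2) phi]] .
    show "htpy_class Z Z (\<lambda>n. idr (cob Z n)) \<cdot>\<^bsub>K\<^esub> v = htpy_class Y' Z (cone_in2 X' Y') \<cdot>\<^bsub>K\<^esub> htpy_class Y Y' \<beta>"
      unfolding v_def htpy_class_cmp[OF c(2) Z Z vm cmaps_idr[OF Z]] htpy_class_cmp[OF c(2) b(1) Z b(2) i2]
      by (simp add: idr_left[OF cmapsD(1)[OF vm]])
    have sh: "hequiv (shift C X') (shift C X) (\<lambda>n. \<alpha>' (n + 1)) (\<lambda>n. \<alpha> (n + 1))"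
      by (rule hequiv_shift[OF hequiv_sym[OF A(1)]])
    have hw: "htpy Z (shift C X') (\<lambda>n. \<alpha> (n + 1) * (\<alpha>' (n + 1) * cone_pr1 X' Y' n)) (cone_pr1 X' Y')"
      by (rule htpy_cancel_left[OF sh p1 Z])
    show "shift_arr C (htpy_class X X' \<alpha>) \<cdot>\<^bsub>K\<^esub> w = htpy_class Z (shift C X') (cone_pr1 X' Y') \<cdot>\<^bsub>K\<^esub> htpy_class Z Z (\<lambda>n. idr (cob Z n))"
      unfolding w_def shift_arr_htpy_class[OF c(1) a(1,2)] htpy_class_cmp[OF Z csX csX' wm sa2] htpy_class_cmp[OF Z Z csX' cmaps_idr[OF Z] p1]
        htpy_class_eq_iff[OF Z csX' cmaps_mult[OF wm sa2] cmaps_mult[OF cmaps_idr[OF Z] p1]]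
      using hw by (simp add: idr_right[OF cmapsD(1)[OF p1]])
  qed
  moreover have sA: "htpy_class X Y \<sigma> \<in> arr Kp" using htpy_class_Hom_Kp[OF X Y sig] by (simp add: Hom_def)
  moreover have "v \<in> arr Kp" unfolding v_def using htpy_class_Hom_Kp[OF Y ZK vm] by (simp add: Hom_def)
  moreover have "w \<in> arr Kp" unfolding w_def using htpy_class_Hom_Kp[OF ZK sX wm] by (simp add: Hom_def)
  ultimately have "(htpy_class X Y \<sigma>, v, w) \<in> K_plus_triangles C" by (simp add: K_plus_triangles_def)
  moreover have "tgt Kp v \<in> null_objs b" using ZN by (simp add: v_def)
  ultimately show ?thesis using sA unfolding null_system_def verdier_system_def by blast
qed

section \<open>The null systems admit a calculus of right fractions\<close>

lemma null_system_arr: "s \<in> null_system b \<Longrightarrow> s \<in> arr Kp"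
  by (simp add: null_system_def verdier_system_def)

lemma null_system_E:
  assumes "s \<in> null_system b" "s \<in> Hom Kp X Y"
  obtains \<sigma> where "X \<in> K_plus_obj C" "Y \<in> K_plus_obj C" "is_cochain C X" "is_cochain C Y" "\<sigma> \<in> cmaps X Y"
    "s = htpy_class X Y \<sigma>" "all_or_some b (qis X Y \<sigma>)"
  by (rule HomKp_E[OF assms(2)]) (use that null_system_imp_qis[OF assms(1)] in blast)

lemma null_system_True_subset: "null_system True \<subseteq> null_system b"
proof
  fix s assume s: "s \<in> null_system True"
  then have "s \<in> Hom Kp (src K s) (tgt K s)" using null_system_arr by (simp add: arr_Kp_Hom[symmetric])
  with s obtain \<sigma> where "src K s \<in> K_plus_obj C" "tgt K s \<in> K_plus_obj C" "\<sigma> \<in> cmaps (src K s) (tgt K s)"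
    "s = htpy_class (src K s) (tgt K s) \<sigma>" "all_or_some True (qis (src K s) (tgt K s) \<sigma>)" by (rule null_system_E)
  moreover from this have "all_or_some b (qis (src K s) (tgt K s) \<sigma>)" unfolding all_or_some_def by presburger
  ultimately show "s \<in> null_system b" using qis_imp_null_system[of "src K s" "tgt K s" \<sigma> b] by simp
qed

lemma null_system_ident: "X \<in> K_plus_obj C \<Longrightarrow> ident K X \<in> null_system b"
  using qis_imp_null_system[of X X "\<lambda>n. idr (cob X n)" b] K_plus_objD[of X] all_or_some_all[of "qis X X (\<lambda>n. idr (cob X n))"]
    qis_hequiv[OF hequiv_refl[of X]]
  by (simp add: ident_K cmaps_idr)

lemma null_system_cmp:
  assumes "s \<in> null_system b" "s \<in> Hom Kp X Y" "t \<in> null_system b" "t \<in> Hom Kp Y Z"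
  shows "t \<cdot>\<^bsub>K\<^esub> s \<in> null_system b"
proof -
  obtain \<sigma> where s: "X \<in> K_plus_obj C" "Y \<in> K_plus_obj C" "is_cochain C X" "is_cochain C Y" "\<sigma> \<in> cmaps X Y"
    "s = htpy_class X Y \<sigma>" "all_or_some b (qis X Y \<sigma>)" using assms(1,2) by (rule null_system_E)
  obtain \<tau> where t: "Z \<in> K_plus_obj C" "is_cochain C Z" "\<tau> \<in> cmaps Y Z"
    "t = htpy_class Y Z \<tau>" "all_or_some b (qis Y Z \<tau>)" using assms(3,4) by (rule null_system_E)
  have "all_or_some b (\<lambda>N. qis X Y \<sigma> N \<and> qis Y Z \<tau> N)"
    by (rule all_or_some_conj[OF s(7) t(5)]) (rule qis_mono, assumption+)+
  then have "all_or_some b (qis X Z (\<lambda>n. \<tau> n * \<sigma> n))"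
    by (rule all_or_some_mono) (use qis_mult[OF s(5) t(3) s(3,4) t(2)] in blast)
  then show ?thesis
    using qis_imp_null_system[OF s(1) t(1) cmaps_mult[OF s(5) t(3)]] by (simp add: s(6) t(4) htpy_class_cmp[OF s(3,4) t(2) s(5) t(3)])
qed

text \<open>\<open>homotopy_pullback\<close> applies to left bounded complexes, so both arrows are
  carried to left bounded replacements and the legs of the pullback are carried back. The pullback
  is left bounded again, and its loss of one degree is absorbed by
  \<open>all_or_some_shift\<close>.\<close>

lemma null_system_ore:
  assumes "f \<in> Hom Kp X Y" "t \<in> null_system b" "t \<in> Hom Kp W Y"
  shows "\<exists>V t' h. t' \<in> null_system b \<and> t' \<in> Hom Kp V X \<and> h \<in> Hom Kp V W \<and> f \<cdot>\<^bsub>K\<^esub> t' = t \<cdot>\<^bsub>K\<^esub> h"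
proof -
  obtain \<sigma> where s: "W \<in> K_plus_obj C" "Y \<in> K_plus_obj C" "is_cochain C W" "is_cochain C Y" "\<sigma> \<in> cmaps W Y"
    "t = htpy_class W Y \<sigma>" "all_or_some b (qis W Y \<sigma>)" using assms(2,3) by (rule null_system_E)
  obtain \<phi> where f: "X \<in> K_plus_obj C" "is_cochain C X" "\<phi> \<in> cmaps X Y" "f = htpy_class X Y \<phi>" using assms(1) by (rule HomKp_E)
  obtain X' \<alpha> \<alpha>' where A: "hequiv X X' \<alpha> \<alpha>'" "left_bounded C X'" using f(1) unfolding K_plus_obj_iff by blast
  obtain Y' \<beta> \<beta>' where B: "hequiv Y Y' \<beta> \<beta>'" "left_bounded C Y'" using s(2) unfolding K_plus_obj_iff by blast
  obtain W' \<gamma> \<gamma>' where G: "hequiv W W' \<gamma> \<gamma>'" "left_bounded C W'" using s(1) unfolding K_plus_obj_iff by blast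
  have a: "is_cochain C X'" "\<alpha> \<in> cmaps X X'" "\<alpha>' \<in> cmaps X' X" using A by (auto simp: hequiv_def)
  have b: "is_cochain C Y'" "\<beta> \<in> cmaps Y Y'" "\<beta>' \<in> cmaps Y' Y" using B by (auto simp: hequiv_def)
  have g: "is_cochain C W'" "\<gamma> \<in> cmaps W W'" "\<gamma>' \<in> cmaps W' W" using G by (auto simp: hequiv_def)
  note sg = cmaps_mult[OF g(3) s(5)] and fa = cmaps_mult[OF a(3) f(3)]
  note bsg = cmaps_mult[OF sg b(2)] and bfa = cmaps_mult[OF fa b(2)]
  obtain P \<tau> \<eta> where P: "is_cochain C P" "left_bounded C P" "\<tau> \<in> cmaps P X'" "\<eta> \<in> cmaps P W'"
     "htpy P Y' (\<lambda>n. \<beta> n * (\<phi> n * \<alpha>' n) * \<tau> n) (\<lambda>n. \<beta> n * (\<sigma> n * \<gamma>' n) * \<eta> n)"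
     "\<forall>N. qis W' Y' (\<lambda>n. \<beta> n * (\<sigma> n * \<gamma>' n)) N \<longrightarrow> qis P X' \<tau> (N + 1)"
    using homotopy_pullback[OF g(1) b(1) a(1) G(2) B(2) A(2) bsg bfa] by blast
  note at = cmaps_mult[OF P(3) a(3)] and ge = cmaps_mult[OF P(4) g(3)]
  have q: "all_or_some b (qis P X (\<lambda>n. \<alpha>' n * \<tau> n))"
  proof (rule all_or_some_shift[OF s(7)])
    fix N assume "qis W Y \<sigma> N"
    then have "qis W' Y (\<lambda>n. \<sigma> n * \<gamma>' n) N"
      by (rule qis_mult[OF g(3) s(5) g(1) s(3,4) qis_hequiv[OF hequiv_sym[OF G(1)]]])
    then have "qis W' Y' (\<lambda>n. \<beta> n * (\<sigma> n * \<gamma>' n)) N"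
      by (rule qis_mult[OF sg b(2) g(1) s(4) b(1) _ qis_hequiv[OF B(1)]])
    then have "qis P X' \<tau> (N + 1)" using P(6) by blast
    then show "qis P X (\<lambda>n. \<alpha>' n * \<tau> n) (N + 1)"
      by (rule qis_mult[OF P(3) a(3) P(1) a(1) f(2) _ qis_hequiv[OF hequiv_sym[OF A(1)]]])
  qed
  have PK: "P \<in> K_plus_obj C" by (rule K_plus_obj_left_bounded[OF P(1,2)])
  note fat = cmaps_mult[OF at f(3)] and sge = cmaps_mult[OF ge s(5)]
  have "htpy P Y (\<lambda>n. \<beta>' n * (\<beta> n * (\<phi> n * \<alpha>' n) * \<tau> n)) (\<lambda>n. \<beta>' n * (\<beta> n * (\<sigma> n * \<gamma>' n) * \<eta> n))"
    by (rule htpy_mult[OF cmaps_mult[OF P(4) bsg] b(3) P(5) htpy_refl[OF b(1) s(4)]])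
  then have h: "htpy P Y (\<lambda>n. \<beta>' n * (\<beta> n * (\<phi> n * (\<alpha>' n * \<tau> n)))) (\<lambda>n. \<beta>' n * (\<beta> n * (\<sigma> n * (\<gamma>' n * \<eta> n))))"
    by (simp add: mult.assoc)
  have "htpy P Y (\<lambda>n. \<phi> n * (\<alpha>' n * \<tau> n)) (\<lambda>n. \<sigma> n * (\<gamma>' n * \<eta> n))"
    by (rule htpy_trans[OF htpy_trans[OF htpy_sym[OF htpy_cancel_left[OF B(1) fat P(1)]] h] htpy_cancel_left[OF B(1) sge P(1)]])
  then have "f \<cdot>\<^bsub>K\<^esub> htpy_class P X (\<lambda>n. \<alpha>' n * \<tau> n) = t \<cdot>\<^bsub>K\<^esub> htpy_class P W (\<lambda>n. \<gamma>' n * \<eta> n)"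
    unfolding f(4) s(6) htpy_class_cmp[OF P(1) f(2) s(4) at f(3)] htpy_class_cmp[OF P(1) s(3,4) ge s(5)] htpy_class_eq_iff[OF P(1) s(4) fat sge] .
  then show ?thesis
    using qis_imp_null_system[OF PK f(1) at q] htpy_class_Hom_Kp[OF PK f(1) at] htpy_class_Hom_Kp[OF PK s(1) ge] by blast
qed

text \<open>\<open>homotopy_equalizer\<close> is applied to the difference of two representatives,
  whose composite with \<open>t\<close> is null-homotopic. It provides a map \<tau> of the system
  after which the difference itself is null-homotopic. Left bounded replacements enter as for the
  Ore square.\<close>

lemma null_system_cancel:
  assumes "f \<in> Hom Kp X Y" "g \<in> Hom Kp X Y" "t \<in> null_system b" "t \<in> Hom Kp Y Z" "t \<cdot>\<^bsub>K\<^esub> f = t \<cdot>\<^bsub>K\<^esub> g"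
  shows "\<exists>V s. s \<in> null_system b \<and> s \<in> Hom Kp V X \<and> f \<cdot>\<^bsub>K\<^esub> s = g \<cdot>\<^bsub>K\<^esub> s"
proof -
  obtain \<sigma> where s: "Y \<in> K_plus_obj C" "Z \<in> K_plus_obj C" "is_cochain C Y" "is_cochain C Z" "\<sigma> \<in> cmaps Y Z"
    "t = htpy_class Y Z \<sigma>" "all_or_some b (qis Y Z \<sigma>)" using assms(3,4) by (rule null_system_E)
  obtain \<phi>1 where f: "X \<in> K_plus_obj C" "is_cochain C X" "\<phi>1 \<in> cmaps X Y" "f = htpy_class X Y \<phi>1" using assms(1) by (rule HomKp_E)
  obtain \<phi>2 where g: "\<phi>2 \<in> cmaps X Y" "g = htpy_class X Y \<phi>2" using assms(2) by (rule HomKp_E)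
  define \<phi> where "\<phi> = (\<lambda>n. \<phi>1 n - \<phi>2 n)"
  have phi: "\<phi> \<in> cmaps X Y" unfolding \<phi>_def by (rule cmaps_minus[OF f(3) g(1)])
  have "htpy X Z (\<lambda>n. \<sigma> n * \<phi>1 n) (\<lambda>n. \<sigma> n * \<phi>2 n)"
    using assms(5) unfolding s(6) f(4) g(2) htpy_class_cmp[OF f(2) s(3,4) f(3) s(5)] htpy_class_cmp[OF f(2) s(3,4) g(1) s(5)]
      htpy_class_eq_iff[OF f(2) s(4) cmaps_mult[OF f(3) s(5)] cmaps_mult[OF g(1) s(5)]] .
  then have nul: "htpy X Z (\<lambda>n. \<sigma> n * \<phi> n) (\<lambda>n. 0)"
    by (simp add: htpy_def \<phi>_def right_diff_distrib)
  obtain X' \<alpha> \<alpha>' where A: "hequiv X X' \<alpha> \<alpha>'" "left_bounded C X'" using f(1) unfolding K_plus_obj_iff by blast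
  obtain Y' \<beta> \<beta>' where B: "hequiv Y Y' \<beta> \<beta>'" "left_bounded C Y'" using s(1) unfolding K_plus_obj_iff by blast
  obtain Z' \<gamma> \<gamma>' where G: "hequiv Z Z' \<gamma> \<gamma>'" "left_bounded C Z'" using s(2) unfolding K_plus_obj_iff by blast
  have a: "is_cochain C X'" "\<alpha> \<in> cmaps X X'" "\<alpha>' \<in> cmaps X' X" using A by (auto simp: hequiv_def)
  have b: "is_cochain C Y'" "\<beta> \<in> cmaps Y Y'" "\<beta>' \<in> cmaps Y' Y" using B by (auto simp: hequiv_def)
  have g': "is_cochain C Z'" "\<gamma> \<in> cmaps Z Z'" "\<gamma>' \<in> cmaps Z' Z" using G by (auto simp: hequiv_def)
  note sb = cmaps_mult[OF b(3) s(5)] and fa = cmaps_mult[OF a(3) phi]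
  note gsb = cmaps_mult[OF sb g'(2)] and bfa = cmaps_mult[OF fa b(2)]
  have "htpy X' Y (\<lambda>n. \<beta>' n * (\<beta> n * (\<phi> n * \<alpha>' n))) (\<lambda>n. \<phi> n * \<alpha>' n)" by (rule htpy_cancel_left[OF B(1) fa a(1)])
  then have "htpy X' Z (\<lambda>n. \<sigma> n * (\<beta>' n * (\<beta> n * (\<phi> n * \<alpha>' n)))) (\<lambda>n. \<sigma> n * (\<phi> n * \<alpha>' n))"
    by (rule htpy_mult[OF fa s(5) _ htpy_refl[OF s(3,4)]])
  moreover have "htpy X' Z (\<lambda>n. \<sigma> n * \<phi> n * \<alpha>' n) (\<lambda>n. 0 * \<alpha>' n)"
    by (rule htpy_mult[OF a(3) cmaps_mult[OF phi s(5)] htpy_refl[OF a(1) f(2)] nul])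
  then have "htpy X' Z (\<lambda>n. \<sigma> n * (\<phi> n * \<alpha>' n)) (\<lambda>n. 0)" by (simp add: mult.assoc)
  ultimately have "htpy X' Z (\<lambda>n. \<sigma> n * (\<beta>' n * (\<beta> n * (\<phi> n * \<alpha>' n)))) (\<lambda>n. 0)" by (rule htpy_trans)
  then have "htpy X' Z' (\<lambda>n. \<gamma> n * (\<sigma> n * (\<beta>' n * (\<beta> n * (\<phi> n * \<alpha>' n))))) (\<lambda>n. \<gamma> n * 0)"
    by (rule htpy_mult[OF cmaps_zero[OF a(1) s(4)] g'(2) _ htpy_refl[OF s(4) g'(1)]])
  then have nul': "htpy X' Z' (\<lambda>n. \<gamma> n * (\<sigma> n * \<beta>' n) * (\<beta> n * (\<phi> n * \<alpha>' n))) (\<lambda>n. 0)" by (simp add: mult.assoc)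
  obtain P \<tau> where P: "is_cochain C P" "left_bounded C P" "\<tau> \<in> cmaps P X'"
     "htpy P Y' (\<lambda>n. \<beta> n * (\<phi> n * \<alpha>' n) * \<tau> n) (\<lambda>n. 0)"
     "\<forall>N. qis Y' Z' (\<lambda>n. \<gamma> n * (\<sigma> n * \<beta>' n)) N \<longrightarrow> qis P X' \<tau> (N + 2)"
    using homotopy_equalizer[OF a(1) b(1) g'(1) A(2) B(2) G(2) gsb bfa nul'] by blast
  note at = cmaps_mult[OF P(3) a(3)]
  have q: "all_or_some b (qis P X (\<lambda>n. \<alpha>' n * \<tau> n))"
  proof (rule all_or_some_shift[OF s(7)])
    fix N assume "qis Y Z \<sigma> N"
    then have "qis Y' Z (\<lambda>n. \<sigma> n * \<beta>' n) N"
      by (rule qis_mult[OF b(3) s(5) b(1) s(3,4) qis_hequiv[OF hequiv_sym[OF B(1)]]])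
    then have "qis Y' Z' (\<lambda>n. \<gamma> n * (\<sigma> n * \<beta>' n)) N"
      by (rule qis_mult[OF sb g'(2) b(1) s(4) g'(1) _ qis_hequiv[OF G(1)]])
    then have "qis P X' \<tau> (N + 2)" using P(5) by blast
    then show "qis P X (\<lambda>n. \<alpha>' n * \<tau> n) (N + 2)"
      by (rule qis_mult[OF P(3) a(3) P(1) a(1) f(2) _ qis_hequiv[OF hequiv_sym[OF A(1)]]])
  qed
  have PK: "P \<in> K_plus_obj C" by (rule K_plus_obj_left_bounded[OF P(1,2)])
  have "htpy P Y (\<lambda>n. \<beta>' n * (\<beta> n * (\<phi> n * \<alpha>' n) * \<tau> n)) (\<lambda>n. \<beta>' n * 0)"
    by (rule htpy_mult[OF cmaps_zero[OF P(1) b(1)] b(3) P(4) htpy_refl[OF b(1) s(3)]])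
  then have h: "htpy P Y (\<lambda>n. \<beta>' n * (\<beta> n * (\<phi> n * (\<alpha>' n * \<tau> n)))) (\<lambda>n. 0)"
    by (simp add: mult.assoc)
  have "htpy P Y (\<lambda>n. \<phi> n * (\<alpha>' n * \<tau> n)) (\<lambda>n. 0)"
    by (rule htpy_trans[OF htpy_sym[OF htpy_cancel_left[OF B(1) cmaps_mult[OF at phi] P(1)]] h])
  then have "htpy P Y (\<lambda>n. \<phi>1 n * (\<alpha>' n * \<tau> n)) (\<lambda>n. \<phi>2 n * (\<alpha>' n * \<tau> n))"
    by (simp add: htpy_def \<phi>_def left_diff_distrib)
  then have "f \<cdot>\<^bsub>K\<^esub> htpy_class P X (\<lambda>n. \<alpha>' n * \<tau> n) = g \<cdot>\<^bsub>K\<^esub> htpy_class P X (\<lambda>n. \<alpha>' n * \<tau> n)"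
    unfolding f(4) g(2) htpy_class_cmp[OF P(1) f(2) s(3) at f(3)] htpy_class_cmp[OF P(1) f(2) s(3) at g(1)]
      htpy_class_eq_iff[OF P(1) s(3) cmaps_mult[OF at f(3)] cmaps_mult[OF at g(1)]] .
  then show ?thesis
    using qis_imp_null_system[OF PK f(1) at q] htpy_class_Hom_Kp[OF PK f(1) at] by blast
qed

section \<open>Intelligent truncation on the homotopy category\<close>

abbreviation "im_obj X n \<equiv> src C (im_arr C (cdiff X (n - 1)))"
abbreviation "im_incl X n \<equiv> emb (im_arr C (cdiff X (n - 1)))"

text \<open>For the last item a factorisation after the epimorphism \<open>a\<close> suffices: the
  cokernel of the differential kills \<open>y a\<close>, hence \<open>y\<close>, so \<open>y\<close>
  factors through the kernel of that cokernel, which is the image.\<close>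

lemma im_facts:
  assumes X: "is_cochain C X"
  shows "im_arr C (cdiff X (n - 1)) \<in> Hom C (im_obj X n) (cob X n)"
    "im_incl X n \<in> Homr (im_obj X n) (cob X n)"
    "monor (im_obj X n) (cob X n) (im_incl X n)"
    "\<exists>\<epsilon>. epir (cob X (n - 1)) (im_obj X n) \<epsilon> \<and> im_incl X n * \<epsilon> = dd X (n - 1)"
    "dd X n * im_incl X n = 0"
    "y \<in> Homr T (cob X n) \<Longrightarrow> epir T' T a \<Longrightarrow> y * a = dd X (n - 1) * z \<Longrightarrow> \<exists>l \<in> Homr T (im_obj X n). im_incl X n * l = y"
proof -
  obtain I where I: "im_arr C (cdiff X (n - 1)) \<in> Hom C I (cob X n)" "im_obj X n = I" "monor I (cob X n) (im_incl X n)"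
    "\<exists>\<epsilon>. epir (cob X (n - 1)) I \<epsilon> \<and> im_incl X n * \<epsilon> = emb (cdiff X (n - 1))"
    and L: "\<And>W g. g \<in> Homr W (cob X n) \<Longrightarrow> emb (coker_arr C (cdiff X (n - 1))) * g = 0 \<Longrightarrow> \<exists>h \<in> Homr W I. im_incl X n * h = g"
    and q: "emb (coker_arr C (cdiff X (n - 1))) * emb (cdiff X (n - 1)) = 0"
    using im_arr_props[OF cochainD(7)[OF X, of n]] by metis
  show 1: "im_arr C (cdiff X (n - 1)) \<in> Hom C (im_obj X n) (cob X n)" using I by simp
  show 2: "im_incl X n \<in> Homr (im_obj X n) (cob X n)" by (rule Homr_emb[OF 1])
  show "monor (im_obj X n) (cob X n) (im_incl X n)" using I by simp
  show 3: "\<exists>\<epsilon>. epir (cob X (n - 1)) (im_obj X n) \<epsilon> \<and> im_incl X n * \<epsilon> = dd X (n - 1)" using I by (simp add: dd_def)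
  then obtain \<epsilon> where e: "epir (cob X (n - 1)) (im_obj X n) \<epsilon>" "im_incl X n * \<epsilon> = dd X (n - 1)" by blast
  have "dd X n * im_incl X n * \<epsilon> = 0" using cochainD(6)[OF X] e(2) by (simp add: mult.assoc)
  then show "dd X n * im_incl X n = 0" by (rule epirD[OF e(1) Homr_mult[OF cochainD(3)[OF X] 2]])
  assume y: "y \<in> Homr T (cob X n)" "epir T' T a" "y * a = dd X (n - 1) * z"
  let ?q = "emb (coker_arr C (cdiff X (n - 1)))"
  have c: "is_cokernel C (cdiff X (n - 1)) (coker_arr C (cdiff X (n - 1)))" by (rule coker_arr[OF cochainD(7)[OF X]])
  have "coker_arr C (cdiff X (n - 1)) \<in> Hom C (cob X n) (tgt C (coker_arr C (cdiff X (n - 1))))"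
    using c cochainD(7)[OF X, of n] by (auto simp: is_cokernel_def Hom_def)
  note qH = Homr_emb[OF this]
  have "?q * y * a = ?q * emb (cdiff X (n - 1)) * z" using y(3) by (simp add: mult.assoc dd_def)
  then have "?q * y * a = 0" using q by simp
  then have "?q * y = 0" by (rule epirD[OF y(2) Homr_mult[OF qH y(1)]])
  then show "\<exists>l \<in> Homr T (im_obj X n). im_incl X n * l = y" using L[OF y(1)] I(2) by simp
qed

text \<open>The corestriction of the differential onto its image. The choice is unambiguous, since
  \<open>im_incl X n\<close> is a monomorphism.\<close>

definition coim :: "('a, 'b) cochain \<Rightarrow> int \<Rightarrow> ('a, 'b) hring" where
  "coim X n = (SOME \<epsilon>. epir (cob X (n - 1)) (im_obj X n) \<epsilon> \<and> im_incl X n * \<epsilon> = dd X (n - 1))"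

lemma coim:
  assumes "is_cochain C X"
  shows "epir (cob X (n - 1)) (im_obj X n) (coim X n)" "im_incl X n * coim X n = dd X (n - 1)"
    "coim X n \<in> Homr (cob X (n - 1)) (im_obj X n)"
proof -
  show "epir (cob X (n - 1)) (im_obj X n) (coim X n)" "im_incl X n * coim X n = dd X (n - 1)"
    using someI_ex[OF im_facts(4)[OF assms]] by (simp_all add: coim_def)
  then show "coim X n \<in> Homr (cob X (n - 1)) (im_obj X n)" using epir_Homr by blast
qed

lemma im_incl_inj:
  assumes "is_cochain C X" "x \<in> Homr T (im_obj X n)" "y \<in> Homr T (im_obj X n)" "im_incl X n * x = im_incl X n * y"
  shows "x = y"
  using monor_cancel[OF im_facts(3)[OF assms(1)] assms(2-4)] .

abbreviation "tr \<equiv> trunc C"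

lemma cob_trunc [simp]: "n \<le> i \<Longrightarrow> cob (tr n X) i = cob X i" "cob (tr n X) (n - 1) = im_obj X n"
  "i < n - 1 \<Longrightarrow> cob (tr n X) i = zero_obj C"
  by (simp_all add: trunc_def)

lemma cdiff_trunc: "n \<le> i \<Longrightarrow> cdiff (tr n X) i = cdiff X i" "cdiff (tr n X) (n - 1) = im_arr C (cdiff X (n - 1))"
  by (simp_all add: trunc_def)

lemma dd_trunc [simp]: "n \<le> i \<Longrightarrow> dd (tr n X) i = dd X i" "dd (tr n X) (n - 1) = im_incl X n"
  by (simp_all add: dd_def cdiff_trunc)

lemma im_obj_obj: "is_cochain C X \<Longrightarrow> im_obj X n \<in> obj C"
  using im_facts(1) Hom_objD by blast

lemma dd_trunc_low: "is_cochain C X \<Longrightarrow> i < n - 1 \<Longrightarrow> dd (tr n X) i = 0"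
  using im_obj_obj[of X n] zero_obj_in by (auto simp: dd_def trunc_def emb_zero)

lemma int_cases3: obtains "(n::int) \<le> i" | "i = n - 1" | "i < n - 1"
  by linarith

lemma is_cochain_trunc:
  assumes X: "is_cochain C X"
  shows "is_cochain C (tr n X)"
  unfolding is_cochain_iff
proof (intro conjI allI)
  fix i
  show "cdiff (tr n X) i \<in> Hom C (cob (tr n X) i) (cob (tr n X) (i + 1))"
  proof (cases rule: int_cases3[of n i])
    case 1
    then show ?thesis using cochainD(2)[OF X] by (simp add: cdiff_trunc)
  next
    case 2
    then show ?thesis using im_facts(1)[OF X] by (simp add: cdiff_trunc)
  next
    case 3
    then have "i = n - 2 \<or> i + 1 < n - 1" by linarith
    then show ?thesis using zero_Hom zero_obj_in im_obj_obj[OF X, of n] 3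
      by (auto simp: trunc_def)
  qed
  show "dd (tr n X) (i + 1) * dd (tr n X) i = 0"
  proof (cases rule: int_cases3[of n i])
    case 1
    then show ?thesis using cochainD(4)[OF X] by simp
  next
    case 2
    then show ?thesis using im_facts(5)[OF X] by simp
  next
    case 3
    then show ?thesis by (simp add: dd_trunc_low[OF X])
  qed
qed

lemma left_bounded_trunc: "left_bounded C (tr n X)"
  unfolding left_bounded_def using zero_obj by (intro exI[of _ "n - 1"]) simp

lemma trunc_K_plus_obj: "is_cochain C X \<Longrightarrow> tr n X \<in> K_plus_obj C"
  by (rule K_plus_obj_left_bounded[OF is_cochain_trunc left_bounded_trunc])

section \<open>Truncation of maps and homotopies\<close>

definition im_map :: "('a, 'b) cochain \<Rightarrow> ('a, 'b) cochain \<Rightarrow> int \<Rightarrow> (int \<Rightarrow> ('a, 'b) hring) \<Rightarrow> ('a, 'b) hring" where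
  "im_map X Y n \<phi> = (SOME l. l \<in> Homr (im_obj X n) (im_obj Y n) \<and> im_incl Y n * l = \<phi> n * im_incl X n)"

text \<open>After composition with the epimorphism \<open>coim X n\<close>, the arrow
  \<open>\<phi> n * im_incl X n\<close> is a coboundary of \<open>Y\<close>, so by the last item of
  \<open>im_facts\<close> it factors through the image there.\<close>

lemma im_map:
  assumes X: "is_cochain C X" and Y: "is_cochain C Y" and phi: "\<phi> \<in> cmaps X Y"
  shows "im_map X Y n \<phi> \<in> Homr (im_obj X n) (im_obj Y n)" "im_incl Y n * im_map X Y n \<phi> = \<phi> n * im_incl X n"
proof -
  note f = cmapsD[OF phi]
  have "\<phi> n * im_incl X n * coim X n = dd Y (n - 1) * \<phi> (n - 1)"
    by (simp add: mult.assoc coim(2)[OF X] f(3))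
  then have "\<exists>l. l \<in> Homr (im_obj X n) (im_obj Y n) \<and> im_incl Y n * l = \<phi> n * im_incl X n"
    using im_facts(6)[OF Y Homr_mult[OF f(1) im_facts(2)[OF X]] coim(1)[OF X]] by blast
  then show "im_map X Y n \<phi> \<in> Homr (im_obj X n) (im_obj Y n)" "im_incl Y n * im_map X Y n \<phi> = \<phi> n * im_incl X n"
    unfolding im_map_def by (metis (mono_tags, lifting) someI_ex)+
qed

definition trunc_map :: "int \<Rightarrow> ('a, 'b) cochain \<Rightarrow> ('a, 'b) cochain \<Rightarrow> (int \<Rightarrow> ('a, 'b) hring) \<Rightarrow> int \<Rightarrow> ('a, 'b) hring" where
  "trunc_map n X Y \<phi> i = (if n \<le> i then \<phi> i else if i = n - 1 then im_map X Y n \<phi> else 0)"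

lemma trunc_map_simps [simp]: "n \<le> i \<Longrightarrow> trunc_map n X Y \<phi> i = \<phi> i" "trunc_map n X Y \<phi> (n - 1) = im_map X Y n \<phi>"
  "i < n - 1 \<Longrightarrow> trunc_map n X Y \<phi> i = 0"
  by (auto simp: trunc_map_def)

lemma trunc_map_cmaps:
  assumes X: "is_cochain C X" and Y: "is_cochain C Y" and phi: "\<phi> \<in> cmaps X Y"
  shows "trunc_map n X Y \<phi> \<in> cmaps (tr n X) (tr n Y)"
proof (rule cmapsI)
  note f = cmapsD[OF phi]
  fix i
  show "trunc_map n X Y \<phi> i \<in> Homr (cob (tr n X) i) (cob (tr n Y) i)"
    by (cases rule: int_cases3[of n i]) (simp_all add: f(1) im_map[OF X Y phi] Homr_zero zero_obj_in)
  show "dd (tr n Y) i * trunc_map n X Y \<phi> i = trunc_map n X Y \<phi> (i + 1) * dd (tr n X) i"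
    by (cases rule: int_cases3[of n i]) (simp_all add: f(2) im_map[OF X Y phi] dd_trunc_low X Y)
qed

text \<open>Above degree \<open>n\<close> the homotopy is kept, and \<open>h n\<close> is
  corestricted to the image, which is its new target. In degree \<open>n - 1\<close> the summand
  with \<open>h (n + 1)\<close> disappears because \<open>dd X n * im_incl X n = 0\<close>, and the
  rest is compared after the monomorphism \<open>im_incl Y n\<close>.\<close>

lemma trunc_map_htpy:
  assumes X: "is_cochain C X" and Y: "is_cochain C Y" and phi: "\<phi> \<in> cmaps X Y" and psi: "\<psi> \<in> cmaps X Y"
    and hp: "htpy X Y \<phi> \<psi>"
  shows "htpy (tr n X) (tr n Y) (trunc_map n X Y \<phi>) (trunc_map n X Y \<psi>)"
proof -
  obtain h where h: "\<And>n. h n \<in> Homr (cob X n) (cob Y (n - 1))"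
    "\<And>n. \<phi> n - \<psi> n = dd Y (n - 1) * h n + h (n + 1) * dd X n" using hp by (rule hpyE) blast
  define k where "k i = (if n + 1 \<le> i then h i else if i = n then coim Y n * h n else 0)" for i
  have k: "n + 1 \<le> i \<Longrightarrow> k i = h i" "k n = coim Y n * h n" "i < n \<Longrightarrow> k i = 0" for i by (auto simp: k_def)
  show ?thesis
  proof (rule hpyI[of k])
    fix i
    show "k i \<in> Homr (cob (tr n X) i) (cob (tr n Y) (i - 1))"
    proof -
      consider "n + 1 \<le> i" | "i = n" | "i < n" by linarith
      then show ?thesis
      proof cases
        case 1
        then show ?thesis using h(1)[of i] by (simp add: k)
      next
        case 2
        then show ?thesis using Homr_mult[OF coim(3)[OF Y] h(1)[of n]] by (simp add: k)
      next
        case 3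
        show ?thesis unfolding k(3)[OF 3]
          by (rule Homr_zero[OF cochain_obj[OF is_cochain_trunc[OF X]] cochain_obj[OF is_cochain_trunc[OF Y]]])
      qed
    qed
    show "trunc_map n X Y \<phi> i - trunc_map n X Y \<psi> i = dd (tr n Y) (i - 1) * k i + k (i + 1) * dd (tr n X) i"
    proof -
      consider "n + 1 \<le> i" | "i = n" | "i = n - 1" | "i < n - 1" by linarith
      then show ?thesis
      proof cases
        case 1
        then show ?thesis using h(2)[of i] by (simp add: k)
      next
        case 2
        then show ?thesis using h(2)[of n] by (simp add: k mult.assoc[symmetric] coim(2)[OF Y])
      next
        case 3
        have eq: "im_incl Y n * (im_map X Y n \<phi> - im_map X Y n \<psi>) = im_incl Y n * (coim Y n * h n * im_incl X n)"
        proof -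
          have "im_incl Y n * (im_map X Y n \<phi> - im_map X Y n \<psi>) = (\<phi> n - \<psi> n) * im_incl X n"
            by (simp add: right_diff_distrib left_diff_distrib im_map[OF X Y phi] im_map[OF X Y psi])
          also have "\<dots> = dd Y (n - 1) * h n * im_incl X n + h (n + 1) * (dd X n * im_incl X n)"
            by (simp only: h(2) distrib_right mult.assoc)
          also have "\<dots> = im_incl Y n * (coim Y n * h n * im_incl X n)"
            unfolding im_facts(5)[OF X] by (simp add: mult.assoc[symmetric] coim(2)[OF Y])
          finally show ?thesis .
        qed
        have "im_map X Y n \<phi> - im_map X Y n \<psi> = coim Y n * h n * im_incl X n"
          by (rule im_incl_inj[OF Y _ _ eq])
            (rule Homr_minus im_map[OF X Y phi] im_map[OF X Y psi] Homr_mult[OF Homr_mult[OF coim(3)[OF Y] h(1)] im_facts(2)[OF X]])+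
        then show ?thesis using 3 by (simp add: k)
      next
        case 4
        then show ?thesis by (simp add: k)
      qed
    qed
  qed
qed

lemma trunc_map_mult:
  assumes X: "is_cochain C X" and Y: "is_cochain C Y" and Z: "is_cochain C Z"
    and phi: "\<phi> \<in> cmaps X Y" and psi: "\<psi> \<in> cmaps Y Z"
  shows "(\<lambda>i. trunc_map n Y Z \<psi> i * trunc_map n X Y \<phi> i) = trunc_map n X Z (\<lambda>i. \<psi> i * \<phi> i)"
proof
  fix i
  note pp = cmaps_mult[OF phi psi]
  have eq: "im_incl Z n * (im_map Y Z n \<psi> * im_map X Y n \<phi>) = im_incl Z n * im_map X Z n (\<lambda>i. \<psi> i * \<phi> i)"
    by (simp add: mult.assoc[symmetric] im_map[OF X Z pp] im_map[OF Y Z psi])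
       (simp add: mult.assoc im_map[OF X Y phi])
  have "im_map Y Z n \<psi> * im_map X Y n \<phi> = im_map X Z n (\<lambda>i. \<psi> i * \<phi> i)"
    by (rule im_incl_inj[OF Z _ _ eq]) (rule Homr_mult[OF im_map(1)[OF Y Z psi] im_map(1)[OF X Y phi]] im_map(1)[OF X Z pp])+
  then show "trunc_map n Y Z \<psi> i * trunc_map n X Y \<phi> i = trunc_map n X Z (\<lambda>i. \<psi> i * \<phi> i) i"
    by (cases rule: int_cases3[of n i]) simp_all
qed

text \<open>Strict equality holds because the image in degree \<open>n\<close> is chosen from the
  differential \<open>cdiff X n\<close> alone, which truncation at \<open>n\<close> leaves
  unchanged.\<close>

lemma trunc_map_Suc_trunc_map: "trunc_map (n + 1) (tr n X) (tr n Y) (trunc_map n X Y \<phi>) = trunc_map (n + 1) X Y \<phi>"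
proof
  fix i
  have "im_map (tr n X) (tr n Y) (n + 1) (trunc_map n X Y \<phi>) = im_map X Y (n + 1) \<phi>"
    by (simp add: im_map_def cdiff_trunc)
  then show "trunc_map (n + 1) (tr n X) (tr n Y) (trunc_map n X Y \<phi>) i = trunc_map (n + 1) X Y \<phi> i"
    by (auto simp: trunc_map_def)
qed

lemma trunc_chain_map_trunc_map:
  assumes X: "is_cochain C X" and Y: "is_cochain C Y" and f: "f \<in> chain_maps C X Y"
  shows "trunc_chain_map C n X Y f \<in> chain_maps C (tr n X) (tr n Y)"
    "(\<lambda>i. emb (trunc_chain_map C n X Y f i)) = trunc_map n X Y (\<lambda>i. emb (f i))"
proof -
  note phi = chain_map_cmaps[OF X Y f]
  have F: "f i \<in> Hom C (cob X i) (cob Y i)" for i using f by (simp add: chain_maps_def)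
  note fm = cmp_Hom[OF im_facts(1)[OF X] F]
  have l: "lift_arr C (im_arr C (cdiff Y (n - 1))) (f n \<cdot> im_arr C (cdiff X (n - 1))) \<in> Hom C (im_obj X n) (im_obj Y n) \<and>
      emb (lift_arr C (im_arr C (cdiff Y (n - 1))) (f n \<cdot> im_arr C (cdiff X (n - 1)))) = im_map X Y n (\<lambda>i. emb (f i))"
    by (rule lift_arr_props[OF im_facts(1)[OF Y] im_facts(3)[OF Y] fm im_map(1)[OF X Y phi]])
      (simp only: im_map(2)[OF X Y phi] emb_cmp[OF im_facts(1)[OF X] F])
  show e: "(\<lambda>i. emb (trunc_chain_map C n X Y f i)) = trunc_map n X Y (\<lambda>i. emb (f i))"
    using l by (auto simp: trunc_chain_map_def trunc_map_def fun_eq_iff emb_zero zero_obj_in)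
  have "trunc_chain_map C n X Y f i \<in> Hom C (cob (tr n X) i) (cob (tr n Y) i)" for i
    by (cases rule: int_cases3[of n i]) (simp_all add: trunc_chain_map_def F l zero_Hom zero_obj_in)
  then show "trunc_chain_map C n X Y f \<in> chain_maps C (tr n X) (tr n Y)"
    unfolding chain_maps_iff[OF is_cochain_trunc[OF X] is_cochain_trunc[OF Y]] e
    using trunc_map_cmaps[OF X Y phi] by blast
qed

lemma trunc_K_htpy_class:
  assumes X: "is_cochain C X" and Y: "is_cochain C Y" and phi: "\<phi> \<in> cmaps X Y"
  shows "trunc_K C n (htpy_class X Y \<phi>) = htpy_class (tr n X) (tr n Y) (trunc_map n X Y \<phi>)"
proof -
  obtain f where f: "f \<in> chain_maps C X Y" "(\<lambda>n. emb (f n)) = \<phi>"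
    by (rule cmaps_chain_map[OF X Y phi])
  define F where "F = fst (snd (htpy_class X Y \<phi>))"
  have "trunc_K C n (htpy_class X Y \<phi>) = hlift C (tr n X) (tr n Y) (trunc_chain_map C n X Y ` F)"
    by (simp add: trunc_K_def htpy_class_def F_def)
  also have "\<dots> = htpy_class (tr n X) (tr n Y) (trunc_map n X Y \<phi>)"
  proof (rule hlift_htpy_class[OF is_cochain_trunc[OF X] is_cochain_trunc[OF Y] trunc_map_cmaps[OF X Y phi]])
    show "trunc_chain_map C n X Y ` F \<noteq> {}"
      using f htpy_refl[OF X Y] by (auto simp: F_def htpy_class_def)
    fix g assume "g \<in> trunc_chain_map C n X Y ` F"
    then obtain f where g: "g = trunc_chain_map C n X Y f" "f \<in> chain_maps C X Y" "htpy X Y \<phi> (\<lambda>n. emb (f n))"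
      by (auto simp: F_def htpy_class_def)
    show "g \<in> chain_maps C (tr n X) (tr n Y) \<and> htpy (tr n X) (tr n Y) (trunc_map n X Y \<phi>) (\<lambda>n. emb (g n))"
      unfolding g(1) trunc_chain_map_trunc_map(2)[OF X Y g(2)]
      using trunc_chain_map_trunc_map(1)[OF X Y g(2)] trunc_map_htpy[OF X Y phi chain_map_cmaps[OF X Y g(2)] g(3)] by blast
  qed
  finally show ?thesis .
qed

section \<open>The projections onto the truncations\<close>

definition trunc_prj :: "int \<Rightarrow> ('a, 'b) cochain \<Rightarrow> int \<Rightarrow> ('a, 'b) hring" where
  "trunc_prj n X i = (if n \<le> i then idr (cob X i) else if i = n - 1 then coim X n else 0)"

lemma trunc_prj_simps [simp]: "n \<le> i \<Longrightarrow> trunc_prj n X i = idr (cob X i)" "trunc_prj n X (n - 1) = coim X n"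
  "i < n - 1 \<Longrightarrow> trunc_prj n X i = 0"
  by (auto simp: trunc_prj_def)

lemma trunc_prj_cmaps:
  assumes X: "is_cochain C X"
  shows "trunc_prj n X \<in> cmaps X (tr n X)"
proof (rule cmapsI)
  fix i
  show "trunc_prj n X i \<in> Homr (cob X i) (cob (tr n X) i)"
    by (cases rule: int_cases3[of n i]) (simp_all add: Homr_idr cochain_obj X coim Homr_zero zero_obj_in)
  consider "n \<le> i" | "i = n - 1" | "i = n - 2" | "i < n - 2" by linarith
  then show "dd (tr n X) i * trunc_prj n X i = trunc_prj n X (i + 1) * dd X i"
  proof cases
    case 1
    then show ?thesis by (simp add: idr_right[OF cochainD(3)[OF X]] idr_left[OF cochainD(3)[OF X]])
  next
    case 2
    then show ?thesis using idr_left[OF cochainD(5)[OF X, of n]] by (simp add: coim[OF X])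
  next
    case 3
    have d: "dd X (n - 2) \<in> Homr (cob X (n - 2)) (cob X (n - 1))"
      using cochainD(3)[OF X, of "n - 2"] by simp
    have "im_incl X n * (coim X n * dd X (n - 2)) = im_incl X n * 0"
      using cochainD(4)[OF X, of "n - 2"] by (simp add: mult.assoc[symmetric] coim[OF X])
    then have "coim X n * dd X (n - 2) = 0"
      by (rule im_incl_inj[OF X Homr_mult[OF coim(3)[OF X] d] Homr_zero[OF cochain_obj[OF X] im_obj_obj[OF X]]])
    then show ?thesis using 3 by (simp add: dd_trunc_low[OF X])
  next
    case 4
    then show ?thesis by simp
  qed
qed

lemma trunc_proj_htpy_class:
  assumes X: "is_cochain C X"
  shows "hclass C X (tr n X) (trunc_proj_chain_map C n X) = htpy_class X (tr n X) (trunc_prj n X)"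
proof -
  have l: "lift_arr C (im_arr C (cdiff X (n - 1))) (cdiff X (n - 1)) \<in> Hom C (cob X (n - 1)) (im_obj X n) \<and>
      emb (lift_arr C (im_arr C (cdiff X (n - 1))) (cdiff X (n - 1))) = coim X n"
    by (rule lift_arr_props[OF im_facts(1)[OF X] im_facts(3)[OF X] cochainD(7)[OF X] coim(3)[OF X]])
      (simp add: coim(2)[OF X] dd_def)
  have e: "(\<lambda>i. emb (trunc_proj_chain_map C n X i)) = trunc_prj n X"
    using l by (auto simp: trunc_proj_chain_map_def trunc_prj_def fun_eq_iff emb_zero zero_obj_in cochain_obj[OF X] idr_def)
  have "trunc_proj_chain_map C n X i \<in> Hom C (cob X i) (cob (tr n X) i)" for i
    by (cases rule: int_cases3[of n i])
      (simp_all add: trunc_proj_chain_map_def ident_Hom l zero_Hom zero_obj_in cochain_obj[OF X])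
  then have "trunc_proj_chain_map C n X \<in> chain_maps C X (tr n X)"
    unfolding chain_maps_iff[OF X is_cochain_trunc[OF X]] e using trunc_prj_cmaps[OF X] by blast
  then show ?thesis using hclass_htpy_class[OF X is_cochain_trunc[OF X]] e by metis
qed

text \<open>In a degree \<open>i\<close> above \<open>n\<close> the projection is the identity on
  the terms in degrees \<open>i\<close> and \<open>i - 1\<close>, so cocycles and coboundaries are
  literally the same on both sides.\<close>

lemma qis_trunc_prj:
  assumes X: "is_cochain C X"
  shows "qis X (tr n X) (trunc_prj n X) (n + 1)"
  unfolding qis_def
proof (intro allI impI conjI)
  fix i assume i: "n + 1 \<le> i"
  show "epi_at X (tr n X) (trunc_prj n X) i"
  proof (rule epi_atI)
    fix T y assume y: "y \<in> Homr T (cob (tr n X) i)" "dd (tr n X) i * y = 0"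
    have T: "T \<in> obj C" using y Homr_obj by blast
    show "\<exists>T' a x y'. epir T' T a \<and> x \<in> Homr T' (cob X i) \<and> y' \<in> Homr T' (cob (tr n X) (i - 1)) \<and>
        dd X i * x = 0 \<and> trunc_prj n X i * x + dd (tr n X) (i - 1) * y' = y * a"
      by (rule exI[of _ T], rule exI[of _ "idr T"], rule exI[of _ y], rule exI[of _ 0])
        (use y i T in \<open>simp add: epir_idr Homr_zero cochain_obj[OF X] idr_left idr_right\<close>)
  qed
  show "mono_at X (tr n X) (trunc_prj n X) i"
  proof (rule mono_atI)
    fix T x y assume x: "x \<in> Homr T (cob X i)" "y \<in> Homr T (cob (tr n X) (i - 1))"
      "dd X i * x = 0" "trunc_prj n X i * x = dd (tr n X) (i - 1) * y"
    have T: "epir T T (idr T)" using x Homr_obj epir_idr by blast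
    have "y \<in> Homr T (cob X (i - 1))" using x(2) i by simp
    moreover have "dd X (i - 1) * y = x * idr T"
      unfolding idr_right[OF x(1)] using x(4) i by (simp add: idr_left[OF x(1)])
    ultimately show "\<exists>T' a x'. epir T' T a \<and> x' \<in> Homr T' (cob X (i - 1)) \<and> dd X (i - 1) * x' = x * a"
      using T by blast
  qed
qed

lemma trunc_prj_natural:
  assumes X: "is_cochain C X" and Y: "is_cochain C Y" and phi: "\<phi> \<in> cmaps X Y"
  shows "(\<lambda>i. trunc_prj n Y i * \<phi> i) = (\<lambda>i. trunc_map n X Y \<phi> i * trunc_prj n X i)"
proof
  fix i
  note f = cmapsD[OF phi]
  have eq: "im_incl Y n * (coim Y n * \<phi> (n - 1)) = im_incl Y n * (im_map X Y n \<phi> * coim X n)"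
    by (simp add: mult.assoc[symmetric] coim(2)[OF Y] im_map(2)[OF X Y phi])
       (simp add: mult.assoc coim(2)[OF X] f(3))
  have "coim Y n * \<phi> (n - 1) = im_map X Y n \<phi> * coim X n"
    by (rule im_incl_inj[OF Y Homr_mult[OF coim(3)[OF Y] f(1)] Homr_mult[OF im_map(1)[OF X Y phi] coim(3)[OF X]] eq])
  then show "trunc_prj n Y i * \<phi> i = trunc_map n X Y \<phi> i * trunc_prj n X i"
    by (cases rule: int_cases3[of n i]) (simp_all add: idr_left[OF f(1)] idr_right[OF f(1)])
qed

text \<open>The corestriction at \<open>n + 1\<close> depends only on \<open>cdiff X n\<close>,
  which truncation at \<open>n\<close> keeps. In degree \<open>n\<close> the projection to level
  \<open>n\<close> is an identity, and below it both sides vanish.\<close>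

lemma trunc_prj_Suc:
  assumes X: "is_cochain C X"
  shows "trunc_prj (n + 1) X = (\<lambda>i. trunc_prj (n + 1) (tr n X) i * trunc_prj n X i)"
proof
  fix i
  have c: "coim (tr n X) (n + 1) = coim X (n + 1)" by (simp add: coim_def cdiff_trunc)
  have r: "coim X (n + 1) * idr (cob X n) = coim X (n + 1)"
    using idr_right[OF coim(3)[OF X, of "n + 1"]] by simp
  have "idr (cob X i) * idr (cob X i) = idr (cob X i)" by (rule idr_left[OF Homr_idr[OF cochain_obj[OF X]]])
  then show "trunc_prj (n + 1) X i = trunc_prj (n + 1) (tr n X) i * trunc_prj n X i"
    using c r by (auto simp: trunc_prj_def)
qed

text \<open>For degrees in which a truncation has no nonzero cocycles: zero is lifted to zero over
  the identity of \<open>T\<close>.\<close>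

lemma trivial_lift:
  assumes "is_cochain C X" "is_cochain C Y"
  shows "x \<in> Homr T U \<Longrightarrow> x = 0 \<Longrightarrow> \<exists>T' a x' y'. epir T' T a \<and> x' \<in> Homr T' (cob X i) \<and> y' \<in> Homr T' (cob Y j) \<and>
      dd X i * x' = 0 \<and> \<phi> i * x' + dd Y j * y' = x * a"
    "x \<in> Homr T U \<Longrightarrow> x = 0 \<Longrightarrow> \<exists>T' a x'. epir T' T a \<and> x' \<in> Homr T' (cob X i) \<and> dd X i * x' = x * a"
proof -
  assume "x \<in> Homr T U" "x = 0"
  then have "T \<in> obj C" using Homr_obj by blast
  then have *: "epir T T (idr T)" "0 \<in> Homr T (cob X i)" "0 \<in> Homr T (cob Y j)"
    using epir_idr Homr_zero cochain_obj assms by blast+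
  show "\<exists>T' a x' y'. epir T' T a \<and> x' \<in> Homr T' (cob X i) \<and> y' \<in> Homr T' (cob Y j) \<and>
      dd X i * x' = 0 \<and> \<phi> i * x' + dd Y j * y' = x * a"
    by (rule exI[of _ T], rule exI[of _ "idr T"], rule exI[of _ 0], rule exI[of _ 0])
      (use * \<open>x = 0\<close> in simp)
  show "\<exists>T' a x'. epir T' T a \<and> x' \<in> Homr T' (cob X i) \<and> dd X i * x' = x * a"
    by (rule exI[of _ T], rule exI[of _ "idr T"], rule exI[of _ 0]) (use * \<open>x = 0\<close> in simp)
qed

text \<open>The bound \<open>M\<close> is arbitrary, so all degrees are covered. Above
  \<open>n\<close> nothing changes. In degree \<open>n\<close> the coboundaries of the truncation
  are the elements of the image, which come from degree \<open>n - 1\<close> after an epimorphism,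
  so bounds are exchanged through \<open>coim\<close>. In degree \<open>n - 1\<close> the
  differential is a monomorphism, so cocycles are zero, and below the objects are zero.\<close>

lemma qis_trunc_map:
  assumes X: "is_cochain C X" and Y: "is_cochain C Y" and phi: "\<phi> \<in> cmaps X Y" and q: "qis X Y \<phi> N" "N \<le> n"
  shows "qis (tr n X) (tr n Y) (trunc_map n X Y \<phi>) M"
  unfolding qis_def
proof (intro allI impI)
  note f = cmapsD[OF phi] and tX = is_cochain_trunc[OF X] and tY = is_cochain_trunc[OF Y]
  fix i
  consider "n + 1 \<le> i" | "i = n" | "i = n - 1" | "i < n - 1" by linarith
  then show "epi_at (tr n X) (tr n Y) (trunc_map n X Y \<phi>) i \<and> mono_at (tr n X) (tr n Y) (trunc_map n X Y \<phi>) i"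
  proof cases
    case 1
    then have "epi_at X Y \<phi> i" "mono_at X Y \<phi> i" using q by (auto simp: qis_def)
    then show ?thesis using 1 by (simp add: epi_at_def mono_at_def)
  next
    case 2
    then have E: "epi_at X Y \<phi> n" and Mo: "mono_at X Y \<phi> n" using q by (auto simp: qis_def)
    have "epi_at (tr n X) (tr n Y) (trunc_map n X Y \<phi>) n"
    proof (rule epi_atI)
      fix T y assume "y \<in> Homr T (cob (tr n Y) n)" "dd (tr n Y) n * y = 0"
      then have y: "y \<in> Homr T (cob Y n)" "dd Y n * y = 0" by simp_all
      obtain T' a x y' where 3: "epir T' T a" "x \<in> Homr T' (cob X n)" "y' \<in> Homr T' (cob Y (n - 1))"
        "dd X n * x = 0" "\<phi> n * x + dd Y (n - 1) * y' = y * a" using epi_atE[OF E y] by blast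
      have "\<phi> n * x + im_incl Y n * (coim Y n * y') = y * a"
        using 3(5) by (simp add: mult.assoc[symmetric] coim(2)[OF Y])
      then show "\<exists>T' a x y'. epir T' T a \<and> x \<in> Homr T' (cob (tr n X) n) \<and> y' \<in> Homr T' (cob (tr n Y) (n - 1)) \<and>
          dd (tr n X) n * x = 0 \<and> trunc_map n X Y \<phi> n * x + dd (tr n Y) (n - 1) * y' = y * a"
        using 3(1,2,4) Homr_mult[OF coim(3)[OF Y] 3(3)]
        by (intro exI[of _ T'] exI[of _ a] exI[of _ x] exI[of _ "coim Y n * y'"]) simp
    qed
    moreover have "mono_at (tr n X) (tr n Y) (trunc_map n X Y \<phi>) n"
    proof (rule mono_atI)
      fix T x y assume "x \<in> Homr T (cob (tr n X) n)" "y \<in> Homr T (cob (tr n Y) (n - 1))"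
        "dd (tr n X) n * x = 0" "trunc_map n X Y \<phi> n * x = dd (tr n Y) (n - 1) * y"
      then have x: "x \<in> Homr T (cob X n)" "y \<in> Homr T (im_obj Y n)" "dd X n * x = 0" "\<phi> n * x = im_incl Y n * y" by simp_all
      \<comment> \<open>An element of the image is lifted to the previous term of \<open>Y\<close>
        by pulling back the epimorphism \<open>coim Y n\<close>.\<close>
      obtain T1 a y' where 3: "epir T1 T a" "y' \<in> Homr T1 (cob Y (n - 1))" "coim Y n * y' = y * a"
        using pullback_epir[OF coim(1)[OF Y] x(2)] by blast
      have "\<phi> n * (x * a) = im_incl Y n * y * a" using x(4) by (simp add: mult.assoc[symmetric])
      also have "\<dots> = dd Y (n - 1) * y'" by (simp only: mult.assoc 3(3)[symmetric]) (simp add: mult.assoc[symmetric] coim(2)[OF Y])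
      finally have e: "\<phi> n * (x * a) = dd Y (n - 1) * y'" .
      have d: "dd X n * (x * a) = 0" using x(3) by (simp add: mult.assoc[symmetric])
      obtain T2 a2 x' where 4: "epir T2 T1 a2" "x' \<in> Homr T2 (cob X (n - 1))" "dd X (n - 1) * x' = x * a * a2"
        using mono_atE[OF Mo Homr_mult[OF x(1) epir_Homr[OF 3(1)]] 3(2) d e] by blast
      have "im_incl X n * (coim X n * x') = x * (a * a2)"
        using 4(3) by (simp add: mult.assoc[symmetric] coim(2)[OF X])
      then show "\<exists>T' a x'. epir T' T a \<and> x' \<in> Homr T' (cob (tr n X) (n - 1)) \<and> dd (tr n X) (n - 1) * x' = x * a"
        using epir_mult[OF 4(1) 3(1)] Homr_mult[OF coim(3)[OF X] 4(2)] by auto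
    qed
    ultimately show ?thesis using 2 by blast
  next
    case 3
    have z: "x = 0" if "x \<in> Homr T (cob (tr n Z) i)" "dd (tr n Z) i * x = 0" "is_cochain C Z" for x T Z
      using that monorD[OF im_facts(3)[OF that(3)]] 3 by simp
    show ?thesis
    proof
      show "epi_at (tr n X) (tr n Y) (trunc_map n X Y \<phi>) i"
        by (rule epi_atI, rule trivial_lift(1)[OF tX tY], assumption, rule z[OF _ _ Y])
      show "mono_at (tr n X) (tr n Y) (trunc_map n X Y \<phi>) i"
        by (rule mono_atI, rule trivial_lift(2)[OF tX tY], assumption, rule z[OF _ _ X])
    qed
  next
    case 4
    have z: "x = 0" if "x \<in> Homr T (cob (tr n Z) i)" for x T Z
      using that 4 zero_obj_Homr(1)[OF zero_obj] by simp
    show ?thesis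
    proof
      show "epi_at (tr n X) (tr n Y) (trunc_map n X Y \<phi>) i"
        by (rule epi_atI, rule trivial_lift(1)[OF tX tY], assumption, rule z)
      show "mono_at (tr n X) (tr n Y) (trunc_map n X Y \<phi>) i"
        by (rule mono_atI, rule trivial_lift(2)[OF tX tY], assumption, rule z)
    qed
  qed
qed

end

section \<open>Calculus of right fractions\<close>

locale right_fractions = preadditive_category +
  fixes S :: "'b set"
  assumes S_arr: "s \<in> S \<Longrightarrow> s \<in> arr C"
    and S_ident: "X \<in> obj C \<Longrightarrow> ident C X \<in> S"
    and S_cmp: "s \<in> S \<Longrightarrow> s \<in> Hom C X Y \<Longrightarrow> t \<in> S \<Longrightarrow> t \<in> Hom C Y Z \<Longrightarrow> t \<cdot> s \<in> S"
    and S_ore: "f \<in> Hom C X Y \<Longrightarrow> t \<in> S \<Longrightarrow> t \<in> Hom C W Y \<Longrightarrow>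
      \<exists>V t' h. t' \<in> S \<and> t' \<in> Hom C V X \<and> h \<in> Hom C V W \<and> f \<cdot> t' = t \<cdot> h"
    and S_cancel: "f \<in> Hom C X Y \<Longrightarrow> g \<in> Hom C X Y \<Longrightarrow> t \<in> S \<Longrightarrow> t \<in> Hom C Y Z \<Longrightarrow> t \<cdot> f = t \<cdot> g \<Longrightarrow>
      \<exists>V s. s \<in> S \<and> s \<in> Hom C V X \<and> f \<cdot> s = g \<cdot> s"
begin

section \<open>Equivalence of roofs\<close>

definition roof :: "'b \<Rightarrow> 'b \<Rightarrow> 'a \<Rightarrow> 'a \<Rightarrow> 'a \<Rightarrow> bool" where
  "roof s f X Z Y \<longleftrightarrow> s \<in> S \<and> s \<in> Hom C Z X \<and> f \<in> Hom C Z Y"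

lemma roofD: "roof s f X Z Y \<Longrightarrow> s \<in> S" "roof s f X Z Y \<Longrightarrow> s \<in> Hom C Z X" "roof s f X Z Y \<Longrightarrow> f \<in> Hom C Z Y"
  by (simp_all add: roof_def)

lemma roofs_iff: "(s, f) \<in> roofs C S X Y \<longleftrightarrow> (\<exists>Z. roof s f X Z Y)"
  using S_arr by (auto simp: roofs_def roof_def Hom_def)

abbreviation roof_eq :: "'b \<Rightarrow> 'b \<Rightarrow> 'b \<Rightarrow> 'b \<Rightarrow> bool" where
  "roof_eq s f s' f' \<equiv> roof_equiv C S (s, f) (s', f')"

lemma equI:
  assumes "roof s f X Z Y" "roof s' f' X Z' Y" "u \<in> Hom C W Z" "v \<in> Hom C W Z'"
    "s \<cdot> u = s' \<cdot> v" "f \<cdot> u = f' \<cdot> v" "s \<cdot> u \<in> S"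
  shows "roof_eq s f s' f'"
proof -
  have "src C s = Z" "src C s' = Z'" using assms by (auto simp: roof_def Hom_def)
  then have "u \<in> Hom C W (src C s)" "v \<in> Hom C W (src C s')" using assms(3,4) by simp_all
  then show ?thesis using assms(5-7) unfolding roof_equiv_def prod.case by blast
qed

lemma equE:
  assumes "roof_eq s f s' f'" "roof s f X Z Y" "roof s' f' X Z' Y"
  obtains W u v where "u \<in> Hom C W Z" "v \<in> Hom C W Z'" "s \<cdot> u = s' \<cdot> v" "f \<cdot> u = f' \<cdot> v" "s \<cdot> u \<in> S"
proof -
  have "src C s = Z" "src C s' = Z'" using assms by (auto simp: roof_def Hom_def)
  then show ?thesis using assms(1) that unfolding roof_equiv_def prod.case by blast
qed

lemma roof_eq_refine:
  assumes r: "roof s f X Z Y" and u: "u \<in> Hom C W Z" "s \<cdot> u \<in> S"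
  shows "roof (s \<cdot> u) (f \<cdot> u) X W Y" "roof_eq s f (s \<cdot> u) (f \<cdot> u)"
proof -
  note R = roofD[OF r]
  show r': "roof (s \<cdot> u) (f \<cdot> u) X W Y" using R u cmp_Hom by (auto simp: roof_def)
  have W: "ident C W \<in> Hom C W W" using u Hom_objD ident_Hom by blast
  show "roof_eq s f (s \<cdot> u) (f \<cdot> u)"
    by (rule equI[OF r r' u(1) W])
      (use R u in \<open>simp_all add: ident_right[OF cmp_Hom[OF u(1) R(2)]] ident_right[OF cmp_Hom[OF u(1) R(3)]]\<close>)
qed

lemma roof_eq_refl:
  assumes "roof s f X Z Y"
  shows "roof_eq s f s f"
proof -
  note R = roofD[OF assms]
  have Z: "ident C Z \<in> Hom C Z Z" using R Hom_objD ident_Hom by blast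
  show ?thesis by (rule equI[OF assms assms Z Z]) (simp_all add: R ident_right[OF R(2)])
qed

lemma roof_eq_sym: "roof_eq s f s' f' \<Longrightarrow> roof_eq s' f' s f"
  unfolding roof_equiv_def prod.case by (metis (no_types, lifting))

text \<open>The Ore square joins the two dominating roofs, but its two maps to \<open>Z'\<close>
  agree only after composition with \<open>s'\<close>; the further refinement \<open>q\<close> makes
  them agree themselves.\<close>

lemma roof_eq_trans:
  assumes 1: "roof_eq s f s' f'" and 2: "roof_eq s' f' s'' f''"
    and r: "roof s f X Z Y" "roof s' f' X Z' Y" "roof s'' f'' X Z'' Y"
  shows "roof_eq s f s'' f''"
proof -
  note R = roofD[OF r(1)] roofD[OF r(2)] roofD[OF r(3)]
  obtain W u v where u: "u \<in> Hom C W Z" "v \<in> Hom C W Z'" "s \<cdot> u = s' \<cdot> v" "f \<cdot> u = f' \<cdot> v" "s \<cdot> u \<in> S"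
    using equE[OF 1 r(1,2)] by blast
  obtain W' u' v' where u': "u' \<in> Hom C W' Z'" "v' \<in> Hom C W' Z''" "s' \<cdot> u' = s'' \<cdot> v'" "f' \<cdot> u' = f'' \<cdot> v'" "s' \<cdot> u' \<in> S"
    using equE[OF 2 r(2,3)] by blast
  obtain V w w' where w: "w \<in> S" "w \<in> Hom C V W" "w' \<in> Hom C V W'" "(s' \<cdot> v) \<cdot> w = (s' \<cdot> u') \<cdot> w'"
    using S_ore[OF cmp_Hom[OF u(2) R(5)] u'(5) cmp_Hom[OF u'(1) R(5)]] by blast
  have "s' \<cdot> (v \<cdot> w) = s' \<cdot> (u' \<cdot> w')"
    using w(4) by (simp add: cmp_assoc[OF w(2) u(2) R(5)] cmp_assoc[OF w(3) u'(1) R(5)])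
  then obtain V' q where q: "q \<in> S" "q \<in> Hom C V' V" "(v \<cdot> w) \<cdot> q = (u' \<cdot> w') \<cdot> q"
    using S_cancel[OF cmp_Hom[OF w(2) u(2)] cmp_Hom[OF w(3) u'(1)] R(4,5)] by blast
  note wq = cmp_Hom[OF q(2) w(2)] and wq' = cmp_Hom[OF q(2) w(3)]
  have e: "v \<cdot> (w \<cdot> q) = u' \<cdot> (w' \<cdot> q)"
    using q(3) by (simp add: cmp_assoc[OF q(2) w(2) u(2)] cmp_assoc[OF q(2) w(3) u'(1)])
  have s: "s \<cdot> (u \<cdot> (w \<cdot> q)) = s'' \<cdot> (v' \<cdot> (w' \<cdot> q))"
    using u(3) u'(3) e by (simp add: cmp_assoc[OF wq u(1) R(2), symmetric] cmp_assoc[OF wq' u'(2) R(8), symmetric])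
      (metis cmp_assoc[OF wq u(2) R(5)] cmp_assoc[OF wq' u'(1) R(5)])
  have f: "f \<cdot> (u \<cdot> (w \<cdot> q)) = f'' \<cdot> (v' \<cdot> (w' \<cdot> q))"
    using u(4) u'(4) e by (simp add: cmp_assoc[OF wq u(1) R(3), symmetric] cmp_assoc[OF wq' u'(2) R(9), symmetric])
      (metis cmp_assoc[OF wq u(2) R(6)] cmp_assoc[OF wq' u'(1) R(6)])
  have "(s \<cdot> u) \<cdot> (w \<cdot> q) \<in> S"
    by (rule S_cmp[OF S_cmp[OF q(1,2) w(1,2)] wq u(5) cmp_Hom[OF u(1) R(2)]])
  then have S: "s \<cdot> (u \<cdot> (w \<cdot> q)) \<in> S" by (simp add: cmp_assoc[OF wq u(1) R(2)])
  show ?thesis by (rule equI[OF r(1,3) cmp_Hom[OF wq u(1)] cmp_Hom[OF wq' u'(2)] s f S])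
qed

abbreviation frac :: "'a \<Rightarrow> 'a \<Rightarrow> 'b \<Rightarrow> 'b \<Rightarrow> ('a, 'b) qarr" where
  "frac X Y s f \<equiv> qclass C S X Y (s, f)"

lemma frac_mem: "(s', f') \<in> fst (snd (frac X Y s f)) \<longleftrightarrow> (\<exists>Z. roof s' f' X Z Y) \<and> roof_eq s f s' f'"
  by (simp add: qclass_def roofs_iff)

lemma frac_eq_iff:
  assumes r: "roof s f X Z Y" "roof s' f' X Z' Y"
  shows "frac X Y s f = frac X Y s' f' \<longleftrightarrow> roof_eq s f s' f'"
proof
  assume "frac X Y s f = frac X Y s' f'"
  moreover have "(s', f') \<in> fst (snd (frac X Y s' f'))" unfolding frac_mem using r roof_eq_refl by blast
  ultimately show "roof_eq s f s' f'" using frac_mem by metis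
next
  assume e: "roof_eq s f s' f'"
  have "(\<exists>Z. roof s2 f2 X Z Y) \<and> roof_eq s f s2 f2 \<longleftrightarrow> (\<exists>Z. roof s2 f2 X Z Y) \<and> roof_eq s' f' s2 f2" for s2 f2
    using roof_eq_trans[OF e _ r] roof_eq_trans[OF roof_eq_sym[OF e] _ r(2,1)] by blast
  then have "fst (snd (frac X Y s f)) = fst (snd (frac X Y s' f'))" using frac_mem by (metis Set.set_eqI surj_pair)
  then show "frac X Y s f = frac X Y s' f'" by (simp add: qclass_def)
qed

text \<open>The counterpart of \<open>hlift_htpy_class\<close> for fractions: all roofs in
  \<open>R\<close> have one class, so the union in \<open>qlift\<close> is that class.\<close>

lemma qlift_frac:
  assumes r: "roof s f X Z Y" and ne: "R \<noteq> {}"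
    and R: "\<And>s' f'. (s', f') \<in> R \<Longrightarrow> \<exists>Z'. roof s' f' X Z' Y \<and> roof_eq s f s' f'"
  shows "qlift C S X Y R = frac X Y s f"
proof -
  have "qclass C S X Y p = frac X Y s f" if "p \<in> R" for p
  proof -
    obtain s' f' where p: "p = (s', f')" by fastforce
    then have "(s', f') \<in> R" using that by simp
    then obtain Z' where "roof s' f' X Z' Y" "roof_eq s f s' f'" using R by blast
    then show ?thesis using frac_eq_iff[OF r] p by metis
  qed
  then have "(\<Union>p \<in> R. fst (snd (qclass C S X Y p))) = fst (snd (frac X Y s f))" using ne by auto
  then show ?thesis by (simp add: qlift_def qclass_def)
qed

section \<open>The localisation as a category\<close>

abbreviation L :: "('a, ('a, 'b) qarr) addcat" where
  "L \<equiv> localisation C S"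

lemma src_tgt_frac [simp]: "src L (frac X Y s f) = X" "tgt L (frac X Y s f) = Y"
  by (simp_all add: localisation_def qclass_def)

lemma frac_Hom: "roof s f X Z Y \<Longrightarrow> frac X Y s f \<in> Hom L X Y"
proof -
  assume r: "roof s f X Z Y"
  then have "X \<in> obj C" "Y \<in> obj C" using roofD Hom_objD by blast+
  moreover have "(s, f) \<in> roofs C S X Y" using r roofs_iff by blast
  ultimately have "frac X Y s f \<in> arr L" by (auto simp: localisation_def)
  then show ?thesis by (simp add: Hom_def)
qed

lemma HomL_E:
  assumes "x \<in> Hom L X Y"
  obtains Z s f where "roof s f X Z Y" "x = frac X Y s f"
proof -
  have "x \<in> arr L" and st: "src L x = X" "tgt L x = Y" using assms by (auto simp: Hom_def)
  then obtain X' Y' s f where x: "x = frac X' Y' s f" "(s, f) \<in> roofs C S X' Y'" by (auto simp: localisation_def)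
  then have "X' = X" "Y' = Y" using st by auto
  then show ?thesis using x that roofs_iff by blast
qed

text \<open>
  Only \<open>s \<cdot> t'\<close> is required to lie in \<open>S\<close>: then a completion for refined roofs is one for the
  original roofs as well, and composition is well defined because completions are unique up to
  equivalence.
\<close>

lemma completion_unique:
  assumes r: "roof s f X Z Y" "roof t g Y V W"
    and c1: "t1 \<in> Hom C U1 Z" "h1 \<in> Hom C U1 V" "s \<cdot> t1 \<in> S" "f \<cdot> t1 = t \<cdot> h1"
    and c2: "t2 \<in> Hom C U2 Z" "h2 \<in> Hom C U2 V" "s \<cdot> t2 \<in> S" "f \<cdot> t2 = t \<cdot> h2"
  shows "roof_eq (s \<cdot> t1) (g \<cdot> h1) (s \<cdot> t2) (g \<cdot> h2)"
proof -
  note R = roofD[OF r(1)] and T = roofD[OF r(2)]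
  obtain A a b where a: "a \<in> S" "a \<in> Hom C A U1" "b \<in> Hom C A U2" "(s \<cdot> t1) \<cdot> a = (s \<cdot> t2) \<cdot> b"
    using S_ore[OF cmp_Hom[OF c1(1) R(2)] c2(3) cmp_Hom[OF c2(1) R(2)]] by blast
  have "s \<cdot> (t1 \<cdot> a) = s \<cdot> (t2 \<cdot> b)"
    using a(4) by (simp add: cmp_assoc[OF a(2) c1(1) R(2)] cmp_assoc[OF a(3) c2(1) R(2)])
  then obtain B p where p: "p \<in> S" "p \<in> Hom C B A" "(t1 \<cdot> a) \<cdot> p = (t2 \<cdot> b) \<cdot> p"
    using S_cancel[OF cmp_Hom[OF a(2) c1(1)] cmp_Hom[OF a(3) c2(1)] R(1,2)] by blast
  note ap = cmp_Hom[OF p(2) a(2)] and bp = cmp_Hom[OF p(2) a(3)]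
  have e: "t1 \<cdot> (a \<cdot> p) = t2 \<cdot> (b \<cdot> p)"
    using p(3) by (simp add: cmp_assoc[OF p(2) a(2) c1(1)] cmp_assoc[OF p(2) a(3) c2(1)])
  \<comment> \<open>The maps \<open>t1\<close> and \<open>t2\<close> agree along \<open>a p\<close>
    and \<open>b p\<close>; \<open>h1\<close> and \<open>h2\<close> do so at first only after
    composition with \<open>t\<close>, which \<open>q\<close> cancels.\<close>
  have "t \<cdot> (h1 \<cdot> (a \<cdot> p)) = f \<cdot> (t1 \<cdot> (a \<cdot> p))"
    by (simp add: cmp_assoc[OF ap c1(2) T(2), symmetric] c1(4)[symmetric] cmp_assoc[OF ap c1(1) R(3)])
  also have "\<dots> = t \<cdot> (h2 \<cdot> (b \<cdot> p))"
    unfolding e by (simp add: cmp_assoc[OF bp c2(2) T(2), symmetric] c2(4)[symmetric] cmp_assoc[OF bp c2(1) R(3)])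
  finally obtain D q where q: "q \<in> S" "q \<in> Hom C D B" "(h1 \<cdot> (a \<cdot> p)) \<cdot> q = (h2 \<cdot> (b \<cdot> p)) \<cdot> q"
    using S_cancel[OF cmp_Hom[OF ap c1(2)] cmp_Hom[OF bp c2(2)] T(1,2)] by blast
  note apq = cmp_Hom[OF q(2) ap] and bpq = cmp_Hom[OF q(2) bp]
  have h: "h1 \<cdot> ((a \<cdot> p) \<cdot> q) = h2 \<cdot> ((b \<cdot> p) \<cdot> q)"
    using q(3) by (simp add: cmp_assoc[OF q(2) ap c1(2)] cmp_assoc[OF q(2) bp c2(2)])
  have t: "t1 \<cdot> ((a \<cdot> p) \<cdot> q) = t2 \<cdot> ((b \<cdot> p) \<cdot> q)"
    using e by (simp add: cmp_assoc[OF q(2) ap c1(1), symmetric] cmp_assoc[OF q(2) bp c2(1), symmetric])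
  have r1: "roof (s \<cdot> t1) (g \<cdot> h1) X U1 W" and r2: "roof (s \<cdot> t2) (g \<cdot> h2) X U2 W"
    using c1 c2 R T cmp_Hom by (auto simp: roof_def)
  show ?thesis
  proof (rule equI[OF r1 r2 apq bpq])
    show "(s \<cdot> t1) \<cdot> ((a \<cdot> p) \<cdot> q) = (s \<cdot> t2) \<cdot> ((b \<cdot> p) \<cdot> q)"
      by (simp add: cmp_assoc[OF apq c1(1) R(2)] cmp_assoc[OF bpq c2(1) R(2)] t)
    show "(g \<cdot> h1) \<cdot> ((a \<cdot> p) \<cdot> q) = (g \<cdot> h2) \<cdot> ((b \<cdot> p) \<cdot> q)"
      by (simp add: cmp_assoc[OF apq c1(2) T(3)] cmp_assoc[OF bpq c2(2) T(3)] h)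
    show "(s \<cdot> t1) \<cdot> ((a \<cdot> p) \<cdot> q) \<in> S"
      by (rule S_cmp[OF S_cmp[OF q(1,2) S_cmp[OF p(1,2) a(1,2)] ap] apq c1(3) cmp_Hom[OF c1(1) R(2)]])
  qed
qed

text \<open>A completion over the common refinements \<open>u\<close>, \<open>v\<close> and
  \<open>p\<close>, \<open>q\<close> is at the same time a completion for both pairs of roofs. Two
  uses of uniqueness connect the given completions through it.\<close>

lemma completion_roof_eq:
  assumes r: "roof s f X Z Y" "roof t g Y V W" "roof s' f' X Z' Y" "roof t' g' Y V' W"
    and e: "roof_eq s f s' f'" "roof_eq t g t' g'"
    and c1: "t1 \<in> Hom C U1 Z" "h1 \<in> Hom C U1 V" "s \<cdot> t1 \<in> S" "f \<cdot> t1 = t \<cdot> h1"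
    and c2: "t2 \<in> Hom C U2 Z'" "h2 \<in> Hom C U2 V'" "s' \<cdot> t2 \<in> S" "f' \<cdot> t2 = t' \<cdot> h2"
  shows "roof_eq (s \<cdot> t1) (g \<cdot> h1) (s' \<cdot> t2) (g' \<cdot> h2)"
proof -
  note R = roofD[OF r(1)] and T = roofD[OF r(2)] and R' = roofD[OF r(3)] and T' = roofD[OF r(4)]
  obtain A u v where u: "u \<in> Hom C A Z" "v \<in> Hom C A Z'" "s \<cdot> u = s' \<cdot> v" "f \<cdot> u = f' \<cdot> v" "s \<cdot> u \<in> S"
    using equE[OF e(1) r(1,3)] by blast
  obtain B p q where p: "p \<in> Hom C B V" "q \<in> Hom C B V'" "t \<cdot> p = t' \<cdot> q" "g \<cdot> p = g' \<cdot> q" "t \<cdot> p \<in> S"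
    using equE[OF e(2) r(2,4)] by blast
  obtain D a b where a: "a \<in> S" "a \<in> Hom C D A" "b \<in> Hom C D B" "(f \<cdot> u) \<cdot> a = (t \<cdot> p) \<cdot> b"
    using S_ore[OF cmp_Hom[OF u(1) R(3)] p(5) cmp_Hom[OF p(1) T(2)]] by blast
  note ua = cmp_Hom[OF a(2) u(1)] and va = cmp_Hom[OF a(2) u(2)] and pb = cmp_Hom[OF a(3) p(1)] and qb = cmp_Hom[OF a(3) p(2)]
  have sS: "(s \<cdot> u) \<cdot> a \<in> S" by (rule S_cmp[OF a(1,2) u(5) cmp_Hom[OF u(1) R(2)]])
  have s1: "s \<cdot> (u \<cdot> a) \<in> S" using sS by (simp add: cmp_assoc[OF a(2) u(1) R(2)])
  have s2: "s' \<cdot> (v \<cdot> a) \<in> S" using sS by (simp add: u(3) cmp_assoc[OF a(2) u(2) R'(2)])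
  have ss: "s \<cdot> (u \<cdot> a) = s' \<cdot> (v \<cdot> a)"
    by (simp add: cmp_assoc[OF a(2) u(1) R(2), symmetric] u(3) cmp_assoc[OF a(2) u(2) R'(2)])
  have gg: "g \<cdot> (p \<cdot> b) = g' \<cdot> (q \<cdot> b)"
    by (simp add: cmp_assoc[OF a(3) p(1) T(3), symmetric] p(4) cmp_assoc[OF a(3) p(2) T'(3)])
  have f1: "f \<cdot> (u \<cdot> a) = t \<cdot> (p \<cdot> b)"
    using a(4) by (simp add: cmp_assoc[OF a(2) u(1) R(3)] cmp_assoc[OF a(3) p(1) T(2)])
  have f2: "f' \<cdot> (v \<cdot> a) = t' \<cdot> (q \<cdot> b)"
    using a(4) by (simp add: u(4) p(3) cmp_assoc[OF a(2) u(2) R'(3)] cmp_assoc[OF a(3) p(2) T'(2)])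
  have 1: "roof_eq (s \<cdot> t1) (g \<cdot> h1) (s \<cdot> (u \<cdot> a)) (g \<cdot> (p \<cdot> b))"
    by (rule completion_unique[OF r(1,2) c1 ua pb s1 f1])
  have 2: "roof_eq (s \<cdot> (u \<cdot> a)) (g \<cdot> (p \<cdot> b)) (s' \<cdot> t2) (g' \<cdot> h2)"
    unfolding ss gg by (rule completion_unique[OF r(3,4) va qb s2 f2 c2])
  have r1: "roof (s \<cdot> t1) (g \<cdot> h1) X U1 W" "roof (s \<cdot> (u \<cdot> a)) (g \<cdot> (p \<cdot> b)) X D W" "roof (s' \<cdot> t2) (g' \<cdot> h2) X U2 W"
    using c1 c2 s1 cmp_Hom[OF c1(1) R(2)] cmp_Hom[OF c1(2) T(3)] cmp_Hom[OF c2(1) R'(2)] cmp_Hom[OF c2(2) T'(3)]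
      cmp_Hom[OF ua R(2)] cmp_Hom[OF pb T(3)] by (auto simp: roof_def)
  show ?thesis by (rule roof_eq_trans[OF 1 2 r1])
qed

lemma frac_cmp:
  assumes r: "roof s f X Z Y" "roof t g Y V W"
    and c: "t1 \<in> S" "t1 \<in> Hom C U Z" "h1 \<in> Hom C U V" "f \<cdot> t1 = t \<cdot> h1"
  shows "roof (s \<cdot> t1) (g \<cdot> h1) X U W" "frac Y W t g \<cdot>\<^bsub>L\<^esub> frac X Y s f = frac X W (s \<cdot> t1) (g \<cdot> h1)"
proof -
  note R = roofD[OF r(1)] and T = roofD[OF r(2)]
  have sS: "s \<cdot> t1 \<in> S" by (rule S_cmp[OF c(1,2) R(1,2)])
  show r': "roof (s \<cdot> t1) (g \<cdot> h1) X U W"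
    using sS cmp_Hom[OF c(2) R(2)] cmp_Hom[OF c(3) T(3)] by (simp add: roof_def)
  define G where "G = {(s' \<cdot> t', g' \<cdot> h) | s' t' g' h. \<exists>f' t2 W'. (s', f') \<in> fst (snd (frac X Y s f)) \<and> (t2, g') \<in> fst (snd (frac Y W t g)) \<and>
          t' \<in> S \<and> t' \<in> Hom C W' (src C s') \<and> h \<in> Hom C W' (src C t2) \<and> f' \<cdot> t' = t2 \<cdot> h}"
  have "frac Y W t g \<cdot>\<^bsub>L\<^esub> frac X Y s f = qlift C S X W G"
    by (simp add: localisation_def qclass_def G_def)
  also have "\<dots> = frac X W (s \<cdot> t1) (g \<cdot> h1)"
  proof (rule qlift_frac[OF r'])
    have st: "src C s = Z" "src C t = V" using R T by (auto simp: Hom_def)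
    have m: "(s, f) \<in> fst (snd (frac X Y s f))" "(t, g) \<in> fst (snd (frac Y W t g))"
      unfolding frac_mem using r roof_eq_refl by blast+
    have "(s \<cdot> t1, g \<cdot> h1) \<in> G" unfolding G_def using m st c by blast
    then show "G \<noteq> {}" by blast
    fix k l assume "(k, l) \<in> G"
    then obtain s' t' g' h f' t2 W' where k: "k = s' \<cdot> t'" "l = g' \<cdot> h" "(s', f') \<in> fst (snd (frac X Y s f))"
      "(t2, g') \<in> fst (snd (frac Y W t g))" "t' \<in> S" "t' \<in> Hom C W' (src C s')" "h \<in> Hom C W' (src C t2)" "f' \<cdot> t' = t2 \<cdot> h"
      unfolding G_def by blast
    obtain Z' where Z': "roof s' f' X Z' Y" "roof_eq s f s' f'" using k(3) unfolding frac_mem by blast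
    obtain V' where V': "roof t2 g' Y V' W" "roof_eq t g t2 g'" using k(4) unfolding frac_mem by blast
    note R' = roofD[OF Z'(1)] and T' = roofD[OF V'(1)]
    have st': "src C s' = Z'" "src C t2 = V'" using R' T' by (auto simp: Hom_def)
    have t'H: "t' \<in> Hom C W' Z'" and hH: "h \<in> Hom C W' V'" using k(6,7) st' by auto
    have S': "s' \<cdot> t' \<in> S" by (rule S_cmp[OF k(5) t'H R'(1,2)])
    have "roof k l X W' W" using S' cmp_Hom[OF t'H R'(2)] cmp_Hom[OF hH T'(3)] k(1,2) by (simp add: roof_def)
    moreover have "roof_eq (s \<cdot> t1) (g \<cdot> h1) k l"
      unfolding k(1,2) by (rule completion_roof_eq[OF r Z'(1) V'(1) Z'(2) V'(2) c(2,3) sS c(4) t'H hH S' k(8)])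
    ultimately show "\<exists>Z'. roof k l X Z' W \<and> roof_eq (s \<cdot> t1) (g \<cdot> h1) k l" by blast
  qed
  finally show "frac Y W t g \<cdot>\<^bsub>L\<^esub> frac X Y s f = frac X W (s \<cdot> t1) (g \<cdot> h1)" .
qed

lemma ident_roof: "f \<in> Hom C X Y \<Longrightarrow> roof (ident C X) f X X Y"
  using Hom_objD ident_Hom S_ident by (auto simp: roof_def)

lemma ident_L: "ident L X = frac X X (ident C X) (ident C X)"
  by (simp add: localisation_def)

lemma category_L: "category L"
proof
  fix x assume "x \<in> arr L"
  then have "x \<in> Hom L (src L x) (tgt L x)" by (simp add: Hom_def)
  then obtain Z s f where "roof s f (src L x) Z (tgt L x)" by (rule HomL_E)
  then have "src L x \<in> obj C" "tgt L x \<in> obj C" using roofD Hom_objD by blast+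
  then show "src L x \<in> obj L" "tgt L x \<in> obj L" by (simp_all add: localisation_def)
next
  fix X assume "X \<in> obj L"
  then have "X \<in> obj C" by (simp add: localisation_def)
  then show "ident L X \<in> Hom L X X" unfolding ident_L using frac_Hom ident_roof ident_Hom by blast
next
  fix X Y Z x y assume x: "x \<in> Hom L X Y" and y: "y \<in> Hom L Y Z"
  obtain A s f where s: "roof s f X A Y" "x = frac X Y s f" using x by (rule HomL_E)
  obtain B t g where t: "roof t g Y B Z" "y = frac Y Z t g" using y by (rule HomL_E)
  obtain U t' h where c: "t' \<in> S" "t' \<in> Hom C U A" "h \<in> Hom C U B" "f \<cdot> t' = t \<cdot> h"
    using S_ore[OF roofD(3)[OF s(1)] roofD(1,2)[OF t(1)]] by blast
  show "y \<cdot>\<^bsub>L\<^esub> x \<in> Hom L X Z"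
    using frac_Hom[OF frac_cmp(1)[OF s(1) t(1) c]] frac_cmp(2)[OF s(1) t(1) c] s(2) t(2) by simp
next
  fix X Y x assume x: "x \<in> Hom L X Y"
  obtain A s f where s: "roof s f X A Y" "x = frac X Y s f" using x by (rule HomL_E)
  note R = roofD[OF s(1)]
  have o: "A \<in> obj C" "X \<in> obj C" "Y \<in> obj C" using R Hom_objD by blast+
  have "frac Y Y (ident C Y) (ident C Y) \<cdot>\<^bsub>L\<^esub> frac X Y s f = frac X Y (s \<cdot> ident C A) (ident C Y \<cdot> f)"
    by (rule frac_cmp(2)[OF s(1) ident_roof[OF ident_Hom[OF o(3)]] S_ident[OF o(1)] ident_Hom[OF o(1)] R(3)])
      (simp add: ident_left[OF R(3)] ident_right[OF R(3)])
  then show "ident L Y \<cdot>\<^bsub>L\<^esub> x = x"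
    by (simp add: ident_L s(2) ident_left[OF R(3)] ident_right[OF R(2)])
  have "frac X Y s f \<cdot>\<^bsub>L\<^esub> frac X X (ident C X) (ident C X) = frac X Y (ident C X \<cdot> s) (f \<cdot> ident C A)"
    by (rule frac_cmp(2)[OF ident_roof[OF ident_Hom[OF o(2)]] s(1) R(1,2) ident_Hom[OF o(1)]])
      (simp add: ident_left[OF R(2)] ident_right[OF R(2)])
  then show "x \<cdot>\<^bsub>L\<^esub> ident L X = x"
    by (simp add: ident_L s(2) ident_left[OF R(2)] ident_right[OF R(3)])
next
  fix W X Y Z x y z assume x: "x \<in> Hom L W X" and y: "y \<in> Hom L X Y" and z: "z \<in> Hom L Y Z"
  obtain A s f where s: "roof s f W A X" "x = frac W X s f" using x by (rule HomL_E)
  obtain B t g where t: "roof t g X B Y" "y = frac X Y t g" using y by (rule HomL_E)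
  obtain D r k where r: "roof r k Y D Z" "z = frac Y Z r k" using z by (rule HomL_E)
  note R = roofD[OF s(1)] and T = roofD[OF t(1)] and Q = roofD[OF r(1)]
  obtain U t' h where c: "t' \<in> S" "t' \<in> Hom C U A" "h \<in> Hom C U B" "f \<cdot> t' = t \<cdot> h"
    using S_ore[OF R(3) T(1,2)] by blast
  obtain E r' m where d: "r' \<in> S" "r' \<in> Hom C E B" "m \<in> Hom C E D" "g \<cdot> r' = r \<cdot> m"
    using S_ore[OF T(3) Q(1,2)] by blast
  \<comment> \<open>A square on top of the two inner ones: from its apex both bracketings can be
    computed.\<close>
  obtain V a b where a: "a \<in> S" "a \<in> Hom C V U" "b \<in> Hom C V E" "h \<cdot> a = r' \<cdot> b"
    using S_ore[OF c(3) d(1,2)] by blast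
  note yx = frac_cmp[OF s(1) t(1) c] and zy = frac_cmp[OF t(1) r(1) d]
  have 1: "(g \<cdot> h) \<cdot> a = r \<cdot> (m \<cdot> b)"
    by (simp add: cmp_assoc[OF a(2) c(3) T(3)] a(4) cmp_assoc[OF a(3) d(2) T(3), symmetric] d(4) cmp_assoc[OF a(3) d(3) Q(2)])
  have "f \<cdot> (t' \<cdot> a) = t \<cdot> (h \<cdot> a)"
    by (simp add: cmp_assoc[OF a(2) c(2) R(3), symmetric] c(4) cmp_assoc[OF a(2) c(3) T(2)])
  then have 2: "f \<cdot> (t' \<cdot> a) = (t \<cdot> r') \<cdot> b"
    by (simp add: a(4) cmp_assoc[OF a(3) d(2) T(2)])
  have "z \<cdot>\<^bsub>L\<^esub> (y \<cdot>\<^bsub>L\<^esub> x) = frac W Z ((s \<cdot> t') \<cdot> a) (k \<cdot> (m \<cdot> b))"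
    unfolding s(2) t(2) r(2) yx(2) by (rule frac_cmp(2)[OF yx(1) r(1) a(1,2) cmp_Hom[OF a(3) d(3)] 1])
  moreover have "(z \<cdot>\<^bsub>L\<^esub> y) \<cdot>\<^bsub>L\<^esub> x = frac W Z (s \<cdot> (t' \<cdot> a)) ((k \<cdot> m) \<cdot> b)"
    unfolding s(2) t(2) r(2) zy(2) by (rule frac_cmp(2)[OF s(1) zy(1) S_cmp[OF a(1,2) c(1,2)] cmp_Hom[OF a(2) c(2)] a(3) 2])
  ultimately show "(z \<cdot>\<^bsub>L\<^esub> y) \<cdot>\<^bsub>L\<^esub> x = z \<cdot>\<^bsub>L\<^esub> y \<cdot>\<^bsub>L\<^esub> x"
    by (simp add: cmp_assoc[OF a(2) c(2) R(2)] cmp_assoc[OF a(3) d(3) Q(3)])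
qed

text \<open>The two equivalences come with unrelated apexes \<open>A\<close> and \<open>B\<close>.
  Refining along \<open>x\<close> and \<open>y\<close> makes the maps to \<open>Z\<close> and to
  \<open>Z'\<close> agree, after cancelling \<open>s\<close> and \<open>s'\<close>, so a single roof
  dominates both pairs and the numerators can be added.\<close>

lemma roof_eq_plus:
  assumes r: "roof s f X Z Y" "roof s' f' X Z' Y" "roof s g X Z Y" "roof s' g' X Z' Y"
    and e: "roof_eq s f s' f'" "roof_eq s g s' g'"
  shows "roof_eq s (f \<boxplus> g) s' (f' \<boxplus> g')"
proof -
  note R = roofD[OF r(1)] and R' = roofD[OF r(2)] and G = roofD(3)[OF r(3)] and G' = roofD(3)[OF r(4)]
  obtain A u v where u: "u \<in> Hom C A Z" "v \<in> Hom C A Z'" "s \<cdot> u = s' \<cdot> v" "f \<cdot> u = f' \<cdot> v" "s \<cdot> u \<in> S"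
    using equE[OF e(1) r(1,2)] by blast
  obtain B p q where p: "p \<in> Hom C B Z" "q \<in> Hom C B Z'" "s \<cdot> p = s' \<cdot> q" "g \<cdot> p = g' \<cdot> q" "s \<cdot> p \<in> S"
    using equE[OF e(2) r(3,4)] by blast
  obtain D a b where a: "a \<in> S" "a \<in> Hom C D A" "b \<in> Hom C D B" "(s \<cdot> u) \<cdot> a = (s \<cdot> p) \<cdot> b"
    using S_ore[OF cmp_Hom[OF u(1) R(2)] p(5) cmp_Hom[OF p(1) R(2)]] by blast
  have "s \<cdot> (u \<cdot> a) = s \<cdot> (p \<cdot> b)"
    using a(4) by (simp add: cmp_assoc[OF a(2) u(1) R(2)] cmp_assoc[OF a(3) p(1) R(2)])
  then obtain E c where c: "c \<in> S" "c \<in> Hom C E D" "(u \<cdot> a) \<cdot> c = (p \<cdot> b) \<cdot> c"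
    using S_cancel[OF cmp_Hom[OF a(2) u(1)] cmp_Hom[OF a(3) p(1)] R(1,2)] by blast
  note ac = cmp_Hom[OF c(2) a(2)] and bc = cmp_Hom[OF c(2) a(3)]
  have uc: "u \<cdot> (a \<cdot> c) = p \<cdot> (b \<cdot> c)"
    using c(3) by (simp add: cmp_assoc[OF c(2) a(2) u(1)] cmp_assoc[OF c(2) a(3) p(1)])
  have "s' \<cdot> (v \<cdot> (a \<cdot> c)) = s \<cdot> (u \<cdot> (a \<cdot> c))"
    by (simp add: cmp_assoc[OF ac u(2) R'(2), symmetric] u(3)[symmetric] cmp_assoc[OF ac u(1) R(2)])
  also have "\<dots> = s' \<cdot> (q \<cdot> (b \<cdot> c))"
    unfolding uc by (simp add: cmp_assoc[OF bc p(1) R(2), symmetric] p(3) cmp_assoc[OF bc p(2) R'(2)])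
  finally obtain F d where d: "d \<in> S" "d \<in> Hom C F E" "(v \<cdot> (a \<cdot> c)) \<cdot> d = (q \<cdot> (b \<cdot> c)) \<cdot> d"
    using S_cancel[OF cmp_Hom[OF ac u(2)] cmp_Hom[OF bc p(2)] R'(1,2)] by blast
  define x where "x = (a \<cdot> c) \<cdot> d"
  define y where "y = (b \<cdot> c) \<cdot> d"
  have x: "x \<in> Hom C F A" and y: "y \<in> Hom C F B" unfolding x_def y_def using cmp_Hom[OF d(2) ac] cmp_Hom[OF d(2) bc] .
  have vx: "v \<cdot> x = q \<cdot> y"
    using d(3) by (simp add: x_def y_def cmp_assoc[OF d(2) ac u(2)] cmp_assoc[OF d(2) bc p(2)])
  have ux: "u \<cdot> x = p \<cdot> y"
    using uc by (simp add: x_def y_def cmp_assoc[OF d(2) ac u(1), symmetric] cmp_assoc[OF d(2) bc p(1), symmetric])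
  have xS: "x \<in> S" unfolding x_def by (rule S_cmp[OF d(1,2) S_cmp[OF c(1,2) a(1,2)] ac])
  note uxH = cmp_Hom[OF x u(1)] and vxH = cmp_Hom[OF x u(2)]
  have r1: "roof s (f \<boxplus> g) X Z Y" "roof s' (f' \<boxplus> g') X Z' Y"
    using R R' plus_Hom[OF R(3) G] plus_Hom[OF R'(3) G'] by (simp_all add: roof_def)
  have fx: "f \<cdot> (u \<cdot> x) = f' \<cdot> (v \<cdot> x)"
    by (simp add: cmp_assoc[OF x u(1) R(3), symmetric] u(4) cmp_assoc[OF x u(2) R'(3)])
  have gx: "g \<cdot> (u \<cdot> x) = g' \<cdot> (v \<cdot> x)"
    unfolding ux vx by (simp add: cmp_assoc[OF y p(1) G, symmetric] p(4) cmp_assoc[OF y p(2) G'])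
  show ?thesis
  proof (rule equI[OF r1 uxH vxH])
    show "s \<cdot> (u \<cdot> x) = s' \<cdot> (v \<cdot> x)"
      by (simp add: cmp_assoc[OF x u(1) R(2), symmetric] u(3) cmp_assoc[OF x u(2) R'(2)])
    show "(f \<boxplus> g) \<cdot> (u \<cdot> x) = (f' \<boxplus> g') \<cdot> (v \<cdot> x)"
      unfolding cmp_plus_left[OF uxH R(3) G] cmp_plus_left[OF vxH R'(3) G'] fx gx ..
    have "(s \<cdot> u) \<cdot> x \<in> S" by (rule S_cmp[OF xS x u(5) cmp_Hom[OF u(1) R(2)]])
    then show "s \<cdot> (u \<cdot> x) \<in> S" by (simp add: cmp_assoc[OF x u(1) R(2)])
  qed
qed

lemma common_denominator:
  assumes "x \<in> Hom L X Y" "y \<in> Hom L X Y"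
  obtains Z s f g where "roof s f X Z Y" "roof s g X Z Y" "x = frac X Y s f" "y = frac X Y s g"
proof -
  obtain A s f where s: "roof s f X A Y" "x = frac X Y s f" using assms(1) by (rule HomL_E)
  obtain B t g where t: "roof t g X B Y" "y = frac X Y t g" using assms(2) by (rule HomL_E)
  note R = roofD[OF s(1)] and T = roofD[OF t(1)]
  obtain U a b where a: "a \<in> S" "a \<in> Hom C U A" "b \<in> Hom C U B" "s \<cdot> a = t \<cdot> b"
    using S_ore[OF R(2) T(1,2)] by blast
  have sa: "s \<cdot> a \<in> S" by (rule S_cmp[OF a(1,2) R(1,2)])
  have tb: "t \<cdot> b \<in> S" using sa a(4) by simp
  note 1 = roof_eq_refine[OF s(1) a(2) sa] and 2 = roof_eq_refine[OF t(1) a(3) tb, folded a(4)]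
  show ?thesis
    by (rule that[OF 1(1) 2(1)]) (use frac_eq_iff[OF s(1) 1(1)] frac_eq_iff[OF t(1) 2(1)] 1(2) 2(2) s(2) t(2) in auto)
qed

lemma frac_plus:
  assumes r: "roof s f X Z Y" "roof s g X Z Y"
  shows "roof s (f \<boxplus> g) X Z Y" "frac X Y s f \<boxplus>\<^bsub>L\<^esub> frac X Y s g = frac X Y s (f \<boxplus> g)"
proof -
  show r': "roof s (f \<boxplus> g) X Z Y" using r plus_Hom[of f Z Y g] by (auto simp: roof_def)
  define G where "G = {(s', f' \<boxplus> g') | s' f' g'. (s', f') \<in> fst (snd (frac X Y s f)) \<and> (s', g') \<in> fst (snd (frac X Y s g))}"
  have "frac X Y s f \<boxplus>\<^bsub>L\<^esub> frac X Y s g = qlift C S X Y G"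
    by (simp add: localisation_def qclass_def G_def)
  also have "\<dots> = frac X Y s (f \<boxplus> g)"
  proof (rule qlift_frac[OF r'])
    have "(s, f) \<in> fst (snd (frac X Y s f))" "(s, g) \<in> fst (snd (frac X Y s g))"
      unfolding frac_mem using r roof_eq_refl by blast+
    then show "G \<noteq> {}" unfolding G_def by blast
    fix k l assume "(k, l) \<in> G"
    then obtain f' g' where k: "l = f' \<boxplus> g'" "(k, f') \<in> fst (snd (frac X Y s f))" "(k, g') \<in> fst (snd (frac X Y s g))"
      unfolding G_def by blast
    obtain Z' where Z': "roof k f' X Z' Y" "roof_eq s f k f'" using k(2) unfolding frac_mem by blast
    obtain Z2 where Z2: "roof k g' X Z2 Y" "roof_eq s g k g'" using k(3) unfolding frac_mem by blast
    have "Z2 = Z'" using Z' Z2 by (auto simp: roof_def Hom_def)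
    then have rg: "roof k g' X Z' Y" using Z2 by simp
    have "roof_eq s (f \<boxplus> g) k l" unfolding k(1) by (rule roof_eq_plus[OF r(1) Z'(1) r(2) rg Z'(2) Z2(2)])
    moreover have "roof k l X Z' Y" using Z'(1) rg plus_Hom[of f' Z' Y g'] k(1) by (auto simp: roof_def)
    ultimately show "\<exists>Z'. roof k l X Z' Y \<and> roof_eq s (f \<boxplus> g) k l" by blast
  qed
  finally show "frac X Y s f \<boxplus>\<^bsub>L\<^esub> frac X Y s g = frac X Y s (f \<boxplus> g)" .
qed

lemma L_plus_Hom:
  assumes "x \<in> Hom L X Y" "y \<in> Hom L X Y"
  shows "x \<boxplus>\<^bsub>L\<^esub> y \<in> Hom L X Y"
proof -
  obtain Z s f g where s: "roof s f X Z Y" "roof s g X Z Y" "x = frac X Y s f" "y = frac X Y s g"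
    using assms by (rule common_denominator)
  show ?thesis unfolding s(3,4) frac_plus(2)[OF s(1,2)] by (rule frac_Hom[OF frac_plus(1)[OF s(1,2)]])
qed

lemma L_cmp_plus_right:
  assumes "x \<in> Hom L X Y" "y \<in> Hom L X Y" "z \<in> Hom L Y W"
  shows "z \<cdot>\<^bsub>L\<^esub> (x \<boxplus>\<^bsub>L\<^esub> y) = z \<cdot>\<^bsub>L\<^esub> x \<boxplus>\<^bsub>L\<^esub> z \<cdot>\<^bsub>L\<^esub> y"
proof -
  obtain Z s f g where s: "roof s f X Z Y" "roof s g X Z Y" "x = frac X Y s f" "y = frac X Y s g"
    using assms(1,2) by (rule common_denominator)
  obtain B t k where t: "roof t k Y B W" "z = frac Y W t k" using assms(3) by (rule HomL_E)
  note R = roofD[OF s(1)] and G = roofD(3)[OF s(2)] and T = roofD[OF t(1)]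
  obtain U a h where a: "a \<in> S" "a \<in> Hom C U Z" "h \<in> Hom C U B" "f \<cdot> a = t \<cdot> h"
    using S_ore[OF R(3) T(1,2)] by blast
  \<comment> \<open>The second square is built on top of the first, so that \<open>a b\<close>
    serves for both numerators \<open>f\<close> and \<open>g\<close>.\<close>
  obtain V b l where b: "b \<in> S" "b \<in> Hom C V U" "l \<in> Hom C V B" "(g \<cdot> a) \<cdot> b = t \<cdot> l"
    using S_ore[OF cmp_Hom[OF a(2) G] T(1,2)] by blast
  note ab = cmp_Hom[OF b(2) a(2)] and hb = cmp_Hom[OF b(2) a(3)]
  have abS: "a \<cdot> b \<in> S" by (rule S_cmp[OF b(1,2) a(1,2)])
  have f: "f \<cdot> (a \<cdot> b) = t \<cdot> (h \<cdot> b)"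
    by (simp add: cmp_assoc[OF b(2) a(2) R(3), symmetric] a(4) cmp_assoc[OF b(2) a(3) T(2)])
  have g: "g \<cdot> (a \<cdot> b) = t \<cdot> l" using b(4) by (simp add: cmp_assoc[OF b(2) a(2) G])
  have fg: "(f \<boxplus> g) \<cdot> (a \<cdot> b) = t \<cdot> (h \<cdot> b \<boxplus> l)"
    unfolding cmp_plus_left[OF ab R(3) G] f g cmp_plus_right[OF hb b(3) T(2)] ..
  note c1 = frac_cmp[OF s(1) t(1) abS ab hb f] and c2 = frac_cmp[OF s(2) t(1) abS ab b(3) g]
    and c3 = frac_cmp[OF frac_plus(1)[OF s(1,2)] t(1) abS ab plus_Hom[OF hb b(3)] fg]
  show ?thesis
    unfolding s(3,4) t(2) frac_plus(2)[OF s(1,2)] c1(2) c2(2) c3(2) frac_plus(2)[OF c1(1) c2(1)]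
      cmp_plus_right[OF hb b(3) T(3)] ..
qed

lemma L_cmp_plus_left:
  assumes "x \<in> Hom L X Y" "y \<in> Hom L X Y" "z \<in> Hom L W X"
  shows "(x \<boxplus>\<^bsub>L\<^esub> y) \<cdot>\<^bsub>L\<^esub> z = x \<cdot>\<^bsub>L\<^esub> z \<boxplus>\<^bsub>L\<^esub> y \<cdot>\<^bsub>L\<^esub> z"
proof -
  obtain Z s f g where s: "roof s f X Z Y" "roof s g X Z Y" "x = frac X Y s f" "y = frac X Y s g"
    using assms(1,2) by (rule common_denominator)
  obtain B t k where t: "roof t k W B X" "z = frac W X t k" using assms(3) by (rule HomL_E)
  note R = roofD[OF s(1)] and G = roofD(3)[OF s(2)] and T = roofD[OF t(1)]
  obtain U a h where a: "a \<in> S" "a \<in> Hom C U B" "h \<in> Hom C U Z" "k \<cdot> a = s \<cdot> h"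
    using S_ore[OF T(3) R(1,2)] by blast
  note c1 = frac_cmp[OF t(1) s(1) a] and c2 = frac_cmp[OF t(1) s(2) a] and c3 = frac_cmp[OF t(1) frac_plus(1)[OF s(1,2)] a]
  show ?thesis
    unfolding s(3,4) t(2) frac_plus(2)[OF s(1,2)] c1(2) c2(2) c3(2) frac_plus(2)[OF c1(1) c2(1)]
      cmp_plus_left[OF a(3) R(3) G] ..
qed

section \<open>The localisation functor and the inverses it creates\<close>

abbreviation loc :: "'b \<Rightarrow> ('a, 'b) qarr" where
  "loc f \<equiv> loc_arr C S f"

lemma loc_frac: "f \<in> Hom C X Y \<Longrightarrow> loc f = frac X Y (ident C X) f"
  by (auto simp: loc_arr_def Hom_def)

lemma loc_Hom: "f \<in> Hom C X Y \<Longrightarrow> loc f \<in> Hom L X Y"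
  using frac_Hom[OF ident_roof] by (simp add: loc_frac)

lemma loc_cmp: "f \<in> Hom C X Y \<Longrightarrow> g \<in> Hom C Y Z \<Longrightarrow> loc (g \<cdot> f) = loc g \<cdot>\<^bsub>L\<^esub> loc f"
proof -
  assume f: "f \<in> Hom C X Y" and g: "g \<in> Hom C Y Z"
  have o: "X \<in> obj C" "Y \<in> obj C" using f Hom_objD by blast+
  have "f \<cdot> ident C X = ident C Y \<cdot> f" by (simp add: ident_left[OF f] ident_right[OF f])
  from frac_cmp(2)[OF ident_roof[OF f] ident_roof[OF g] S_ident[OF o(1)] ident_Hom[OF o(1)] f this]
  show ?thesis by (simp add: loc_frac[OF f] loc_frac[OF g] loc_frac[OF cmp_Hom[OF f g]] ident_left[OF ident_Hom[OF o(1)]])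
qed

lemma frac_loc:
  assumes r: "roof s f X Z Y"
  shows "frac X Y s f \<cdot>\<^bsub>L\<^esub> loc s = loc f"
proof -
  note R = roofD[OF r]
  have o: "Z \<in> obj C" using R Hom_objD by blast
  from frac_cmp(2)[OF ident_roof[OF R(2)] r S_ident[OF o] ident_Hom[OF o] ident_Hom[OF o] refl]
  show ?thesis by (simp add: loc_frac[OF R(2)] loc_frac[OF R(3)] ident_left[OF ident_Hom[OF o]] ident_right[OF R(3)])
qed

lemma loc_inverse:
  assumes s: "s \<in> S" "s \<in> Hom C Z X"
  obtains i where "i \<in> Hom L X Z" "i \<cdot>\<^bsub>L\<^esub> loc s = ident L Z" "loc s \<cdot>\<^bsub>L\<^esub> i = ident L X"
proof -
  have o: "Z \<in> obj C" "X \<in> obj C" using s Hom_objD by blast+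
  note iZ = ident_Hom[OF o(1)] and iX = ident_Hom[OF o(2)]
  have r: "roof s (ident C Z) X Z Z" "roof s s X Z X" using s iZ by (simp_all add: roof_def)
  have 1: "frac X Z s (ident C Z) \<cdot>\<^bsub>L\<^esub> loc s = ident L Z"
    using frac_loc[OF r(1)] by (simp add: loc_frac[OF iZ] ident_L)
  have "loc s \<cdot>\<^bsub>L\<^esub> frac X Z s (ident C Z) = frac X X (s \<cdot> ident C Z) (s \<cdot> ident C Z)"
    unfolding loc_frac[OF s(2)] by (rule frac_cmp(2)[OF r(1) ident_roof[OF s(2)] S_ident[OF o(1)] iZ iZ refl])
  also have "\<dots> = frac X X s s" by (simp add: ident_right[OF s(2)])
  also have "\<dots> = frac X X (ident C X) (ident C X)"
    unfolding frac_eq_iff[OF r(2) ident_roof[OF iX]]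
    by (rule equI[OF r(2) ident_roof[OF iX] iZ s(2)]) (simp_all add: ident_right[OF s(2)] ident_left[OF s(2)] s)
  finally show ?thesis using that frac_Hom[OF r(1)] 1 ident_L by metis
qed

end

lemma (in category) inverse_arr_eq:
  assumes f: "f \<in> Hom C X Y" and g: "g \<in> Hom C Y X" "g \<cdot> f = ident C X" "f \<cdot> g = ident C Y"
  shows "inverse_arr C f = g"
  unfolding inverse_arr_def
proof (rule the_equality)
  have st: "src C f = X" "tgt C f = Y" using f by (auto simp: Hom_def)
  show "g \<in> Hom C (tgt C f) (src C f) \<and> g \<cdot> f = ident C (src C f) \<and> f \<cdot> g = ident C (tgt C f)" using g st by simp
  fix h assume "h \<in> Hom C (tgt C f) (src C f) \<and> h \<cdot> f = ident C (src C f) \<and> f \<cdot> h = ident C (tgt C f)"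
  then have h: "h \<in> Hom C Y X" "h \<cdot> f = ident C X" by (simp_all add: st)
  have "h = h \<cdot> (f \<cdot> g)" using ident_right[OF h(1)] g(3) by simp
  also have "\<dots> = (h \<cdot> f) \<cdot> g" by (rule cmp_assoc[OF g(1) f h(1), symmetric])
  also have "\<dots> = g" by (simp add: h(2) ident_left[OF g(1)])
  finally show "h = g" .
qed

section \<open>Inductive limits along the integers\<close>

lemma transition_add: "transition t n (i + j) x = transition t (n + int i) j (transition t n i x)"
  by (induction j) (simp_all add: algebra_simps)

text \<open>The class of a pair \<open>(m, x)\<close> is the whole fibre of the family \<psi> over
  \<open>\<psi> m x\<close>: one inclusion is compatibility with the transitions, the other is
  \<open>inj\<close> at a common later index. With \<open>surj\<close>, classes correspond to
  elements of \<open>N\<close>, and \<open>ind_lim_map\<close> takes the constant value of \<psi> on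
  a fibre.\<close>

lemma ind_lim_map_iso:
  fixes M :: "int \<Rightarrow> 'a monoid" and N :: "'b monoid"
  assumes t: "\<And>n x. x \<in> carrier (M n) \<Longrightarrow> t n x \<in> carrier (M (n + 1))"
    and mult: "\<And>n x y. x \<in> carrier (M n) \<Longrightarrow> y \<in> carrier (M n) \<Longrightarrow> x \<otimes>\<^bsub>M n\<^esub> y \<in> carrier (M n)"
    and psi: "\<And>n x. x \<in> carrier (M n) \<Longrightarrow> \<psi> n x \<in> carrier N"
    and psi_t: "\<And>n x. x \<in> carrier (M n) \<Longrightarrow> \<psi> (n + 1) (t n x) = \<psi> n x"
    and psi_mult: "\<And>n x y. x \<in> carrier (M n) \<Longrightarrow> y \<in> carrier (M n) \<Longrightarrow> \<psi> n (x \<otimes>\<^bsub>M n\<^esub> y) = \<psi> n x \<otimes>\<^bsub>N\<^esub> \<psi> n y"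
    and inj: "\<And>n x y. x \<in> carrier (M n) \<Longrightarrow> y \<in> carrier (M n) \<Longrightarrow> \<psi> n x = \<psi> n y \<Longrightarrow>
      \<exists>k. transition t n k x = transition t n k y"
    and surj: "\<And>z. z \<in> carrier N \<Longrightarrow> \<exists>n. \<exists>x \<in> carrier (M n). \<psi> n x = z"
  shows "ind_lim_map \<psi> \<in> iso (ind_lim M t) N"
proof -
  have tr: "transition t n k x \<in> carrier (M (n + int k)) \<and> \<psi> (n + int k) (transition t n k x) = \<psi> n x"
    if "x \<in> carrier (M n)" for n k x
  proof (induction k)
    case (Suc k)
    then show ?case using t[of _ "n + int k"] psi_t[of _ "n + int k"] by (simp add: algebra_simps)
  qed (use that in simp)
  define cl where "cl z = {(n, y). y \<in> carrier (M n) \<and> \<psi> n y = z}" for z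
  have raise: "\<exists>y \<in> carrier (M m). \<psi> m y = \<psi> n x" if "x \<in> carrier (M n)" "n \<le> m" for n m x
    using tr[OF that(1), of "nat (m - n)"] that(2) by auto
  have ind: "ind_class M t (m, x) = cl (\<psi> m x)" if x: "x \<in> carrier (M m)" for m x
  proof (intro Set.set_eqI iffI)
    fix p assume "p \<in> ind_class M t (m, x)"
    then obtain n y i j where p: "p = (n, y)" "y \<in> carrier (M n)" "m + int i = n + int j" "transition t m i x = transition t n j y"
      by (auto simp: ind_class_def)
    then show "p \<in> cl (\<psi> m x)" using tr[OF x, of i] tr[OF p(2), of j] by (simp add: cl_def)
  next
    fix p assume "p \<in> cl (\<psi> m x)"
    then obtain n y where p: "p = (n, y)" "y \<in> carrier (M n)" "\<psi> n y = \<psi> m x" by (auto simp: cl_def)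
    define i where "i = nat (max m n - m)"
    define j where "j = nat (max m n - n)"
    have ij: "m + int i = max m n" "n + int j = max m n" by (auto simp: i_def j_def)
    have 1: "transition t m i x \<in> carrier (M (max m n)) \<and> \<psi> (max m n) (transition t m i x) = \<psi> m x"
      using tr[OF x, of i] by (simp add: ij)
    have 2: "transition t n j y \<in> carrier (M (max m n)) \<and> \<psi> (max m n) (transition t n j y) = \<psi> n y"
      using tr[OF p(2), of j] by (simp add: ij)
    obtain k where "transition t (max m n) k (transition t m i x) = transition t (max m n) k (transition t n j y)"
      using inj[of "transition t m i x" "max m n" "transition t n j y"] 1 2 p(3) by auto
    then have "transition t m (i + k) x = transition t n (j + k) y" by (simp add: transition_add ij)
    moreover have "m + int (i + k) = n + int (j + k)" using ij by simp
    ultimately show "p \<in> ind_class M t (m, x)" using p(1,2) unfolding ind_class_def by blast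
  qed
  have carr: "carrier (ind_lim M t) = cl ` carrier N"
  proof (intro Set.set_eqI iffI)
    fix c assume "c \<in> carrier (ind_lim M t)"
    then show "c \<in> cl ` carrier N" using ind psi by (auto simp: ind_lim_def)
  next
    fix c assume "c \<in> cl ` carrier N"
    then obtain z where z: "z \<in> carrier N" "c = cl z" by blast
    then obtain n x where "x \<in> carrier (M n)" "\<psi> n x = z" using surj by blast
    moreover from this have "c = ind_class M t (n, x)" using z ind by simp
    ultimately show "c \<in> carrier (ind_lim M t)" unfolding ind_lim_def by auto
  qed
  have ev: "ind_lim_map \<psi> (cl z) = z" if z: "z \<in> carrier N" for z
  proof -
    obtain n x where "x \<in> carrier (M n)" "\<psi> n x = z" using surj z by blast
    then have "(\<lambda>(n, x). \<psi> n x) ` cl z = {z}" by (force simp: cl_def)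
    then show ?thesis by (simp add: ind_lim_map_def)
  qed
  have clm: "cl z \<otimes>\<^bsub>ind_lim M t\<^esub> cl w = cl (z \<otimes>\<^bsub>N\<^esub> w)" and zw: "z \<otimes>\<^bsub>N\<^esub> w \<in> carrier N"
    if z: "z \<in> carrier N" and w: "w \<in> carrier N" for z w
  proof -
    obtain n x where x: "x \<in> carrier (M n)" "\<psi> n x = z" using surj z by blast
    obtain m y where y: "y \<in> carrier (M m)" "\<psi> m y = w" using surj w by blast
    \<comment> \<open>Both factors are moved to a common index, since the product of two classes is
      formed from representatives at the same index.\<close>
    obtain x' where x': "x' \<in> carrier (M (max m n))" "\<psi> (max m n) x' = z" using raise[OF x(1), of "max m n"] x(2) by auto
    obtain y' where y': "y' \<in> carrier (M (max m n))" "\<psi> (max m n) y' = w" using raise[OF y(1), of "max m n"] y(2) by auto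
    show "z \<otimes>\<^bsub>N\<^esub> w \<in> carrier N" using psi_mult[OF x'(1) y'(1)] psi[OF mult[OF x'(1) y'(1)]] x' y' by simp
    have "ind_class M t (n, x \<otimes>\<^bsub>M n\<^esub> y) = cl (z \<otimes>\<^bsub>N\<^esub> w)" if "(n, x) \<in> cl z" "(n, y) \<in> cl w" for n x y
      using that ind[OF mult] psi_mult by (auto simp: cl_def)
    moreover have "(max m n, x') \<in> cl z" "(max m n, y') \<in> cl w" using x' y' by (auto simp: cl_def)
    ultimately have "{ind_class M t (n, x \<otimes>\<^bsub>M n\<^esub> y) | n x y. (n, x) \<in> cl z \<and> (n, y) \<in> cl w} = {cl (z \<otimes>\<^bsub>N\<^esub> w)}"
      by blast
    then show "cl z \<otimes>\<^bsub>ind_lim M t\<^esub> cl w = cl (z \<otimes>\<^bsub>N\<^esub> w)" by (simp add: ind_lim_def)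
  qed
  have "ind_lim_map \<psi> \<in> hom (ind_lim M t) N"
    unfolding hom_def carr using ev clm zw by auto
  moreover have "bij_betw (ind_lim_map \<psi>) (carrier (ind_lim M t)) (carrier N)"
    unfolding carr by (rule bij_betw_byWitness[where f' = cl]) (use ev in auto)
  ultimately show ?thesis by (simp add: iso_def)
qed

section \<open>The natural map\<close>

context abelian_category
begin

lemma right_fractions_Kp: "right_fractions Kp (null_system b)"
proof (intro right_fractions.intro preadditive_Kp right_fractions_axioms.intro)
  show "s \<in> null_system b \<Longrightarrow> s \<in> arr Kp" for s by (rule null_system_arr)
  show "X \<in> obj Kp \<Longrightarrow> ident Kp X \<in> null_system b" for X using null_system_ident obj_Kp by simp
  show "s \<in> null_system b \<Longrightarrow> s \<in> Hom Kp X Y \<Longrightarrow> t \<in> null_system b \<Longrightarrow> t \<in> Hom Kp Y Z \<Longrightarrow> t \<cdot>\<^bsub>Kp\<^esub> s \<in> null_system b" for s t X Y Z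
    using null_system_cmp by simp
  show "f \<in> Hom Kp X Y \<Longrightarrow> t \<in> null_system b \<Longrightarrow> t \<in> Hom Kp W Y \<Longrightarrow>
      \<exists>V t' h. t' \<in> null_system b \<and> t' \<in> Hom Kp V X \<and> h \<in> Hom Kp V W \<and> f \<cdot>\<^bsub>Kp\<^esub> t' = t \<cdot>\<^bsub>Kp\<^esub> h" for f X Y t W
    using null_system_ore by simp
  show "f \<in> Hom Kp X Y \<Longrightarrow> g \<in> Hom Kp X Y \<Longrightarrow> t \<in> null_system b \<Longrightarrow> t \<in> Hom Kp Y Z \<Longrightarrow> t \<cdot>\<^bsub>Kp\<^esub> f = t \<cdot>\<^bsub>Kp\<^esub> g \<Longrightarrow>
      \<exists>V s. s \<in> null_system b \<and> s \<in> Hom Kp V X \<and> f \<cdot>\<^bsub>Kp\<^esub> s = g \<cdot>\<^bsub>Kp\<^esub> s" for f g X Y t Z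
    using null_system_cancel by simp
qed

section \<open>Truncation and its projections on arrows of the homotopy category\<close>

abbreviation "tK \<equiv> trunc_K C"

lemma tK_Hom: "u \<in> Hom Kp X Y \<Longrightarrow> tK n u \<in> Hom Kp (tr n X) (tr n Y)"
  by (erule HomKp_E) (simp add: trunc_K_htpy_class htpy_class_Hom_Kp trunc_K_plus_obj trunc_map_cmaps)

lemma tK_cmp:
  assumes "u \<in> Hom Kp X Y" "v \<in> Hom Kp Y Z"
  shows "tK n (v \<cdot>\<^bsub>Kp\<^esub> u) = tK n v \<cdot>\<^bsub>Kp\<^esub> tK n u"
proof -
  obtain \<phi> where u: "is_cochain C X" "is_cochain C Y" "\<phi> \<in> cmaps X Y" "u = htpy_class X Y \<phi>" using assms(1) by (rule HomKp_E)
  obtain \<psi> where v: "is_cochain C Z" "\<psi> \<in> cmaps Y Z" "v = htpy_class Y Z \<psi>" using assms(2) by (rule HomKp_E)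
  show ?thesis
    using u v by (simp add: htpy_class_cmp trunc_K_htpy_class cmaps_mult trunc_map_cmaps is_cochain_trunc trunc_map_mult)
qed

lemma tK_Suc: "u \<in> Hom Kp X Y \<Longrightarrow> tK (n + 1) (tK n u) = tK (n + 1) u"
  by (erule HomKp_E) (simp add: trunc_K_htpy_class trunc_map_cmaps is_cochain_trunc trunc_map_Suc_trunc_map trunc_Suc_trunc)

text \<open>The first conclusion serves for \<open>b = True\<close>, where it says that every
  truncation preserves quasi-isomorphisms and thus acts on fractions of \<open>D_plus C\<close>. The
  second serves for \<open>b = False\<close>: once \<open>n\<close> passes the bound of \<sigma>,
  \<open>qis_trunc_map\<close> applies.\<close>

lemma tK_null_system:
  assumes "s \<in> null_system b" "s \<in> Hom Kp X Y"
  shows "all_or_some b (\<lambda>n. tK n s \<in> null_system True)" "\<exists>N. \<forall>n \<ge> N. tK n s \<in> null_system True"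
proof -
  obtain \<sigma> where s: "X \<in> K_plus_obj C" "Y \<in> K_plus_obj C" "is_cochain C X" "is_cochain C Y" "\<sigma> \<in> cmaps X Y"
    "s = htpy_class X Y \<sigma>" "all_or_some b (qis X Y \<sigma>)" using assms by (rule null_system_E)
  have *: "tK n s \<in> null_system True" if "qis X Y \<sigma> N" "N \<le> n" for n N
    unfolding s(6) trunc_K_htpy_class[OF s(3-5)]
    by (rule qis_imp_null_system[OF trunc_K_plus_obj[OF s(3)] trunc_K_plus_obj[OF s(4)] trunc_map_cmaps[OF s(3-5)]])
      (rule all_or_some_all, rule qis_trunc_map[OF s(3-5) that])
  show "all_or_some b (\<lambda>n. tK n s \<in> null_system True)" by (rule all_or_some_mono[OF s(7)]) (use * in blast)
  obtain N where "qis X Y \<sigma> N" using s(7) unfolding all_or_some_def by presburger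
  then show "\<exists>N. \<forall>n \<ge> N. tK n s \<in> null_system True" using * by blast
qed

definition trunc_prj_K :: "int \<Rightarrow> ('a, 'b) cochain \<Rightarrow> ('a, 'b) harr" where
  "trunc_prj_K n X = htpy_class X (tr n X) (trunc_prj n X)"

lemma trunc_prj_K_Hom: "X \<in> K_plus_obj C \<Longrightarrow> trunc_prj_K n X \<in> Hom Kp X (tr n X)"
  unfolding trunc_prj_K_def by (rule htpy_class_Hom_Kp) (simp_all add: trunc_K_plus_obj trunc_prj_cmaps K_plus_objD)

lemma trunc_prj_K_null_system: "X \<in> K_plus_obj C \<Longrightarrow> trunc_prj_K n X \<in> null_system False"
proof -
  assume X: "X \<in> K_plus_obj C"
  note c = K_plus_objD[OF X]
  have "\<exists>N. qis X (tr n X) (trunc_prj n X) N" using qis_trunc_prj[OF c] by blast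
  then have "all_or_some False (qis X (tr n X) (trunc_prj n X))" by (simp add: all_or_some_def)
  then show ?thesis
    unfolding trunc_prj_K_def by (rule qis_imp_null_system[OF X trunc_K_plus_obj[OF c] trunc_prj_cmaps[OF c]])
qed

lemma trunc_prj_K_natural: "u \<in> Hom Kp X Y \<Longrightarrow> trunc_prj_K n Y \<cdot>\<^bsub>Kp\<^esub> u = tK n u \<cdot>\<^bsub>Kp\<^esub> trunc_prj_K n X"
  by (erule HomKp_E) (simp add: trunc_prj_K_def trunc_K_htpy_class htpy_class_cmp trunc_prj_cmaps trunc_map_cmaps is_cochain_trunc trunc_prj_natural)

lemma trunc_prj_K_Suc: "X \<in> K_plus_obj C \<Longrightarrow> trunc_prj_K (n + 1) X = trunc_prj_K (n + 1) (tr n X) \<cdot>\<^bsub>Kp\<^esub> trunc_prj_K n X"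
proof -
  assume "X \<in> K_plus_obj C"
  then have X: "is_cochain C X" by (rule K_plus_objD)
  note tX = is_cochain_trunc[OF X]
  show ?thesis
    unfolding trunc_prj_K_def trunc_Suc_trunc Kp_simps
      htpy_class_cmp[OF X tX tX trunc_prj_cmaps[OF X] trunc_prj_cmaps[OF tX, of "n + 1" n, unfolded trunc_Suc_trunc]]
    by (simp only: trunc_prj_Suc[OF X])
qed

lemma D_plus_eq: "D_plus C = localisation Kp (null_system True)" "D_plus_inf C = localisation Kp (null_system False)"
  "S_exact C = null_system True" "S_b C = null_system False"
  by (simp_all add: D_plus_def D_plus_inf_def verdier_quotient_def null_system_def null_objs_def)

lemma natural_map_iso:
  assumes X: "X \<in> K_plus_obj C" and Y: "Y \<in> K_plus_obj C"
  shows "natural_map C X Y \<in> iso (hom_colim C X Y) (hom_group (D_plus_inf C) (G_obj X) (G_obj Y))"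
proof -
  interpret E: right_fractions Kp "null_system True" by (rule right_fractions_Kp)
  interpret F: right_fractions Kp "null_system False" by (rule right_fractions_Kp)
  interpret LF: category F.L by (rule F.category_L)
  have sub: "s \<in> null_system True \<Longrightarrow> s \<in> null_system False" for s using null_system_True_subset by blast
  have EF: "F.roof s f V Z W" if "E.roof s f V Z W" for s f V Z W
    using that sub by (simp add: E.roof_def F.roof_def)
  have EFe: "F.roof_eq s f s' f'" if "E.roof_eq s f s' f'" for s f s' f'
    using that sub unfolding roof_equiv_def prod.case by blast
  \<comment> \<open>The larger system identifies more roofs, so all representatives of a class for
    the smaller system stay equivalent to \<open>(s, f)\<close>.\<close>
  have G: "G_arr C (E.frac V W s f) = F.frac V W s f" if r: "E.roof s f V Z W" for s f V Z W
  proof -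
    have "G_arr C (E.frac V W s f) = qlift Kp (null_system False) V W (fst (snd (E.frac V W s f)))"
      by (simp add: G_arr_def G_obj_def D_plus_eq(4) qclass_def)
    also have "\<dots> = F.frac V W s f"
    proof (rule F.qlift_frac[OF EF[OF r]])
      have "(s, f) \<in> fst (snd (E.frac V W s f))" unfolding E.frac_mem using r E.roof_eq_refl by blast
      then show "fst (snd (E.frac V W s f)) \<noteq> {}" by blast
      show "\<exists>Z'. F.roof s' f' V Z' W \<and> F.roof_eq s f s' f'" if "(s', f') \<in> fst (snd (E.frac V W s f))" for s' f'
        using that EF EFe unfolding E.frac_mem by blast
    qed
    finally show ?thesis .
  qed
  have Gloc: "G_arr C (trunc_proj C n V) = F.loc (trunc_prj_K n V)" if V: "V \<in> K_plus_obj C" for n V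
  proof -
    have "trunc_proj C n V = E.loc (trunc_prj_K n V)"
      by (simp add: trunc_proj_def D_plus_eq(3) trunc_proj_htpy_class[OF K_plus_objD[OF V]] trunc_prj_K_def)
    then show ?thesis
      using G[OF E.ident_roof[OF trunc_prj_K_Hom[OF V]]] E.loc_frac[OF trunc_prj_K_Hom[OF V]] F.loc_frac[OF trunc_prj_K_Hom[OF V]] by simp
  qed
  have troof: "E.roof (tK m s) (tK m f) (tr m V) (tr m Z) (tr m W)" if r: "E.roof s f V Z W" for m s f V Z W
  proof -
    have "tK m s \<in> null_system True" using tK_null_system(1)[of s True Z V] E.roofD[OF r] by (simp add: all_or_some_def)
    then show ?thesis using E.roofD[OF r] tK_Hom by (simp add: E.roof_def)
  qed
  \<comment> \<open>The membership condition concerns the truncated arrow only. So this covers roofs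
    equivalent in \<open>D_plus C\<close>, for every \<open>m\<close>, and roofs that become
    equivalent in \<open>D_plus_inf C\<close>, for large \<open>m\<close>.\<close>
  have tequ: "E.roof_eq (tK m s) (tK m f) (tK m s') (tK m f')"
    if r: "E.roof s f V Z W" "E.roof s' f' V Z' W" and u: "u \<in> Hom Kp U Z" "v \<in> Hom Kp U Z'"
      "s \<cdot>\<^bsub>Kp\<^esub> u = s' \<cdot>\<^bsub>Kp\<^esub> v" "f \<cdot>\<^bsub>Kp\<^esub> u = f' \<cdot>\<^bsub>Kp\<^esub> v" "tK m (s \<cdot>\<^bsub>Kp\<^esub> u) \<in> null_system True"
    for m s f s' f' V Z Z' W U u v
  proof (rule E.equI[OF troof[OF r(1)] troof[OF r(2)] tK_Hom[OF u(1)] tK_Hom[OF u(2)]])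
    note R = E.roofD[OF r(1)] E.roofD[OF r(2)]
    show "tK m s \<cdot>\<^bsub>Kp\<^esub> tK m u = tK m s' \<cdot>\<^bsub>Kp\<^esub> tK m v"
      unfolding tK_cmp[OF u(1) R(2), symmetric] tK_cmp[OF u(2) R(5), symmetric] u(3) ..
    show "tK m f \<cdot>\<^bsub>Kp\<^esub> tK m u = tK m f' \<cdot>\<^bsub>Kp\<^esub> tK m v"
      unfolding tK_cmp[OF u(1) R(3), symmetric] tK_cmp[OF u(2) R(6), symmetric] u(4) ..
    show "tK m s \<cdot>\<^bsub>Kp\<^esub> tK m u \<in> null_system True"
      unfolding tK_cmp[OF u(1) R(2), symmetric] by (rule u(5))
  qed
  have tD: "trunc_D C m (E.frac V W s f) = E.frac (tr m V) (tr m W) (tK m s) (tK m f)" if r: "E.roof s f V Z W" for m V W s f Z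
  proof -
    have "trunc_D C m (E.frac V W s f) =
        qlift Kp (null_system True) (tr m V) (tr m W) ((\<lambda>(s, f). (tK m s, tK m f)) ` fst (snd (E.frac V W s f)))"
      by (simp add: trunc_D_def D_plus_eq(3) qclass_def)
    also have "\<dots> = E.frac (tr m V) (tr m W) (tK m s) (tK m f)"
    proof (rule E.qlift_frac[OF troof[OF r]])
      have "(s, f) \<in> fst (snd (E.frac V W s f))" unfolding E.frac_mem using r E.roof_eq_refl by blast
      then show "(\<lambda>(s, f). (tK m s, tK m f)) ` fst (snd (E.frac V W s f)) \<noteq> {}" by blast
      fix k l assume "(k, l) \<in> (\<lambda>(s, f). (tK m s, tK m f)) ` fst (snd (E.frac V W s f))"
      then obtain s' f' where k: "k = tK m s'" "l = tK m f'" "(s', f') \<in> fst (snd (E.frac V W s f))" by auto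
      then obtain Z' where r': "E.roof s' f' V Z' W" "E.roof_eq s f s' f'" unfolding E.frac_mem by blast
      obtain U u v where u: "u \<in> Hom Kp U Z" "v \<in> Hom Kp U Z'" "s \<cdot>\<^bsub>Kp\<^esub> u = s' \<cdot>\<^bsub>Kp\<^esub> v"
        "f \<cdot>\<^bsub>Kp\<^esub> u = f' \<cdot>\<^bsub>Kp\<^esub> v" "s \<cdot>\<^bsub>Kp\<^esub> u \<in> null_system True"
        using E.equE[OF r'(2) r r'(1)] by blast
      have "tK m (s \<cdot>\<^bsub>Kp\<^esub> u) \<in> null_system True"
        using tK_null_system(1)[OF u(5) E.cmp_Hom[OF u(1) E.roofD(2)[OF r]]] by (simp add: all_or_some_def)
      then show "\<exists>Z'. E.roof k l (tr m V) Z' (tr m W) \<and> E.roof_eq (tK m s) (tK m f) k l"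
        unfolding k(1,2) using troof[OF r'(1)] tequ[OF r r'(1) u(1-4)] by blast
    qed
    finally show ?thesis .
  qed
  have obj: "V \<in> K_plus_obj C \<and> Z \<in> K_plus_obj C \<and> W \<in> K_plus_obj C" if "F.roof s f V Z W" for s f V Z W
    using F.roofD[OF that] Hom_Kp by blast
  \<comment> \<open>Arrows of the system become invertible, so they may be cancelled on the
    right.\<close>
  have loc_epi: "x = y" if s: "s \<in> null_system False" "s \<in> Hom Kp Z V" and x: "x \<in> Hom F.L V W" "y \<in> Hom F.L V W"
    "x \<cdot>\<^bsub>F.L\<^esub> F.loc s = y \<cdot>\<^bsub>F.L\<^esub> F.loc s" for s Z V W x y
  proof -
    obtain i where i: "i \<in> Hom F.L V Z" "F.loc s \<cdot>\<^bsub>F.L\<^esub> i = ident F.L V" using F.loc_inverse[OF s] by blast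
    note l = F.loc_Hom[OF s(2)]
    have "x = (x \<cdot>\<^bsub>F.L\<^esub> F.loc s) \<cdot>\<^bsub>F.L\<^esub> i"
      by (simp add: LF.cmp_assoc[OF i(1) l x(1)] i(2) LF.ident_right[OF x(1)])
    also have "\<dots> = y"
      unfolding x(3) by (simp add: LF.cmp_assoc[OF i(1) l x(2)] i(2) LF.ident_right[OF x(2)])
    finally show ?thesis .
  qed
  \<comment> \<open>After composition with \<open>F.loc s\<close> the fraction becomes the image of
    an arrow, and the claim reduces to \<open>trunc_prj_K_natural\<close> for \<open>s\<close> and
    for \<open>f\<close>.\<close>
  have natF: "F.frac (tr n V) (tr n W) (tK n s) (tK n f) \<cdot>\<^bsub>F.L\<^esub> F.loc (trunc_prj_K n V) =
      F.loc (trunc_prj_K n W) \<cdot>\<^bsub>F.L\<^esub> F.frac V W s f"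
    if r: "F.roof s f V Z W" and r': "F.roof (tK n s) (tK n f) (tr n V) (tr n Z) (tr n W)" for n V W Z s f
  proof -
    note R = F.roofD[OF r] and R' = F.roofD[OF r'] and o = obj[OF r]
    have p: "trunc_prj_K n V \<in> Hom Kp V (tr n V)" "trunc_prj_K n Z \<in> Hom Kp Z (tr n Z)" "trunc_prj_K n W \<in> Hom Kp W (tr n W)"
      using o trunc_prj_K_Hom by blast+
    note fH = F.frac_Hom[OF r] and fH' = F.frac_Hom[OF r']
    note l = F.loc_Hom[OF p(1)] F.loc_Hom[OF p(2)] F.loc_Hom[OF p(3)]
    show ?thesis
    proof (rule loc_epi[OF R(1,2) LF.cmp_Hom[OF l(1) fH'] LF.cmp_Hom[OF fH l(3)]])
      have "(F.frac (tr n V) (tr n W) (tK n s) (tK n f) \<cdot>\<^bsub>F.L\<^esub> F.loc (trunc_prj_K n V)) \<cdot>\<^bsub>F.L\<^esub> F.loc s =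
          F.frac (tr n V) (tr n W) (tK n s) (tK n f) \<cdot>\<^bsub>F.L\<^esub> F.loc (trunc_prj_K n V \<cdot>\<^bsub>Kp\<^esub> s)"
        by (simp only: LF.cmp_assoc[OF F.loc_Hom[OF R(2)] l(1) fH'] F.loc_cmp[OF R(2) p(1)])
      also have "\<dots> = (F.frac (tr n V) (tr n W) (tK n s) (tK n f) \<cdot>\<^bsub>F.L\<^esub> F.loc (tK n s)) \<cdot>\<^bsub>F.L\<^esub> F.loc (trunc_prj_K n Z)"
        by (simp only: trunc_prj_K_natural[OF R(2)] F.loc_cmp[OF p(2) R'(2)] LF.cmp_assoc[OF l(2) F.loc_Hom[OF R'(2)] fH'])
      also have "\<dots> = F.loc (tK n f) \<cdot>\<^bsub>F.L\<^esub> F.loc (trunc_prj_K n Z)" by (simp only: F.frac_loc[OF r'])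
      also have "\<dots> = F.loc (trunc_prj_K n W) \<cdot>\<^bsub>F.L\<^esub> F.loc f"
        by (simp only: F.loc_cmp[OF p(2) R'(3), symmetric] F.loc_cmp[OF R(3) p(3), symmetric] trunc_prj_K_natural[OF R(3)])
      also have "\<dots> = (F.loc (trunc_prj_K n W) \<cdot>\<^bsub>F.L\<^esub> F.frac V W s f) \<cdot>\<^bsub>F.L\<^esub> F.loc s"
        by (simp only: LF.cmp_assoc[OF F.loc_Hom[OF R(2)] fH l(3)] F.frac_loc[OF r])
      finally show "(F.frac (tr n V) (tr n W) (tK n s) (tK n f) \<cdot>\<^bsub>F.L\<^esub> F.loc (trunc_prj_K n V)) \<cdot>\<^bsub>F.L\<^esub> F.loc s =
          (F.loc (trunc_prj_K n W) \<cdot>\<^bsub>F.L\<^esub> F.frac V W s f) \<cdot>\<^bsub>F.L\<^esub> F.loc s" .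
    qed
  qed
  note pX = F.loc_Hom[OF trunc_prj_K_Hom[OF X]] and pY = F.loc_Hom[OF trunc_prj_K_Hom[OF Y]]
  have GH: "G_arr C x \<in> Hom F.L V W" if "x \<in> Hom E.L V W" for x V W
    by (rule E.HomL_E[OF that]) (simp add: G F.frac_Hom[OF EF])
  \<comment> \<open>\<open>level_map\<close> is characterised as the only arrow closing the square
    with the two projections. Its compatibility, its additivity and its values are read off from
    this square, without handling the inverse again.\<close>
  have lev: "level_map C X Y n x \<in> Hom F.L X Y \<and>
      F.loc (trunc_prj_K n Y) \<cdot>\<^bsub>F.L\<^esub> level_map C X Y n x = G_arr C x \<cdot>\<^bsub>F.L\<^esub> F.loc (trunc_prj_K n X)"
    "y \<in> Hom F.L X Y \<Longrightarrow> F.loc (trunc_prj_K n Y) \<cdot>\<^bsub>F.L\<^esub> y = G_arr C x \<cdot>\<^bsub>F.L\<^esub> F.loc (trunc_prj_K n X) \<Longrightarrow> level_map C X Y n x = y"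
    if x: "x \<in> Hom E.L (tr n X) (tr n Y)" for n x y
  proof -
    obtain i where i: "i \<in> Hom F.L (tr n Y) Y" "i \<cdot>\<^bsub>F.L\<^esub> F.loc (trunc_prj_K n Y) = ident F.L Y"
      "F.loc (trunc_prj_K n Y) \<cdot>\<^bsub>F.L\<^esub> i = ident F.L (tr n Y)" using F.loc_inverse[OF trunc_prj_K_null_system[OF Y] trunc_prj_K_Hom[OF Y]] by blast
    have inv: "inverse_arr F.L (F.loc (trunc_prj_K n Y)) = i" by (rule LF.inverse_arr_eq[OF pY i])
    have l: "level_map C X Y n x = i \<cdot>\<^bsub>F.L\<^esub> (G_arr C x \<cdot>\<^bsub>F.L\<^esub> F.loc (trunc_prj_K n X))"
      by (simp add: level_map_def D_plus_eq(2) Gloc X Y inv)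
    note gp = LF.cmp_Hom[OF pX GH[OF x]]
    show "level_map C X Y n x \<in> Hom F.L X Y \<and>
        F.loc (trunc_prj_K n Y) \<cdot>\<^bsub>F.L\<^esub> level_map C X Y n x = G_arr C x \<cdot>\<^bsub>F.L\<^esub> F.loc (trunc_prj_K n X)"
      unfolding l using LF.cmp_Hom[OF gp i(1)] LF.cmp_assoc[OF gp i(1) pY, symmetric] LF.ident_left[OF gp] i(3) by simp
    assume y: "y \<in> Hom F.L X Y" "F.loc (trunc_prj_K n Y) \<cdot>\<^bsub>F.L\<^esub> y = G_arr C x \<cdot>\<^bsub>F.L\<^esub> F.loc (trunc_prj_K n X)"
    show "level_map C X Y n x = y"
      unfolding l y(2)[symmetric] using LF.cmp_assoc[OF y(1) pY i(1), symmetric] LF.ident_left[OF y(1)] i(2) by simp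
  qed
  have hg: "carrier (hom_group D V W) = Hom D V W" "u \<otimes>\<^bsub>hom_group D V W\<^esub> v = u \<boxplus>\<^bsub>D\<^esub> v"
    for D :: "(('a, 'b) cochain, ('a, 'b) darr) addcat" and V W u v
    by (simp_all add: hom_group_def)
  \<comment> \<open>By \<open>tK_Suc\<close> iterated truncation equals a single truncation at the
    last index. At least one step is taken, because the given roof at level \<open>n\<close> need
    not itself be a truncated one.\<close>
  have trans: "E.roof (tK m s) (tK m f) (tr m X) (tr m Z) (tr m Y) \<and>
      transition (\<lambda>n. trunc_D C (n + 1)) n (Suc j) (E.frac (tr n X) (tr n Y) s f) =
        E.frac (tr m X) (tr m Y) (tK m s) (tK m f)"
    if r: "E.roof s f (tr n X) Z (tr n Y)" and m: "m = n + int j + 1" for n s f Z j m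
    using m
  proof (induction j arbitrary: m)
    case 0
    then show ?case using troof[OF r, of "n + 1"] tD[OF r, of "n + 1"] by (simp add: trunc_Suc_trunc)
  next
    case (Suc j)
    define k where "k = n + int j + 1"
    have k: "m = k + 1" "n + int (Suc j) = k" using Suc.prems by (simp_all add: k_def)
    note r' = Suc.IH[OF k_def, THEN conjunct1] and t = Suc.IH[OF k_def, THEN conjunct2]
    note S = tK_Suc[OF E.roofD(2)[OF r]] tK_Suc[OF E.roofD(3)[OF r]]
    show ?case
      using troof[OF r', of "k + 1"] tD[OF r', of "k + 1"]
      unfolding k transition.simps(2)[of _ n "Suc j"] t by (simp add: trunc_Suc_trunc S)
  qed
  have "ind_lim_map (level_map C X Y) \<in>
      iso (ind_lim (\<lambda>n. hom_group E.L (tr n X) (tr n Y)) (\<lambda>n. trunc_D C (n + 1))) (hom_group F.L X Y)"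
  proof (rule ind_lim_map_iso, unfold hg)
    fix n x assume x: "x \<in> Hom E.L (tr n X) (tr n Y)"
    obtain Z s f where s: "E.roof s f (tr n X) Z (tr n Y)" "x = E.frac (tr n X) (tr n Y) s f" using x by (rule E.HomL_E)
    note tx = tD[OF s(1), of "n + 1", folded s(2), unfolded trunc_Suc_trunc]
    note tr' = troof[OF s(1), of "n + 1", unfolded trunc_Suc_trunc]
    show tH: "trunc_D C (n + 1) x \<in> Hom E.L (tr (n + 1) X) (tr (n + 1) Y)"
      unfolding tx by (rule E.frac_Hom[OF tr'])
    show yH: "level_map C X Y n x \<in> Hom F.L X Y" using lev(1)[OF x] by blast
    show "level_map C X Y (n + 1) (trunc_D C (n + 1) x) = level_map C X Y n x"
    \<comment> \<open>The projection to level \<open>n + 1\<close> factors through level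
      \<open>n\<close>, and \<open>natF\<close> moves the second factor across the fraction.\<close>
    proof (rule lev(2)[OF tH yH])
      have ot: "tr n X \<in> K_plus_obj C" "tr n Y \<in> K_plus_obj C"
        using trunc_K_plus_obj[OF K_plus_objD[OF X]] trunc_K_plus_obj[OF K_plus_objD[OF Y]] by blast+
      note qXH = trunc_prj_K_Hom[OF ot(1), of "n + 1", unfolded trunc_Suc_trunc] and qYH = trunc_prj_K_Hom[OF ot(2), of "n + 1", unfolded trunc_Suc_trunc]
      note qX = F.loc_Hom[OF qXH] and qY = F.loc_Hom[OF qYH]
      have "F.loc (trunc_prj_K (n + 1) Y) \<cdot>\<^bsub>F.L\<^esub> level_map C X Y n x =
          F.loc (trunc_prj_K (n + 1) (tr n Y)) \<cdot>\<^bsub>F.L\<^esub> (F.loc (trunc_prj_K n Y) \<cdot>\<^bsub>F.L\<^esub> level_map C X Y n x)"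
        unfolding trunc_prj_K_Suc[OF Y] F.loc_cmp[OF trunc_prj_K_Hom[OF Y] qYH] by (rule LF.cmp_assoc[OF yH pY qY])
      also have "\<dots> = F.loc (trunc_prj_K (n + 1) (tr n Y)) \<cdot>\<^bsub>F.L\<^esub> (F.frac (tr n X) (tr n Y) s f \<cdot>\<^bsub>F.L\<^esub> F.loc (trunc_prj_K n X))"
        using lev(1)[OF x] G[OF s(1)] s(2) by simp
      also have "\<dots> = (F.loc (trunc_prj_K (n + 1) (tr n Y)) \<cdot>\<^bsub>F.L\<^esub> F.frac (tr n X) (tr n Y) s f) \<cdot>\<^bsub>F.L\<^esub> F.loc (trunc_prj_K n X)"
        by (rule LF.cmp_assoc[OF pX F.frac_Hom[OF EF[OF s(1)]] qY, symmetric])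
      also have "\<dots> = (G_arr C (trunc_D C (n + 1) x) \<cdot>\<^bsub>F.L\<^esub> F.loc (trunc_prj_K (n + 1) (tr n X))) \<cdot>\<^bsub>F.L\<^esub> F.loc (trunc_prj_K n X)"
        unfolding tx G[OF tr'] using natF[OF EF[OF s(1)] EF[OF troof[OF s(1)]], of "n + 1"] by (simp add: trunc_Suc_trunc)
      also have "\<dots> = G_arr C (trunc_D C (n + 1) x) \<cdot>\<^bsub>F.L\<^esub> F.loc (trunc_prj_K (n + 1) X)"
        unfolding trunc_prj_K_Suc[OF X] F.loc_cmp[OF trunc_prj_K_Hom[OF X] qXH] by (rule LF.cmp_assoc[OF pX qX GH[OF tH]])
      finally show "F.loc (trunc_prj_K (n + 1) Y) \<cdot>\<^bsub>F.L\<^esub> level_map C X Y n x =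
          G_arr C (trunc_D C (n + 1) x) \<cdot>\<^bsub>F.L\<^esub> F.loc (trunc_prj_K (n + 1) X)" .
    qed
  next
    fix n x y assume x: "x \<in> Hom E.L (tr n X) (tr n Y)" and y: "y \<in> Hom E.L (tr n X) (tr n Y)"
    show xy: "x \<boxplus>\<^bsub>E.L\<^esub> y \<in> Hom E.L (tr n X) (tr n Y)" by (rule E.L_plus_Hom[OF x y])
    obtain Z s f g where s: "E.roof s f (tr n X) Z (tr n Y)" "E.roof s g (tr n X) Z (tr n Y)"
      "x = E.frac (tr n X) (tr n Y) s f" "y = E.frac (tr n X) (tr n Y) s g" using x y by (rule E.common_denominator)
    note lx = lev(1)[OF x, THEN conjunct1] lev(1)[OF x, THEN conjunct2] and ly = lev(1)[OF y, THEN conjunct1] lev(1)[OF y, THEN conjunct2]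
    have Gp: "G_arr C (x \<boxplus>\<^bsub>E.L\<^esub> y) = G_arr C x \<boxplus>\<^bsub>F.L\<^esub> G_arr C y"
      unfolding s(3,4) E.frac_plus(2)[OF s(1,2)] G[OF s(1)] G[OF s(2)] G[OF E.frac_plus(1)[OF s(1,2)]]
        F.frac_plus(2)[OF EF[OF s(1)] EF[OF s(2)]] ..
    show "level_map C X Y n (x \<boxplus>\<^bsub>E.L\<^esub> y) = level_map C X Y n x \<boxplus>\<^bsub>F.L\<^esub> level_map C X Y n y"
      by (rule lev(2)[OF xy F.L_plus_Hom[OF lx(1) ly(1)]])
        (simp only: F.L_cmp_plus_right[OF lx(1) ly(1) pY] lx(2) ly(2) Gp F.L_cmp_plus_left[OF GH[OF x] GH[OF y] pX])
    assume eq: "level_map C X Y n x = level_map C X Y n y"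
    have "G_arr C x \<cdot>\<^bsub>F.L\<^esub> F.loc (trunc_prj_K n X) = G_arr C y \<cdot>\<^bsub>F.L\<^esub> F.loc (trunc_prj_K n X)" using lx(2) ly(2) eq by simp
    then have "G_arr C x = G_arr C y" by (rule loc_epi[OF trunc_prj_K_null_system[OF X] trunc_prj_K_Hom[OF X] GH[OF x] GH[OF y]])
    then have "F.roof_eq s f s g"
      unfolding s(3,4) G[OF s(1)] G[OF s(2)] F.frac_eq_iff[OF EF[OF s(1)] EF[OF s(2)]] .
    then obtain U u v where u: "u \<in> Hom Kp U Z" "v \<in> Hom Kp U Z" "s \<cdot>\<^bsub>Kp\<^esub> u = s \<cdot>\<^bsub>Kp\<^esub> v" "f \<cdot>\<^bsub>Kp\<^esub> u = g \<cdot>\<^bsub>Kp\<^esub> v" "s \<cdot>\<^bsub>Kp\<^esub> u \<in> null_system False"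
      using F.equE[OF _ EF[OF s(1)] EF[OF s(2)]] by blast
    obtain N where N: "\<forall>m \<ge> N. tK m (s \<cdot>\<^bsub>Kp\<^esub> u) \<in> null_system True"
      using tK_null_system(2)[OF u(5) E.cmp_Hom[OF u(1) E.roofD(2)[OF s(1)]]] by blast
    \<comment> \<open>With this \<open>j\<close> the index \<open>m\<close> lies beyond
      \<open>N\<close> and also strictly above \<open>n\<close>, as \<open>trans\<close>
      requires.\<close>
    define j where "j = nat (N - n)"
    define m where "m = n + int j + 1"
    have "N \<le> m" by (simp add: m_def j_def)
    then have e: "E.roof_eq (tK m s) (tK m f) (tK m s) (tK m g)" by (intro tequ[OF s(1,2) u(1-4)]) (use N in blast)
    have a: "E.roof (tK m s) (tK m f) (tr m X) (tr m Z) (tr m Y)" "E.roof (tK m s) (tK m g) (tr m X) (tr m Z) (tr m Y)"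
      "transition (\<lambda>n. trunc_D C (n + 1)) n (Suc j) x = E.frac (tr m X) (tr m Y) (tK m s) (tK m f)"
      "transition (\<lambda>n. trunc_D C (n + 1)) n (Suc j) y = E.frac (tr m X) (tr m Y) (tK m s) (tK m g)"
      using trans[OF s(1) m_def] trans[OF s(2) m_def] unfolding s(3,4) by auto
    have "transition (\<lambda>n. trunc_D C (n + 1)) n (Suc j) x = transition (\<lambda>n. trunc_D C (n + 1)) n (Suc j) y"
      unfolding a(3,4) using E.frac_eq_iff[OF a(1,2)] e by simp
    then show "\<exists>k. transition (\<lambda>n. trunc_D C (n + 1)) n k x = transition (\<lambda>n. trunc_D C (n + 1)) n k y" by blast
  next
    fix z assume "z \<in> Hom F.L X Y"
    then obtain Z s f where s: "F.roof s f X Z Y" "z = F.frac X Y s f" by (rule F.HomL_E)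
    note R = F.roofD[OF s(1)]
    obtain n where n: "tK n s \<in> null_system True" using tK_null_system(2)[OF R(1,2)] by blast
    have r: "E.roof (tK n s) (tK n f) (tr n X) (tr n Z) (tr n Y)"
      using n tK_Hom R by (simp add: E.roof_def)
    have "level_map C X Y n (E.frac (tr n X) (tr n Y) (tK n s) (tK n f)) = z"
      unfolding s(2) by (rule lev(2)[OF E.frac_Hom[OF r] F.frac_Hom[OF s(1)]]) (simp only: G[OF r] natF[OF s(1) EF[OF r]])
    then show "\<exists>n. \<exists>x \<in> Hom E.L (tr n X) (tr n Y). level_map C X Y n x = z" using E.frac_Hom[OF r] by blast
  qed
  then show ?thesis by (simp add: natural_map_def hom_colim_def D_plus_eq G_obj_def)
qed

end

theorem proposition4p7:
  fixes A :: "('o, 'm) addcat" and X Y :: "('o, 'm) cochain"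
  assumes "abelian_category A"
    and "X \<in> obj (D_plus A)" and "Y \<in> obj (D_plus A)"
  shows "natural_map A X Y \<in>
    iso (hom_colim A X Y) (hom_group (D_plus_inf A) (G_obj X) (G_obj Y))"
proof -
  interpret abelian_category A by (rule assms)
  have "obj (D_plus A) = obj Kp" by (simp add: D_plus_eq localisation_def)
  then show ?thesis using natural_map_iso assms(2,3) obj_Kp by simp
qed

end
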